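(* Let $\Omega$ be a smooth planar domain, $\Sigma$ a compact connected portion of its boundary, and $L=X+iY$ a smooth locally solvable complex vector field defined near each point of $\Sigma$ and transversal to $\Sigma$. Let $f$ be continuous on $\Omega$ with $Lf=0$ where $L$ is defined, and assume that for some defining function $\rho$ of $\Omega$ there exists an integer $N$ such that $$\int_{\rho=t}|f|\,d\sigma_t=O(t^{-N})\quad\text{as } t\to0^+ .$$ Assume that the boundary value $bf$ of $f$ belongs to $L^p(\Sigma)$ for some $1\le p\le\infty$. Let $\Gamma(p)$, $p\in\Sigma$, be the approach regions constructed in the context. Then for almost all $p\in\Sigma$, $$\lim_{\Gamma(p)\ni q\to p}f(q)=bf(p).$$
   Context: $X,Y$ are real vector fields. A smooth complex vector field $L$ is locally solvable if every point has a neighborhood $V$ such that for every $g\in C^\infty_c(V)$ there is $u\in\mathcal{D}'(V)$ with $Lu=g$ in $V$; locally solvable (nonvanishing) planar vector fields are known to be locally integrable, i.e. near each point there is a smooth $Z$ (a first integral) with $LZ=0$, $dZ\neq0$. The defining function $\rho$ is smooth, positive in $\Omega$, zero on $\partial\Omega$, with $d\rho\ne0$ on $\partial\Omega$; $\sigma_t$ is arc length on $\{\rho=t\}$. "Almost all" is with respect to arc length. Trace: near any point of $\Sigma$ choose coordinates $(x,t)$ with $t=\rho$, $\Sigma=\{t=0\}$, $\Omega=\{t>0\}$, in which $L$ is a nonvanishing multiple of $\partial_t+a(x,t)\partial_x$. Under the growth assumption $f(\cdot,t)$ converges in the sense of distributions as $t\to0^+$; the limit is the boundary value (trace) $bf$.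 After multiplying $L$ by $i$ if necessary, one assumes that $X$ is transversal to $\Sigma$ and points toward $\Omega$. Construction of $\Gamma(p)$ (local: it is carried out for $p$ in a small neighborhood in $\Sigma$ of any given point of $\Sigma$). Take a first integral $Z$ of $L$ in a neighborhood of the given point such that the restriction of $\operatorname{Re}Z$ to $\Sigma$ has nonzero differential. For a real vector $(a,b)$ close to $(1,0)$ put $$S_{a,b}(p)=\{w:\operatorname{Re}\big((a+ib)Z(w)\big)=\operatorname{Re}\big((a+ib)Z(p)\big)\}.$$ For $(a,b)$ in a sufficiently small disc $V\subset\mathbb{R}^2$ centered at $(1,0)$ these curves are transversal to $\Sigma$. Let $S^+_{a,b}(p)$ be the part of $S_{a,b}(p)$ contained in $\Omega$, and set $$\Gamma(p)=\bigcup_{(a,b)\in V}S^+_{a,b}(p).$$ All these sets are considered as germs at $p$, i.e. only in arbitrarily small neighborhoods of $p$; the disc $V$ is taken sufficiently small. *)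

theory Defs
  imports "HOL-Analysis.Analysis"
begin

type_synonym plane = "real \<times> real"

section \<open>Smooth functions, vector fields, distributions\<close>

primrec iter_pd ::
    "'a list \<Rightarrow> ('a::euclidean_space \<Rightarrow> 'b::real_normed_vector) \<Rightarrow> 'a \<Rightarrow> 'b" where
  "iter_pd [] f = f"
| "iter_pd (v # vs) f = (\<lambda>x. frechet_derivative (iter_pd vs f) (at x) v)"

text \<open>Only used for open \<open>S\<close>. Differentiability of every iterated partial derivative also gives
  its continuity, so this is the class of infinitely differentiable functions on \<open>S\<close>.\<close>

definition smooth_on ::
    "'a::euclidean_space set \<Rightarrow> ('a \<Rightarrow> 'b::real_normed_vector) \<Rightarrow> bool" where
  "smooth_on S f \<longleftrightarrow> (\<forall>vs. set vs \<subseteq> Basis \<longrightarrow> iter_pd vs f differentiable_on S)"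

definition test_fun :: "'a::euclidean_space set \<Rightarrow> ('a \<Rightarrow> complex) \<Rightarrow> bool" where
  "test_fun V \<phi> \<longleftrightarrow> smooth_on UNIV \<phi> \<and>
     compact (closure {x. \<phi> x \<noteq> 0}) \<and> closure {x. \<phi> x \<noteq> 0} \<subseteq> V"

text \<open>Complex distributions on the open set \<open>V\<close>. A distribution is a function on all of
  \<open>'a \<Rightarrow> complex\<close> of which only the values on test functions in \<open>V\<close> are relevant; continuity is
  expressed by the usual seminorm estimates.\<close>

definition distribution_on ::
    "'a::euclidean_space set \<Rightarrow> (('a \<Rightarrow> complex) \<Rightarrow> complex) \<Rightarrow> bool" where
  "distribution_on V u \<longleftrightarrow>
     (\<forall>\<phi> \<psi>. test_fun V \<phi> \<longrightarrow> test_fun V \<psi> \<longrightarrow> u (\<lambda>x. \<phi> x + \<psi> x) = u \<phi> + u \<psi>) \<and>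
     (\<forall>c \<phi>. test_fun V \<phi> \<longrightarrow> u (\<lambda>x. c * \<phi> x) = c * u \<phi>) \<and>
     (\<forall>K. compact K \<longrightarrow> K \<subseteq> V \<longrightarrow>
        (\<exists>C m. \<forall>\<phi>. test_fun V \<phi> \<longrightarrow> closure {x. \<phi> x \<noteq> 0} \<subseteq> K \<longrightarrow>
           norm (u \<phi>) \<le> C * (\<Sum>vs | set vs \<subseteq> Basis \<and> length vs \<le> m.
                               SUP x. norm (iter_pd vs \<phi> x))))"

text \<open>A complex vector field \<open>L = X + iY\<close> is given by the real vector fields \<open>X\<close> and \<open>Y\<close>.\<close>

definition vf_apply :: "(plane \<Rightarrow> plane) \<Rightarrow> (plane \<Rightarrow> plane) \<Rightarrow> (plane \<Rightarrow> complex) \<Rightarrow> plane \<Rightarrow> complex"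
  where
  "vf_apply X Y u z = frechet_derivative u (at z) (X z) + \<i> * frechet_derivative u (at z) (Y z)"

text \<open>The formal transpose \<open>\<phi> \<mapsto> - div (\<phi> X) - i div (\<phi> Y)\<close>.\<close>

definition vf_transpose ::
    "(plane \<Rightarrow> plane) \<Rightarrow> (plane \<Rightarrow> plane) \<Rightarrow> (plane \<Rightarrow> complex) \<Rightarrow> plane \<Rightarrow> complex" where
  "vf_transpose X Y \<phi> z =
     - (\<Sum>e\<in>Basis. frechet_derivative (\<lambda>w. \<phi> w * of_real (X w \<bullet> e)) (at z) e)
     - \<i> * (\<Sum>e\<in>Basis. frechet_derivative (\<lambda>w. \<phi> w * of_real (Y w \<bullet> e)) (at z) e)"

text \<open>\<open>Lu = g\<close> in \<open>V\<close> in the sense of distributions.\<close>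

definition vf_solves :: "plane set \<Rightarrow> (plane \<Rightarrow> plane) \<Rightarrow> (plane \<Rightarrow> plane) \<Rightarrow>
    ((plane \<Rightarrow> complex) \<Rightarrow> complex) \<Rightarrow> (plane \<Rightarrow> complex) \<Rightarrow> bool" where
  "vf_solves V X Y u g \<longleftrightarrow>
     (\<forall>\<phi>. test_fun V \<phi> \<longrightarrow> u (vf_transpose X Y \<phi>) = (LINT z|lborel. g z * \<phi> z))"

definition regular_distribution :: "(plane \<Rightarrow> complex) \<Rightarrow> (plane \<Rightarrow> complex) \<Rightarrow> complex" where
  "regular_distribution f = (\<lambda>\<phi>. LINT z|lborel. f z * \<phi> z)"

definition locally_solvable_on :: "plane set \<Rightarrow> (plane \<Rightarrow> plane) \<Rightarrow> (plane \<Rightarrow> plane) \<Rightarrow> bool" where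
  "locally_solvable_on U X Y \<longleftrightarrow>
     (\<forall>z\<in>U. \<exists>V. open V \<and> z \<in> V \<and> V \<subseteq> U \<and>
        (\<forall>g. test_fun V g \<longrightarrow> (\<exists>u. distribution_on V u \<and> vf_solves V X Y u g)))"

section \<open>Domains and arc length\<close>

text \<open>The existence of a defining function forces the boundary of the open set \<open>\<Omega>\<close> to be a smooth
  curve with \<open>\<Omega>\<close> locally on one side of it: if \<open>\<Omega>\<close> were on both sides, \<open>\<rho>\<close> would have a critical
  point on the boundary.\<close>

definition defining_function :: "plane set \<Rightarrow> (plane \<Rightarrow> real) \<Rightarrow> bool" where
  "defining_function \<Omega> \<rho> \<longleftrightarrow>
     (\<exists>W. open W \<and> closure \<Omega> \<subseteq> W \<and> smooth_on W \<rho>) \<and>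
     (\<forall>z\<in>\<Omega>. \<rho> z > 0) \<and>
     (\<forall>z\<in>frontier \<Omega>. \<rho> z = 0 \<and> frechet_derivative \<rho> (at z) \<noteq> (\<lambda>v. 0))"

text \<open>Arc length on a curve is one-dimensional Hausdorff measure (normalised by the diameter, so
  that it is length on rectifiable arcs). As Borel sets are Caratheodory measurable for a metric
  outer measure, \<open>hausdorff1\<close> agrees with \<open>hausdorff1_outer\<close> on Borel sets.\<close>

definition hausdorff1_outer :: "plane set \<Rightarrow> ennreal" where
  "hausdorff1_outer A =
     (SUP d\<in>{0::real<..}.
        INF C\<in>{C :: nat \<Rightarrow> plane set. A \<subseteq> (\<Union>i. C i) \<and> (\<forall>i. bounded (C i) \<and> diameter (C i) \<le> d)}.
          \<Sum>i. ennreal (diameter (C i)))"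

definition hausdorff1 :: "plane measure" where
  "hausdorff1 = measure_of UNIV (sets borel) hausdorff1_outer"

definition arc_length :: "plane set \<Rightarrow> plane measure" where
  "arc_length S = completion (restrict_space hausdorff1 S)"

definition mem_Lp :: "ennreal \<Rightarrow> 'a measure \<Rightarrow> ('a \<Rightarrow> complex) \<Rightarrow> bool" where
  "mem_Lp p M h \<longleftrightarrow> h \<in> borel_measurable M \<and>
     (if p = \<infinity> then \<exists>C. AE z in M. norm (h z) \<le> C
      else (\<integral>\<^sup>+z. ennreal (norm (h z) powr enn2real p) \<partial>M) < \<infinity>)"

definition growth_bound :: "plane set \<Rightarrow> (plane \<Rightarrow> real) \<Rightarrow> int \<Rightarrow> (plane \<Rightarrow> complex) \<Rightarrow> bool" where
  "growth_bound \<Omega> \<rho> N f \<longleftrightarrow>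
     (\<exists>C. \<forall>\<^sub>F t in at_right 0.
        (\<integral>\<^sup>+z. ennreal (norm (f z)) \<partial>arc_length {w\<in>\<Omega>. \<rho> w = t}) \<le> ennreal (C * t powi (- N)))"

section \<open>Boundary values\<close>

text \<open>Inverse \<open>\<kappa> (x, t)\<close> of a coordinate system near a boundary point, defined on
  \<open>I \<times> (-\<delta>, \<delta>)\<close>, with \<open>t = \<rho>\<close>, \<open>\<Omega> = {t > 0}\<close> and the boundary of \<open>\<Omega>\<close> equal to \<open>{t = 0}\<close>. The last
  condition \<open>Lt \<noteq> 0\<close> says that \<open>L\<close> is a nonvanishing multiple of some \<open>\<partial>\<^sub>t + a \<partial>\<^sub>x\<close>.\<close>

definition boundary_chart ::
    "plane set \<Rightarrow> (plane \<Rightarrow> real) \<Rightarrow> plane set \<Rightarrow> (plane \<Rightarrow> plane) \<Rightarrow> (plane \<Rightarrow> plane) \<Rightarrow>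
     real set \<Rightarrow> real \<Rightarrow> (plane \<Rightarrow> plane) \<Rightarrow> bool" where
  "boundary_chart \<Omega> \<rho> U X Y I \<delta> \<kappa> \<longleftrightarrow>
     open I \<and> is_interval I \<and> \<delta> > 0 \<and>
     smooth_on (I \<times> {-\<delta><..<\<delta>}) \<kappa> \<and> inj_on \<kappa> (I \<times> {-\<delta><..<\<delta>}) \<and>
     (\<forall>x\<in>I. \<forall>t\<in>{-\<delta><..<\<delta>}.
        inj (frechet_derivative \<kappa> (at (x, t))) \<and>
        \<kappa> (x, t) \<in> U \<and>
        \<rho> (\<kappa> (x, t)) = t \<and>
        (\<kappa> (x, t) \<in> \<Omega> \<longleftrightarrow> t > 0) \<and>
        (\<kappa> (x, t) \<in> frontier \<Omega> \<longleftrightarrow> t = 0) \<and>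
        vf_apply X Y (\<lambda>w. of_real (\<rho> w)) (\<kappa> (x, t)) \<noteq> 0)"

text \<open>The trace \<open>bf\<close>, i.e. the distributional limit of \<open>f(\<cdot>, t)\<close> as \<open>t \<rightarrow> 0+\<close>, is the function
  \<open>h\<close> on \<open>S\<close>. The charts are those whose boundary part lies in \<open>S\<close>, so that nothing is said about
  possible end points of \<open>S\<close>. Lebesgue measure appears on the right because \<open>h\<close> is only assumed to
  be measurable for the completed arc length.\<close>

definition has_boundary_value ::
    "plane set \<Rightarrow> (plane \<Rightarrow> real) \<Rightarrow> plane set \<Rightarrow> (plane \<Rightarrow> plane) \<Rightarrow> (plane \<Rightarrow> plane) \<Rightarrow>
     plane set \<Rightarrow> (plane \<Rightarrow> complex) \<Rightarrow> (plane \<Rightarrow> complex) \<Rightarrow> bool" where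
  "has_boundary_value \<Omega> \<rho> U X Y S f h \<longleftrightarrow>
     (\<forall>I \<delta> \<kappa>. boundary_chart \<Omega> \<rho> U X Y I \<delta> \<kappa> \<and> (\<forall>x\<in>I. \<kappa> (x, 0) \<in> S) \<longrightarrow>
        (\<forall>\<psi>. test_fun I \<psi> \<longrightarrow>
           ((\<lambda>t. LINT x|lborel. f (\<kappa> (x, t)) * \<psi> x) \<longlongrightarrow>
              (LINT x|lebesgue. h (\<kappa> (x, 0)) * \<psi> x)) (at_right 0)))"

section \<open>Approach regions\<close>

text \<open>The last condition says that the restriction of \<open>Re Z\<close> to \<open>S\<close> has nonzero differential, the
  tangent line at a boundary point being the kernel of \<open>d\<rho>\<close>.\<close>

definition first_integral ::
    "(plane \<Rightarrow> real) \<Rightarrow> plane set \<Rightarrow> (plane \<Rightarrow> plane) \<Rightarrow> (plane \<Rightarrow> plane) \<Rightarrow>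
     plane set \<Rightarrow> (plane \<Rightarrow> complex) \<Rightarrow> bool" where
  "first_integral \<rho> S X Y W Z \<longleftrightarrow>
     smooth_on W Z \<and>
     (\<forall>w\<in>W. vf_apply X Y Z w = 0 \<and> frechet_derivative Z (at w) \<noteq> (\<lambda>v. 0)) \<and>
     (\<forall>z\<in>S \<inter> W. \<forall>v. v \<noteq> 0 \<and> frechet_derivative \<rho> (at z) v = 0 \<longrightarrow>
        frechet_derivative (\<lambda>w. Re (Z w)) (at z) v \<noteq> 0)"

definition level_curve :: "plane set \<Rightarrow> (plane \<Rightarrow> complex) \<Rightarrow> real \<times> real \<Rightarrow> plane \<Rightarrow> plane set"
  where
  "level_curve W Z ab z =
     {w\<in>W. Re (Complex (fst ab) (snd ab) * Z w) = Re (Complex (fst ab) (snd ab) * Z z)}"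

text \<open>The disc \<open>V\<close> is the one with centre \<open>(1, 0)\<close> and radius \<open>\<epsilon>\<close>. The domain \<open>W\<close> of the first
  integral stands for a representative of the germ at \<open>z\<close>; a limit within the region at \<open>z\<close> depends
  only on the germ.\<close>

definition approach_region ::
    "plane set \<Rightarrow> plane set \<Rightarrow> (plane \<Rightarrow> complex) \<Rightarrow> real \<Rightarrow> plane \<Rightarrow> plane set" where
  "approach_region \<Omega> W Z \<epsilon> z = (\<Union>ab\<in>ball (1, 0) \<epsilon>. level_curve W Z ab z \<inter> \<Omega>)"

end

theory Submission
  imports Defs "HOL-Complex_Analysis.Complex_Analysis" "HOL-Probability.Probability"
begin

text \<open>In the coordinates \<open>x = Re Z\<close>, \<open>t = \<rho>\<close> the first integral is \<open>Z = x + i phi(x, t)\<close>, and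
 \<open>Lf = 0\<close> says that \<open>f h(Z) dZ\<close> is exact for every entire \<open>h\<close>. Iterated primitives \<open>H\<^sub>0 = f\<close>,
 \<open>dH\<^sub>j\<^sub>+\<^sub>1 = H\<^sub>j dZ\<close> become continuous up to \<open>t = 0\<close> after finitely many steps, by the growth
 condition. Gaussian weights \<open>h\<close> show that each \<open>H\<^sub>j\<close> is constant on the fibres of \<open>Z\<close>; so where
 \<open>phi(x, t) \<noteq> phi(x, 0)\<close> one has \<open>H\<^sub>K = G(Z)\<close> with \<open>G\<close> holomorphic and \<open>f\<close> the \<open>K\<close>-th
 derivative of \<open>G\<close> at \<open>Z\<close>. On the boundary \<open>bf\<close> is the weak \<open>K\<close>-th derivative of \<open>H\<^sub>K\<close> with respect
 to \<open>Z\<close>; by du Bois-Reymond's lemma and Lebesgue differentiation, \<open>H\<^sub>K\<close> has at almost every point a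
 Taylor expansion in \<open>Z\<close> with top coefficient \<open>bf / K!\<close>. A Phragmen-Lindelof argument carries the
 expansion into the domain of \<open>G\<close>, and Cauchy's estimates on discs of radius comparable to
 \<open>\<bar>phi(x, t) - phi(x, 0)\<bar>\<close> give \<open>f \<rightarrow> bf\<close> within the approach regions. Where \<open>phi(x, \<cdot>)\<close>
 is constant near \<open>t = 0\<close>, for \<open>x\<close> in a set accumulating at the point (all but countably many
 points), the Taylor expansions of \<open>H\<^sub>K\<close> on \<open>t = 0\<close> and at height \<open>t\<close> are compared along this set.\<close>

section \<open>Calculus of smooth functions\<close>

text \<open>Two obstacles shape the argument. The gap \<open>phi(x, t) - phi(x, 0)\<close> may
  vanish, oscillate or change sign, so \<open>Z\<close> need not be injective and no single
  holomorphic function represents the solution; and the solution has no continuity at the boundary,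
  so nothing can be restricted to \<open>t = 0\<close> before it is integrated. Integration with
  respect to \<open>dZ\<close> keeps constancy on fibres, so curing the second obstacle does no harm
  to the first. Both ends balance: \<open>K\<close> derivatives on a disc of radius proportional to
  the gap \<open>e\<close> cost a factor \<open>e ^ (- K)\<close>, while the Taylor remainder of
  order \<open>K\<close> at distance comparable to \<open>e\<close> is \<open>o(e ^ K)\<close>;
  inside an approach region the distance to the boundary point is controlled by the gap. The
  expansion is known only on the lower edge of the domain of \<open>G\<close>, with a mere power
  bound near the point, hence Phragmen-Lindelof instead of the maximum principle alone. Negative
  gaps are reduced to positive ones by conjugation. The exceptional set consists of the points where
  differentiation fails, of countably many isolated flat columns, and of end points of
  \<open>S\<close>.\<close>

abbreviation pd :: "'a::euclidean_space => ('a => 'b::real_normed_vector) => 'a => 'b" where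
 "pd v f \<equiv> (\<lambda>x. frechet_derivative f (at x) v)"

text \<open>The recursion differentiates \<open>f\<close> itself, whereas \<open>iter_pd\<close>
  puts new derivatives outside. Closure under products and composites is proved by induction on the
  order with functions replaced by their partial derivatives, and this form makes those inductions
  direct.\<close>

primrec ndiff :: "nat => 'a::euclidean_space set => ('a => 'b::real_normed_vector) => bool" where
 "ndiff 0 S f \<longleftrightarrow> f differentiable_on S"
| "ndiff (Suc n) S f \<longleftrightarrow> f differentiable_on S \<and> (\<forall>v\<in>Basis. ndiff n S (pd v f))"

lemma iter_pd_snoc: "iter_pd (vs @ [v]) f = iter_pd vs (pd v f)"
 by (induction vs) auto

lemma ndiff_iff:
 "ndiff n S f \<longleftrightarrow> (\<forall>vs. set vs \<subseteq> Basis \<and> length vs \<le> n --> iter_pd vs f differentiable_on S)"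
proof (induction n arbitrary: f)
 case (Suc n)
 show ?case
 proof
  assume L: "ndiff (Suc n) S f"
  show "\<forall>vs. set vs \<subseteq> Basis \<and> length vs \<le> Suc n --> iter_pd vs f differentiable_on S"
  proof (intro allI impI)
   fix vs :: "'a list" assume vs: "set vs \<subseteq> Basis \<and> length vs \<le> Suc n"
   show "iter_pd vs f differentiable_on S"
   proof (cases vs rule: rev_cases)
    case Nil then show ?thesis using L by simp
   next
    case (snoc us u)
    then have "ndiff n S (pd u f)" using L vs by auto
    then show ?thesis using Suc.IH[of "pd u f"] snoc vs by (auto simp: iter_pd_snoc)
   qed
  qed
 next
  assume R: "\<forall>vs. set vs \<subseteq> Basis \<and> length vs \<le> Suc n --> iter_pd vs f differentiable_on S"
  have "ndiff n S (pd v f)" if "v \<in> Basis" for v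
   unfolding Suc.IH
  proof (intro allI impI)
   fix vs :: "'a list" assume vs: "set vs \<subseteq> Basis \<and> length vs \<le> n"
   then show "iter_pd vs (pd v f) differentiable_on S"
    using R[rule_format, of "vs @ [v]"] that by (auto simp: iter_pd_snoc)
  qed
  moreover have "f differentiable_on S" using R[rule_format, of "[]"] by simp
  ultimately show "ndiff (Suc n) S f" by simp
 qed
qed simp

lemma smooth_on_iff_ndiff: "smooth_on S f \<longleftrightarrow> (\<forall>n. ndiff n S f)"
 unfolding smooth_on_def ndiff_iff by blast

lemma smooth_on_imp_ndiff: "smooth_on S f ==> ndiff n S f"
 by (simp add: smooth_on_iff_ndiff)

lemma smooth_on_pd: "smooth_on S f ==> v \<in> Basis ==> smooth_on S (pd v f)"
 unfolding smooth_on_iff_ndiff by (metis ndiff.simps(2))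

lemma smooth_on_iff_pd:
 "smooth_on S f \<longleftrightarrow> f differentiable_on S \<and> (\<forall>v\<in>Basis. smooth_on S (pd v f))"
 unfolding smooth_on_iff_ndiff
 by (metis ndiff.simps(1) ndiff.simps(2) nat.exhaust)

lemma ndiff_differentiable: "ndiff n S f ==> f differentiable_on S"
 by (cases n) auto

lemma ndiff_Suc: "ndiff (Suc n) S f ==> ndiff n S f"
 by (auto simp: ndiff_iff)


lemma smooth_on_subset: "smooth_on S f ==> T \<subseteq> S ==> smooth_on T f"
 by (meson smooth_on_def differentiable_on_subset)

lemma differentiable_on_openD: "f differentiable_on S ==> open S ==> x \<in> S ==> f differentiable (at x)"
 by (simp add: differentiable_on_eq_differentiable_at)

lemma smooth_on_has_derivative:
 assumes "smooth_on S f" "open S" "x \<in> S"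
 shows "(f has_derivative frechet_derivative f (at x)) (at x)"
 using assms differentiable_on_openD frechet_derivative_works smooth_on_iff_pd by blast

lemma smooth_on_imp_continuous_on: "smooth_on S f ==> continuous_on S f"
 using differentiable_imp_continuous_on smooth_on_iff_pd by blast

lemma frechet_derivative_cong_open:
 assumes "open S" "x \<in> S" "\<And>y. y \<in> S ==> f y = g y"
 shows "frechet_derivative f (at x) = frechet_derivative g (at x)"
proof -
 have "(f has_derivative D) (at x) \<longleftrightarrow> (g has_derivative D) (at x)" for D
  using assms has_derivative_transform_within_open[of f D x UNIV S g]
   has_derivative_transform_within_open[of g D x UNIV S f] by auto
 then show ?thesis by (simp add: frechet_derivative_def)
qed

lemma differentiable_on_cong_on:
 assumes "f differentiable_on S" "\<And>y. y \<in> S ==> f y = g y"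
 shows "g differentiable_on S"
 unfolding differentiable_on_def
proof
 fix x assume "x \<in> S"
 then obtain D where "(f has_derivative D) (at x within S)"
  using assms(1) by (auto simp: differentiable_on_def differentiable_def)
 from has_derivative_transform[OF \<open>x \<in> S\<close> _ this, of g]
 show "g differentiable (at x within S)"
  using assms(2) by (metis differentiableI)
qed

lemma ndiff_cong:
 assumes "open S" "\<And>y. y \<in> S ==> f y = g y" "ndiff n S f"
 shows "ndiff n S g"
 using assms
proof (induction n arbitrary: f g)
 case 0
 then show ?case using differentiable_on_cong_on[of f S g] by simp
next
 case (Suc n)
 have "g differentiable_on S"
  using Suc.prems differentiable_on_cong_on[of f S g] by simp
 moreover have "ndiff n S (pd v g)" if "v \<in> Basis" for v
 proof (rule Suc.IH[of "pd v f"])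
  show "pd v f y = pd v g y" if "y \<in> S" for y
   using frechet_derivative_cong_open[of S y f g] that Suc.prems by simp
 qed (use Suc.prems that in auto)
 ultimately show ?case by simp
qed

lemma smooth_on_cong:
 assumes "open S" "\<And>y. y \<in> S ==> f y = g y" "smooth_on S f"
 shows "smooth_on S g"
 using assms ndiff_cong unfolding smooth_on_iff_ndiff by blast

lemma ndiff_Un:
 assumes "open S" "open T" "ndiff n S f" "ndiff n T f"
 shows "ndiff n (S \<union> T) f"
 using assms
 by (auto simp: ndiff_iff differentiable_on_eq_differentiable_at open_Un)

lemma smooth_on_Un:
 assumes "open S" "open T" "smooth_on S f" "smooth_on T f"
 shows "smooth_on (S \<union> T) f"
 using assms ndiff_Un unfolding smooth_on_iff_ndiff by blast

lemma ndiff_zero: "ndiff n S (\<lambda>_. 0)"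
 by (induction n) auto

lemma ndiff_const: "ndiff n S (\<lambda>_. c)"
 by (cases n) (auto simp: ndiff_zero)

lemma smooth_on_const [simp]: "smooth_on S (\<lambda>_. c)"
 by (simp add: smooth_on_iff_ndiff ndiff_const)

lemma ndiff_bounded_linear:
 assumes "bounded_linear f" shows "ndiff n S f"
proof -
 have "f differentiable_on S"
  using assms bounded_linear_imp_differentiable_on by blast
 moreover have "frechet_derivative f (at x) = f" for x
  using assms frechet_derivative_at bounded_linear_imp_has_derivative by metis
 ultimately show ?thesis by (cases n) (auto simp: ndiff_const)
qed

lemma smooth_on_bounded_linear: "bounded_linear f ==> smooth_on S f"
 by (simp add: smooth_on_iff_ndiff ndiff_bounded_linear)

lemma ndiff_add:
 assumes "open S" "ndiff n S f" "ndiff n S g"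
 shows "ndiff n S (\<lambda>x. f x + g x)"
 using assms
proof (induction n arbitrary: f g)
 case 0
 then show ?case by simp
next
 case (Suc n)
 have "ndiff n S (pd v (\<lambda>x. f x + g x))" if "v \<in> Basis" for v
 proof (rule ndiff_cong[OF \<open>open S\<close> _ Suc.IH[OF \<open>open S\<close>, of "pd v f" "pd v g"]])
  fix x assume "x \<in> S"
  then have "f differentiable (at x)" "g differentiable (at x)"
   using Suc.prems differentiable_on_openD by auto
  then have "((\<lambda>x. f x + g x) has_derivative (\<lambda>h. frechet_derivative f (at x) h + frechet_derivative g (at x) h)) (at x)"
   by (simp add: frechet_derivative_works has_derivative_add)
  from frechet_derivative_at[OF this]
  show "frechet_derivative f (at x) v + frechet_derivative g (at x) v = pd v (\<lambda>x. f x + g x) x"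
   by (simp add: fun_eq_iff)
 qed (use Suc.prems that in auto)
 then show ?case using Suc.prems by simp
qed

lemma ndiff_sum:
 assumes "open S" "finite I" "\<And>i. i \<in> I ==> ndiff n S (f i)"
 shows "ndiff n S (\<lambda>x. \<Sum>i\<in>I. f i x)"
 using assms(2,3) by (induction I rule: finite_induct) (auto simp: ndiff_zero ndiff_add assms(1))

lemma ndiff_bilinear:
 assumes "bounded_bilinear B" "open S" "ndiff n S f" "ndiff n S g"
 shows "ndiff n S (\<lambda>x. B (f x) (g x))"
 using assms(3,4)
proof (induction n arbitrary: f g)
 case 0
 then show ?case
  unfolding ndiff.simps differentiable_on_def differentiable_def
  using bounded_bilinear.FDERIV[OF assms(1)] by blast
next
 case (Suc n)
 have df: "(f has_derivative frechet_derivative f (at x)) (at x)" "(g has_derivative frechet_derivative g (at x)) (at x)"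
  if "x \<in> S" for x
  using that Suc.prems differentiable_on_openD[OF _ \<open>open S\<close>] by (auto simp: frechet_derivative_works[symmetric])
 have d: "((\<lambda>x. B (f x) (g x)) has_derivative
   (\<lambda>h. B (f x) (frechet_derivative g (at x) h) + B (frechet_derivative f (at x) h) (g x))) (at x)" if "x \<in> S" for x
  using bounded_bilinear.FDERIV[OF assms(1) df[OF that]] .
 have "ndiff n S (pd v (\<lambda>x. B (f x) (g x)))" if "v \<in> Basis" for v
 proof (rule ndiff_cong[OF \<open>open S\<close>])
  show "ndiff n S (\<lambda>x. B (f x) (pd v g x) + B (pd v f x) (g x))"
   by (intro ndiff_add[OF \<open>open S\<close>] Suc.IH) (use Suc.prems ndiff_Suc that in auto)
 next
  fix x assume "x \<in> S"
  from frechet_derivative_at[OF d[OF this]]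
  show "B (f x) (frechet_derivative g (at x) v) + B (frechet_derivative f (at x) v) (g x) = pd v (\<lambda>x. B (f x) (g x)) x"
   by (simp add: fun_eq_iff)
 qed
 moreover have "(\<lambda>x. B (f x) (g x)) differentiable_on S"
  using d by (meson differentiable_on_def differentiable_def has_derivative_at_withinI)
 ultimately show ?case by simp
qed

lemma smooth_on_add:
 "open S ==> smooth_on S f ==> smooth_on S g ==> smooth_on S (\<lambda>x. f x + g x)"
 by (simp add: smooth_on_iff_ndiff ndiff_add)

lemma smooth_on_bilinear:
 "bounded_bilinear B ==> open S ==> smooth_on S f ==> smooth_on S g ==> smooth_on S (\<lambda>x. B (f x) (g x))"
 by (simp add: smooth_on_iff_ndiff ndiff_bilinear)

lemmas smooth_on_mult = smooth_on_bilinear[OF bounded_bilinear_mult]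

text \<open>By the chain rule each partial derivative of the composite is a sum of products of
  components of the derivative of \<open>f\<close> with the functions \<open>pd e g\<close> composed
  with \<open>f\<close>. So the induction ranges over all \<open>g\<close>, with \<open>f\<close>
  fixed.\<close>

lemma ndiff_compose:
 fixes f :: "'a::euclidean_space => 'b::euclidean_space"
 assumes "open S" "open T" "f ` S \<subseteq> T" "ndiff n T g" "ndiff n S f"
 shows "ndiff n S (\<lambda>x. g (f x))"
 using assms(4,5)
proof (induction n arbitrary: g)
 case 0
 then show ?case
  using differentiable_on_compose[of f S g] assms(3)
  by (simp add: differentiable_on_subset o_def)
next
 case (Suc n)
 have df: "(f has_derivative frechet_derivative f (at x)) (at x)" "(g has_derivative frechet_derivative g (at (f x))) (at (f x))"
  if "x \<in> S" for x
  using that Suc.prems assms(3) differentiable_on_openD[OF _ \<open>open S\<close>, of f x] differentiable_on_openD[OF _ \<open>open T\<close>, of g "f x"]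
  by (auto simp: frechet_derivative_works[symmetric])
 have d: "((\<lambda>x. g (f x)) has_derivative (\<lambda>h. frechet_derivative g (at (f x)) (frechet_derivative f (at x) h))) (at x)" if "x \<in> S" for x
  using diff_chain_at[OF df[OF that]] by (simp add: o_def)
 have "ndiff n S (pd v (\<lambda>x. g (f x)))" if v: "v \<in> Basis" for v
 proof (rule ndiff_cong[OF \<open>open S\<close>])
  have "ndiff n S (\<lambda>x. pd v f x \<bullet> e)" for e
   using ndiff_bilinear[OF bounded_bilinear_inner \<open>open S\<close> _ ndiff_const[of n S e], of "pd v f"] Suc.prems v by auto
  then show "ndiff n S (\<lambda>x. \<Sum>e\<in>Basis. (pd v f x \<bullet> e) *\<^sub>R (pd e g (f x)))"
   by (intro ndiff_sum[OF \<open>open S\<close>] ndiff_bilinear[OF bounded_bilinear_scaleR \<open>open S\<close>] Suc.IH)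
    (use Suc.prems ndiff_Suc in auto)
 next
  fix x assume "x \<in> S"
  have lin: "linear (frechet_derivative g (at (f x)))"
   using df(2)[OF \<open>x \<in> S\<close>] has_derivative_linear by blast
  have "(\<Sum>e\<in>Basis. (pd v f x \<bullet> e) *\<^sub>R (pd e g (f x))) = frechet_derivative g (at (f x)) (\<Sum>e\<in>Basis. (pd v f x \<bullet> e) *\<^sub>R e)"
   by (simp add: linear_sum[OF lin] linear_scale[OF lin])
  then show "(\<Sum>e\<in>Basis. (pd v f x \<bullet> e) *\<^sub>R (pd e g (f x))) = pd v (\<lambda>x. g (f x)) x"
   using frechet_derivative_at[OF d[OF \<open>x \<in> S\<close>]] by (simp add: fun_eq_iff euclidean_representation)
 qed
 moreover have "(\<lambda>x. g (f x)) differentiable_on S"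
  using d by (meson differentiable_on_def differentiable_def has_derivative_at_withinI)
 ultimately show ?case by simp
qed

lemma smooth_on_compose:
 fixes f :: "'a::euclidean_space => 'b::euclidean_space"
 assumes "open S" "open T" "f ` S \<subseteq> T" "smooth_on T g" "smooth_on S f"
 shows "smooth_on S (\<lambda>x. g (f x))"
 using assms ndiff_compose unfolding smooth_on_iff_ndiff by blast

lemma smooth_on_linear_compose:
 fixes f :: "'a::euclidean_space => 'b::euclidean_space"
 assumes "bounded_linear L" "open S" "smooth_on S f"
 shows "smooth_on S (\<lambda>x. L (f x))"
 by (rule smooth_on_compose[OF assms(2) open_UNIV _ smooth_on_bounded_linear[OF assms(1)] assms(3)]) auto

lemma smooth_on_Pair:
 fixes f :: "'a::euclidean_space => 'b::euclidean_space" and g :: "'a => 'c::euclidean_space"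
 assumes "open S" "smooth_on S f" "smooth_on S g"
 shows "smooth_on S (\<lambda>x. (f x, g x))"
proof -
 have l: "bounded_linear (\<lambda>x::'b. (x, 0::'c))" "bounded_linear (\<lambda>x::'c. (0::'b, x))"
  by (auto intro!: bounded_linear_Pair bounded_linear_ident bounded_linear_zero)
 have "smooth_on S (\<lambda>x. (f x, 0::'c) + (0::'b, g x))"
  by (intro smooth_on_add assms smooth_on_linear_compose[OF l(1)] smooth_on_linear_compose[OF l(2)])
 then show ?thesis by simp
qed

lemma smooth_on_minus:
 fixes f :: "'a::euclidean_space => 'b::euclidean_space"
 shows "open S ==> smooth_on S f ==> smooth_on S (\<lambda>x. - f x)"
 by (rule smooth_on_linear_compose[OF bounded_linear_minus[OF bounded_linear_ident]])

lemma smooth_on_diff: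
 fixes f :: "'a::euclidean_space => 'b::euclidean_space"
 shows "open S ==> smooth_on S f ==> smooth_on S g ==> smooth_on S (\<lambda>x. f x - g x)"
 using smooth_on_add[OF _ _ smooth_on_minus, of S f g] by simp

lemma ndiff_inverse:
 "ndiff n (- {0}) (inverse :: 'a => 'a::{euclidean_space, real_normed_field})"
proof (induction n)
 case 0
 show ?case by (auto intro!: differentiable_on_inverse simp: differentiable_on_id[unfolded id_def] differentiable_on_def)
next
 case (Suc n)
 have d: "(inverse has_derivative (\<lambda>h. - (inverse x * h * inverse x))) (at x)" if "x \<noteq> 0" for x :: 'a
  using that has_derivative_inverse'[of x UNIV] by simp
 have o: "open (- {0::'a})" by auto
 have "ndiff n (- {0}) (pd v (inverse :: 'a => 'a))" for v
 proof (rule ndiff_cong[OF o])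
  show "ndiff n (- {0}) (\<lambda>x::'a. - v * (inverse x * inverse x))"
   by (intro ndiff_bilinear[OF bounded_bilinear_mult o] Suc.IH ndiff_const)
  show "- v * (inverse x * inverse x) = pd v inverse x" if "x \<in> - {0}" for x :: 'a
   using frechet_derivative_at[OF d[of x]] that by (simp add: fun_eq_iff mult_ac)
 qed
 moreover have "(inverse :: 'a => 'a) differentiable_on (- {0})"
  using Suc ndiff_differentiable by blast
 ultimately show ?case by simp
qed

lemma smooth_on_inverse:
 fixes f :: "'a::euclidean_space => 'b::{euclidean_space, real_normed_field}"
 assumes "open S" "smooth_on S f" "\<And>x. x \<in> S ==> f x \<noteq> 0"
 shows "smooth_on S (\<lambda>x. inverse (f x))"
 by (rule smooth_on_compose[OF assms(1) _ _ _ assms(2), of "-{0}"])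
  (use assms(3) ndiff_inverse in \<open>auto simp: smooth_on_iff_ndiff\<close>)

lemma smooth_on_divide:
 fixes f g :: "'a::euclidean_space => 'b::{euclidean_space, real_normed_field}"
 assumes "open S" "smooth_on S f" "smooth_on S g" "\<And>x. x \<in> S ==> g x \<noteq> 0"
 shows "smooth_on S (\<lambda>x. f x / g x)"
 unfolding divide_inverse by (intro smooth_on_mult smooth_on_inverse assms)

lemma ndiff_holomorphic:
 assumes "f holomorphic_on S" "open S"
 shows "ndiff n S f"
 using assms(1)
proof (induction n arbitrary: f)
 case 0
 then show ?case
  by (metis field_differentiable_imp_differentiable holomorphic_on_def differentiable_on_def ndiff.simps(1))
next
 case (Suc n)
 have "ndiff n S (pd v f)" for v
 proof (rule ndiff_cong[OF \<open>open S\<close>])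
  show "ndiff n S (\<lambda>x. deriv f x * v)"
   by (intro ndiff_bilinear[OF bounded_bilinear_mult \<open>open S\<close>] ndiff_const Suc.IH holomorphic_deriv Suc.prems assms)
  show "deriv f x * v = pd v f x" if "x \<in> S" for x
   using frechet_derivative_at[OF holomorphic_derivI[OF Suc.prems \<open>open S\<close> that, unfolded has_field_derivative_def]]
   by (simp add: fun_eq_iff)
 qed
 moreover have "f differentiable_on S"
  by (metis field_differentiable_imp_differentiable holomorphic_on_def differentiable_on_def Suc.prems)
 ultimately show ?case by simp
qed

lemma smooth_on_holomorphic: "f holomorphic_on S ==> open S ==> smooth_on S f"
 by (simp add: smooth_on_iff_ndiff ndiff_holomorphic)

section \<open>A smooth step function\<close>

text \<open>\<open>flat 1\<close> is the classical function \<open>exp (- (1 / u))\<close> continued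
  by zero. The polynomial factors make the class closed under differentiation, so that smoothness
  becomes an induction.\<close>

definition flat :: "real poly => real => real" where
 "flat p u = (if u > 0 then poly p (1 / u) * exp (- (1 / u)) else 0)"

lemma poly_over_exp_tendsto_0: "((\<lambda>y. poly p y * exp (- y)) \<longlongrightarrow> (0::real)) at_top"
proof -
 have "((\<lambda>y. coeff p i * (y ^ i / exp y)) \<longlongrightarrow> coeff p i * 0) at_top" for i
  by (intro tendsto_mult tendsto_const tendsto_power_div_exp_0)
 then have "((\<lambda>y. \<Sum>i\<le>degree p. coeff p i * (y ^ i / exp y)) \<longlongrightarrow> (\<Sum>i\<le>degree p. coeff p i * 0)) at_top"
  by (intro tendsto_sum)
 moreover have "(\<Sum>i\<le>degree p. coeff p i * (y ^ i / exp y)) = poly p y * exp (- y)" for y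
  by (simp add: poly_altdef sum_distrib_right exp_minus divide_inverse mult.assoc)
 ultimately show ?thesis by simp
qed

lemma flat_tendsto_0: "(flat p \<longlongrightarrow> 0) (at 0)"
proof -
 have "((\<lambda>u. poly p (inverse u) * exp (- inverse u)) \<longlongrightarrow> 0) (at_right 0)"
  using filterlim_compose[OF poly_over_exp_tendsto_0 filterlim_inverse_at_top_right] .
 then have "(flat p \<longlongrightarrow> 0) (at_right 0)"
  by (rule tendsto_cong[THEN iffD1, rotated])
   (auto simp: flat_def inverse_eq_divide eventually_at_right_field intro!: exI[of _ 1])
 moreover have "(flat p \<longlongrightarrow> 0) (at_left 0)"
  by (rule tendsto_cong[THEN iffD1, OF _ tendsto_const])
   (auto simp: flat_def eventually_at_left_field intro!: exI[of _ "-1"])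
 ultimately show ?thesis by (simp add: filterlim_at_split)
qed

text \<open>With \<open>y = 1 / u\<close> one has \<open>d/du = - y^2 d/dy\<close>, and
  \<open>p(y) exp (- y)\<close> has the \<open>y\<close>-derivative
  \<open>(p' - p)(y) exp (- y)\<close>. At \<open>0\<close> the difference quotients tend to
  zero.\<close>

lemma flat_has_derivative: "(flat p has_field_derivative flat ([:0, 0, 1:] * (p - pderiv p)) u) (at u)"
proof -
 consider "u > 0" | "u < 0" | "u = 0" by linarith
 then show ?thesis
 proof cases
  case 1
  have "((\<lambda>u. poly p (1 / u) * exp (- (1 / u))) has_field_derivative
    flat ([:0, 0, 1:] * (p - pderiv p)) u) (at u)"
   using 1 by (auto intro!: derivative_eq_intros DERIV_chain2[OF poly_DERIV] simp: flat_def field_simps power2_eq_square)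
  then show ?thesis
   by (rule has_field_derivative_transform_within_open[of _ _ _ "{0<..}"]) (use 1 in \<open>auto simp: flat_def\<close>)
 next
  case 2
  have "((\<lambda>u. 0) has_field_derivative flat ([:0, 0, 1:] * (p - pderiv p)) u) (at u)"
   using 2 by (simp add: flat_def)
  then show ?thesis
   by (rule has_field_derivative_transform_within_open[of _ _ _ "{..<0}"]) (use 2 in \<open>auto simp: flat_def\<close>)
 next
  case 3
  \<comment> \<open>Dividing by \<open>h\<close> multiplies \<open>p(y)\<close> by \<open>y\<close>,
    so the difference quotient at \<open>0\<close> is again a function of the class.\<close>
  have "((\<lambda>h. flat (pCons 0 p) h) \<longlongrightarrow> 0) (at 0)" by (rule flat_tendsto_0)
  moreover have "flat (pCons 0 p) h = (flat p (0 + h) - flat p 0) / h" if "h \<noteq> 0" for h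
   using that by (simp add: flat_def)
  ultimately have "((\<lambda>h. (flat p (0 + h) - flat p 0) / h) \<longlongrightarrow> 0) (at 0)"
   by (subst (asm) tendsto_cong[of _ "\<lambda>h. (flat p (0 + h) - flat p 0) / h"]) (auto simp: eventually_at intro!: exI[of _ 1])
  then show ?thesis using 3 by (simp add: DERIV_def flat_def)
 qed
qed

lemma frechet_derivative_real:
 fixes f :: "real => 'b::real_normed_field"
 shows "(f has_vector_derivative D) (at x) ==> frechet_derivative f (at x) v = v *\<^sub>R D"
 unfolding has_vector_derivative_def using frechet_derivative_at by metis

lemma ndiff_flat: "ndiff n UNIV (flat p)"
proof (induction n arbitrary: p)
 case 0
 show ?case using flat_has_derivative
  by (auto simp: differentiable_on_def has_field_derivative_def differentiable_def intro: has_derivative_at_withinI)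
next
 case (Suc n)
 have "pd 1 (flat p) = flat ([:0, 0, 1:] * (p - pderiv p))"
  using frechet_derivative_real[OF flat_has_derivative[unfolded has_real_derivative_iff_has_vector_derivative], of p _ 1]
  by (simp add: fun_eq_iff)
 then show ?case using Suc[of p] Suc[of "[:0, 0, 1:] * (p - pderiv p)"] by (simp add: ndiff_differentiable)
qed

definition step :: "real => real" where
 "step u = flat 1 u / (flat 1 u + flat 1 (1 - u))"

lemma step_denom_pos: "flat 1 u + flat 1 (1 - u) > 0"
 by (auto simp: flat_def add_pos_pos)

lemma smooth_step: "smooth_on UNIV step"
proof -
 have f: "smooth_on UNIV (flat 1)" by (simp add: smooth_on_iff_ndiff ndiff_flat)
 have "smooth_on UNIV (\<lambda>u::real. 1 - u)"
  by (intro smooth_on_diff smooth_on_const smooth_on_bounded_linear bounded_linear_ident open_UNIV)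
 then have "smooth_on UNIV (\<lambda>u. flat 1 (1 - u))"
  by (intro smooth_on_compose[OF open_UNIV open_UNIV _ f]) auto
 then show ?thesis
  unfolding step_def[abs_def] using f step_denom_pos
  by (intro smooth_on_divide smooth_on_add open_UNIV) (auto simp: less_imp_neq[symmetric])
qed

lemma step_le_0: "u \<le> 0 ==> step u = 0" by (simp add: step_def flat_def)

lemma step_ge_1: "u \<ge> 1 ==> step u = 1" by (simp add: step_def flat_def)

lemma step_bounds: "0 \<le> step u" "step u \<le> 1"
 using step_denom_pos[of u] by (auto simp: step_def flat_def divide_simps)

definition dstep :: "real => real" where "dstep = pd 1 step"

lemma step_has_derivative: "(step has_field_derivative dstep u) (at u)"
proof -
 have "step differentiable (at u)"
  using smooth_step differentiable_on_openD smooth_on_iff_pd by blast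
 then obtain D where D: "(step has_field_derivative D) (at u)"
  using real_differentiableE by blast
 moreover have "dstep u = D"
  unfolding dstep_def using frechet_derivative_real[OF D[unfolded has_real_derivative_iff_has_vector_derivative], of 1] by simp
 ultimately show ?thesis by simp
qed

lemma continuous_on_dstep: "continuous_on S dstep"
 using smooth_on_imp_continuous_on[OF smooth_on_pd[OF smooth_step, of 1]] continuous_on_subset
 unfolding dstep_def by auto

lemma dstep_eq_0:
 assumes "u \<notin> {0..1}" shows "dstep u = 0"
proof -
 consider "u < 0" | "u > 1" using assms by force
 then have "(step has_field_derivative 0) (at u)"
 proof cases
  case 1
  show ?thesis
   by (rule has_field_derivative_transform_within_open[of "\<lambda>_. 0" _ _ "{..<0}"]) (use 1 in \<open>auto simp: step_le_0\<close>)
 next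
  case 2
  show ?thesis
   by (rule has_field_derivative_transform_within_open[of "\<lambda>_. 1" _ _ "{1<..}"]) (use 2 in \<open>auto simp: step_ge_1\<close>)
 qed
 then show ?thesis using step_has_derivative DERIV_unique by blast
qed

lemma dstep_bounded: obtains B where "B > 0" "\<And>u. \<bar>dstep u\<bar> \<le> B"
proof -
 have "bounded (dstep ` {0..1})"
  by (intro compact_imp_bounded compact_continuous_image continuous_on_dstep) auto
 then obtain B where B: "B > 0" "\<forall>y\<in>dstep ` {0..1}. norm y \<le> B"
  unfolding bounded_pos by blast
 show ?thesis
 proof (rule that[OF B(1)])
  show "\<bar>dstep u\<bar> \<le> B" for u
   using B dstep_eq_0[of u] by (cases "u \<in> {0..1}") auto
 qed
qed

lemma dstep_integral: "(LINT s|lborel. dstep s) = 1"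
proof -
 have "(dstep has_integral (step 1 - step 0)) {0..1}"
  by (rule fundamental_theorem_of_calculus)
   (use step_has_derivative in \<open>auto simp: has_real_derivative_iff_has_vector_derivative intro: has_vector_derivative_at_within\<close>)
 moreover have "set_integrable lborel {0..1} dstep"
  by (intro borel_integrable_atLeastAtMost') (rule continuous_on_dstep)
 ultimately have "(LINT s:{0..1}|lborel. dstep s) = 1"
  using set_borel_integral_eq_integral(2)[of "{0..1}" dstep] by (simp add: integral_unique step_ge_1 step_le_0)
 moreover have "indicator {0..1} s *\<^sub>R dstep s = dstep s" for s
  using dstep_eq_0[of s] by (auto simp: indicator_def)
 ultimately show ?thesis by (simp only: set_lebesgue_integral_def)
qed

text \<open>The derivatives of \<open>u \<mapsto> step (c\<^sub>n (u - a))\<close> approximate the unit mass at \<open>a\<close>.\<close>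

lemma dstep_kernel_limit:
 fixes w :: "nat => real => complex"
 assumes c: "\<And>n. c n > 0"
  and cont: "\<And>n. continuous_on {a..a + 1 / c n} (w n)"
  and bd: "\<And>n u. u \<in> {a..a + 1 / c n} ==> norm (w n u) \<le> B"
  and lim: "\<And>s. s \<in> {0..1} ==> (\<lambda>n. w n (a + s / c n)) \<longlonglongrightarrow> L"
 shows "(\<lambda>n. LINT u|lborel. (c n * dstep (c n * (u - a))) *\<^sub>R w n u) \<longlonglongrightarrow> L"
proof -
 obtain D where D: "D > 0" "\<And>u. \<bar>dstep u\<bar> \<le> D" using dstep_bounded by blast
 have "(LINT u|lborel. (c n * dstep (c n * (u - a))) *\<^sub>R w n u) = (LINT s|lborel. dstep s *\<^sub>R w n (a + s / c n))" for n
  using lborel_integral_real_affine[of "1 / c n" "\<lambda>u. (c n * dstep (c n * (u - a))) *\<^sub>R w n u" a] c[of n]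
  by (simp add: field_simps flip: integral_scaleR_right)
 moreover have "(\<lambda>n. LINT s|lborel. dstep s *\<^sub>R w n (a + s / c n)) \<longlonglongrightarrow> (LINT s|lborel. dstep s *\<^sub>R L)"
 proof (rule integral_dominated_convergence[where w = "\<lambda>s. indicator {0..1} s *\<^sub>R (D * B)"])
  show "(\<lambda>s. dstep s *\<^sub>R L) \<in> borel_measurable lborel"
   using continuous_on_dstep[of UNIV] by (auto intro!: borel_measurable_continuous_onI continuous_intros)
  show "(\<lambda>s. dstep s *\<^sub>R w n (a + s / c n)) \<in> borel_measurable lborel" for n
  proof -
   have "continuous_on {0..1} (\<lambda>s. dstep s *\<^sub>R w n (a + s / c n))"
   proof (intro continuous_intros continuous_on_dstep continuous_on_compose2[OF cont[of n]])
    show "\<forall>x\<in>{0..1::real}. c n \<noteq> 0" using c[of n] by simp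
    show "(\<lambda>x. a + x / c n) ` {0..1} \<subseteq> {a..a + 1 / c n}" using c[of n] by (auto simp: divide_right_mono)
   qed
   then have "(\<lambda>s. indicator {0..1} s *\<^sub>R (dstep s *\<^sub>R w n (a + s / c n))) \<in> borel_measurable borel"
    by (intro borel_measurable_continuous_on_indicator) auto
   also have "(\<lambda>s. indicator {0..1} s *\<^sub>R (dstep s *\<^sub>R w n (a + s / c n))) = (\<lambda>s. dstep s *\<^sub>R w n (a + s / c n))"
    using dstep_eq_0 by (force simp: indicator_def fun_eq_iff)
   finally show ?thesis by simp
  qed
  show "integrable lborel (\<lambda>s::real. indicator {0..1} s *\<^sub>R (D * B))"
   by (rule integrable_real_indicator[THEN integrable_scaleR_left]) auto
  show "AE s in lborel. (\<lambda>n. dstep s *\<^sub>R w n (a + s / c n)) \<longlonglongrightarrow> dstep s *\<^sub>R L"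
  proof (rule AE_I2)
   fix s show "(\<lambda>n. dstep s *\<^sub>R w n (a + s / c n)) \<longlonglongrightarrow> dstep s *\<^sub>R L"
    by (cases "s \<in> {0..1}") (auto intro!: tendsto_intros lim simp: dstep_eq_0)
  qed
  show "AE s in lborel. norm (dstep s *\<^sub>R w n (a + s / c n)) \<le> indicator {0..1} s *\<^sub>R (D * B)" for n
  proof (rule AE_I2)
   fix s show "norm (dstep s *\<^sub>R w n (a + s / c n)) \<le> indicator {0..1} s *\<^sub>R (D * B)"
   proof (cases "s \<in> {0..1}")
    case True
    then have "norm (w n (a + s / c n)) \<le> B" using c[of n] by (intro bd) (auto simp: divide_right_mono)
    then show ?thesis using True D(2)[of s] D(1) by (simp add: mult_mono')
   qed (simp add: dstep_eq_0)
  qed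
 qed
 moreover have "(LINT s|lborel. dstep s *\<^sub>R L) = L"
 proof -
  have "integrable lborel dstep"
  proof -
   have "set_integrable lborel {0..1} dstep"
    by (intro borel_integrable_atLeastAtMost') (rule continuous_on_dstep)
   moreover have "indicator {0..1} s *\<^sub>R dstep s = dstep s" for s
    using dstep_eq_0[of s] by (auto simp: indicator_def)
   ultimately show ?thesis by (simp only: set_integrable_def)
  qed
  then show ?thesis by (simp add: dstep_integral)
 qed
 ultimately show ?thesis by simp
qed

text \<open>A smooth version of the indicator of \<open>{a<..b}\<close> at scale
  \<open>1 / c\<close>. Its derivative is the difference of two kernels of integral one, supported
  just to the right of \<open>a\<close> and of \<open>b\<close>; this turns weak identities into
  identities between boundary terms.\<close>

definition plateau :: "real => real => real => real => real" where
 "plateau c a b u = step (c * (u - a)) - step (c * (u - b))"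

lemma smooth_plateau: "smooth_on UNIV (plateau c a b)"
proof -
 have l: "smooth_on UNIV (\<lambda>u::real. c * (u - a))" for a
  by (intro smooth_on_diff smooth_on_mult smooth_on_const smooth_on_bounded_linear[OF bounded_linear_ident] open_UNIV)
 have "smooth_on UNIV (\<lambda>u. step (c * (u - a)))" for a
  by (rule smooth_on_compose[OF open_UNIV open_UNIV _ smooth_step l]) auto
 then show ?thesis unfolding plateau_def[abs_def] by (intro smooth_on_diff) auto
qed

lemma plateau_has_derivative:
 "(plateau c a b has_field_derivative (c * dstep (c * (u - a)) - c * dstep (c * (u - b)))) (at u)"
proof -
 have "((\<lambda>u. step (c * (u - a))) has_field_derivative c * dstep (c * (u - a))) (at u)" for a
 proof -
  have "((\<lambda>u. c * (u - a)) has_field_derivative c) (at u)"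
   by (auto intro!: derivative_eq_intros)
  from DERIV_chain2[OF step_has_derivative this] show ?thesis by (simp only: mult.commute)
 qed
 from DERIV_diff[OF this[of a] this[of b]] show ?thesis unfolding plateau_def[abs_def] .
qed


lemma plateau_eq_0:
 assumes "c > 0" "a \<le> b" "u \<notin> {a..b + 1 / c}" shows "plateau c a b u = 0"
proof (cases "u < a")
 case True
 then show ?thesis using assms by (simp add: plateau_def step_le_0 mult_nonneg_nonpos)
next
 case False
 then have "u > b + 1 / c" using assms by auto
 then have "c * (u - b) \<ge> 1" using assms(1) by (simp add: field_simps)
 moreover have "c * (u - a) \<ge> c * (u - b)" using assms by (intro mult_left_mono) auto
 ultimately show ?thesis by (simp add: plateau_def step_ge_1)
qed

lemma plateau_bounds:
 assumes "c > 0" "a \<le> b" shows "\<bar>plateau c a b u\<bar> \<le> 1"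
 using step_bounds[of "c * (u - a)"] step_bounds[of "c * (u - b)"] by (auto simp: plateau_def)

lemma plateau_tendsto:
 assumes c: "filterlim c at_top sequentially" and "a < b"
 shows "(\<lambda>n. plateau (c n) a b u) \<longlonglongrightarrow> indicator {a<..b} u"
proof -
 have pos: "\<forall>\<^sub>F n in sequentially. c n > 0"
  using c by (simp add: filterlim_at_top_dense)
 have one: "(\<lambda>n. step (c n * (u - a))) \<longlonglongrightarrow> 1" if "a < u" for a
 proof (rule tendsto_eventually)
  have "\<forall>\<^sub>F n in sequentially. c n \<ge> 1 / (u - a)" using c by (simp add: filterlim_at_top)
  then show "\<forall>\<^sub>F n in sequentially. step (c n * (u - a)) = 1"
   by eventually_elim (use that in \<open>simp add: step_ge_1 field_simps\<close>)
 qed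
 have zero: "(\<lambda>n. step (c n * (u - a))) \<longlonglongrightarrow> 0" if "u \<le> a" for a
  by (rule tendsto_eventually, use pos in eventually_elim) (use that in \<open>simp add: step_le_0 mult_nonneg_nonpos\<close>)
 have "(\<lambda>n. step (c n * (u - a)) - step (c n * (u - b))) \<longlonglongrightarrow> (if a < u then 1 else 0) - (if b < u then 1 else 0)"
  by (intro tendsto_diff) (auto intro: one zero)
 then show ?thesis using \<open>a < b\<close> by (auto simp: plateau_def indicator_def split: if_splits)
qed

section \<open>One-dimensional Hausdorff measure\<close>

definition small_covers :: "real => plane set => (nat => plane set) set" where
 "small_covers d A = {C. A \<subseteq> (\<Union>i. C i) \<and> (\<forall>i. bounded (C i) \<and> diameter (C i) \<le> d)}"

definition hcontent :: "real => plane set => ennreal" where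
 "hcontent d A = (INF C\<in>small_covers d A. \<Sum>i. ennreal (diameter (C i)))"

lemma hausdorff1_outer_eq: "hausdorff1_outer A = (SUP d\<in>{0<..}. hcontent d A)"
 by (simp add: hausdorff1_outer_def hcontent_def small_covers_def)

lemma hcontent_le_hausdorff1_outer: "d > 0 ==> hcontent d A \<le> hausdorff1_outer A"
 unfolding hausdorff1_outer_eq by (rule SUP_upper) simp

lemma hcontent_le: "C \<in> small_covers d A ==> hcontent d A \<le> (\<Sum>i. ennreal (diameter (C i)))"
 unfolding hcontent_def by (rule INF_lower)

lemma hcontent_close: "hcontent d A < e ==> \<exists>C\<in>small_covers d A. (\<Sum>i. ennreal (diameter (C i))) < e"
 unfolding hcontent_def INF_less_iff by auto

lemma hcontent_antimono: "d \<le> d' ==> hcontent d' A \<le> hcontent d A"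
 unfolding hcontent_def by (rule INF_superset_mono) (auto simp: small_covers_def intro: order_trans)

lemma hcontent_mono: "A \<subseteq> B ==> hcontent d A \<le> hcontent d B"
 unfolding hcontent_def by (rule INF_superset_mono) (auto simp: small_covers_def)

lemma hausdorff1_outer_mono: "A \<subseteq> B ==> hausdorff1_outer A \<le> hausdorff1_outer B"
 unfolding hausdorff1_outer_eq by (rule SUP_mono') (rule hcontent_mono)

lemma space_hausdorff1 [simp]: "space hausdorff1 = UNIV"
 and sets_hausdorff1 [measurable_cong]: "sets hausdorff1 = sets borel"
 unfolding hausdorff1_def by (simp_all add: sets_measure_of_conv space_measure_of_conv sets.sigma_sets_eq[of borel, simplified])

lemma emeasure_hausdorff1:
 assumes "A \<in> sets borel"
 shows "emeasure hausdorff1 A = (if measure_space UNIV (sets borel) hausdorff1_outer then hausdorff1_outer A else 0)"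
 using assms sets.sigma_sets_eq[of "borel :: plane measure"] by (simp add: hausdorff1_def emeasure_measure_of_conv)

section \<open>Arc length and parametrisations\<close>

text \<open>A \<open>K\<close>-Lipschitz function maps a set of diameter \<open>d\<close> into an
  interval of length at most \<open>K d\<close>, so every cover of \<open>A\<close> gives a cover of
  \<open>B\<close> by intervals whose total length is at most \<open>K\<close> times the sum of the
  diameters.\<close>

lemma lborel_le_hausdorff1_outer:
 fixes g :: "plane => real"
 assumes K: "K > 0" and lip: "\<And>y z. y \<in> A ==> z \<in> A ==> \<bar>g y - g z\<bar> \<le> K * dist y z"
  and B: "B \<in> sets borel" "B \<subseteq> g ` A"
 shows "emeasure lborel B \<le> ennreal K * hausdorff1_outer A"
proof (rule ennreal_le_epsilon)
 fix e :: real assume e: "e > 0" and fin: "ennreal K * hausdorff1_outer A < top"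
 have "hcontent 1 A \<le> hausdorff1_outer A" by (rule hcontent_le_hausdorff1_outer) simp
 moreover have "hausdorff1_outer A < top"
  using fin K by (cases "hausdorff1_outer A = 0") (auto simp: ennreal_mult_less_top)
 moreover from this have "hausdorff1_outer A < hausdorff1_outer A + ennreal (e / K)"
  using e K by (cases "hausdorff1_outer A") (auto simp: ennreal_plus[symmetric] ennreal_less_iff simp del: ennreal_plus)
 ultimately have "hcontent 1 A < hausdorff1_outer A + ennreal (e / K)"
  using le_less_trans by blast
 then obtain C where C: "C \<in> small_covers 1 A" and sum: "(\<Sum>i. ennreal (diameter (C i))) < hausdorff1_outer A + ennreal (e / K)"
  using hcontent_close by blast
 define G where "G i = g ` (C i \<inter> A)" for i
 \<comment> \<open>The interval spanned by the image; an empty piece is kept apart because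
   \<open>Inf\<close> and \<open>Sup\<close> of the empty set carry no information.\<close>
 define I where "I i = (if G i = {} then {} else {Inf (G i)..Sup (G i)})" for i
 have G: "bdd_above (G i) \<and> bdd_below (G i) \<and> Sup (G i) - Inf (G i) \<le> K * diameter (C i)" if "G i \<noteq> {}" for i
 proof -
  have d: "x - y \<le> K * diameter (C i)" if xy: "x \<in> G i" "y \<in> G i" for x y
  proof -
   obtain u v where uv: "u \<in> C i" "u \<in> A" "v \<in> C i" "v \<in> A" "x = g u" "y = g v" using xy by (auto simp: G_def)
   have "dist u v \<le> diameter (C i)"
    using C uv by (intro diameter_bounded_bound) (auto simp: small_covers_def)
   then have "K * dist u v \<le> K * diameter (C i)" using K by simp
   then show ?thesis using lip[OF uv(2,4)] uv by linarith
  qed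
  obtain x0 where x0: "x0 \<in> G i" using \<open>G i \<noteq> {}\<close> by blast
  have a: "bdd_above (G i)" using d[OF _ x0] by (intro bdd_aboveI[of _ "x0 + K * diameter (C i)"]) (simp add: diff_le_eq add.commute)
  have b: "bdd_below (G i)" using d[OF x0] by (intro bdd_belowI[of _ "x0 - K * diameter (C i)"]) (simp add: algebra_simps)
  have "Sup (G i) \<le> Inf (G i) + K * diameter (C i)"
  proof (rule cSup_least[OF that])
   fix x assume "x \<in> G i"
   have "x - K * diameter (C i) \<le> Inf (G i)"
    using d[OF \<open>x \<in> G i\<close>] by (intro cInf_greatest[OF that]) (simp add: algebra_simps)
   then show "x \<le> Inf (G i) + K * diameter (C i)" by simp
  qed
  then show ?thesis using a b by simp
 qed
 have "B \<subseteq> (\<Union>i. I i)"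
 proof
  fix x assume "x \<in> B"
  then obtain y where y: "y \<in> A" "x = g y" using B(2) by blast
  then obtain i where "y \<in> C i" using C by (auto simp: small_covers_def)
  then have "x \<in> G i" using y by (auto simp: G_def)
  then have "x \<in> I i" using G[of i] by (auto simp: I_def intro: cInf_lower cSup_upper)
  then show "x \<in> (\<Union>i. I i)" by blast
 qed
 then have "emeasure lborel B \<le> emeasure lborel (\<Union>i. I i)"
  by (intro emeasure_mono) (auto simp: I_def)
 also have "\<dots> \<le> (\<Sum>i. emeasure lborel (I i))"
  by (intro emeasure_subadditive_countably) (auto simp: I_def)
 also have "\<dots> \<le> (\<Sum>i. ennreal K * ennreal (diameter (C i)))"
 proof (intro suminf_le allI)
  fix i show "emeasure lborel (I i) \<le> ennreal K * ennreal (diameter (C i))"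
  proof (cases "G i = {}")
   case False
   then have "Inf (G i) \<le> Sup (G i)" using G[of i] cInf_le_cSup by blast
   then show ?thesis using G[of i] False K by (simp add: I_def ennreal_mult[symmetric] diameter_ge_0 ennreal_leI
     C[unfolded small_covers_def, simplified])
  qed (simp add: I_def)
 qed auto
 also have "\<dots> = ennreal K * (\<Sum>i. ennreal (diameter (C i)))" by (rule ennreal_suminf_cmult)
 also have "\<dots> \<le> ennreal K * (hausdorff1_outer A + ennreal (e / K))"
  using sum by (intro mult_left_mono) auto
 also have "\<dots> = ennreal K * hausdorff1_outer A + ennreal e"
  using K e by (simp add: distrib_left ennreal_mult[symmetric])
 finally show "emeasure lborel B \<le> ennreal K * hausdorff1_outer A + ennreal e" .
qed

text \<open>\<open>N\<close> has an open neighbourhood of small measure. Its components are disjoint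
  intervals, and the part of \<open>N\<close> in a component has an image of diameter at most
  \<open>K\<close> times the length of that component.\<close>

lemma hausdorff1_outer_lipschitz_null:
 fixes T :: "real => plane"
 assumes N: "negligible N" and K: "K > 0"
  and lip: "\<And>x y. x \<in> N ==> y \<in> N ==> dist (T x) (T y) \<le> K * \<bar>x - y\<bar>"
 shows "hausdorff1_outer (T ` N) = 0"
proof -
 have "hcontent d (T ` N) \<le> 0 + ennreal e" if d: "d > 0" and e: "e > 0" for d e
 proof -
  \<comment> \<open>\<open>K * r \<le> d\<close> keeps the covering sets admissible,
    \<open>K * r \<le> e\<close> bounds the sum of their diameters.\<close>
  define r where "r = min d e / K"
  have r: "r > 0" "K * r \<le> d" "K * r \<le> e" using d e K by (auto simp: r_def)
  have N0: "N \<in> null_sets lebesgue" using N by (simp add: negligible_iff_null_sets)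
  obtain U where U: "open U" "N \<subseteq> U" "emeasure lebesgue (U - N) < ennreal r"
   using sets_lebesgue_outer_open[of N r] N0 r(1) by (metis null_setsD2)
  have "emeasure lebesgue (U - N) = emeasure lebesgue U" using N0 U(1) by (intro emeasure_Diff_null_set) auto
  then have Ue: "emeasure lborel U < ennreal r" using U by simp
  \<comment> \<open>There may be finitely many components only; numbering them by an injection
    leaves the remaining \<open>E k\<close> empty.\<close>
  define i where "i = to_nat_on (components U)"
  have i: "inj_on i (components U)"
   unfolding i_def using pairwise_disjoint_components open_components[OF U(1)]
   by (intro inj_on_to_nat_on countable_disjoint_open_subsets) (auto simp: pairwise_def disjnt_def)
  define E where "E k = \<Union>{c \<in> components U. i c = k}" for k
  have E: "E k = {} \<or> E k \<in> components U" for k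
  proof (cases "\<exists>c\<in>components U. i c = k")
   case True
   then obtain c where "c \<in> components U" "i c = k" by blast
   moreover from this i have "{c \<in> components U. i c = k} = {c}" by (auto dest: inj_onD)
   ultimately show ?thesis by (simp add: E_def)
  qed (auto simp: E_def)
  have oE: "open (E k)" for k
   unfolding E_def using open_components[OF U(1)] by (intro open_Union) auto
  have EU: "(\<Union>k. E k) = U" unfolding E_def using Union_components[of U] by blast
  have disj: "disjoint_family E"
   unfolding disjoint_family_on_def E_def using components_nonoverlap[of _ U] by fast
  define m where "m k = measure lborel (E k)" for k
  have mE: "emeasure lborel (E k) = ennreal (m k)" "m k \<le> r" for k
  proof -
   have le: "emeasure lborel (E k) \<le> emeasure lborel U" using EU U(1) by (intro emeasure_mono) auto
   then have "emeasure lborel (E k) \<noteq> \<infinity>" using Ue by (auto simp: top_unique)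
   then show "emeasure lborel (E k) = ennreal (m k)" unfolding m_def by (simp add: emeasure_eq_ennreal_measure)
   with le Ue r(1) show "m k \<le> r" by (metis ennreal_le_iff less_imp_le order_trans)
  qed
  have dd: "dist x y \<le> K * m k" if xy: "x \<in> T ` (E k \<inter> N)" "y \<in> T ` (E k \<inter> N)" for x y k
  proof -
   obtain u v where uv: "u \<in> E k" "v \<in> E k" "u \<in> N" "v \<in> N" "x = T u" "y = T v" using xy by auto
   have "connected (E k)" using E[of k] in_components_connected by auto
   then have "{min u v..max u v} \<subseteq> E k" using uv(1,2) connected_contains_Icc by (auto simp: min_def max_def)
   then have "emeasure lborel {min u v..max u v} \<le> emeasure lborel (E k)" using oE by (intro emeasure_mono) auto
   then have "\<bar>u - v\<bar> \<le> m k" unfolding mE by (auto simp: m_def min_def max_def ennreal_le_iff split: if_splits)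
   then show ?thesis using lip[OF uv(3,4)] K uv(5,6) by (metis mult_left_mono less_imp_le order_trans)
  qed
  have dm: "diameter (T ` (E k \<inter> N)) \<le> K * m k" for k
   using dd[of _ k] K by (intro diameter_le) (auto simp: dist_norm m_def)
  have "(\<lambda>k. T ` (E k \<inter> N)) \<in> small_covers d (T ` N)"
   unfolding small_covers_def
  proof (intro CollectI conjI allI)
   show "T ` N \<subseteq> (\<Union>k. T ` (E k \<inter> N))" using U(2) EU by blast
   show "bounded (T ` (E k \<inter> N))" for k unfolding bounded_two_points using dd by blast
   have "K * m k \<le> K * r" for k using mE(2) K by simp
   then show "diameter (T ` (E k \<inter> N)) \<le> d" for k using dm r(2) by (meson order_trans)
  qed
  then have "hcontent d (T ` N) \<le> (\<Sum>k. ennreal (diameter (T ` (E k \<inter> N))))" by (rule hcontent_le)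
  also have "\<dots> \<le> (\<Sum>k. ennreal K * emeasure lborel (E k))"
   using dm K by (intro suminf_le allI) (auto simp: mE m_def ennreal_mult[symmetric] ennreal_leI)
  also have "\<dots> = ennreal K * emeasure lborel U"
   using suminf_emeasure[of E lborel] disj oE EU by (simp add: ennreal_suminf_cmult image_subset_iff)
  also have "\<dots> \<le> ennreal K * ennreal r" using Ue by (intro mult_left_mono) auto
  also have "\<dots> \<le> 0 + ennreal e" using K r by (simp add: ennreal_mult[symmetric] ennreal_leI)
  finally show ?thesis .
 qed
 then have "hcontent d (T ` N) = 0" if "d > 0" for d
  using ennreal_le_epsilon[of 0 "hcontent d (T ` N)"] that by simp
 then show ?thesis by (auto simp: hausdorff1_outer_eq SUP_eq_const)
qed

text \<open>Closing the covering sets does not change their diameters. The intersection, over the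
  scales \<open>1 / (n + 1)\<close>, of the unions of the closed covers is therefore a Borel set
  that is covered just as cheaply as \<open>E\<close>.\<close>

lemma hausdorff1_null_hull:
 assumes "hausdorff1_outer E = 0"
 obtains B where "B \<in> sets borel" "E \<subseteq> B" "hausdorff1_outer B = 0"
proof -
 have "\<exists>C\<in>small_covers (1 / real (Suc n)) E. (\<Sum>i. ennreal (diameter (C i))) < ennreal (1 / real (Suc n))" for n
 proof (rule hcontent_close)
  have "hcontent (1 / real (Suc n)) E = 0"
   using hcontent_le_hausdorff1_outer[of "1 / real (Suc n)" E] assms by simp
  then show "hcontent (1 / real (Suc n)) E < ennreal (1 / real (Suc n))" by simp
 qed
 then obtain C where C: "\<And>n. C n \<in> small_covers (1 / real (Suc n)) E"
  "\<And>n. (\<Sum>i. ennreal (diameter (C n i))) < ennreal (1 / real (Suc n))" by metis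
 define B where "B = (\<Inter>n. \<Union>i. closure (C n i))"
 have small: "(\<lambda>i. closure (C n i)) \<in> small_covers (1 / real (Suc n)) B" for n
  using C(1)[of n] by (auto simp: small_covers_def B_def diameter_closure)
 have "hcontent d B \<le> 0 + ennreal e" if "d > 0" "e > 0" for d e
 proof -
  obtain n where n: "1 / real (Suc n) < min d e"
  proof -
   assume *: "\<And>n. 1 / real (Suc n) < min d e ==> thesis"
   have "0 < min d e" using \<open>d > 0\<close> \<open>e > 0\<close> by simp
   from reals_Archimedean[OF this] show thesis unfolding inverse_eq_divide using * by blast
  qed
  have "hcontent d B \<le> hcontent (1 / real (Suc n)) B" using n by (intro hcontent_antimono) auto
  also have "\<dots> \<le> (\<Sum>i. ennreal (diameter (closure (C n i))))" by (rule hcontent_le[OF small])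
  also have "\<dots> = (\<Sum>i. ennreal (diameter (C n i)))"
   using C(1)[of n] by (simp add: small_covers_def diameter_closure)
  also have "\<dots> \<le> ennreal (1 / real (Suc n))" using C(2)[of n] by simp
  also have "\<dots> \<le> 0 + ennreal e" using n by (simp add: ennreal_leI)
  finally show ?thesis .
 qed
 then have "hcontent d B = 0" if "d > 0" for d
  using ennreal_le_epsilon[of 0 "hcontent d B"] that by simp
 then have "hausdorff1_outer B = 0" by (auto simp: hausdorff1_outer_eq SUP_eq_const)
 moreover have "E \<subseteq> B"
  using C(1) closure_subset unfolding B_def small_covers_def by (auto simp: subset_iff) blast
 moreover have "B \<in> sets borel" unfolding B_def by auto
 ultimately show ?thesis using that by blast
qed

text \<open>Caratheodory's theorem for metric outer measures provides the hypothesis on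
 \<open>hausdorff1_outer\<close>, but it is dispensable here: without it \<open>measure_of\<close> would be the zero
 measure, and there would be nothing to show.\<close>

lemma AE_arc_length_measure_space:
 assumes S: "S \<in> sets borel"
  and "measure_space UNIV (sets borel) hausdorff1_outer ==> AE z in arc_length S. P z"
 shows "AE z in arc_length S. P z"
proof (cases "measure_space UNIV (sets borel) hausdorff1_outer")
 case False
 then have "S \<in> null_sets (restrict_space hausdorff1 S)"
  using S by (auto simp: null_sets_def emeasure_restrict_space sets_restrict_space_iff sets_hausdorff1 emeasure_hausdorff1)
 then have "AE z in restrict_space hausdorff1 S. P z"
  by (rule AE_I') (auto simp: space_restrict_space)
 then show ?thesis unfolding arc_length_def by (rule AE_completion)
qed fact

text \<open>\<open>E\<close> need not be Borel, and all that is known is that its outer measure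
  vanishes; a Borel null set containing it gives a null set of the restricted measure.\<close>

lemma AE_arc_lengthI:
 assumes S: "S \<in> sets borel" and E: "hausdorff1_outer E = 0" and P: "\<And>z. z \<in> S ==> z \<notin> E ==> P z"
 shows "AE z in arc_length S. P z"
proof -
 obtain B where B: "B \<in> sets borel" "E \<subseteq> B" "hausdorff1_outer B = 0"
  using hausdorff1_null_hull[OF E] .
 have "hausdorff1_outer (B \<inter> S) = 0"
  using hausdorff1_outer_mono[of "B \<inter> S" B] B(3) by simp
 then have "B \<inter> S \<in> null_sets (restrict_space hausdorff1 S)"
  using B(1) S by (auto simp: null_sets_def emeasure_restrict_space sets_restrict_space_iff sets_hausdorff1 emeasure_hausdorff1)
 then have "AE z in restrict_space hausdorff1 S. P z"
  by (rule AE_I') (use B(2) P in \<open>auto simp: space_restrict_space\<close>)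
 then show ?thesis unfolding arc_length_def by (rule AE_completion)
qed

lemma complete_measure_lebesgue_on:
 assumes "J \<in> sets lebesgue" shows "complete_measure (lebesgue_on J)"
proof
 fix A B assume "B \<subseteq> A" "A \<in> null_sets (lebesgue_on J)"
 then have "A \<in> null_sets lebesgue" "A \<subseteq> J"
  using assms by (auto simp: null_sets_restrict_space)
 then have "B \<in> null_sets lebesgue" using \<open>B \<subseteq> A\<close> completion.complete2 by blast
 then show "B \<in> sets (lebesgue_on J)"
  using assms \<open>A \<subseteq> J\<close> \<open>B \<subseteq> A\<close> by (auto simp: sets_restrict_space_iff)
qed

text \<open>The parameter is recovered by \<open>g\<close>, which is \<open>K\<close>-Lipschitz on
  the arc. Hence the preimage of a Borel set has Lebesgue measure at most \<open>K\<close> times its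
  arc length: the image of Lebesgue measure under \<open>T\<close> is dominated by \<open>K\<close>
  times arc length. The growth bound along level curves and the integrability of the boundary value
  pass to the coordinates in this way.\<close>

lemma parametrised_arc_length:
 fixes g :: "plane => real" and T :: "real => plane"
 assumes ms: "measure_space UNIV (sets borel) hausdorff1_outer"
  and A: "A \<in> sets borel" and J: "J \<in> sets borel" and T: "continuous_on J T" "T ` J \<subseteq> A"
  and g: "\<And>x. x \<in> J ==> g (T x) = x" and K: "K > 0"
  and lip: "\<And>x y. x \<in> J ==> y \<in> J ==> \<bar>x - y\<bar> \<le> K * dist (T x) (T y)"
 shows "T \<in> measurable (lebesgue_on J) (arc_length A)"
  and "F \<in> borel_measurable (arc_length A) ==>
   (\<integral>\<^sup>+x. F (T x) \<partial>lebesgue_on J) \<le> ennreal K * (\<integral>\<^sup>+z. F z \<partial>arc_length A)"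
proof -
 define M where "M = restrict_space hausdorff1 A"
 have Jl: "J \<in> sets lebesgue" using J by simp
 interpret complete_measure "lebesgue_on J" by (rule complete_measure_lebesgue_on[OF Jl])
 have sM: "B \<in> sets M \<longleftrightarrow> B \<subseteq> A \<and> B \<in> sets borel" for B
  using A by (simp add: M_def sets_restrict_space_iff sets_hausdorff1)
 have spM: "space M = A" by (simp add: M_def space_restrict_space)
 have TM: "T \<in> measurable (lebesgue_on J) M"
 proof (rule measurableI)
  fix x assume "x \<in> space (lebesgue_on J)" then show "T x \<in> space M" using T by (auto simp: spM)
 next
  fix B assume "B \<in> sets M"
  then have "B \<in> sets borel" by (simp add: sM)
  then have "T -` B \<inter> space (restrict_space borel J) \<in> sets (restrict_space borel J)"
   using borel_measurable_continuous_on_restrict[OF T(1)] by (rule measurable_sets[rotated])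
  then show "T -` B \<inter> space (lebesgue_on J) \<in> sets (lebesgue_on J)"
   using J by (auto simp: sets_restrict_space_iff space_restrict_space)
 qed
 have TB: "T -` B \<inter> J \<in> sets borel" if "B \<in> sets M" for B
 proof -
  have "T -` B \<inter> space (restrict_space borel J) \<in> sets (restrict_space borel J)"
   using borel_measurable_continuous_on_restrict[OF T(1)] that by (intro measurable_sets) (auto simp: sM)
  then show ?thesis using J by (auto simp: sets_restrict_space_iff space_restrict_space)
 qed
 have le: "emeasure (lebesgue_on J) (T -` B \<inter> J) \<le> ennreal K * emeasure M B" if B: "B \<in> sets M" for B
 proof -
  have "emeasure lborel (T -` B \<inter> J) \<le> ennreal K * hausdorff1_outer (B \<inter> T ` J)"
  proof (rule lborel_le_hausdorff1_outer[OF K _ TB[OF B], of _ g])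
   show "T -` B \<inter> J \<subseteq> g ` (B \<inter> T ` J)" using g by force
   show "\<bar>g y - g z\<bar> \<le> K * dist y z" if "y \<in> B \<inter> T ` J" "z \<in> B \<inter> T ` J" for y z
    using that lip g by auto
  qed
  also have "\<dots> \<le> ennreal K * hausdorff1_outer B" by (intro mult_left_mono hausdorff1_outer_mono) auto
  also have "hausdorff1_outer B = emeasure M B"
   using B A sM[of B] ms by (simp add: M_def emeasure_restrict_space sets_hausdorff1 emeasure_hausdorff1)
  finally show ?thesis using TB[OF B] Jl by (simp add: emeasure_restrict_space)
 qed
 \<comment> \<open>Measurability survives the completion because null sets of the arc pull back to
   null sets of the line.\<close>
 have Tc: "T \<in> measurable (lebesgue_on J) (completion M)"
 proof (rule measurable_completion2[OF TM])
  show "null_sets M \<subseteq> null_sets (distr (lebesgue_on J) M T)"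
  proof
   fix B assume B: "B \<in> null_sets M"
   then have "emeasure (lebesgue_on J) (T -` B \<inter> J) = 0" using le[of B] by (auto simp: null_sets_def)
   then show "B \<in> null_sets (distr (lebesgue_on J) M T)"
    using B by (auto simp: null_sets_def emeasure_distr[OF TM])
  qed
 qed
 then show "T \<in> measurable (lebesgue_on J) (arc_length A)" by (simp add: arc_length_def M_def)
 assume F: "F \<in> borel_measurable (arc_length A)"
 then have F': "F \<in> borel_measurable (completion M)" by (simp add: arc_length_def M_def)
 \<comment> \<open>A set of the completion is replaced by a measurable superset of the same measure,
   to which the Borel estimate applies.\<close>
 have "distr (lebesgue_on J) (completion M) T \<le> scale_measure (ennreal K) (completion M)"
 proof (subst le_measure, simp, intro ballI)
  fix B assume "B \<in> sets (distr (lebesgue_on J) (completion M) T)"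
  then have B: "B \<in> sets (completion M)" by (simp only: sets_distr)
  obtain B' where B': "B \<subseteq> B'" "B' \<in> sets M" "B' - B \<in> null_sets (completion M)"
    "emeasure (completion M) B = emeasure M B'"
   by (rule completion_upper[OF B])
  have "emeasure (distr (lebesgue_on J) (completion M) T) B = emeasure (lebesgue_on J) (T -` B \<inter> J)"
   unfolding emeasure_distr[OF Tc B] by (simp only: space_lebesgue_on)
  also have "\<dots> \<le> emeasure (lebesgue_on J) (T -` B' \<inter> J)"
   using B' measurable_sets[OF TM B'(2)] by (intro emeasure_mono) auto
  also have "\<dots> \<le> ennreal K * emeasure M B'" by (rule le[OF B'(2)])
  finally show "emeasure (distr (lebesgue_on J) (completion M) T) B \<le> emeasure (scale_measure (ennreal K) (completion M)) B"
   using B' by simp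
 qed
 then have "(\<integral>\<^sup>+z. F z \<partial>distr (lebesgue_on J) (completion M) T) \<le> (\<integral>\<^sup>+z. F z \<partial>scale_measure (ennreal K) (completion M))"
  by (intro nn_integral_mono_measure) auto
 then show "(\<integral>\<^sup>+x. F (T x) \<partial>lebesgue_on J) \<le> ennreal K * (\<integral>\<^sup>+z. F z \<partial>arc_length A)"
  using nn_integral_distr[OF Tc, of F] F' nn_integral_scale_measure[OF F'] unfolding arc_length_def M_def by simp
qed

text \<open>On a bounded set \<open>L^p\<close> lies in \<open>L^1\<close>:
  \<open>norm w \<le> 1 + norm w powr r\<close> for \<open>r \<ge> 1\<close>, and for
  \<open>p = \<infinity>\<close> the set where the bound fails has a null preimage. Integrability in
  the coordinate is what du Bois-Reymond's lemma and Lebesgue differentiation work with.\<close>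

lemma mem_Lp_imp_integrable:
 fixes g :: "plane => real" and T :: "real => plane"
 assumes ms: "measure_space UNIV (sets borel) hausdorff1_outer"
  and A: "A \<in> sets borel" and J: "J \<in> sets borel" "bounded J" and T: "continuous_on J T" "T ` J \<subseteq> A"
  and g: "\<And>x. x \<in> J ==> g (T x) = x" and K: "K > 0"
  and lip: "\<And>x y. x \<in> J ==> y \<in> J ==> \<bar>x - y\<bar> \<le> K * dist (T x) (T y)"
  and p: "1 \<le> p" "mem_Lp p (arc_length A) h"
 shows "integrable (lebesgue_on J) (\<lambda>x. h (T x))"
proof -
 note par = parametrised_arc_length[OF ms A J(1) T g K lip]
 have h: "h \<in> borel_measurable (arc_length A)" using p by (simp add: mem_Lp_def)
 have hT: "(\<lambda>x. h (T x)) \<in> borel_measurable (lebesgue_on J)"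
  using measurable_compose[OF par(1) h] .
 have Jf: "emeasure (lebesgue_on J) (space (lebesgue_on J)) < \<infinity>"
  using J emeasure_bounded_finite[OF J(2)] by (simp add: emeasure_restrict_space)
 show ?thesis
 proof (cases "p = \<infinity>")
  case True
  then obtain C where "AE z in arc_length A. norm (h z) \<le> C" using p by (auto simp: mem_Lp_def)
  then have "(\<integral>\<^sup>+z. indicator {z \<in> space (arc_length A). \<not> norm (h z) \<le> C} z \<partial>arc_length A) = 0"
   using h by (subst nn_integral_indicator) (auto simp: AE_iff_measurable[OF _ refl])
  then have "(\<integral>\<^sup>+x. indicator {z \<in> space (arc_length A). \<not> norm (h z) \<le> C} (T x) \<partial>lebesgue_on J) = 0"
   using par(2)[of "indicator {z \<in> space (arc_length A). \<not> norm (h z) \<le> C}"] h by (auto simp: le_zero_eq)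
  then have "AE x in lebesgue_on J. indicator {z \<in> space (arc_length A). \<not> norm (h z) \<le> C} (T x) = (0::ennreal)"
   using h by (subst (asm) nn_integral_0_iff_AE) (auto intro!: measurable_compose[OF par(1)])
  then have "AE x in lebesgue_on J. norm (h (T x)) \<le> C"
  proof (rule AE_mp, intro AE_I2 impI)
   fix x assume "x \<in> space (lebesgue_on J)"
   moreover assume "indicator {z \<in> space (arc_length A). \<not> norm (h z) \<le> C} (T x) = (0::ennreal)"
   ultimately show "norm (h (T x)) \<le> C"
    using measurable_space[OF par(1)] by (auto simp: indicator_def split: if_splits)
  qed
  then show ?thesis
   by (intro integrableI_bounded_set[of "space (lebesgue_on J)" _ _ C]) (use hT Jf in \<open>auto simp del: space_restrict_space space_lebesgue_on\<close>)
 next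
  case False
  define r where "r = enn2real p"
  have r: "r \<ge> 1" using p(1) False unfolding r_def
   by (metis enn2real_1 enn2real_mono infinity_ennreal_def top.not_eq_extremum)
  have fin: "(\<integral>\<^sup>+z. ennreal (norm (h z) powr r) \<partial>arc_length A) < \<infinity>"
   using p False by (simp add: mem_Lp_def r_def)
  have bd: "norm w \<le> 1 + norm w powr r" for w :: complex
  proof (cases "norm w \<le> 1")
   case False
   then have "norm w powr 1 \<le> norm w powr r" using r by (intro powr_mono) auto
   then show ?thesis using False by simp
  qed (simp add: add_increasing2)
  have "(\<integral>\<^sup>+x. ennreal (norm (h (T x))) \<partial>lebesgue_on J) \<le> (\<integral>\<^sup>+x. 1 + ennreal (norm (h (T x)) powr r) \<partial>lebesgue_on J)"
   using bd by (intro nn_integral_mono) (simp add: ennreal_plus[symmetric] del: ennreal_plus flip: ennreal_1)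
  also have "\<dots> = emeasure (lebesgue_on J) (space (lebesgue_on J)) + (\<integral>\<^sup>+x. ennreal (norm (h (T x)) powr r) \<partial>lebesgue_on J)"
   using hT by (subst nn_integral_add) auto
  also have "\<dots> \<le> emeasure (lebesgue_on J) (space (lebesgue_on J)) + ennreal K * (\<integral>\<^sup>+z. ennreal (norm (h z) powr r) \<partial>arc_length A)"
   using h by (intro add_left_mono par(2)) auto
  also have "\<dots> < \<infinity>" using Jf fin by (simp add: ennreal_mult_less_top)
  finally show ?thesis using hT by (intro integrableI_bounded) auto
 qed
qed

section \<open>Exact differential forms in the plane\<close>

text \<open>The form \<open>p dx + q dt\<close> at a point as a real-linear map, so that
  \<open>(P has_derivative dform p q)\<close> reads \<open>dP = p dx + q dt\<close>.\<close>

definition dform :: "complex => complex => plane => complex" where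
 "dform p q v = fst v *\<^sub>R p + snd v *\<^sub>R q"

text \<open>The increment in \<open>t\<close> is controlled uniformly by the continuity of
  \<open>q\<close>, the increment in \<open>x\<close> by differentiability at the one point. The
  asymmetry fits primitives obtained by integrating in \<open>t\<close>, and sheared coordinates in
  which a single horizontal curve is under control.\<close>

lemma has_derivative_partials:
 fixes F :: "plane => complex"
 assumes S: "open S" "(x0, t0) \<in> S"
  and fx: "((\<lambda>x. F (x, t0)) has_vector_derivative p (x0, t0)) (at x0)"
  and ft: "\<And>x t. (x, t) \<in> S ==> ((\<lambda>t. F (x, t)) has_vector_derivative q (x, t)) (at t)"
  and cont: "continuous_on S q"
 shows "(F has_derivative dform (p (x0, t0)) (q (x0, t0))) (at (x0, t0))"
proof -
 obtain A B where AB: "open A" "open B" "x0 \<in> A" "t0 \<in> B" "A \<times> B \<subseteq> S"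
  using open_prod_elim[OF S(1,2)] by (metis mem_Sigma_iff)
 obtain r where r: "r > 0" "ball t0 r \<subseteq> B" using AB open_contains_ball by blast
 have *: "((\<lambda>(x, y). F (x, y)) has_derivative (\<lambda>(tx, ty). tx *\<^sub>R p (x0, t0) + blinfun_apply (blinfun_scaleR_left (q (x0, t0))) ty)) (at (x0, t0) within A \<times> ball t0 r)"
 proof (rule has_derivative_partialsI[where fy = "\<lambda>x y. blinfun_scaleR_left (q (x, y))"])
  show "((\<lambda>x. F (x, t0)) has_derivative (\<lambda>tx. tx *\<^sub>R p (x0, t0))) (at x0 within A)"
   by (rule has_derivative_at_withinI[OF fx[unfolded has_vector_derivative_def]])
  show "((\<lambda>y. F (x, y)) has_derivative blinfun_apply (blinfun_scaleR_left (q (x, y)))) (at y within ball t0 r)"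
   if "x \<in> A" "y \<in> ball t0 r" for x y
  proof -
   have "(x, y) \<in> S" using that AB r by auto
   from has_derivative_at_withinI[OF ft[OF this, unfolded has_vector_derivative_def]] show ?thesis by simp
  qed
  have "(q \<longlongrightarrow> q (x0, t0)) (at (x0, t0) within A \<times> ball t0 r)"
  proof (rule tendsto_within_subset)
   show "(q \<longlongrightarrow> q (x0, t0)) (at (x0, t0) within S)"
    using cont S(2) by (auto simp: continuous_on_def)
  qed (use AB r in auto)
  then have "((\<lambda>z. blinfun_scaleR_left (q z)) \<longlongrightarrow> blinfun_scaleR_left (q (x0, t0))) (at (x0, t0) within A \<times> ball t0 r)"
   by (rule bounded_linear.tendsto[OF bounded_linear_blinfun_scaleR_left])
  then show "continuous (at (x0, t0) within A \<times> ball t0 r) (\<lambda>(x, y). blinfun_scaleR_left (q (x, y)))"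
   by (simp add: split_def continuous_within)
 qed (use r in auto)
 have "open (A \<times> ball t0 r)" "(x0, t0) \<in> A \<times> ball t0 r" using AB r by (auto intro: open_Times)
 then have "at (x0, t0) within A \<times> ball t0 r = at (x0, t0)" by (intro at_within_open)
 then show ?thesis
  using * by (simp add: dform_def[abs_def] split_def)
qed

lemma has_derivative_dform_fst:
 fixes F :: "plane => complex"
 assumes "(F has_derivative dform p q) (at (x, t))"
 shows "((\<lambda>x. F (x, t)) has_vector_derivative p) (at x)"
proof -
 have "((\<lambda>x. (x, t)) has_derivative (\<lambda>h. (h, 0))) (at x)"
  by (auto intro!: derivative_eq_intros)
 from has_derivative_compose[OF this assms] show ?thesis
  by (simp add: has_vector_derivative_def dform_def o_def)
qed

lemma has_derivative_dform_snd:
 fixes F :: "plane => complex"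
 assumes "(F has_derivative dform p q) (at (x, t))"
 shows "((\<lambda>t. F (x, t)) has_vector_derivative q) (at t)"
proof -
 have "((\<lambda>t. (x, t)) has_derivative (\<lambda>h. (0, h))) (at t)"
  by (auto intro!: derivative_eq_intros)
 from has_derivative_compose[OF this assms] show ?thesis
  by (simp add: has_vector_derivative_def dform_def o_def)
qed

lemma antiderivative_upper:
 fixes f :: "real => complex"
 assumes "continuous_on {a..b} f" "a < x" "x < b"
 shows "((\<lambda>u. integral {a..u} f) has_vector_derivative f x) (at x)"
proof -
 have "((\<lambda>u. integral {a..u} f) has_vector_derivative f x) (at x within {a..b})"
  using assms by (intro integral_has_vector_derivative) auto
 then show ?thesis by (simp only: at_within_Icc_at[OF assms(2,3)])
qed

text \<open>\<open>P\<close> integrates along the path that runs horizontally at height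
  \<open>c\<close> and then upwards, which gives the \<open>t\<close>-derivative. By
  \<open>rect\<close> the path that goes up at \<open>a\<close> and then runs horizontally yields
  the same value, and this gives the \<open>x\<close>-derivative.\<close>

lemma closed_form_primitive:
 fixes p q :: "plane => complex"
 assumes ab: "a < b" "c < d" and cont: "continuous_on ({a..b} \<times> {c..d}) p" "continuous_on ({a..b} \<times> {c..d}) q"
  and rect: "\<And>x t. a < x ==> x < b ==> c < t ==> t < d ==>
   integral {a..x} (\<lambda>s. p (s, c)) + integral {c..t} (\<lambda>s. q (x, s)) =
   integral {c..t} (\<lambda>s. q (a, s)) + integral {a..x} (\<lambda>s. p (s, t))"
 shows "\<exists>P. \<forall>z\<in>{a<..<b} \<times> {c<..<d}. (P has_derivative dform (p z) (q z)) (at z)"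
proof -
 define P where "P z = integral {a..fst z} (\<lambda>s. p (s, c)) + integral {c..snd z} (\<lambda>s. q (fst z, s))" for z
 have "(P has_derivative dform (p (x, t)) (q (x, t))) (at (x, t))" if "(x, t) \<in> {a<..<b} \<times> {c<..<d}" for x t
 proof (rule has_derivative_partials[where S = "{a<..<b} \<times> {c<..<d}"])
  have xt: "a < x" "x < b" "c < t" "t < d" using that by auto
  have "continuous_on {a..b} (\<lambda>s. p (s, t))"
   using xt by (intro continuous_on_compose2[OF cont(1)] continuous_intros) auto
  from has_vector_derivative_add[OF has_vector_derivative_const antiderivative_upper[OF this xt(1,2)]]
  have "((\<lambda>x. integral {c..t} (\<lambda>s. q (a, s)) + integral {a..x} (\<lambda>s. p (s, t))) has_vector_derivative p (x, t)) (at x)"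
   by simp
  then show "((\<lambda>x. P (x, t)) has_vector_derivative p (x, t)) (at x)"
   by (rule has_vector_derivative_transform_within_open[where S = "{a<..<b}"])
    (use xt rect in \<open>auto simp: P_def\<close>)
 next
  fix x t assume "(x, t) \<in> {a<..<b} \<times> {c<..<d}"
  then have xt: "a < x" "x < b" "c < t" "t < d" by auto
  have "continuous_on {c..d} (\<lambda>s. q (x, s))"
   using xt by (intro continuous_on_compose2[OF cont(2)] continuous_intros) auto
  from has_vector_derivative_add[OF has_vector_derivative_const antiderivative_upper[OF this xt(3,4)]]
  show "((\<lambda>t. P (x, t)) has_vector_derivative q (x, t)) (at t)"
   unfolding P_def by simp
 next
  show "continuous_on ({a<..<b} \<times> {c<..<d}) q" by (rule continuous_on_subset[OF cont(2)]) auto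
 qed (use that in \<open>auto intro: open_Times\<close>)
 then show ?thesis by (intro exI[of _ P]) auto
qed

text \<open>\<open>F\<close> is integrated horizontally at height \<open>t0\<close> and vertically
  from there, so its \<open>t\<close>-derivative is right everywhere and its
  \<open>x\<close>-derivative at \<open>t0\<close>. The latter property spreads along the column by
  connectedness: near any point \<open>F\<close> differs from a local primitive by a function of
  \<open>x\<close> alone.\<close>

lemma locally_exact_imp_exact:
 fixes p q :: "plane => complex"
 assumes ab: "a < b" "c < d" and cont: "continuous_on ({a<..<b} \<times> {c<..<d}) p" "continuous_on ({a<..<b} \<times> {c<..<d}) q"
  and loc: "\<And>z. z \<in> {a<..<b} \<times> {c<..<d} ==>
   \<exists>N P. open N \<and> z \<in> N \<and> (\<forall>w\<in>N. (P has_derivative dform (p w) (q w)) (at w))"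
 shows "\<exists>P. \<forall>z\<in>{a<..<b} \<times> {c<..<d}. (P has_derivative dform (p z) (q z)) (at z)"
proof -
 define t0 where "t0 = (c + d) / 2"
 have t0: "c < t0" "t0 < d" using ab by (auto simp: t0_def)
 have "\<exists>F. \<forall>x::real. ereal a < x --> x < ereal b --> (F has_vector_derivative p (x, t0)) (at x)"
 proof (rule einterval_antiderivative)
  fix x :: real assume "ereal a < x" "x < ereal b"
  moreover have "continuous_on {a<..<b} (\<lambda>x. p (x, t0))"
   by (rule continuous_on_compose2[OF cont(1)]) (auto intro!: continuous_intros t0)
  ultimately show "isCont (\<lambda>x. p (x, t0)) x" by (simp add: continuous_on_eq_continuous_at)
 qed (use ab in auto)
 then obtain A where A: "\<And>x. a < x ==> x < b ==> (A has_vector_derivative p (x, t0)) (at x)" by auto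
 have "\<exists>G. \<forall>t::real. ereal c < t --> t < ereal d --> (G has_vector_derivative q (x, t)) (at t)" if "a < x" "x < b" for x
 proof (rule einterval_antiderivative)
  fix t :: real assume "ereal c < t" "t < ereal d"
  moreover have "continuous_on {c<..<d} (\<lambda>t. q (x, t))"
   by (rule continuous_on_compose2[OF cont(2)]) (use that in \<open>auto intro!: continuous_intros\<close>)
  ultimately show "isCont (\<lambda>t. q (x, t)) t" by (simp add: continuous_on_eq_continuous_at)
 qed (use ab in auto)
 then have "\<forall>x\<in>{a<..<b}. \<exists>G. \<forall>t. c < t --> t < d --> (G has_vector_derivative q (x, t)) (at t)" by auto
 then obtain G where G: "\<And>x t. x \<in> {a<..<b} ==> c < t ==> t < d ==> (G x has_vector_derivative q (x, t)) (at t)"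
  by metis
 define F where "F z = A (fst z) + (G (fst z) (snd z) - G (fst z) t0)" for z
 have Ft: "((\<lambda>t. F (x, t)) has_vector_derivative q (x, t)) (at t)" if "a < x" "x < b" "c < t" "t < d" for x t
 proof -
  have "((\<lambda>t. A x + (G x t - G x t0)) has_vector_derivative 0 + (q (x, t) - 0)) (at t)"
   by (intro has_vector_derivative_add has_vector_derivative_diff has_vector_derivative_const G) (use that in auto)
  then show ?thesis by (simp add: F_def)
 qed
 have F0: "F (x, t0) = A x" for x by (simp add: F_def)
 have Fx: "((\<lambda>x. F (x, t)) has_vector_derivative p (x, t)) (at x)" if x: "a < x" "x < b" and t: "c < t" "t < d" for x t
 proof -
  define Q where "Q t \<longleftrightarrow> (\<exists>e>0. \<forall>y\<in>{a<..<b}. \<bar>y - x\<bar> < e --> ((\<lambda>x. F (x, t)) has_vector_derivative p (y, t)) (at y))" for t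
  have "Q t"
  proof (rule connected_induction_simple[of "{c<..<d}" t0 t Q])
   show "Q t0" unfolding Q_def F0 using A by (intro exI[of _ 1]) auto
   fix s assume s: "s \<in> {c<..<d}"
   then have "(x, s) \<in> {a<..<b} \<times> {c<..<d}" using x by simp
   from loc[OF this] obtain N P where N: "open N" "(x, s) \<in> N"
    "\<And>w. w \<in> N ==> (P has_derivative dform (p w) (q w)) (at w)" by blast
   obtain U V where UV: "open U" "open V" "x \<in> U" "s \<in> V" "U \<times> V \<subseteq> N"
    using open_prod_elim[OF N(1,2)] by (metis mem_Sigma_iff)
   obtain e where e: "e > 0" "ball x e \<subseteq> U" "ball s e \<subseteq> V"
   proof -
    obtain e1 e2 where "e1 > 0" "ball x e1 \<subseteq> U" "e2 > 0" "ball s e2 \<subseteq> V"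
     using UV open_contains_ball by meson
    then show thesis by (intro that[of "min e1 e2"]) auto
   qed
   define T where "T = {c<..<d} \<inter> ball s e"
   have "Q u" if u: "u \<in> T" and v: "v \<in> T" and Qv: "Q v" for u v
   proof -
    obtain e' where e': "e' > 0" "\<And>y. y \<in> {a<..<b} ==> \<bar>y - x\<bar> < e' ==> ((\<lambda>x. F (x, v)) has_vector_derivative p (y, v)) (at y)"
     using Qv unfolding Q_def by blast
    \<comment> \<open>Both functions have the \<open>t\<close>-derivative \<open>q\<close>, so their
      difference does not depend on the height within \<open>T\<close>.\<close>
    have const: "F (y, u) - P (y, u) = F (y, v) - P (y, v)" if y: "y \<in> {a<..<b}" "\<bar>y - x\<bar> < e" for y
    proof -
     have "(\<lambda>t. F (y, t) - P (y, t)) u = (\<lambda>t. F (y, t) - P (y, t)) v"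
     proof (rule has_derivative_zero_unique[where s = T])
      show "convex T" unfolding T_def by (intro convex_Int convex_ball) auto
      fix r assume r: "r \<in> T"
      have "(y, r) \<in> N" using UV e y r by (auto simp: T_def dist_real_def abs_minus_commute subset_iff)
      then have "((\<lambda>t. P (y, t)) has_vector_derivative q (y, r)) (at r)"
       using N(3) has_derivative_dform_snd by blast
      then have "((\<lambda>t. F (y, t) - P (y, t)) has_vector_derivative q (y, r) - q (y, r)) (at r)"
       using y r by (intro has_vector_derivative_diff Ft) (auto simp: T_def)
      then have "((\<lambda>t. F (y, t) - P (y, t)) has_derivative (\<lambda>h. 0)) (at r)"
       by (simp add: has_vector_derivative_def)
      then show "((\<lambda>t. F (y, t) - P (y, t)) has_derivative (\<lambda>h. 0)) (at r within T)"
       by (rule has_derivative_at_withinI)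
     qed (use u v in auto)
     then show ?thesis by simp
    qed
    have "((\<lambda>x. F (x, u)) has_vector_derivative p (y, u)) (at y)" if y: "y \<in> {a<..<b}" "\<bar>y - x\<bar> < min e e'" for y
    proof -
     have yN: "(y, r) \<in> N" if "r \<in> T" for r
      using UV e y that by (auto simp: T_def dist_real_def abs_minus_commute subset_iff)
     have Pd: "((\<lambda>x. P (x, r)) has_vector_derivative p (y, r)) (at y)" if "r \<in> T" for r
      using N(3)[OF yN[OF that]] has_derivative_dform_fst by blast
     have "((\<lambda>x. P (x, u) + (F (x, v) - P (x, v))) has_vector_derivative p (y, u) + (p (y, v) - p (y, v))) (at y)"
      by (intro has_vector_derivative_add has_vector_derivative_diff Pd u v e') (use y in auto)
     then have "((\<lambda>x. P (x, u) + (F (x, v) - P (x, v))) has_vector_derivative p (y, u)) (at y)"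
      by simp
     then show ?thesis
     proof (rule has_vector_derivative_transform_within_open[where S = "{a<..<b} \<inter> ball x e"])
      show "P (z, u) + (F (z, v) - P (z, v)) = F (z, u)" if "z \<in> {a<..<b} \<inter> ball x e" for z
       using const[of z] that by (auto simp: dist_real_def abs_minus_commute algebra_simps)
     qed (use y in \<open>auto simp: dist_real_def\<close>)
    qed
    then show ?thesis unfolding Q_def using e e' by (intro exI[of _ "min e e'"]) auto
   qed
   moreover have "openin (top_of_set {c<..<d}) T" "s \<in> T"
    unfolding T_def openin_open using s e(1) by auto
   ultimately show "\<exists>T. openin (top_of_set {c<..<d}) T \<and> s \<in> T \<and> (\<forall>x\<in>T. \<forall>y\<in>T. Q x --> Q y)"
    by blast
  qed (use t t0 in auto)
  then show ?thesis using x unfolding Q_def by fastforce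
 qed
 have "(F has_derivative dform (p (x, t)) (q (x, t))) (at (x, t))" if "(x, t) \<in> {a<..<b} \<times> {c<..<d}" for x t
  by (rule has_derivative_partials[where S = "{a<..<b} \<times> {c<..<d}"]) (use that cont Ft Fx in \<open>auto intro: open_Times\<close>)
 then show ?thesis by (intro exI[of _ F]) auto
qed

section \<open>From weak solutions to exact forms\<close>

text \<open>The factor \<open>1 / eta\<close> keeps the transition zones, of length
  \<open>1 / scale eta n\<close>, within \<open>eta\<close> of their base points for every
  \<open>n\<close>; one margin \<open>eta\<close> around a rectangle serves the whole
  sequence.\<close>

definition scale :: "real => nat => real" where "scale eta n = real (Suc n) / eta"

lemma scale_pos: "eta > 0 ==> scale eta n > 0" by (simp add: scale_def)

lemma scale_inverse_le: "eta > 0 ==> 1 / scale eta n \<le> eta"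
 by (simp add: scale_def divide_le_eq mult_left_mono)

lemma filterlim_scale:
 assumes "eta > 0" shows "filterlim (scale eta) at_top sequentially"
proof -
 have "filterlim (\<lambda>n. real (Suc n)) at_top sequentially"
  by (rule filterlim_compose[OF filterlim_real_sequentially filterlim_Suc])
 from filterlim_tendsto_pos_mult_at_top[OF tendsto_const[of "1 / eta"] _ this] assms
 show ?thesis by (simp add: scale_def[abs_def])
qed

abbreviation tent :: "real => nat => real => real => real => real" where
 "tent eta n \<equiv> plateau (scale eta n)"

abbreviation bump :: "real => nat => real => real => real" where
 "bump eta n a u \<equiv> scale eta n * dstep (scale eta n * (u - a))"

lemma tent_eq_0:
 assumes "eta > 0" "a \<le> b" "u \<notin> {a..b + eta}" shows "tent eta n a b u = 0"
 using plateau_eq_0[OF scale_pos[OF assms(1)] assms(2), of u n] scale_inverse_le[OF assms(1), of n] assms(3) by auto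

lemma bump_eq_0:
 assumes "eta > 0" "u \<notin> {a..a + eta}" shows "bump eta n a u = 0"
proof -
 have "scale eta n * (u - a) \<notin> {0..1}"
 proof
  assume "scale eta n * (u - a) \<in> {0..1}"
  then have "u \<ge> a" "u - a \<le> 1 / scale eta n"
   using scale_pos[OF assms(1), of n] by (auto simp: zero_le_mult_iff field_simps)
  then show False using scale_inverse_le[OF assms(1), of n] assms(2) by auto
 qed
 then show ?thesis by (simp add: dstep_eq_0)
qed

lemma continuous_on_tent: "continuous_on S (tent eta n a b)"
 using smooth_on_imp_continuous_on[OF smooth_plateau] continuous_on_subset by blast

lemma continuous_on_bump: "continuous_on S (bump eta n a)"
 by (intro continuous_intros continuous_on_compose2[OF continuous_on_dstep[of UNIV]]) auto

text \<open>A cut-off in \<open>u\<close> times an approximate unit mass in \<open>v\<close>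
  converges to integration over the segment at height \<open>c\<close>. The inner integral is
  evaluated at the heights \<open>c + s / scale eta n\<close>, so that cut-off and integrand
  converge together.\<close>

lemma tent_bump_limit:
 fixes W :: "real => real => complex"
 assumes eta: "eta > 0" and ab: "a < b"
  and cont: "continuous_on ({a..b + eta} \<times> {c..c + eta}) (\<lambda>(u, v). W u v)"
 shows "(\<lambda>n. LINT v|lborel. LINT u|lborel. (tent eta n a b u * bump eta n c v) *\<^sub>R W u v)
  \<longlonglongrightarrow> integral {a..b} (\<lambda>u. W u c)"
proof -
 note pos = scale_pos[OF eta]
 have W1: "continuous_on {a..b + eta} (\<lambda>u. W u v)" if "v \<in> {c..c + eta}" for v
 proof -
  have "continuous_on {a..b + eta} (\<lambda>u. (\<lambda>(u, v). W u v) (u, v))"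
   by (rule continuous_on_compose2[OF cont]) (use that in \<open>auto intro!: continuous_intros\<close>)
  then show ?thesis by simp
 qed
 have "compact ((\<lambda>(u, v). W u v) ` ({a..b + eta} \<times> {c..c + eta}))"
  by (intro compact_continuous_image cont compact_Times) auto
 then obtain B where B: "\<And>u v. u \<in> {a..b + eta} ==> v \<in> {c..c + eta} ==> norm (W u v) \<le> B"
  using compact_imp_bounded bounded_iff by (metis (mono_tags, lifting) SigmaI case_prod_conv image_eqI)
 define w where "w n v = (LINT u|lborel. tent eta n a b u *\<^sub>R W u v)" for n v
 have inner: "set_integrable lborel {a..b + eta} (\<lambda>u. tent eta n a b u *\<^sub>R W u v)" if "v \<in> {c..c + eta}" for n v
  by (intro borel_integrable_atLeastAtMost' continuous_intros continuous_on_tent W1 that)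
 have w_eq: "w n v = integral {a..b + eta} (\<lambda>u. tent eta n a b u *\<^sub>R W u v)" if "v \<in> {c..c + eta}" for n v
 proof -
  have "tent eta n a b u *\<^sub>R W u v = indicator {a..b + eta} u *\<^sub>R (tent eta n a b u *\<^sub>R W u v)" for u
   using tent_eq_0[OF eta, of a b u n] ab by (auto simp: indicator_def)
  then have "w n v = (LINT u:{a..b + eta}|lborel. tent eta n a b u *\<^sub>R W u v)"
   unfolding w_def set_lebesgue_integral_def by metis
  then show ?thesis using set_borel_integral_eq_integral(2)[OF inner[OF that]] by simp
 qed
 have sub: "{c..c + 1 / scale eta n} \<subseteq> {c..c + eta}" for n using scale_inverse_le[OF eta, of n] by auto
 have "(\<lambda>n. LINT v|lborel. (scale eta n * dstep (scale eta n * (v - c))) *\<^sub>R w n v) \<longlonglongrightarrow> integral {a..b} (\<lambda>u. W u c)"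
 proof (rule dstep_kernel_limit[OF pos])
  fix n
  have "continuous_on {c..c + eta} (\<lambda>v. integral (cbox a (b + eta)) (\<lambda>u. tent eta n a b u *\<^sub>R W u v))"
  proof (rule integral_continuous_on_param)
   have "continuous_on ({c..c + eta} \<times> {a..b + eta}) (\<lambda>z. tent eta n a b (snd z) *\<^sub>R (\<lambda>(u, v). W u v) (snd z, fst z))"
    by (intro continuous_on_scaleR continuous_on_compose2[OF continuous_on_tent[of UNIV]] continuous_on_compose2[OF cont])
     (auto intro!: continuous_intros)
   then show "continuous_on ({c..c + eta} \<times> cbox a (b + eta)) (\<lambda>(v, u). tent eta n a b u *\<^sub>R W u v)"
    by (simp add: split_def)
  qed
  then have "continuous_on {c..c + eta} (w n)"
   by (rule continuous_on_eq) (simp add: w_eq)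
  then show "continuous_on {c..c + 1 / scale eta n} (w n)"
   by (rule continuous_on_subset[OF _ sub])
 next
  fix n v assume "v \<in> {c..c + 1 / scale eta n}"
  then have v: "v \<in> {c..c + eta}" using sub by blast
  have "norm (integral {a..b + eta} (\<lambda>u. tent eta n a b u *\<^sub>R W u v)) \<le> B * (b + eta - a)"
  proof (rule integral_bound)
   show "a \<le> b + eta" using ab eta by simp
   show "continuous_on {a..b + eta} (\<lambda>u. tent eta n a b u *\<^sub>R W u v)"
    by (intro continuous_intros continuous_on_tent W1 v)
   show "norm (tent eta n a b u *\<^sub>R W u v) \<le> B" if "u \<in> {a..b + eta}" for u
    using B[OF that v] plateau_bounds[OF pos less_imp_le[OF ab], of n u] mult_mono[of "\<bar>tent eta n a b u\<bar>" 1 "norm (W u v)" B] by simp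
  qed
  then show "norm (w n v) \<le> B * (b + eta - a)" using w_eq[OF v] ab eta by simp
 next
  fix s :: real assume s: "s \<in> {0..1}"
  have v: "c + s / scale eta n \<in> {c..c + eta}" for n
  proof -
   have "s / scale eta n \<le> 1 / scale eta n" "0 \<le> s / scale eta n" using s pos[of n] by (auto simp: divide_right_mono)
   then show ?thesis using scale_inverse_le[OF eta, of n] by auto
  qed
  have vlim: "(\<lambda>n. c + s / scale eta n) \<longlonglongrightarrow> c"
   using tendsto_add[OF tendsto_const[of c] tendsto_divide_0[OF tendsto_const[of s] filterlim_at_top_imp_at_infinity[OF filterlim_scale[OF eta]]]]
   by simp
  have "(\<lambda>n. integral {a..b + eta} (\<lambda>u. tent eta n a b u *\<^sub>R W u (c + s / scale eta n)))
    \<longlonglongrightarrow> integral {a..b + eta} (\<lambda>u. indicator {a<..b} u *\<^sub>R W u c)"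
  proof (rule dominated_convergence(2)[where h = "\<lambda>_. B"])
   show "(\<lambda>u. tent eta n a b u *\<^sub>R W u (c + s / scale eta n)) integrable_on {a..b + eta}" for n
    by (intro integrable_continuous_real continuous_intros continuous_on_tent W1 v)
   fix u assume u: "u \<in> {a..b + eta}"
   show "norm (tent eta n a b u *\<^sub>R W u (c + s / scale eta n)) \<le> B" for n
    using B[OF u v[of n]] plateau_bounds[OF pos less_imp_le[OF ab], of n u]
     mult_mono[of "\<bar>tent eta n a b u\<bar>" 1 "norm (W u (c + s / scale eta n))" B] by simp
   have "(\<lambda>n. (\<lambda>(u, v). W u v) (u, c + s / scale eta n)) \<longlonglongrightarrow> (\<lambda>(u, v). W u v) (u, c)"
    by (rule continuous_on_tendsto_compose[OF cont]) (use u v eta in \<open>auto intro!: tendsto_intros vlim\<close>)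
   then show "(\<lambda>n. tent eta n a b u *\<^sub>R W u (c + s / scale eta n)) \<longlonglongrightarrow> indicator {a<..b} u *\<^sub>R W u c"
    by (intro tendsto_scaleR plateau_tendsto filterlim_scale eta ab) simp
  qed (rule integrable_const_ivl)
  \<comment> \<open>The limit of the cut-offs is the indicator of a half-open interval, which
    differs from the closed one in a single point.\<close>
  moreover have "integral {a..b + eta} (\<lambda>u. indicator {a<..b} u *\<^sub>R W u c) = integral {a..b + eta} (\<lambda>u. if u \<in> {a..b} then W u c else 0)"
   by (rule integral_spike[of "{a}"]) (auto simp: indicator_def)
  moreover have "\<dots> = integral {a..b} (\<lambda>u. W u c)"
   using integral_restrict_Int[of "{a..b + eta}" "{a..b}" "\<lambda>u. W u c"] eta by (simp add: inf.absorb2)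
  ultimately show "(\<lambda>n. w n (c + s / scale eta n)) \<longlonglongrightarrow> integral {a..b} (\<lambda>u. W u c)"
   using w_eq[OF v] by simp
 qed
 moreover have "(LINT u|lborel. (tent eta n a b u * bump eta n c v) *\<^sub>R W u v) = bump eta n c v *\<^sub>R w n v" for n v
  unfolding w_def by (subst integral_scaleR_right[symmetric]) (simp add: mult.commute)
 ultimately show ?thesis by simp
qed

section \<open>Stokes' identity on rectangles for weakly closed continuous forms\<close>

lemma compact_support_integrable:
 fixes g :: "plane => complex"
 assumes "compact K" "continuous_on K g" "\<And>z. z \<notin> K ==> g z = 0"
 shows "integrable lborel g"
proof -
 have "integrable lborel (\<lambda>z. indicator K z *\<^sub>R g z)" by (rule borel_integrable_compact[OF assms(1,2)])
 moreover have "indicator K z *\<^sub>R g z = g z" for z using assms(3)[of z] by (auto simp: indicator_def)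
 ultimately show ?thesis by simp
qed

text \<open>\<open>weak\<close> is the pairing of \<open>p dx + q dt\<close> with the differential
  of a product of two plateau functions. Their derivatives live near the four sides, so the pairing
  becomes the boundary integral in the limit, without any derivative falling on \<open>p\<close> or
  \<open>q\<close>.\<close>

lemma weakly_closed_imp_rect:
 fixes p q :: "plane => complex"
 assumes eta: "eta > 0" and ab: "a < b" "c < d"
  and cont: "continuous_on ({a..b + eta} \<times> {c..d + eta}) p" "continuous_on ({a..b + eta} \<times> {c..d + eta}) q"
  and weak: "\<And>n. (LINT z|lborel. ((bump eta n a (fst z) - bump eta n b (fst z)) * tent eta n c d (snd z)) *\<^sub>R q z
    - (tent eta n a b (fst z) * (bump eta n c (snd z) - bump eta n d (snd z))) *\<^sub>R p z) = 0"
 shows "integral {a..b} (\<lambda>s. p (s, c)) + integral {c..d} (\<lambda>s. q (b, s)) =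
   integral {c..d} (\<lambda>s. q (a, s)) + integral {a..b} (\<lambda>s. p (s, d))"
proof -
 define R where "R = {a..b + eta} \<times> {c..d + eta}"
 have R: "compact R" unfolding R_def by (intro compact_Times) auto
 define P where "P n e z = (tent eta n a b (fst z) * bump eta n e (snd z)) *\<^sub>R p z" for n e z
 define Q where "Q n e z = (bump eta n e (fst z) * tent eta n c d (snd z)) *\<^sub>R q z" for n e z
 have cP: "continuous_on R (P n e)" for n e
  unfolding P_def R_def
  by (intro continuous_intros cont continuous_on_compose2[OF continuous_on_tent[of UNIV]] continuous_on_compose2[OF continuous_on_bump[of UNIV]]) auto
 have cQ: "continuous_on R (Q n e)" for n e
  unfolding Q_def R_def
  by (intro continuous_intros cont continuous_on_compose2[OF continuous_on_tent[of UNIV]] continuous_on_compose2[OF continuous_on_bump[of UNIV]]) auto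
 have zP: "P n e z = 0" if "e \<in> {c, d}" "z \<notin> R" for n e z
 proof -
  have "fst z \<notin> {a..b + eta} \<or> snd z \<notin> {e..e + eta}" using that ab eta by (cases z) (auto simp: R_def)
  then have "tent eta n a b (fst z) = 0 \<or> bump eta n e (snd z) = 0"
   using tent_eq_0[OF eta less_imp_le[OF ab(1)]] bump_eq_0[OF eta] by blast
  then show ?thesis unfolding P_def by auto
 qed
 have zQ: "Q n e z = 0" if "e \<in> {a, b}" "z \<notin> R" for n e z
 proof -
  have "fst z \<notin> {e..e + eta} \<or> snd z \<notin> {c..d + eta}" using that ab eta by (cases z) (auto simp: R_def)
  then have "bump eta n e (fst z) = 0 \<or> tent eta n c d (snd z) = 0"
   using tent_eq_0[OF eta less_imp_le[OF ab(2)]] bump_eq_0[OF eta] by blast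
  then show ?thesis unfolding Q_def by auto
 qed
 have iP: "integrable lborel (P n e)" if "e \<in> {c, d}" for n e
  by (rule compact_support_integrable[OF R cP]) (rule zP[OF that])
 have iQ: "integrable lborel (Q n e)" if "e \<in> {a, b}" for n e
  by (rule compact_support_integrable[OF R cQ]) (rule zQ[OF that])
 have lP: "(\<lambda>n. LINT z|lborel. P n e z) \<longlonglongrightarrow> integral {a..b} (\<lambda>s. p (s, e))" if e: "e \<in> {c, d}" for e
 proof -
  have "(LINT v|lborel. LINT u|lborel. P n e (u, v)) = (LINT z|lborel. P n e z)" for n
   using lborel_pair.integral_snd[of "\<lambda>u v. P n e (u, v)"] iP[OF e, of n] by (simp add: lborel_prod)
  moreover have "(\<lambda>n. LINT v|lborel. LINT u|lborel. (tent eta n a b u * bump eta n e v) *\<^sub>R p (u, v)) \<longlonglongrightarrow> integral {a..b} (\<lambda>u. p (u, e))"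
   by (rule tent_bump_limit[OF eta ab(1)], simp, rule continuous_on_subset[OF cont(1)]) (use e ab in auto)
  ultimately show ?thesis by (simp add: P_def)
 qed
 have lQ: "(\<lambda>n. LINT z|lborel. Q n e z) \<longlonglongrightarrow> integral {c..d} (\<lambda>s. q (e, s))" if e: "e \<in> {a, b}" for e
 proof -
  have "(LINT u|lborel. LINT v|lborel. Q n e (u, v)) = (LINT z|lborel. Q n e z)" for n
   using lborel_pair.integral_fst[of "\<lambda>u v. Q n e (u, v)"] iQ[OF e, of n] by (simp add: lborel_prod)
  moreover have "(\<lambda>n. LINT u|lborel. LINT v|lborel. (tent eta n c d v * bump eta n e u) *\<^sub>R q (u, v)) \<longlonglongrightarrow> integral {c..d} (\<lambda>v. q (e, v))"
  proof (rule tent_bump_limit[OF eta ab(2)])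
   have "continuous_on ({c..d + eta} \<times> {e..e + eta}) (\<lambda>z. q (snd z, fst z))"
    by (rule continuous_on_compose2[OF cont(2)]) (use e ab in \<open>auto intro!: continuous_intros\<close>)
   then show "continuous_on ({c..d + eta} \<times> {e..e + eta}) (\<lambda>(v, u). q (u, v))" by (simp add: split_def)
  qed
  ultimately show ?thesis by (simp add: Q_def mult.commute)
 qed
 have "(\<lambda>n. (LINT z|lborel. Q n a z) - (LINT z|lborel. Q n b z) - ((LINT z|lborel. P n c z) - (LINT z|lborel. P n d z)))
   \<longlonglongrightarrow> integral {c..d} (\<lambda>s. q (a, s)) - integral {c..d} (\<lambda>s. q (b, s)) - (integral {a..b} (\<lambda>s. p (s, c)) - integral {a..b} (\<lambda>s. p (s, d)))"
  by (intro tendsto_diff lP lQ) auto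
 moreover have "(LINT z|lborel. Q n a z) - (LINT z|lborel. Q n b z) - ((LINT z|lborel. P n c z) - (LINT z|lborel. P n d z)) = 0" for n
 proof -
  have "(LINT z|lborel. Q n a z - Q n b z - (P n c z - P n d z)) = 0"
   using weak[of n] unfolding P_def Q_def by (simp add: algebra_simps scaleR_diff_left)
  then show ?thesis using iP[of c n] iP[of d n] iQ[of a n] iQ[of b n]
   by (simp add: Bochner_Integration.integral_diff Bochner_Integration.integrable_diff)
 qed
 ultimately show ?thesis by (simp add: LIMSEQ_const_iff algebra_simps)
qed

section \<open>Complex vector fields in components, and the forms attached to weak solutions\<close>

lemma smooth_on_differentiable: "smooth_on S f ==> open S ==> x \<in> S ==> f differentiable (at x)"
 using smooth_on_has_derivative differentiableI by blast

lemma Basis_plane: "(Basis :: plane set) = {(1, 0), (0, 1)}"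
 by (auto simp: Basis_prod_def)

lemma frechet_derivative_plane:
 fixes f :: "plane => complex"
 assumes "(f has_derivative D) (at z)"
 shows "D v = fst v *\<^sub>R D (1, 0) + snd v *\<^sub>R D (0, 1)"
proof -
 have "linear D" using assms has_derivative_linear by blast
 then have "D (fst v *\<^sub>R (1, 0) + snd v *\<^sub>R (0, 1)) = fst v *\<^sub>R D (1, 0) + snd v *\<^sub>R D (0, 1)"
  by (simp only: linear_add linear_scale)
 then show ?thesis by simp
qed

definition vf_comp :: "(plane => plane) => (plane => plane) => plane => plane => complex" where
 "vf_comp X Y e w = of_real (X w \<bullet> e) + \<i> * of_real (Y w \<bullet> e)"

lemma smooth_on_of_real_inner:
 fixes X :: "plane => plane"
 assumes "open S" "smooth_on S X"
 shows "smooth_on S (\<lambda>w. complex_of_real (X w \<bullet> e))"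
proof -
 have "bounded_linear (\<lambda>v::plane. complex_of_real (v \<bullet> e))"
  by (intro bounded_linear_compose[OF bounded_linear_of_real] bounded_linear_inner_left)
 from smooth_on_linear_compose[OF this assms] show ?thesis .
qed

lemma smooth_on_vf_comp:
 assumes "open S" "smooth_on S X" "smooth_on S Y"
 shows "smooth_on S (vf_comp X Y e)"
 unfolding vf_comp_def[abs_def] using assms
 by (intro smooth_on_add smooth_on_mult smooth_on_const smooth_on_of_real_inner)

lemma vf_apply_eq:
 assumes "(u has_derivative D) (at w)"
 shows "vf_apply X Y u w = vf_comp X Y (1, 0) w * D (1, 0) + vf_comp X Y (0, 1) w * D (0, 1)"
proof -
 have "frechet_derivative u (at w) = D" using frechet_derivative_at[OF assms] by simp
 then show ?thesis
  unfolding vf_apply_def vf_comp_def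
  using frechet_derivative_plane[OF assms, of "X w"] frechet_derivative_plane[OF assms, of "Y w"]
  by (cases "X w"; cases "Y w") (simp add: scaleR_conv_of_real algebra_simps)
qed

lemma frechet_derivative_worksI:
 "f differentiable (at x) ==> (f has_derivative frechet_derivative f (at x)) (at x)"
 by (simp add: frechet_derivative_works)

lemma pd_mult_complex:
 fixes a b :: "plane => complex"
 assumes "a differentiable (at z)" "b differentiable (at z)"
 shows "pd v (\<lambda>w. a w * b w) z = a z * pd v b z + pd v a z * b z"
proof -
 have "((\<lambda>w. a w * b w) has_derivative (\<lambda>h. a z * frechet_derivative b (at z) h + frechet_derivative a (at z) h * b z)) (at z)"
  using has_derivative_mult[OF assms[unfolded frechet_derivative_works]] .
 from fun_cong[OF frechet_derivative_at[OF this], of v] show ?thesis by simp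
qed

lemma pd_eq_0:
 fixes a :: "plane => complex"
 assumes "open S" "z \<in> S" "\<And>w. w \<in> S ==> a w = 0"
 shows "pd v a z = 0"
proof -
 have "frechet_derivative a (at z) = frechet_derivative (\<lambda>_. 0) (at z)"
  by (rule frechet_derivative_cong_open[OF assms(1,2)]) (use assms(3) in auto)
 then show ?thesis by simp
qed

lemma vf_transpose_eq:
 assumes dX: "X differentiable (at z)" and dY: "Y differentiable (at z)" and dphi: "phi differentiable (at z)"
 shows "vf_transpose X Y phi z = - (\<Sum>e\<in>Basis. pd e (\<lambda>w. phi w * vf_comp X Y e w) z)"
proof -
 have X: "(\<lambda>w. complex_of_real (X w \<bullet> e)) differentiable (at z)" and Y: "(\<lambda>w. complex_of_real (Y w \<bullet> e)) differentiable (at z)" for e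
  using dX dY
  by (auto intro!: differentiable_compose[OF bounded_linear_imp_differentiable[OF bounded_linear_of_real]] differentiable_inner)
 have "pd e (\<lambda>w. phi w * vf_comp X Y e w) z = pd e (\<lambda>w. phi w * of_real (X w \<bullet> e)) z + \<i> * pd e (\<lambda>w. phi w * of_real (Y w \<bullet> e)) z" for e
 proof -
  have "((\<lambda>w. phi w * of_real (X w \<bullet> e) + \<i> * (phi w * of_real (Y w \<bullet> e))) has_derivative
   (\<lambda>h. frechet_derivative (\<lambda>w. phi w * of_real (X w \<bullet> e)) (at z) h + \<i> * frechet_derivative (\<lambda>w. phi w * of_real (Y w \<bullet> e)) (at z) h)) (at z)"
   by (intro has_derivative_add has_derivative_mult_right frechet_derivative_worksI differentiable_mult dphi X Y)
  from fun_cong[OF frechet_derivative_at[OF this], of e]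
  show ?thesis by (simp add: vf_comp_def distrib_left mult.left_commute)
 qed
 then show ?thesis unfolding vf_transpose_def by (simp add: sum.distrib sum_distrib_left)
qed

lemma smooth_on_dform:
 fixes f :: "plane => complex"
 assumes "smooth_on S f" "open S" "q \<in> S"
 shows "(f has_derivative dform (pd (1, 0) f q) (pd (0, 1) f q)) (at q)"
proof -
 note D = smooth_on_has_derivative[OF assms]
 have "frechet_derivative f (at q) = dform (pd (1, 0) f q) (pd (0, 1) f q)"
  unfolding dform_def by (rule ext) (rule frechet_derivative_plane[OF D])
 with D show ?thesis by simp
qed

text \<open>Differentiation under the integral sign gives \<open>f\<^sub>y(x, y) - f\<^sub>y(a, y) = \<integral>\<^sub>a\<^sup>x f\<^sub>x\<^sub>y(s, y) ds\<close>.\<close>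

lemma pd_commute:
 fixes f :: "plane => complex"
 assumes S: "open S" "(x0, y0) \<in> S" and f: "smooth_on S f"
 shows "pd (0, 1) (pd (1, 0) f) (x0, y0) = pd (1, 0) (pd (0, 1) f) (x0, y0)"
proof -
 have sm: "smooth_on S (pd (1, 0) f)" "smooth_on S (pd (0, 1) f)" by (intro smooth_on_pd f; simp add: Basis_plane)+
 obtain A B where AB: "open A" "open B" "x0 \<in> A" "y0 \<in> B" "A \<times> B \<subseteq> S"
  using open_prod_elim[OF S] by (metis mem_Sigma_iff)
 obtain r where r: "r > 0" "cball x0 r \<subseteq> A" using AB open_contains_cball by blast
 obtain e where e: "e > 0" "ball y0 e \<subseteq> B" using AB open_contains_ball by blast
 define a where "a = x0 - r"
 have box: "(s, y) \<in> S" if "s \<in> {a..x0 + r}" "y \<in> ball y0 e" for s y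
  using that r e AB(5) by (auto simp: a_def dist_real_def subset_iff)
 define g where "g y s = pd (0, 1) (pd (1, 0) f) (s, y)" for y s
 have cg: "continuous_on (ball y0 e \<times> {a..x0 + r}) (\<lambda>z. g (fst z) (snd z))"
  unfolding g_def by (rule continuous_on_compose2[OF smooth_on_imp_continuous_on[OF smooth_on_pd[OF sm(1), of "(0, 1)"]]])
   (use box in \<open>auto simp: Basis_plane intro!: continuous_intros\<close>)
 have key: "pd (0, 1) f (x, y0) = pd (0, 1) f (a, y0) + integral {a..x} (g y0)" if x: "x \<in> {a<..<x0 + r}" for x
 proof -
  have "((\<lambda>y. integral (cbox a x) (\<lambda>s. pd (1, 0) f (s, y))) has_vector_derivative integral (cbox a x) (g y0)) (at y0 within ball y0 e)"
  proof (rule leibniz_rule_vector_derivative)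
   fix y s assume y: "y \<in> ball y0 e" and s: "s \<in> cbox a x"
   then have "(s, y) \<in> S" using x by (intro box) auto
   from has_derivative_dform_snd[OF smooth_on_dform[OF sm(1) S(1) this]]
   show "((\<lambda>y. pd (1, 0) f (s, y)) has_vector_derivative g y s) (at y within ball y0 e)"
    unfolding g_def by (rule has_vector_derivative_at_within)
  next
   fix y assume "y \<in> ball y0 e"
   then show "(\<lambda>s. pd (1, 0) f (s, y)) integrable_on cbox a x"
    using x box by (intro integrable_continuous continuous_on_compose2[OF smooth_on_imp_continuous_on[OF sm(1)]]) (auto intro!: continuous_intros)
  next
   show "continuous_on (ball y0 e \<times> cbox a x) (\<lambda>(y, s). g y s)"
    unfolding split_def by (rule continuous_on_subset[OF cg]) (use x in auto)
  qed (use e in auto)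
  then have "((\<lambda>y. integral {a..x} (\<lambda>s. pd (1, 0) f (s, y))) has_vector_derivative integral {a..x} (g y0)) (at y0)"
   using e by (simp add: at_within_open[of y0 "ball y0 e"])
  moreover have "integral {a..x} (\<lambda>s. pd (1, 0) f (s, y)) = f (x, y) - f (a, y)" if y: "y \<in> ball y0 e" for y
  proof (rule integral_unique[OF fundamental_theorem_of_calculus])
   fix s assume "s \<in> {a..x}"
   then have "(s, y) \<in> S" using x y by (intro box) auto
   from has_derivative_dform_fst[OF smooth_on_dform[OF f S(1) this]]
   show "((\<lambda>s. f (s, y)) has_vector_derivative pd (1, 0) f (s, y)) (at s within {a..x})" by (rule has_vector_derivative_at_within)
  qed (use x in auto)
  ultimately have "((\<lambda>y. f (x, y) - f (a, y)) has_vector_derivative integral {a..x} (g y0)) (at y0)"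
   using e by (elim has_vector_derivative_transform_within_open[of _ _ _ "ball y0 e"]) auto
  moreover have "((\<lambda>y. f (x, y) - f (a, y)) has_vector_derivative pd (0, 1) f (x, y0) - pd (0, 1) f (a, y0)) (at y0)"
   by (intro has_vector_derivative_diff has_derivative_dform_snd[OF smooth_on_dform[OF f S(1)]] box) (use x r e in \<open>auto simp: a_def\<close>)
  ultimately have "integral {a..x} (g y0) = pd (0, 1) f (x, y0) - pd (0, 1) f (a, y0)" by (rule vector_derivative_unique_at)
  then show ?thesis by simp
 qed
 have "continuous_on {a..x0 + r} (\<lambda>s. g (fst (y0, s)) (snd (y0, s)))"
  by (rule continuous_on_compose2[OF cg]) (use e in \<open>auto intro!: continuous_intros\<close>)
 then have "continuous_on {a..x0 + r} (g y0)" by simp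
 from has_vector_derivative_add[OF has_vector_derivative_const antiderivative_upper[OF this]]
 have "((\<lambda>x. pd (0, 1) f (a, y0) + integral {a..x} (g y0)) has_vector_derivative g y0 x0) (at x0)"
  using r by (simp add: a_def)
 then have "((\<lambda>x. pd (0, 1) f (x, y0)) has_vector_derivative g y0 x0) (at x0)"
  by (rule has_vector_derivative_transform_within_open[of _ _ _ "{a<..<x0 + r}"]) (use key r in \<open>auto simp: a_def\<close>)
 moreover have "((\<lambda>x. pd (0, 1) f (x, y0)) has_vector_derivative pd (1, 0) (pd (0, 1) f) (x0, y0)) (at x0)"
  by (rule has_derivative_dform_fst[OF smooth_on_dform[OF sm(2) S]])
 ultimately have "g y0 x0 = pd (1, 0) (pd (0, 1) f) (x0, y0)" by (rule vector_derivative_unique_at)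
 then show ?thesis by (simp add: g_def)
qed

text \<open>If \<open>LZ = 0\<close> then \<open>L\<close> is a multiple of \<open>Z\<^sub>2 \<partial>\<^sub>1 - Z\<^sub>1 \<partial>\<^sub>2\<close>; hence for \<open>Lf = 0\<close> the form \<open>f dZ\<close> is weakly closed.\<close>

lemma weak_solution_closed:
 assumes S: "open S" "S \<subseteq> V" and sm: "smooth_on S X" "smooth_on S Y" "smooth_on S Z"
  and LZ: "\<And>w. w \<in> S ==> vf_apply X Y Z w = 0" and L0: "\<And>w. w \<in> S ==> X w \<noteq> 0 \<or> Y w \<noteq> 0"
  and sol: "vf_solves V X Y (regular_distribution f) (\<lambda>_. 0)" and \<theta>: "test_fun S \<theta>"
 shows "(LINT z|lborel. f z * (pd (1, 0) \<theta> z * pd (0, 1) Z z - pd (0, 1) \<theta> z * pd (1, 0) Z z)) = 0"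
proof -
 define K where "K = closure {x. \<theta> x \<noteq> 0}"
 have K: "compact K" "K \<subseteq> S" "smooth_on UNIV \<theta>" using \<theta> by (auto simp: test_fun_def K_def)
 have \<theta>0: "\<theta> w = 0" if "w \<notin> K" for w using that closure_subset[of "{x. \<theta> x \<noteq> 0}"] by (auto simp: K_def)
 define L1 where "L1 = vf_comp X Y (1, 0)"
 define L2 where "L2 = vf_comp X Y (0, 1)"
 define Z1 where "Z1 = pd (1, 0) Z"
 define Z2 where "Z2 = pd (0, 1) Z"
 define N where "N w = L1 w * cnj (L1 w) + L2 w * cnj (L2 w)" for w
 \<comment> \<open>\<open>m\<close> is the factor with \<open>m L1 = Z2\<close> and
   \<open>m L2 = - Z1\<close>, found by projecting onto the conjugate of \<open>(L1, L2)\<close>;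
   this formula is smooth without the choice of a nonvanishing component.\<close>
 define m where "m w = (Z2 w * cnj (L1 w) - Z1 w * cnj (L2 w)) / N w" for w
 define phi where "phi w = \<theta> w * m w" for w
 have sL: "smooth_on S L1" "smooth_on S L2" unfolding L1_def L2_def by (intro smooth_on_vf_comp S sm)+
 have sZ: "smooth_on S Z1" "smooth_on S Z2"
  unfolding Z1_def Z2_def by (intro smooth_on_pd sm; simp add: Basis_plane)+
 have sc: "smooth_on S (\<lambda>w. cnj (L1 w))" "smooth_on S (\<lambda>w. cnj (L2 w))"
  by (intro smooth_on_linear_compose[OF bounded_linear_cnj] S sL)+
 have N0: "N w \<noteq> 0" if "w \<in> S" for w
 proof -
  have "N w = of_real ((cmod (L1 w))\<^sup>2 + (cmod (L2 w))\<^sup>2)"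
   by (simp only: N_def complex_norm_square of_real_add)
  moreover have "L1 w \<noteq> 0 \<or> L2 w \<noteq> 0"
   using L0[OF that] by (cases "X w"; cases "Y w") (auto simp: zero_prod_def L1_def L2_def vf_comp_def complex_eq_iff)
  ultimately show ?thesis
   by (metis of_real_eq_0_iff sum_power2_eq_zero_iff norm_eq_zero)
 qed
 have sN: "smooth_on S N" unfolding N_def[abs_def] by (intro smooth_on_add smooth_on_mult S sL sc)
 have sm': "smooth_on S m" unfolding m_def[abs_def]
  by (intro smooth_on_divide smooth_on_diff smooth_on_mult S sZ sc sN N0)
 have sphiS: "smooth_on S phi" unfolding phi_def[abs_def]
  by (intro smooth_on_mult S sm' smooth_on_subset[OF K(3)]) auto
 have oK: "open (- K)" using K(1) compact_imp_closed by auto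
 have "smooth_on (- K) phi"
  by (rule smooth_on_cong[OF oK _ smooth_on_const[of _ 0]]) (simp add: phi_def \<theta>0)
 from smooth_on_Un[OF S(1) oK sphiS this]
 have sphi: "smooth_on UNIV phi" using K(2) by (metis Compl_partition Un_UNIV_left sup.absorb_iff1 sup_commute compl_sup_top sup.mono order_refl top.extremum_uniqueI)
 have "{x. phi x \<noteq> 0} \<subseteq> {x. \<theta> x \<noteq> 0}" by (auto simp: phi_def)
 then have sub: "closure {x. phi x \<noteq> 0} \<subseteq> K" unfolding K_def by (rule closure_mono)
 then have "test_fun V phi"
  using sphi K(2) S(2) compact_Int_closed[OF K(1) closed_closure, of "{x. phi x \<noteq> 0}"]
  by (simp add: test_fun_def inf.absorb2[OF sub] order_trans[OF sub])
 then have "regular_distribution f (vf_transpose X Y phi) = 0"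
  using sol by (simp add: vf_solves_def)
 moreover have "vf_transpose X Y phi z = - (pd (1, 0) \<theta> z * pd (0, 1) Z z - pd (0, 1) \<theta> z * pd (1, 0) Z z)" for z
 proof (cases "z \<in> S")
  case True
  have LZ0: "L1 w * Z1 w + L2 w * Z2 w = 0" if "w \<in> S" for w
   using LZ[OF that] vf_apply_eq[OF smooth_on_has_derivative[OF sm(3) S(1) that]] by (simp add: L1_def L2_def Z1_def Z2_def)
  have e1: "phi w * L1 w = \<theta> w * Z2 w" if "w \<in> S" for w
  proof -
   have "(Z2 w * cnj (L1 w) - Z1 w * cnj (L2 w)) * L1 w = Z2 w * N w - (L1 w * Z1 w + L2 w * Z2 w) * cnj (L2 w)"
    unfolding N_def by (simp add: algebra_simps)
   then have "(Z2 w * cnj (L1 w) - Z1 w * cnj (L2 w)) * L1 w = Z2 w * N w"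
    by (simp add: LZ0[OF that])
   moreover have "phi w * L1 w = \<theta> w * ((Z2 w * cnj (L1 w) - Z1 w * cnj (L2 w)) * L1 w) / N w"
    by (simp add: phi_def m_def)
   ultimately show ?thesis using N0[OF that] by simp
  qed
  have e2: "phi w * L2 w = - \<theta> w * Z1 w" if "w \<in> S" for w
  proof -
   have "(Z2 w * cnj (L1 w) - Z1 w * cnj (L2 w)) * L2 w = - Z1 w * N w + (L1 w * Z1 w + L2 w * Z2 w) * cnj (L1 w)"
    unfolding N_def by (simp add: algebra_simps)
   then have "(Z2 w * cnj (L1 w) - Z1 w * cnj (L2 w)) * L2 w = - Z1 w * N w"
    by (simp add: LZ0[OF that])
   moreover have "phi w * L2 w = \<theta> w * ((Z2 w * cnj (L1 w) - Z1 w * cnj (L2 w)) * L2 w) / N w"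
    by (simp add: phi_def m_def)
   ultimately show ?thesis using N0[OF that] by simp
  qed
  have d: "X differentiable (at z)" "Y differentiable (at z)" "phi differentiable (at z)"
   "\<theta> differentiable (at z)" "Z1 differentiable (at z)" "Z2 differentiable (at z)"
   using sm sZ sphiS smooth_on_subset[OF K(3), of S] by (simp_all add: smooth_on_differentiable[OF _ S(1) True])
  have "vf_transpose X Y phi z = - (pd (1, 0) (\<lambda>w. phi w * L1 w) z + pd (0, 1) (\<lambda>w. phi w * L2 w) z)"
   unfolding vf_transpose_eq[OF d(1,2,3)] Basis_plane by (simp add: L1_def L2_def)
  also have "pd (1, 0) (\<lambda>w. phi w * L1 w) z = pd (1, 0) (\<lambda>w. \<theta> w * Z2 w) z"
   by (simp add: frechet_derivative_cong_open[OF S(1) True e1])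
  also have "pd (0, 1) (\<lambda>w. phi w * L2 w) z = pd (0, 1) (\<lambda>w. \<theta> w * - Z1 w) z"
   using e2 by (subst frechet_derivative_cong_open[OF S(1) True, of _ "\<lambda>w. \<theta> w * - Z1 w"]) auto
  also have "pd (1, 0) (\<lambda>w. \<theta> w * Z2 w) z = \<theta> z * pd (1, 0) Z2 z + pd (1, 0) \<theta> z * Z2 z"
   by (rule pd_mult_complex[OF d(4,6)])
  also have "pd (0, 1) (\<lambda>w. \<theta> w * - Z1 w) z = \<theta> z * pd (0, 1) (\<lambda>w. - Z1 w) z + pd (0, 1) \<theta> z * - Z1 z"
   by (rule pd_mult_complex[OF d(4)]) (rule differentiable_minus[OF d(5)])
  also have "pd (0, 1) (\<lambda>w. - Z1 w) z = - pd (0, 1) Z1 z"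
   using fun_cong[OF frechet_derivative_at[OF has_derivative_minus[OF d(5)[unfolded frechet_derivative_works]]], of "(0, 1)"]
   by simp
  \<comment> \<open>Equality of mixed derivatives removes the terms in which \<open>\<theta>\<close>
    is not differentiated.\<close>
  also have "pd (0, 1) Z1 z = pd (1, 0) Z2 z"
   unfolding Z1_def Z2_def using pd_commute[of S "fst z" "snd z" Z] S(1) True sm(3) by simp
  finally show ?thesis by (simp add: Z1_def Z2_def algebra_simps)
 next
  case False
  then have z: "z \<in> - K" using K by auto
  have "pd v (\<lambda>w. phi w * g w) z = 0" "pd v \<theta> z = 0" for v g
   by (rule pd_eq_0[OF oK z]; simp add: phi_def \<theta>0)+
  then show ?thesis by (simp add: vf_transpose_def)
 qed
 ultimately show ?thesis
  unfolding regular_distribution_def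
  by (simp only: mult_minus_right Bochner_Integration.integral_minus neg_equal_0_iff_equal)
qed

lemma smooth_on_tensor:
 "smooth_on UNIV (\<lambda>w::plane. complex_of_real (plateau c a b (fst w) * plateau c' a' b' (snd w)))"
proof -
 have 1: "smooth_on UNIV (\<lambda>w::plane. plateau c a b (fst w))" for c a b
  by (rule smooth_on_compose[OF open_UNIV open_UNIV _ smooth_plateau smooth_on_bounded_linear[OF bounded_linear_fst]]) auto
 have 2: "smooth_on UNIV (\<lambda>w::plane. plateau c a b (snd w))" for c a b
  by (rule smooth_on_compose[OF open_UNIV open_UNIV _ smooth_plateau smooth_on_bounded_linear[OF bounded_linear_snd]]) auto
 show ?thesis
  by (intro smooth_on_linear_compose[OF bounded_linear_of_real] smooth_on_mult 1 2 open_UNIV)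
qed

lemma tensor_has_derivative:
 "((\<lambda>w::plane. complex_of_real (plateau c a b (fst w) * plateau c' a' b' (snd w))) has_derivative
   (\<lambda>h. complex_of_real (plateau c a b (fst z) * ((c' * dstep (c' * (snd z - a')) - c' * dstep (c' * (snd z - b'))) * snd h)
    + ((c * dstep (c * (fst z - a)) - c * dstep (c * (fst z - b))) * fst h) * plateau c' a' b' (snd z)))) (at z)"
proof -
 have 1: "((\<lambda>w::plane. plateau c a b (fst w)) has_derivative (\<lambda>h. (c * dstep (c * (fst z - a)) - c * dstep (c * (fst z - b))) * fst h)) (at z)"
 proof -
  have "((\<lambda>w::plane. fst w) has_derivative fst) (at z)" by (auto intro!: derivative_eq_intros)
  from has_derivative_compose[OF this plateau_has_derivative[unfolded has_field_derivative_def]]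
  show ?thesis by simp
 qed
 have 2: "((\<lambda>w::plane. plateau c' a' b' (snd w)) has_derivative (\<lambda>h. (c' * dstep (c' * (snd z - a')) - c' * dstep (c' * (snd z - b'))) * snd h)) (at z)"
 proof -
  have "((\<lambda>w::plane. snd w) has_derivative snd) (at z)" by (auto intro!: derivative_eq_intros)
  from has_derivative_compose[OF this plateau_has_derivative[unfolded has_field_derivative_def]]
  show ?thesis by simp
 qed
 show ?thesis by (rule has_derivative_of_real[OF has_derivative_mult[OF 1 2]])
qed

text \<open>The test function is \<open>h(Z) T\<close> with \<open>T\<close> a product of plateau
  functions. In the exterior product of \<open>d(h(Z) T)\<close> with \<open>dZ\<close> the
  derivative of \<open>h(Z)\<close> drops out, being a multiple of \<open>dZ\<close>; so an entire
  weight costs nothing, and \<open>weakly_closed_imp_rect\<close> applies to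
  \<open>f h(Z) dZ\<close>.\<close>

lemma weak_solution_locally_exact:
 assumes S: "open S" "S \<subseteq> V" and sm: "smooth_on S X" "smooth_on S Y" "smooth_on S Z"
  and LZ: "\<And>w. w \<in> S ==> vf_apply X Y Z w = 0" and L0: "\<And>w. w \<in> S ==> X w \<noteq> 0 \<or> Y w \<noteq> 0"
  and sol: "vf_solves V X Y (regular_distribution f) (\<lambda>_. 0)" and f: "continuous_on S f"
  and h: "h holomorphic_on UNIV" and w0: "w0 \<in> S"
 shows "\<exists>N P. open N \<and> w0 \<in> N \<and> N \<subseteq> S \<and>
  (\<forall>w\<in>N. (P has_derivative (\<lambda>v. f w * h (Z w) * frechet_derivative Z (at w) v)) (at w))"
proof -
 obtain u0 v0 where w0_eq: "w0 = (u0, v0)" by (cases w0)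
 obtain A B where AB: "open A" "open B" "u0 \<in> A" "v0 \<in> B" "A \<times> B \<subseteq> S"
  using open_prod_elim[OF S(1) w0] w0_eq by (metis mem_Sigma_iff)
 obtain r where r: "r > 0" "cball u0 r \<subseteq> A" "cball v0 r \<subseteq> B"
 proof -
  obtain r1 r2 where "r1 > 0" "cball u0 r1 \<subseteq> A" "r2 > 0" "cball v0 r2 \<subseteq> B"
   using AB open_contains_cball by meson
  then show thesis by (intro that[of "min r1 r2"]) auto
 qed
 \<comment> \<open>Half of \<open>r\<close> is the size of the rectangle, the other half the margin
   into which the cut-offs spread.\<close>
 define eta where "eta = r / 2"
 define a b c d where "a = u0 - eta" and "b = u0 + eta" and "c = v0 - eta" and "d = v0 + eta"
 have eta: "eta > 0" using r by (simp add: eta_def)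
 define p where "p w = f w * h (Z w) * pd (1, 0) Z w" for w
 define q where "q w = f w * h (Z w) * pd (0, 1) Z w" for w
 have inS: "{a..b + eta} \<times> {c..d + eta} \<subseteq> S"
 proof -
  have "{a..b + eta} \<subseteq> cball u0 r" "{c..d + eta} \<subseteq> cball v0 r"
   using eta by (auto simp: a_def b_def c_def d_def eta_def dist_real_def)
  then show ?thesis using AB r by blast
 qed
 have cZ: "continuous_on S Z" by (rule smooth_on_imp_continuous_on[OF sm(3)])
 have ch: "continuous_on S (\<lambda>w. h (Z w))"
  by (rule continuous_on_compose2[OF holomorphic_on_imp_continuous_on[OF h] cZ]) auto
 have cp: "continuous_on S p" "continuous_on S q" unfolding p_def q_def
  by (intro continuous_intros f ch smooth_on_imp_continuous_on smooth_on_pd sm; simp add: Basis_plane)+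
 have shZ: "smooth_on S (\<lambda>w. h (Z w))"
  by (rule smooth_on_compose[OF S(1) open_UNIV _ smooth_on_holomorphic[OF h open_UNIV] sm(3)]) auto
 have rect: "integral {a..x} (\<lambda>s. p (s, c)) + integral {c..t} (\<lambda>s. q (x, s)) =
   integral {c..t} (\<lambda>s. q (a, s)) + integral {a..x} (\<lambda>s. p (s, t))"
  if x: "a < x" "x < b" and t: "c < t" "t < d" for x t
 proof (rule weakly_closed_imp_rect[OF eta x(1) t(1)])
  have R: "{a..x + eta} \<times> {c..t + eta} \<subseteq> S" using inS x t by auto
  show "continuous_on ({a..x + eta} \<times> {c..t + eta}) p" "continuous_on ({a..x + eta} \<times> {c..t + eta}) q"
   using cp R continuous_on_subset by blast+
  fix n
  define k where "k = scale eta n"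
  define T where "T w = complex_of_real (plateau k a x (fst w) * plateau k c t (snd w))" for w :: plane
  define \<theta> where "\<theta> w = (if w \<in> S then h (Z w) * T w else 0)" for w
  have T0: "T w = 0" if "w \<notin> {a..x + eta} \<times> {c..t + eta}" for w
   using that tent_eq_0[OF eta less_imp_le[OF x(1)], of "fst w" n] tent_eq_0[OF eta less_imp_le[OF t(1)], of "snd w" n]
   by (cases w) (auto simp: T_def k_def)
  have cl: "closed ({a..x + eta} \<times> {c..t + eta})" by (intro closed_Times) auto
  have supp: "closure {w. \<theta> w \<noteq> 0} \<subseteq> {a..x + eta} \<times> {c..t + eta}"
  proof (rule closure_minimal[OF _ cl], rule subsetI, rule ccontr)
   fix w assume "w \<in> {w. \<theta> w \<noteq> 0}" "w \<notin> {a..x + eta} \<times> {c..t + eta}"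
   then show False using T0[of w] by (simp add: \<theta>_def split: if_splits)
  qed
  have s\<theta>: "smooth_on S \<theta>"
  proof (rule smooth_on_cong[OF S(1)])
   show "smooth_on S (\<lambda>w. h (Z w) * T w)" unfolding T_def
    by (intro smooth_on_mult S shZ smooth_on_subset[OF smooth_on_tensor]) auto
  qed (simp add: \<theta>_def)
  have o: "open (- ({a..x + eta} \<times> {c..t + eta}))" using cl by auto
  have "smooth_on (- ({a..x + eta} \<times> {c..t + eta})) \<theta>"
   by (rule smooth_on_cong[OF o _ smooth_on_const[of _ 0]]) (use T0 in \<open>auto simp: \<theta>_def\<close>)
  from smooth_on_Un[OF S(1) o s\<theta> this] have "smooth_on UNIV \<theta>"
   using R by (metis Compl_partition2 Un_upper2 compl_le_compl_iff sup.absorb2 sup_assoc top.extremum_uniqueI Un_UNIV_right)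
  moreover have "compact (closure {w. \<theta> w \<noteq> 0})"
   using supp compact_Times[of "{a..x + eta}" "{c..t + eta}"] by (meson bounded_subset closed_closure compact_Icc compact_Times compact_eq_bounded_closed)
  ultimately have "test_fun S \<theta>" using supp R by (auto simp: test_fun_def)
  from weak_solution_closed[OF S sm LZ L0 sol this]
  have "(LINT z|lborel. f z * (pd (1, 0) \<theta> z * pd (0, 1) Z z - pd (0, 1) \<theta> z * pd (1, 0) Z z)) = 0" .
  moreover have "f z * (pd (1, 0) \<theta> z * pd (0, 1) Z z - pd (0, 1) \<theta> z * pd (1, 0) Z z)
    = ((bump eta n a (fst z) - bump eta n x (fst z)) * tent eta n c t (snd z)) *\<^sub>R q z
    - (tent eta n a x (fst z) * (bump eta n c (snd z) - bump eta n t (snd z))) *\<^sub>R p z" for z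
  proof (cases "z \<in> S")
   case True
   have dT: "(T has_derivative (\<lambda>h. complex_of_real (plateau k a x (fst z) * ((k * dstep (k * (snd z - c)) - k * dstep (k * (snd z - t))) * snd h)
    + ((k * dstep (k * (fst z - a)) - k * dstep (k * (fst z - x))) * fst h) * plateau k c t (snd z)))) (at z)"
    unfolding T_def[abs_def] by (rule tensor_has_derivative)
   have dZ: "(Z has_derivative frechet_derivative Z (at z)) (at z)"
    by (rule smooth_on_has_derivative[OF sm(3) S(1) True])
   have dh: "(h has_derivative (*) (deriv h (Z z))) (at (Z z))"
    using holomorphic_derivI[OF h open_UNIV, of "Z z"] by (simp add: has_field_derivative_def)
   have dhZ: "((\<lambda>w. h (Z w)) has_derivative (\<lambda>v. deriv h (Z z) * frechet_derivative Z (at z) v)) (at z)"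
    using has_derivative_compose[OF dZ dh] by (simp add: o_def)
   have "frechet_derivative \<theta> (at z) = frechet_derivative (\<lambda>w. h (Z w) * T w) (at z)"
    by (rule frechet_derivative_cong_open[OF S(1) True]) (simp add: \<theta>_def)
   then have D: "frechet_derivative \<theta> (at z) v = h (Z z) * complex_of_real (plateau k a x (fst z) * ((k * dstep (k * (snd z - c)) - k * dstep (k * (snd z - t))) * snd v)
    + ((k * dstep (k * (fst z - a)) - k * dstep (k * (fst z - x))) * fst v) * plateau k c t (snd z))
     + deriv h (Z z) * frechet_derivative Z (at z) v * T z" for v
    using fun_cong[OF frechet_derivative_at[OF has_derivative_mult[OF dhZ dT]], of v] by simp
   show ?thesis
    unfolding D T_def p_def q_def k_def scaleR_conv_of_real by (simp add: algebra_simps)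
  next
   case False
   then have z: "z \<in> - ({a..x + eta} \<times> {c..t + eta})" using R by blast
   have "\<theta> w = 0" if "w \<in> - ({a..x + eta} \<times> {c..t + eta})" for w using T0[of w] that by (auto simp: \<theta>_def)
   from pd_eq_0[OF o z this] have 0: "pd v \<theta> z = 0" for v .
   have "fst z \<notin> {a..x + eta} \<or> snd z \<notin> {c..t + eta}" using z by (cases z) auto
   then have "tent eta n a x (fst z) = 0 \<and> bump eta n a (fst z) = 0 \<and> bump eta n x (fst z) = 0 \<or>
      tent eta n c t (snd z) = 0 \<and> bump eta n c (snd z) = 0 \<and> bump eta n t (snd z) = 0"
   proof
    assume "fst z \<notin> {a..x + eta}"
    then show ?thesis using x eta by (intro disjI1 conjI tent_eq_0 bump_eq_0) auto
   next
    assume "snd z \<notin> {c..t + eta}"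
    then show ?thesis using t eta by (intro disjI2 conjI tent_eq_0 bump_eq_0) auto
   qed
   then show ?thesis using 0 by auto
  qed
  ultimately show "(LINT z|lborel. ((bump eta n a (fst z) - bump eta n x (fst z)) * tent eta n c t (snd z)) *\<^sub>R q z
    - (tent eta n a x (fst z) * (bump eta n c (snd z) - bump eta n t (snd z))) *\<^sub>R p z) = 0" by simp
 qed
 have abcd: "a < b" "c < d" using eta by (auto simp: a_def b_def c_def d_def)
 have sub: "{a..b} \<times> {c..d} \<subseteq> S" using inS eta by (auto simp: subset_iff)
 have "\<exists>P. \<forall>z\<in>{a<..<b} \<times> {c<..<d}. (P has_derivative dform (p z) (q z)) (at z)"
  by (rule closed_form_primitive[OF abcd continuous_on_subset[OF cp(1) sub] continuous_on_subset[OF cp(2) sub] rect])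
 then obtain P where P: "\<And>z. z \<in> {a<..<b} \<times> {c<..<d} ==> (P has_derivative dform (p z) (q z)) (at z)"
  by blast
 show ?thesis
 proof (intro exI[of _ "{a<..<b} \<times> {c<..<d}"] exI[of _ P] conjI ballI)
  show "open ({a<..<b} \<times> {c<..<d})" by (intro open_Times) auto
  show "w0 \<in> {a<..<b} \<times> {c<..<d}" using eta by (simp add: w0_eq a_def b_def c_def d_def)
  show sub: "{a<..<b} \<times> {c<..<d} \<subseteq> S" using inS eta by (auto simp: subset_iff)
  fix w assume w: "w \<in> {a<..<b} \<times> {c<..<d}"
  then have "w \<in> S" using sub by blast
  have "dform (p w) (q w) v = f w * h (Z w) * frechet_derivative Z (at w) v" for v
   using frechet_derivative_plane[OF smooth_on_has_derivative[OF sm(3) S(1) \<open>w \<in> S\<close>], of v]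
   by (simp add: dform_def p_def q_def scaleR_conv_of_real algebra_simps)
  then show "(P has_derivative (\<lambda>v. f w * h (Z w) * frechet_derivative Z (at w) v)) (at w)"
   using P[OF w] by (metis (no_types, lifting) ext)
 qed
qed

section \<open>Solutions are constant on the fibres of the first integral\<close>

lemma compact_norm_bound:
 fixes f :: "'a::topological_space => 'b::real_normed_vector"
 assumes "compact K" "continuous_on K f"
 obtains B where "B > 0" "\<And>x. x \<in> K ==> norm (f x) \<le> B"
proof -
 have "bounded (f ` K)" using assms by (intro compact_imp_bounded compact_continuous_image)
 then show thesis using that unfolding bounded_pos by blast
qed

lemma has_vector_derivative_quotient:
 fixes f :: "real => 'a::real_normed_vector"
 assumes "(f has_vector_derivative c) (at x)"
 shows "((\<lambda>y. (f y - f x) /\<^sub>R (y - x)) \<longlongrightarrow> c) (at x)"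
proof -
 have "((\<lambda>y. norm (f y - f x - (y - x) *\<^sub>R c) / norm (y - x)) \<longlongrightarrow> 0) (at x)"
  using assms by (simp add: has_vector_derivative_def has_derivative_iff_norm)
 then have "((\<lambda>y. norm ((f y - f x) /\<^sub>R (y - x) - c)) \<longlongrightarrow> 0) (at x)"
 proof (rule Lim_transform_eventually)
  have "norm (f y - f x - (y - x) *\<^sub>R c) / norm (y - x) = norm ((f y - f x) /\<^sub>R (y - x) - c)" if "y \<noteq> x" for y
  proof -
   have "(f y - f x) /\<^sub>R (y - x) - c = (f y - f x - (y - x) *\<^sub>R c) /\<^sub>R (y - x)"
    using that by (simp add: scaleR_diff_right)
   then show ?thesis by (simp add: divide_inverse_commute)
  qed
  then show "\<forall>\<^sub>F y in at x. norm (f y - f x - (y - x) *\<^sub>R c) / norm (y - x) = norm ((f y - f x) /\<^sub>R (y - x) - c)"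
   by (auto simp: eventually_at intro!: exI[of _ 1])
 qed
 then show ?thesis by (simp add: tendsto_norm_zero_iff LIM_zero_iff)
qed

lemma integrable_gaussian: "integrable lborel (\<lambda>s::real. exp (- (s\<^sup>2 / 2)))"
proof -
 have "integrable lborel (\<lambda>s. sqrt (2 * pi) * std_normal_density s)"
  using integrable_normal_density[of 1 0] by simp
 then show ?thesis by (simp add: normal_density_def)
qed

lemma gaussian_integral_nonzero: "(LINT s|lborel. exp (- complex_of_real (s\<^sup>2))) \<noteq> 0"
proof -
 have i: "integrable lborel (\<lambda>s::real. exp (- s\<^sup>2))"
  by (rule Bochner_Integration.integrable_bound[OF integrable_gaussian]) auto
 have "(LINT s|lborel. exp (- (s::real)\<^sup>2)) \<noteq> 0"
 proof
  assume "(LINT s|lborel. exp (- (s::real)\<^sup>2)) = 0"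
  then have "AE s in lborel. exp (- (s::real)\<^sup>2) = 0"
   using integral_nonneg_eq_0_iff_AE[OF i] by simp
  then have "AE s::real in lborel. False" by simp
  then have "ae_filter (lborel :: real measure) = bot" by (simp add: trivial_limit_def)
  then show False by (simp add: ae_filter_eq_bot_iff)
 qed
 moreover have "(LINT s|lborel. exp (- complex_of_real (s\<^sup>2))) = of_real (LINT s|lborel. exp (- (s::real)\<^sup>2))"
 proof -
  have "complex_of_real (exp (- s\<^sup>2)) = exp (- complex_of_real (s\<^sup>2))" for s
   by (simp add: exp_of_real[symmetric])
  then show ?thesis using integral_complex_of_real[of lborel "\<lambda>s. exp (- s\<^sup>2)"] by simp
 qed
 ultimately show ?thesis by simp
qed

text \<open>Laplace's method: the substitution \<open>y = x + s / sqrt (n + 1)\<close> turns the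
  exponent into the square of a difference quotient of \<open>\<gamma>\<close> at \<open>x\<close>,
  scaled by \<open>s\<close>, and the coercivity bound supplies the dominating function
  \<open>B exp (- (s^2 / 2))\<close>.\<close>

lemma gauss_limit:
 fixes g \<gamma> :: "real => complex"
 assumes r: "r > 0" and cont: "continuous_on {x - r..x + r} g" "continuous_on {x - r..x + r} \<gamma>"
  and d: "(\<gamma> has_vector_derivative c) (at x)" and \<gamma>0: "\<gamma> x = 0"
  and coerc: "\<And>y. y \<in> {x - r..x + r} ==> (y - x)\<^sup>2 / 2 \<le> Re (\<mu> * (\<gamma> y)\<^sup>2)"
 shows "(\<lambda>n. of_real (sqrt (real (Suc n))) * integral {x - r..x + r} (\<lambda>y. g y * exp (- (of_nat (Suc n) * (\<mu> * (\<gamma> y)\<^sup>2)))))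
  \<longlonglongrightarrow> g x * (LINT s|lborel. exp (- (\<mu> * c\<^sup>2 * of_real (s\<^sup>2))))"
proof -
 define I where "I = {x - r..x + r}"
 obtain B where B: "\<And>y. y \<in> I ==> norm (g y) \<le> B"
  unfolding I_def using compact_norm_bound[OF compact_Icc cont(1)] by blast
 define \<nu> where "\<nu> n = sqrt (real (Suc n))" for n
 have \<nu>: "\<nu> n > 0" "(\<nu> n)\<^sup>2 = real (Suc n)" for n by (auto simp: \<nu>_def)
 define k where "k n y = g y * exp (- (of_nat (Suc n) * (\<mu> * (\<gamma> y)\<^sup>2)))" for n y
 define p where "p n s = x + s / \<nu> n" for n s
 define F where "F n s = indicator I (p n s) *\<^sub>R k n (p n s)" for n s
 have kc: "continuous_on I (k n)" for n unfolding k_def using cont unfolding I_def by (intro continuous_intros)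
 have eq: "of_real (\<nu> n) * integral I (k n) = (LINT s|lborel. F n s)" for n
 proof -
  have "set_integrable lborel I (k n)"
   using kc[of n] unfolding I_def by (rule borel_integrable_atLeastAtMost')
  from set_borel_integral_eq_integral(2)[OF this]
  have "integral I (k n) = (LINT y|lborel. indicator I y *\<^sub>R k n y)" by (simp add: set_lebesgue_integral_def)
  also have "\<dots> = \<bar>1 / \<nu> n\<bar> *\<^sub>R (LINT s|lborel. indicator I (x + 1 / \<nu> n * s) *\<^sub>R k n (x + 1 / \<nu> n * s))"
   using \<nu>(1)[of n] by (intro lborel_integral_real_affine) auto
  also have "\<dots> = \<bar>1 / \<nu> n\<bar> *\<^sub>R (LINT s|lborel. F n s)" by (simp add: F_def p_def)
  finally show ?thesis using \<nu>(1)[of n] by (simp add: scaleR_conv_of_real)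
 qed
 have xI: "x \<in> I" using r by (simp add: I_def)
 have "filterlim \<nu> at_top sequentially" unfolding \<nu>_def
  by (rule filterlim_compose[OF sqrt_at_top filterlim_compose[OF filterlim_real_sequentially filterlim_Suc]])
 then have "(\<lambda>n. s / \<nu> n) \<longlonglongrightarrow> 0" for s
  by (intro tendsto_divide_0[OF tendsto_const] filterlim_at_top_imp_at_infinity)
 from tendsto_add[OF tendsto_const this] have yl: "(\<lambda>n. p n s) \<longlonglongrightarrow> x" for s unfolding p_def by simp
 have evI: "\<forall>\<^sub>F n in sequentially. p n s \<in> I" for s
 proof -
  have "\<forall>\<^sub>F n in sequentially. p n s \<in> {x - r<..<x + r}"
   by (rule topological_tendstoD[OF yl[of s]]) (use r in auto)
  then show ?thesis by eventually_elim (auto simp: I_def)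
 qed
 have "(\<lambda>n. LINT s|lborel. F n s) \<longlonglongrightarrow> (LINT s|lborel. g x * exp (- (\<mu> * c\<^sup>2 * of_real (s\<^sup>2))))"
 proof (rule integral_dominated_convergence[where w = "\<lambda>s. B * exp (- (s\<^sup>2 / 2))"])
  show "(\<lambda>s. g x * exp (- (\<mu> * c\<^sup>2 * of_real (s\<^sup>2)))) \<in> borel_measurable lborel"
   unfolding measurable_lborel2 by (intro borel_measurable_continuous_onI continuous_intros)
  show "F n \<in> borel_measurable lborel" for n
  proof -
   have "(\<lambda>y. indicator I y *\<^sub>R k n y) \<in> borel_measurable borel"
    by (rule borel_measurable_continuous_on_indicator[OF _ kc]) (simp add: I_def)
   from measurable_compose[OF _ this, of "p n" borel]
   show ?thesis unfolding F_def p_def measurable_lborel2 by (simp add: borel_measurable_continuous_onI continuous_intros)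
  qed
  show "integrable lborel (\<lambda>s. B * exp (- (s\<^sup>2 / 2)))" by (intro integrable_mult_right integrable_gaussian)
  show "AE s in lborel. norm (F n s) \<le> B * exp (- (s\<^sup>2 / 2))" for n
  proof (rule AE_I2)
   fix s show "norm (F n s) \<le> B * exp (- (s\<^sup>2 / 2))"
   proof (cases "p n s \<in> I")
    case True
    have "(p n s - x)\<^sup>2 = s\<^sup>2 / real (Suc n)"
     unfolding \<nu>(2)[symmetric] by (simp add: p_def power_divide)
    then have "s\<^sup>2 / 2 = real (Suc n) * ((p n s - x)\<^sup>2 / 2)" by (simp del: of_nat_Suc)
    also have "\<dots> \<le> real (Suc n) * Re (\<mu> * (\<gamma> (p n s))\<^sup>2)"
     using coerc[of "p n s"] True unfolding I_def by (intro mult_left_mono) auto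
    finally have "exp (Re (- (of_nat (Suc n) * (\<mu> * (\<gamma> (p n s))\<^sup>2)))) \<le> exp (- (s\<^sup>2 / 2))" by simp
    then show ?thesis
     using B[OF True] True unfolding F_def k_def by (simp add: norm_mult mult_mono' del: of_nat_Suc minus_complex.sel)
   next
    case False
    have "B \<ge> 0" using B[OF xI] norm_ge_zero order_trans by blast
    then show ?thesis using False by (simp add: F_def)
   qed
  qed
  show "AE s in lborel. (\<lambda>n. F n s) \<longlonglongrightarrow> g x * exp (- (\<mu> * c\<^sup>2 * of_real (s\<^sup>2)))"
  proof (rule AE_I2)
   fix s
   have glim: "(\<lambda>n. g (p n s)) \<longlonglongrightarrow> g x"
    by (rule continuous_on_tendsto_compose[OF cont(1) yl[of s]]) (use xI evI[of s] in \<open>auto simp: I_def\<close>)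
   have "(\<lambda>n. of_real (\<nu> n) * \<gamma> (p n s)) \<longlonglongrightarrow> c * of_real s"
   proof (cases "s = 0")
    case False
    have "filterlim (\<lambda>n. p n s) (at x) sequentially"
     using yl[of s] False \<nu>(1) by (auto simp: p_def filterlim_at less_imp_neq[symmetric] intro!: always_eventually)
    from filterlim_compose[OF has_vector_derivative_quotient[OF d] this]
    have "(\<lambda>n. (\<gamma> (p n s) - \<gamma> x) /\<^sub>R (p n s - x) * of_real s) \<longlonglongrightarrow> c * of_real s"
     by (intro tendsto_mult tendsto_const)
    moreover have "(\<gamma> (p n s) - \<gamma> x) /\<^sub>R (p n s - x) * of_real s = of_real (\<nu> n) * \<gamma> (p n s)" for n
     using False \<nu>(1)[of n] by (simp add: p_def \<gamma>0 scaleR_conv_of_real field_simps)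
    ultimately show ?thesis by simp
   qed (simp add: p_def \<gamma>0)
   then have sq: "(\<lambda>n. (of_real (\<nu> n) * \<gamma> (p n s))\<^sup>2) \<longlonglongrightarrow> (c * of_real s)\<^sup>2" by (rule tendsto_power)
   have "(\<lambda>n. g (p n s) * exp (- (\<mu> * (of_real (\<nu> n) * \<gamma> (p n s))\<^sup>2))) \<longlonglongrightarrow> g x * exp (- (\<mu> * (c * of_real s)\<^sup>2))"
    by (intro tendsto_mult tendsto_exp tendsto_minus tendsto_const glim sq)
   moreover have "g (p n s) * exp (- (\<mu> * (of_real (\<nu> n) * \<gamma> (p n s))\<^sup>2)) = k n (p n s)" for n
   proof -
    have "(of_real (\<nu> n))\<^sup>2 = (of_nat (Suc n) :: complex)"
     using \<nu>(2)[of n] by (metis of_real_of_nat_eq of_real_power)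
    then show ?thesis by (simp add: k_def power_mult_distrib mult_ac del: of_nat_Suc)
   qed
   ultimately have "(\<lambda>n. k n (p n s)) \<longlonglongrightarrow> g x * exp (- (\<mu> * c\<^sup>2 * of_real (s\<^sup>2)))"
    by (simp only: power_mult_distrib of_real_power mult.assoc)
   then show "(\<lambda>n. F n s) \<longlonglongrightarrow> g x * exp (- (\<mu> * c\<^sup>2 * of_real (s\<^sup>2)))"
    by (rule Lim_transform_eventually) (use evI[of s] in eventually_elim, simp add: F_def)
  qed
 qed
 then show ?thesis
  using eq unfolding I_def \<nu>_def k_def by simp
qed

text \<open>Complex weights \<open>exp (- n \<lambda> (Z - \<zeta>)\<^sup>2)\<close> concentrate at the two points of the fibre over \<open>\<zeta>\<close>;
 the contributions of the vertical sides are negligible. The normalising constants of the two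
 limits agree because \<open>u = 1\<close> is also a solution.\<close>

lemma fibre_constant:
 fixes u Z zx zt :: "plane => complex"
 assumes r: "r > 0" and t: "t1 \<le> t2"
  and Q: "Q = {x - r..x + r} \<times> {t1..t2}"
  and cont: "continuous_on Q u" "continuous_on Q Z" "continuous_on Q zx" "continuous_on Q zt"
  and d: "\<And>t. t \<in> {t1, t2} ==> ((\<lambda>y. Z (y, t)) has_vector_derivative zx (x, t)) (at x)"
  and fib: "Z (x, t1) = Z (x, t2)" and zx0: "zx (x, t1) \<noteq> 0"
  and coerc: "\<And>y t. (y, t) \<in> Q ==> t \<in> {t1, t2} \<or> \<bar>y - x\<bar> = r ==>
   (y - x)\<^sup>2 / 2 \<le> Re (((Z (y, t) - Z (x, t1)) / zx (x, t1))\<^sup>2)"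
  and rect: "\<And>h w. h holomorphic_on UNIV ==> w = u \<or> w = (\<lambda>_. 1) ==>
   integral {x - r..x + r} (\<lambda>y. w (y, t1) * h (Z (y, t1)) * zx (y, t1)) + integral {t1..t2} (\<lambda>s. w (x + r, s) * h (Z (x + r, s)) * zt (x + r, s))
   = integral {t1..t2} (\<lambda>s. w (x - r, s) * h (Z (x - r, s)) * zt (x - r, s)) + integral {x - r..x + r} (\<lambda>y. w (y, t2) * h (Z (y, t2)) * zx (y, t2))"
 shows "u (x, t1) = u (x, t2)"
proof -
 define \<zeta> where "\<zeta> = Z (x, t1)"
 \<comment> \<open>Normalised so that the rescaled exponent at height \<open>t1\<close> is
   \<open>s^2\<close>; the limit constant there is a real Gaussian integral times
   \<open>zx (x, t1)\<close>, hence nonzero.\<close>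
 define \<mu> where "\<mu> = inverse ((zx (x, t1))\<^sup>2)"
 define e where "e n z = exp (- (of_nat (Suc n) * (\<mu> * (z - \<zeta>)\<^sup>2)))" for n and z :: complex
 define \<Theta> where "\<Theta> t = zx (x, t) * (LINT s|lborel. exp (- (\<mu> * (zx (x, t))\<^sup>2 * of_real (s\<^sup>2))))" for t
 define q where "q n = complex_of_real (sqrt (real (Suc n)))" for n
 have ehol: "e n holomorphic_on UNIV" for n unfolding e_def by (intro holomorphic_intros)
 have coerc': "(y - x)\<^sup>2 / 2 \<le> Re (\<mu> * (Z (y, t) - \<zeta>)\<^sup>2)" if "(y, t) \<in> Q" "t \<in> {t1, t2} \<or> \<bar>y - x\<bar> = r" for y t
 proof -
  have "\<mu> * (Z (y, t) - \<zeta>)\<^sup>2 = ((Z (y, t) - Z (x, t1)) / zx (x, t1))\<^sup>2"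
   by (simp only: \<mu>_def \<zeta>_def power_divide) (simp add: divide_inverse)
  then show ?thesis using coerc[OF that] by (simp only:)
 qed
 have slice: "continuous_on {x - r..x + r} (\<lambda>y. w (y, t))" if "continuous_on Q w" "t \<in> {t1..t2}" for w :: "plane => complex" and t
  by (rule continuous_on_compose2[OF that(1)]) (use that Q in \<open>auto intro!: continuous_intros\<close>)
 have vslice: "continuous_on {t1..t2} (\<lambda>s. w (y, s))" if "continuous_on Q w" "y \<in> {x - r..x + r}" for w :: "plane => complex" and y
  by (rule continuous_on_compose2[OF that(1)]) (use that Q in \<open>auto intro!: continuous_intros\<close>)
 have hor: "(\<lambda>n. q n * integral {x - r..x + r} (\<lambda>y. w (y, t) * e n (Z (y, t)) * zx (y, t))) \<longlonglongrightarrow> w (x, t) * \<Theta> t"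
  if w: "continuous_on Q w" and tt: "t \<in> {t1, t2}" for w t
 proof -
  have t': "t \<in> {t1..t2}" using tt t by auto
  have "(\<lambda>n. of_real (sqrt (real (Suc n))) * integral {x - r..x + r} (\<lambda>y. (w (y, t) * zx (y, t)) * exp (- (of_nat (Suc n) * (\<mu> * (Z (y, t) - \<zeta>)\<^sup>2)))))
   \<longlonglongrightarrow> (w (x, t) * zx (x, t)) * (LINT s|lborel. exp (- (\<mu> * (zx (x, t))\<^sup>2 * of_real (s\<^sup>2))))"
  proof (rule gauss_limit[OF r])
   show "continuous_on {x - r..x + r} (\<lambda>y. w (y, t) * zx (y, t))"
    by (intro continuous_intros slice w cont t')
   show "continuous_on {x - r..x + r} (\<lambda>y. Z (y, t) - \<zeta>)"
    by (intro continuous_intros slice cont t')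
   show "((\<lambda>y. Z (y, t) - \<zeta>) has_vector_derivative zx (x, t)) (at x)"
    using has_vector_derivative_diff[OF d[OF tt] has_vector_derivative_const[of \<zeta>]] by simp
   show "Z (x, t) - \<zeta> = 0" using tt fib by (auto simp: \<zeta>_def)
   show "(y - x)\<^sup>2 / 2 \<le> Re (\<mu> * (Z (y, t) - \<zeta>)\<^sup>2)" if "y \<in> {x - r..x + r}" for y
    by (rule coerc') (use that t' tt Q in auto)
  qed
  then show ?thesis by (simp add: q_def e_def \<Theta>_def mult_ac)
 qed
 \<comment> \<open>On the vertical sides the exponent is at least \<open>(n + 1) r^2 / 2\<close>,
   which beats the factor \<open>sqrt (n + 1)\<close>.\<close>
 have decay: "(\<lambda>n. sqrt (real (Suc n)) * exp (- (real (Suc n) * (r\<^sup>2 / 2)))) \<longlonglongrightarrow> 0"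
  using r by real_asymp
 have ver: "(\<lambda>n. q n * integral {t1..t2} (\<lambda>s. w (y, s) * e n (Z (y, s)) * zt (y, s))) \<longlonglongrightarrow> 0"
  if w: "continuous_on Q w" and y: "y \<in> {x - r, x + r}" for w y
 proof -
  have y': "y \<in> {x - r..x + r}" using y r by auto
  have "continuous_on {t1..t2} (\<lambda>s. w (y, s) * zt (y, s))"
   by (intro continuous_intros vslice w cont y')
  then obtain B where B: "\<And>s. s \<in> {t1..t2} ==> norm (w (y, s) * zt (y, s)) \<le> B"
   using compact_norm_bound[OF compact_Icc] by blast
  have "norm (q n * integral {t1..t2} (\<lambda>s. w (y, s) * e n (Z (y, s)) * zt (y, s)))
    \<le> sqrt (real (Suc n)) * exp (- (real (Suc n) * (r\<^sup>2 / 2))) * (B * (t2 - t1))" for n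
  proof -
   have "norm (integral {t1..t2} (\<lambda>s. w (y, s) * e n (Z (y, s)) * zt (y, s))) \<le> exp (- (real (Suc n) * (r\<^sup>2 / 2))) * B * (t2 - t1)"
   proof (rule integral_bound[OF t])
    show "continuous_on {t1..t2} (\<lambda>s. w (y, s) * e n (Z (y, s)) * zt (y, s))"
     unfolding e_def by (intro continuous_intros vslice w cont y')
    fix s assume s: "s \<in> {t1..t2}"
    have "(y - x)\<^sup>2 / 2 \<le> Re (\<mu> * (Z (y, s) - \<zeta>)\<^sup>2)"
     by (rule coerc') (use s y y' Q r in auto)
    moreover have "(y - x)\<^sup>2 = r\<^sup>2" using y by auto
    ultimately have "real (Suc n) * (r\<^sup>2 / 2) \<le> real (Suc n) * Re (\<mu> * (Z (y, s) - \<zeta>)\<^sup>2)"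
     by (intro mult_left_mono) auto
    then have "norm (e n (Z (y, s))) \<le> exp (- (real (Suc n) * (r\<^sup>2 / 2)))"
     unfolding e_def by (simp del: of_nat_Suc)
    then have "norm (e n (Z (y, s))) * norm (w (y, s) * zt (y, s)) \<le> exp (- (real (Suc n) * (r\<^sup>2 / 2))) * B"
     using B[OF s] by (intro mult_mono') auto
    then show "norm (w (y, s) * e n (Z (y, s)) * zt (y, s)) \<le> exp (- (real (Suc n) * (r\<^sup>2 / 2))) * B"
     by (simp add: norm_mult mult_ac)
   qed
   then have "sqrt (real (Suc n)) * norm (integral {t1..t2} (\<lambda>s. w (y, s) * e n (Z (y, s)) * zt (y, s))) \<le>
     sqrt (real (Suc n)) * (exp (- (real (Suc n) * (r\<^sup>2 / 2))) * B * (t2 - t1))"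
    by (intro mult_left_mono) auto
   then show ?thesis by (simp add: q_def norm_mult mult.assoc)
  qed
  moreover have "(\<lambda>n. sqrt (real (Suc n)) * exp (- (real (Suc n) * (r\<^sup>2 / 2))) * (B * (t2 - t1))) \<longlonglongrightarrow> 0"
   using tendsto_mult_left_zero[OF decay] .
  ultimately show ?thesis by (rule Lim_null_comparison[OF always_eventually, rule_format])
 qed
 have key: "w (x, t1) * \<Theta> t1 = w (x, t2) * \<Theta> t2" if w: "continuous_on Q w" "w = u \<or> w = (\<lambda>_. 1)" for w
 proof -
  have "(\<lambda>n. q n * integral {x - r..x + r} (\<lambda>y. w (y, t1) * e n (Z (y, t1)) * zx (y, t1)) + q n * integral {t1..t2} (\<lambda>s. w (x + r, s) * e n (Z (x + r, s)) * zt (x + r, s)))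
    \<longlonglongrightarrow> w (x, t1) * \<Theta> t1 + 0"
   by (intro tendsto_add hor ver w(1)) auto
  moreover have "(\<lambda>n. q n * integral {t1..t2} (\<lambda>s. w (x - r, s) * e n (Z (x - r, s)) * zt (x - r, s)) + q n * integral {x - r..x + r} (\<lambda>y. w (y, t2) * e n (Z (y, t2)) * zx (y, t2)))
    \<longlonglongrightarrow> 0 + w (x, t2) * \<Theta> t2"
   by (intro tendsto_add hor ver w(1)) auto
  ultimately show ?thesis
   using LIMSEQ_unique rect[OF ehol w(2)] by (simp add: distrib_left[symmetric])
 qed
 have "\<Theta> t1 = \<Theta> t2" using key[of "\<lambda>_. 1"] by simp
 moreover have "\<Theta> t1 \<noteq> 0"
  using zx0 gaussian_integral_nonzero by (simp add: \<Theta>_def \<mu>_def)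
 ultimately show ?thesis using key[of u] cont(1) by simp
qed

section \<open>Solutions in adapted coordinates\<close>

definition zmap :: "(plane => real) => plane => complex" where
 "zmap phi q = Complex (fst q) (phi q)"

definition zdx :: "(plane => real) => plane => complex" where
 "zdx phix q = Complex 1 (phix q)"

definition zdt :: "(plane => real) => plane => complex" where
 "zdt phit q = Complex 0 (phit q)"

text \<open>In coordinates with \<open>x = Re Z\<close> and \<open>t = \<rho>\<close> the first integral is \<open>Z = x + i phi(x, t)\<close>.\<close>

locale coords =
 fixes a b delta C :: real and phi phix phit :: "plane => real"
 assumes ab: "a < b" and delta: "delta > 0" and C: "C \<ge> 1"
  and dphi: "\<And>q. q \<in> {a<..<b} \<times> {-delta<..<delta} ==> (phi has_derivative (\<lambda>v. fst v * phix q + snd v * phit q)) (at q)"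
  and cphix: "continuous_on ({a<..<b} \<times> {-delta<..<delta}) phix"
  and cphit: "continuous_on ({a<..<b} \<times> {-delta<..<delta}) phit"
  and bphix: "\<And>q. q \<in> {a<..<b} \<times> {-delta<..<delta} ==> \<bar>phix q\<bar> \<le> C"
  and bphit: "\<And>q. q \<in> {a<..<b} \<times> {-delta<..<delta} ==> \<bar>phit q\<bar> \<le> C"
  and lipphit: "\<And>x y t. x \<in> {a<..<b} ==> y \<in> {a<..<b} ==> t \<in> {-delta<..<delta} ==> \<bar>phit (x, t) - phit (y, t)\<bar> \<le> C * \<bar>x - y\<bar>"
  and osc: "\<And>q q'. q \<in> {a<..<b} \<times> {-delta<..<delta} ==> q' \<in> {a<..<b} \<times> {-delta<..<delta} ==> \<bar>phix q - phix q'\<bar> \<le> 1/16"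
begin

abbreviation box0 :: "plane set" where "box0 \<equiv> {a<..<b} \<times> {-delta<..<delta}"

abbreviation box1 :: "plane set" where "box1 \<equiv> {a<..<b} \<times> {0<..<delta}"

text \<open>The regions \<open>\<bar>x - x\<^sub>1\<bar> \<le> L \<bar>phi(x, t) - phi(x, 0)\<bar>\<close> are the approach regions in the coordinates.\<close>

definition nt_limit :: "(plane => complex) => complex => real => bool" where
 "nt_limit F l x1 \<longleftrightarrow> (\<forall>L\<ge>0. \<forall>eta>0. \<exists>d>0. \<forall>x t. 0 < t --> t < d --> \<bar>x - x1\<bar> < d -->
  \<bar>x - x1\<bar> \<le> L * \<bar>phi (x, t) - phi (x, 0)\<bar> --> norm (F (x, t) - l) < eta)"

lemma zmap_has_derivative:
 assumes "q \<in> box0"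
 shows "(zmap phi has_derivative dform (zdx phix q) (zdt phit q)) (at q)"
proof -
 have "((\<lambda>q. of_real (fst q) + \<i> * of_real (phi q)) has_derivative (\<lambda>v. of_real (fst v) + \<i> * of_real (fst v * phix q + snd v * phit q))) (at q)"
  by (intro has_derivative_add has_derivative_mult_right has_derivative_of_real dphi[OF assms] has_derivative_fst has_derivative_ident)
 moreover have "(\<lambda>q. of_real (fst q) + \<i> * of_real (phi q)) = zmap phi"
  by (auto simp: zmap_def complex_eq_iff)
 moreover have "(\<lambda>v. of_real (fst v) + \<i> * of_real (fst v * phix q + snd v * phit q)) = dform (zdx phix q) (zdt phit q)"
  by (auto simp: dform_def zdx_def zdt_def complex_eq_iff fun_eq_iff)
 ultimately show ?thesis by simp
qed

lemma continuous_on_phi: "continuous_on box0 phi"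
 by (rule has_derivative_continuous_on[OF has_derivative_at_withinI[OF dphi]])

lemma continuous_on_zmap: "continuous_on box0 (zmap phi)"
 by (rule has_derivative_continuous_on[OF has_derivative_at_withinI[OF zmap_has_derivative]])

lemma continuous_on_zdx: "continuous_on box0 (zdx phix)"
proof -
 have "zdx phix = (\<lambda>q. 1 + \<i> * of_real (phix q))" by (auto simp: zdx_def complex_eq_iff)
 then show ?thesis using cphix by (auto intro!: continuous_intros)
qed

lemma continuous_on_zdt: "continuous_on box0 (zdt phit)"
proof -
 have "zdt phit = (\<lambda>q. \<i> * of_real (phit q))" by (auto simp: zdt_def complex_eq_iff)
 then show ?thesis using cphit by (auto intro!: continuous_intros)
qed

lemma phi_deriv_x:
 assumes "x \<in> {a<..<b}" "t \<in> {-delta<..<delta}"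
 shows "((\<lambda>x. phi (x, t)) has_field_derivative phix (x, t)) (at x)"
proof -
 have "((\<lambda>x. (x, t)) has_derivative (\<lambda>h. (h, 0))) (at x)" by (auto intro!: derivative_eq_intros)
 from has_derivative_compose[OF this dphi] assms
 show ?thesis by (simp add: has_field_derivative_def mult_commute_abs)
qed

lemma phi_deriv_t:
 assumes "x \<in> {a<..<b}" "t \<in> {-delta<..<delta}"
 shows "((\<lambda>t. phi (x, t)) has_field_derivative phit (x, t)) (at t)"
proof -
 have "((\<lambda>t. (x, t)) has_derivative (\<lambda>h. (0, h))) (at t)" by (auto intro!: derivative_eq_intros)
 from has_derivative_compose[OF this dphi] assms
 show ?thesis by (simp add: has_field_derivative_def mult_commute_abs)
qed

lemma phi_lipschitz_t:
 assumes "x \<in> {a<..<b}" "s \<in> {-delta<..<delta}" "t \<in> {-delta<..<delta}"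
 shows "\<bar>phi (x, s) - phi (x, t)\<bar> \<le> C * \<bar>s - t\<bar>"
proof -
 have "norm (phi (x, s) - phi (x, t)) \<le> C * norm (s - t)"
 proof (rule field_differentiable_bound[where S = "{-delta<..<delta}"])
  fix u assume "u \<in> {-delta<..<delta}"
  then show "((\<lambda>t. phi (x, t)) has_field_derivative phit (x, u)) (at u within {-delta<..<delta})"
   using phi_deriv_t[OF assms(1)] has_field_derivative_at_within by blast
 qed (use assms bphit in auto)
 then show ?thesis by simp
qed

text \<open>By \<open>osc\<close> the slope may be taken at any point of the box, not only on the
  segment. The error \<open>1/16\<close> is the share of the horizontal variation in the
  \<open>1/8\<close> allowed by \<open>coercive\<close>.\<close>

lemma phi_linear_x:
 assumes "x \<in> {a<..<b}" "y \<in> {a<..<b}" "t \<in> {-delta<..<delta}" "q \<in> box0"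
 shows "\<bar>phi (y, t) - phi (x, t) - (y - x) * phix q\<bar> \<le> \<bar>y - x\<bar> / 16"
proof -
 have "norm ((phi (y, t) - y * phix q) - (phi (x, t) - x * phix q)) \<le> 1/16 * norm (y - x)"
 proof (rule field_differentiable_bound[where S = "{a<..<b}" and f' = "\<lambda>u. phix (u, t) - phix q"])
  fix u assume u: "u \<in> {a<..<b}"
  have "((\<lambda>u. phi (u, t) - u * phix q) has_field_derivative phix (u, t) - phix q) (at u)"
   using phi_deriv_x[OF u assms(3)] by (auto intro!: derivative_eq_intros)
  then show "((\<lambda>u. phi (u, t) - u * phix q) has_field_derivative phix (u, t) - phix q) (at u within {a<..<b})"
   using has_field_derivative_at_within by blast
  show "norm (phix (u, t) - phix q) \<le> 1/16" using osc[of "(u, t)" q] u assms by simp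
 qed (use assms in auto)
 then show ?thesis by (simp add: algebra_simps)
qed

lemma phi_lipschitz_x:
 assumes "x \<in> {a<..<b}" "y \<in> {a<..<b}" "t \<in> {-delta<..<delta}"
 shows "\<bar>phi (y, t) - phi (x, t)\<bar> \<le> C * \<bar>y - x\<bar>"
proof -
 have "norm (phi (y, t) - phi (x, t)) \<le> C * norm (y - x)"
 proof (rule field_differentiable_bound[where S = "{a<..<b}"])
  fix u assume "u \<in> {a<..<b}"
  then show "((\<lambda>u. phi (u, t)) has_field_derivative phix (u, t)) (at u within {a<..<b})"
   using phi_deriv_x[OF _ assms(3)] has_field_derivative_at_within by blast
 qed (use assms bphix in auto)
 then show ?thesis by simp
qed

text \<open>The mean value theorem in \<open>t\<close> for \<open>phi(y, t) - phi(x, t)\<close>. The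
  Lipschitz constant of the gap in \<open>x\<close> is small of order \<open>t\<close>; so for small
  \<open>t\<close>, within an approach region, the gaps over \<open>x\<close> and over
  \<open>x1\<close> have the same sign and comparable size.\<close>

lemma phi_mixed:
 assumes "x \<in> {a<..<b}" "y \<in> {a<..<b}" "0 \<le> t" "t < delta"
 shows "\<bar>(phi (y, t) - phi (y, 0)) - (phi (x, t) - phi (x, 0))\<bar> \<le> C * t * \<bar>y - x\<bar>"
proof -
 have "norm ((phi (y, t) - phi (x, t)) - (phi (y, 0) - phi (x, 0))) \<le> (C * \<bar>y - x\<bar>) * norm (t - 0)"
 proof (rule field_differentiable_bound[where S = "{-delta<..<delta}" and f = "\<lambda>s. phi (y, s) - phi (x, s)" and f' = "\<lambda>s. phit (y, s) - phit (x, s)"])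
  fix u assume u: "u \<in> {-delta<..<delta}"
  have "((\<lambda>s. phi (y, s) - phi (x, s)) has_field_derivative phit (y, u) - phit (x, u)) (at u)"
   by (intro DERIV_diff phi_deriv_t assms u)
  then show "((\<lambda>s. phi (y, s) - phi (x, s)) has_field_derivative phit (y, u) - phit (x, u)) (at u within {-delta<..<delta})"
   using has_field_derivative_at_within by blast
  show "norm (phit (y, u) - phit (x, u)) \<le> C * \<bar>y - x\<bar>"
   using lipphit[of y x u] assms u by simp
 qed (use assms in auto)
 then show ?thesis using assms by (simp add: algebra_simps)
qed

end

text \<open>The functions \<open>H j\<close> are iterated primitives: \<open>H 0\<close> is the solution and
 \<open>d H\<^sub>j\<^sub>+\<^sub>1 = H\<^sub>j dZ\<close>; those with \<open>j \<ge> K\<close> are continuous up to the boundary \<open>t = 0\<close>.\<close>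

locale strip = coords +
 fixes H :: "nat => plane => complex" and K :: nat
 assumes H0: "continuous_on box1 (H 0)"
  and dH: "\<And>j q. q \<in> box1 ==> (H (Suc j) has_derivative dform (H j q * zdx phix q) (H j q * zdt phit q)) (at q)"
  and exact: "\<And>j h. h holomorphic_on UNIV ==> \<exists>P. \<forall>q\<in>box1.
    (P has_derivative dform (H j q * h (zmap phi q) * zdx phix q) (H j q * h (zmap phi q) * zdt phit q)) (at q)"
  and cH: "\<And>j. j \<ge> K ==> continuous_on ({a<..<b} \<times> {0..<delta}) (H j)"
begin

lemma continuous_on_H: "continuous_on box1 (H j)"
proof (cases j)
 case (Suc i)
 show ?thesis unfolding Suc by (rule has_derivative_continuous_on[OF has_derivative_at_withinI[OF dH]])
qed (simp add: H0)

lemma rect_of_primitive: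
 assumes sub: "{a1..b1} \<times> {t1..t2} \<subseteq> S" and le: "a1 \<le> b1" "t1 \<le> t2"
  and P: "\<And>q. q \<in> S ==> (P has_derivative dform (p q) (r q)) (at q)"
 shows "integral {a1..b1} (\<lambda>y. p (y, t1)) + integral {t1..t2} (\<lambda>s. r (b1, s))
   = integral {t1..t2} (\<lambda>s. r (a1, s)) + integral {a1..b1} (\<lambda>y. p (y, t2))"
proof -
 have h: "integral {a1..b1} (\<lambda>y. p (y, t)) = P (b1, t) - P (a1, t)" if "t \<in> {t1..t2}" for t
 proof (rule integral_unique[OF fundamental_theorem_of_calculus[OF le(1)]])
  fix y assume "y \<in> {a1..b1}"
  then have "(y, t) \<in> S" using sub that by auto
  from has_derivative_dform_fst[OF P[OF this]]
  show "((\<lambda>y. P (y, t)) has_vector_derivative p (y, t)) (at y within {a1..b1})"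
   by (rule has_vector_derivative_at_within)
 qed
 have v: "integral {t1..t2} (\<lambda>s. r (y, s)) = P (y, t2) - P (y, t1)" if "y \<in> {a1..b1}" for y
 proof (rule integral_unique[OF fundamental_theorem_of_calculus[OF le(2)]])
  fix s assume "s \<in> {t1..t2}"
  then have "(y, s) \<in> S" using sub that by auto
  from has_derivative_dform_snd[OF P[OF this]]
  show "((\<lambda>s. P (y, s)) has_vector_derivative r (y, s)) (at s within {t1..t2})"
   by (rule has_vector_derivative_at_within)
 qed
 show ?thesis using h[of t1] h[of t2] v[of a1] v[of b1] le by simp
qed

text \<open>For \<open>t1 = 0\<close> the identity is the limit of those for positive heights,
  because the primitives from level \<open>K\<close> on are continuous up to the boundary.\<close>

lemma rect_exact:
 assumes x: "a < a1" "a1 \<le> b1" "b1 < b" and t: "0 \<le> t1" "t1 \<le> t2" "t2 < delta" and j: "0 < t1 \<or> K \<le> j"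
  and h: "h holomorphic_on UNIV"
 shows "integral {a1..b1} (\<lambda>y. H j (y, t1) * h (zmap phi (y, t1)) * zdx phix (y, t1)) + integral {t1..t2} (\<lambda>s. H j (b1, s) * h (zmap phi (b1, s)) * zdt phit (b1, s))
   = integral {t1..t2} (\<lambda>s. H j (a1, s) * h (zmap phi (a1, s)) * zdt phit (a1, s)) + integral {a1..b1} (\<lambda>y. H j (y, t2) * h (zmap phi (y, t2)) * zdx phix (y, t2))"
proof -
 define p where "p q = H j q * h (zmap phi q) * zdx phix q" for q
 define r where "r q = H j q * h (zmap phi q) * zdt phit q" for q
 have pos: "integral {a1..b1} (\<lambda>y. p (y, u)) + integral {u..t2} (\<lambda>s. r (b1, s))
   = integral {u..t2} (\<lambda>s. r (a1, s)) + integral {a1..b1} (\<lambda>y. p (y, t2))" if u: "0 < u" "u \<le> t2" for u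
 proof -
  obtain P where P: "\<And>q. q \<in> box1 ==> (P has_derivative dform (p q) (r q)) (at q)"
   using exact[OF h, of j] unfolding p_def r_def by blast
  show ?thesis by (rule rect_of_primitive[OF _ _ _ P]) (use x t u in auto)
 qed
 have "integral {a1..b1} (\<lambda>y. p (y, t1)) + integral {t1..t2} (\<lambda>s. r (b1, s))
   = integral {t1..t2} (\<lambda>s. r (a1, s)) + integral {a1..b1} (\<lambda>y. p (y, t2))"
 proof (cases "0 < t1 \<or> t1 = t2")
  case True
  then show ?thesis using pos[of t1] t by auto
 next
  case False
  then have t1: "t1 = 0" "0 < t2" and jK: "K \<le> j" using t j by auto
  define S where "S = {a1..b1} \<times> {0..t2}"
  have S1: "S \<subseteq> {a<..<b} \<times> {0..<delta}" "S \<subseteq> box0" using x t delta by (auto simp: S_def)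
  have hc: "continuous_on UNIV h" using h by (rule holomorphic_on_imp_continuous_on)
  have cont: "continuous_on S p" "continuous_on S r" unfolding p_def r_def
   by (intro continuous_intros continuous_on_subset[OF cH[OF jK] S1(1)] continuous_on_subset[OF continuous_on_zdx S1(2)]
     continuous_on_subset[OF continuous_on_zdt S1(2)] continuous_on_compose2[OF hc continuous_on_subset[OF continuous_on_zmap S1(2)]]; simp)+
  have c1: "continuous_on {0..t2} (\<lambda>u. integral (cbox a1 b1) (\<lambda>y. p (y, u)))"
  proof (rule integral_continuous_on_param)
   have "continuous_on ({0..t2} \<times> {a1..b1}) (\<lambda>z. p (snd z, fst z))"
    by (rule continuous_on_compose2[OF cont(1)]) (auto simp: S_def intro!: continuous_intros)
   then show "continuous_on ({0..t2} \<times> cbox a1 b1) (\<lambda>(u, y). p (y, u))" by (simp add: split_def)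
  qed
  have c2: "continuous_on {0..t2} (\<lambda>u. integral {u..t2} (\<lambda>s. r (y, s)))" if "y \<in> {a1..b1}" for y
  proof (rule indefinite_integral_continuous_1')
   have "continuous_on {0..t2} (\<lambda>s. r (y, s))"
    by (rule continuous_on_compose2[OF cont(2)]) (use that in \<open>auto simp: S_def intro!: continuous_intros\<close>)
   then show "(\<lambda>s. r (y, s)) integrable_on {0..t2}" by (rule integrable_continuous_real)
  qed
  define F where "F u = integral {a1..b1} (\<lambda>y. p (y, u)) + integral {u..t2} (\<lambda>s. r (b1, s))
   - integral {u..t2} (\<lambda>s. r (a1, s)) - integral {a1..b1} (\<lambda>y. p (y, t2))" for u
  have "continuous_on {0..t2} F" unfolding F_def
   using c1 by (intro continuous_intros c2) (use x in auto)
  moreover have "F u = 0" if "0 < u" "u \<le> t2" for u using pos[OF that] by (simp add: F_def)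
  ultimately have "F 0 = 0"
   using continuous_constant_on_closure[of "{0<..t2}" F 0 0] t1 by (simp add: closure_greaterThanAtMost)
  then show ?thesis by (simp add: F_def t1 algebra_simps)
 qed
 then show ?thesis by (simp add: p_def r_def)
qed

text \<open>The case of the constant solution: \<open>h(Z) dZ\<close> has the primitive
  \<open>h1(Z)\<close> with \<open>h1\<close> a primitive of \<open>h\<close>. It provides the
  comparison that identifies the limit constants in \<open>fibre_constant\<close>.\<close>

lemma rect_one:
 assumes x: "a < a1" "a1 \<le> b1" "b1 < b" and t: "0 \<le> t1" "t1 \<le> t2" "t2 < delta" and h: "h holomorphic_on UNIV"
 shows "integral {a1..b1} (\<lambda>y. h (zmap phi (y, t1)) * zdx phix (y, t1)) + integral {t1..t2} (\<lambda>s. h (zmap phi (b1, s)) * zdt phit (b1, s))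
   = integral {t1..t2} (\<lambda>s. h (zmap phi (a1, s)) * zdt phit (a1, s)) + integral {a1..b1} (\<lambda>y. h (zmap phi (y, t2)) * zdx phix (y, t2))"
proof -
 obtain h1 where h1: "\<And>z. z \<in> UNIV ==> (h1 has_field_derivative h z) (at z within UNIV)"
  using holomorphic_convex_primitive'[OF convex_UNIV open_UNIV h] by blast
 have "((\<lambda>q. h1 (zmap phi q)) has_derivative dform (h (zmap phi q) * zdx phix q) (h (zmap phi q) * zdt phit q)) (at q)"
  if "q \<in> box0" for q
 proof -
  have "((\<lambda>q. h1 (zmap phi q)) has_derivative (\<lambda>v. h (zmap phi q) * dform (zdx phix q) (zdt phit q) v)) (at q)"
   using has_derivative_compose[OF zmap_has_derivative[OF that] h1[unfolded has_field_derivative_def, OF UNIV_I]] .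
  moreover have "(\<lambda>v. h (zmap phi q) * dform (zdx phix q) (zdt phit q) v) = dform (h (zmap phi q) * zdx phix q) (h (zmap phi q) * zdt phit q)"
   by (auto simp: dform_def algebra_simps)
  ultimately show ?thesis by simp
 qed
 then have "q \<in> box0 ==>
   ((\<lambda>q. h1 (zmap phi q)) has_derivative dform (h (zmap phi q) * zdx phix q) (h (zmap phi q) * zdt phit q)) (at q)" for q .
 moreover have "{a1..b1} \<times> {t1..t2} \<subseteq> box0" using x t delta by auto
 ultimately show ?thesis
  using rect_of_primitive[of a1 b1 t1 t2 "box0" "\<lambda>q. h1 (zmap phi q)" "\<lambda>q. h (zmap phi q) * zdx phix q" "\<lambda>q. h (zmap phi q) * zdt phit q"] x t
  by blast
qed

text \<open>\<open>(7/8)^2 - (1/8)^2 = 3/4\<close>, which leaves room above the required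
  \<open>1/2\<close> when the perturbation is an eighth of the increment.\<close>

lemma coercive:
 fixes s :: real and w :: complex
 assumes "norm w \<le> \<bar>s\<bar> / 8"
 shows "s\<^sup>2 / 2 \<le> Re ((of_real s + w)\<^sup>2)"
proof -
 have "\<bar>Re w\<bar> \<le> \<bar>s\<bar> / 8" "\<bar>Im w\<bar> \<le> \<bar>s\<bar> / 8"
  using assms abs_Re_le_cmod[of w] abs_Im_le_cmod[of w] by linarith+
 then have "\<bar>7/8 * \<bar>s\<bar>\<bar> \<le> \<bar>s + Re w\<bar>" "\<bar>Im w\<bar> \<le> \<bar>\<bar>s\<bar> / 8\<bar>" by linarith+
 then have "(7/8 * \<bar>s\<bar>)\<^sup>2 \<le> (s + Re w)\<^sup>2" "(Im w)\<^sup>2 \<le> (\<bar>s\<bar> / 8)\<^sup>2"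
  by (simp_all only: abs_le_square_iff)
 moreover have "Re ((of_real s + w)\<^sup>2) = (s + Re w)\<^sup>2 - (Im w)\<^sup>2"
  by (simp add: power2_eq_square algebra_simps)
 ultimately have "49 * s\<^sup>2 \<le> (s + Re w)\<^sup>2 * 64" "(Im w)\<^sup>2 * 64 \<le> s\<^sup>2"
   "Re ((of_real s + w)\<^sup>2) = (s + Re w)\<^sup>2 - (Im w)\<^sup>2"
  by (simp_all add: power_mult_distrib power_divide)
 then show ?thesis using zero_le_power2[of s] by linarith
qed

text \<open>After division by \<open>zdx phix (x, t1)\<close>, of modulus at least one, the
  increment of \<open>Z\<close> is \<open>y - x\<close> up to a relative error \<open>1/8\<close>.
  One \<open>1/16\<close> is the oscillation of the slope, the other the variation of
  \<open>phi\<close> along the column over \<open>x\<close>, which vanishes at the two heights and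
  is at most \<open>C * t2 \<le> r / 16\<close> on the vertical sides.\<close>

lemma fibre:
 assumes x: "a < x - r" "x + r < b" "r > 0" and t: "0 \<le> t1" "t1 \<le> t2" "t2 < delta" and j: "0 < t1 \<or> K \<le> j"
  and small: "C * t2 \<le> r / 16" and eq: "phi (x, t1) = phi (x, t2)"
 shows "H j (x, t1) = H j (x, t2)"
proof -
 define Q where "Q = {x - r..x + r} \<times> {t1..t2}"
 have Qs: "Q \<subseteq> box0" using x t delta by (auto simp: Q_def)
 have xb: "x \<in> {a<..<b}" using x by auto
 have zx0: "zdx phix (x, t1) \<noteq> 0" "norm (zdx phix (x, t1)) \<ge> 1"
  using abs_Re_le_cmod[of "zdx phix (x, t1)"] by (auto simp: zdx_def complex_eq_iff)
 show ?thesis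
 proof (rule fibre_constant[OF x(3) t(2) Q_def, where Z = "zmap phi" and zx = "zdx phix" and zt = "zdt phit"])
  show "continuous_on Q (H j)"
  proof (cases "0 < t1")
   case True
   then show ?thesis by (intro continuous_on_subset[OF continuous_on_H]) (use x t in \<open>auto simp: Q_def\<close>)
  next
   case False
   then show ?thesis using j by (intro continuous_on_subset[OF cH]) (use x t in \<open>auto simp: Q_def\<close>)
  qed
  show "continuous_on Q (zmap phi)" "continuous_on Q (zdx phix)" "continuous_on Q (zdt phit)"
   using continuous_on_zmap continuous_on_zdx continuous_on_zdt Qs continuous_on_subset by blast+
  fix t assume "t \<in> {t1, t2}"
  then show "((\<lambda>y. zmap phi (y, t)) has_vector_derivative zdx phix (x, t)) (at x)"
   using has_derivative_dform_fst[OF zmap_has_derivative[of "(x, t)"]] xb t delta by auto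
 next
  show "zmap phi (x, t1) = zmap phi (x, t2)" using eq by (simp add: zmap_def)
  show "zdx phix (x, t1) \<noteq> 0" by (rule zx0)
  fix y t assume yt: "(y, t) \<in> Q" and cases: "t \<in> {t1, t2} \<or> \<bar>y - x\<bar> = r"
  have ytd: "y \<in> {a<..<b}" "t \<in> {-delta<..<delta}" "(x, t1) \<in> box0" using yt Qs xb t delta by auto
  define e where "e = phi (y, t) - phi (x, t1) - (y - x) * phix (x, t1)"
  have "\<bar>phi (x, t) - phi (x, t1)\<bar> \<le> \<bar>y - x\<bar> / 16"
  proof (cases "t \<in> {t1, t2}")
   case True
   then show ?thesis using eq by auto
  next
   case False
   then have r: "\<bar>y - x\<bar> = r" using cases by auto
   have "\<bar>phi (x, t) - phi (x, t1)\<bar> \<le> C * \<bar>t - t1\<bar>" using phi_lipschitz_t[OF xb ytd(2), of t1] ytd(3) by auto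
   also have "\<dots> \<le> C * t2" using yt t C by (intro mult_left_mono) (auto simp: Q_def)
   finally show ?thesis using small r by simp
  qed
  then have e: "\<bar>e\<bar> \<le> \<bar>y - x\<bar> / 8"
   using phi_linear_x[OF xb ytd(1,2,3)] unfolding e_def by linarith
  have "(zmap phi (y, t) - zmap phi (x, t1)) = of_real (y - x) * zdx phix (x, t1) + \<i> * of_real e"
   by (simp add: zmap_def zdx_def e_def complex_eq_iff)
  then have "(zmap phi (y, t) - zmap phi (x, t1)) / zdx phix (x, t1) = of_real (y - x) + \<i> * of_real e / zdx phix (x, t1)"
   using zx0 by (simp add: field_simps)
  moreover have "norm (\<i> * of_real e / zdx phix (x, t1)) \<le> \<bar>y - x\<bar> / 8"
  proof -
   have "norm (\<i> * of_real e / zdx phix (x, t1)) = \<bar>e\<bar> / norm (zdx phix (x, t1))" by (simp add: norm_divide norm_mult)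
   also have "\<dots> \<le> \<bar>e\<bar> / 1" using zx0 by (intro divide_left_mono) auto
   finally show ?thesis using e by simp
  qed
  ultimately show "(y - x)\<^sup>2 / 2 \<le> Re (((zmap phi (y, t) - zmap phi (x, t1)) / zdx phix (x, t1))\<^sup>2)"
   using coercive[of "\<i> * of_real e / zdx phix (x, t1)" "y - x"] by simp
 next
  fix h and w :: "plane => complex" assume h: "h holomorphic_on UNIV" and w: "w = H j \<or> w = (\<lambda>_. 1)"
  have xr: "a < x - r" "x - r \<le> x + r" "x + r < b" using x by auto
  show "integral {x - r..x + r} (\<lambda>y. w (y, t1) * h (zmap phi (y, t1)) * zdx phix (y, t1)) + integral {t1..t2} (\<lambda>s. w (x + r, s) * h (zmap phi (x + r, s)) * zdt phit (x + r, s))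
   = integral {t1..t2} (\<lambda>s. w (x - r, s) * h (zmap phi (x - r, s)) * zdt phit (x - r, s)) + integral {x - r..x + r} (\<lambda>y. w (y, t2) * h (zmap phi (y, t2)) * zdx phix (y, t2))"
   using w rect_exact[OF xr t j h] rect_one[OF xr t h] by auto
 qed
qed

end

section \<open>Descent of the primitives to the plane of \<open>Z\<close>\<close>

lemma compact_quotient:
 fixes f :: "plane => complex" and u :: "plane => complex"
 assumes S: "compact S" and f: "continuous_on S f" and u: "continuous_on S u"
  and const: "\<And>x y. x \<in> S ==> y \<in> S ==> f x = f y ==> u x = u y"
 shows "\<exists>G. continuous_on (f ` S) G \<and> (\<forall>x\<in>S. G (f x) = u x)"
proof -
 define G where "G w = u (SOME x. x \<in> S \<and> f x = w)" for w
 have G: "G (f x) = u x" if "x \<in> S" for x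
 proof -
  have "(SOME y. y \<in> S \<and> f y = f x) \<in> S \<and> f (SOME y. y \<in> S \<and> f y = f x) = f x"
   by (rule someI[of _ x]) (use that in simp)
  then show ?thesis unfolding G_def using const[OF _ that] by blast
 qed
 have cl: "closed (f ` S)" using compact_continuous_image[OF f S] by (rule compact_imp_closed)
 \<comment> \<open>A continuous map on a compact set is closed, hence a quotient map onto its image:
   the preimage of a closed set under \<open>G\<close> is the image of a compact set.\<close>
 have "continuous_on (f ` S) G"
  unfolding continuous_on_closed_vimage[OF cl]
 proof (intro allI impI)
  fix B :: "complex set" assume "closed B"
  have "compact (S \<inter> u -` B)"
  proof -
   have "closed (S \<inter> u -` B)"
    by (rule continuous_closed_preimage[OF u compact_imp_closed[OF S] \<open>closed B\<close>])
   then have "compact (S \<inter> (S \<inter> u -` B))" using S by (rule compact_Int_closed[rotated])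
   then show ?thesis by (simp add: inf_absorb2)
  qed
  then have "compact (f ` (S \<inter> u -` B))"
   by (intro compact_continuous_image continuous_on_subset[OF f]) auto
  moreover have "G -` B \<inter> f ` S = f ` (S \<inter> u -` B)" using G by auto
  ultimately show "closed (G -` B \<inter> f ` S)" by (simp add: compact_imp_closed)
 qed
 then show ?thesis using G by blast
qed

text \<open>\<open>t\<close> is the earliest time at which \<open>y'\<close> is reached, and
  \<open>s\<close> the last time before it with value \<open>y\<close>. Between them the values stay
  in \<open>{y..y'}\<close> although \<open>f\<close> need not be monotone; so a column can be
  followed inside a region where the primitives factor through \<open>Z\<close>.\<close>

lemma monotone_crossing:
 fixes f :: "real => real"
 assumes cont: "continuous_on {0..T} f" and T: "0 \<le> T" and v: "f 0 \<le> y" "y < y'" "y' \<le> f T"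
 obtains s t where "0 \<le> s" "s < t" "t \<le> T" "f s = y" "f t = y'" "\<And>u. u \<in> {s..t} ==> y \<le> f u \<and> f u \<le> y'"
proof -
 have lev: "compact {u \<in> {p..q}. f u = z}" if "{p..q} \<subseteq> {0..T}" for p q z
 proof -
  have "closed ({p..q} \<inter> f -` {z})"
   by (rule continuous_closed_preimage[OF continuous_on_subset[OF cont that]]) auto
  then have "compact ({p..q} \<inter> ({p..q} \<inter> f -` {z}))" by (intro compact_Int_closed) auto
  moreover have "{p..q} \<inter> ({p..q} \<inter> f -` {z}) = {u \<in> {p..q}. f u = z}" by auto
  ultimately show ?thesis by simp
 qed
 have "\<exists>u\<ge>0. u \<le> T \<and> f u = y'"
  by (rule IVT'[of f 0 y' T]) (use v T cont in auto)
 then have "{u \<in> {0..T}. f u = y'} \<noteq> {}" by auto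
 from compact_attains_inf[OF lev[OF order_refl] this]
 obtain t where t: "t \<in> {0..T}" "f t = y'" and tmin: "\<And>u. u \<in> {0..T} ==> f u = y' ==> t \<le> u" by auto
 have below: "f u \<le> y'" if "u \<in> {0..t}" for u
 proof (rule ccontr)
  assume "\<not> f u \<le> y'"
  moreover have "continuous_on {0..u} f" by (rule continuous_on_subset[OF cont]) (use that t in auto)
  ultimately have "\<exists>w\<ge>0. w \<le> u \<and> f w = y'" using v that by (intro IVT'[of f 0 y' u]) auto
  then obtain w where w: "0 \<le> w" "w \<le> u" "f w = y'" by blast
  then have "t \<le> w" using tmin[of w] that t by auto
  then have "u = t" using w that by auto
  then show False using \<open>\<not> f u \<le> y'\<close> t by simp
 qed
 have "\<exists>u\<ge>0. u \<le> t \<and> f u = y"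
  by (rule IVT'[of f 0 y t]) (use v t continuous_on_subset[OF cont] in auto)
 then have ne: "{u \<in> {0..t}. f u = y} \<noteq> {}" by auto
 have "{0..t} \<subseteq> {0..T}" using t by auto
 from compact_attains_sup[OF lev[OF this] ne]
 obtain s where s: "s \<in> {0..t}" "f s = y" and smax: "\<And>u. u \<in> {0..t} ==> f u = y ==> u \<le> s" by auto
 have above: "y \<le> f u" if "u \<in> {s..t}" for u
 proof (rule ccontr)
  assume "\<not> y \<le> f u"
  moreover have "continuous_on {u..t} f" by (rule continuous_on_subset[OF cont]) (use that s t in auto)
  ultimately have "\<exists>w\<ge>u. w \<le> t \<and> f w = y" using v t that by (intro IVT'[of f u y t]) auto
  then obtain w where w: "u \<le> w" "w \<le> t" "f w = y" by blast
  then have "w \<le> s" using smax[of w] that s by auto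
  then have "u = s" using w that by auto
  then show False using \<open>\<not> y \<le> f u\<close> s by simp
 qed
 have "s \<noteq> t" using s t v by auto
 then show thesis using that[of s t] s t below above by auto
qed

text \<open>The situation over a point \<open>x1\<close> whose column rises above the ground value
  \<open>phi(x1, 0)\<close>. For \<open>x\<close> near \<open>x1\<close> the column has risen by
  \<open>c0\<close> or more at height \<open>T1\<close>, so the image of \<open>Z\<close> contains
  the whole curved strip of width \<open>c0\<close> above the boundary curve. \<open>r1\<close> is
  the half-width of the rectangles in the fibre argument, and \<open>C * T1 \<le> r1 / 16\<close> is
  the smallness demanded there.\<close>

locale strip_plus = strip +
 fixes x1 r0 r1 T1 c0 :: real
 assumes r0: "r0 > 0" and r1: "r1 > 0" and x1_r1: "a < x1 - r0 - r1" "x1 + r0 + r1 < b"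
  and T1: "0 < T1" "T1 < delta" "C * T1 \<le> r1 / 16" and c0: "c0 > 0"
  and top: "\<And>x. \<bar>x - x1\<bar> \<le> r0 ==> phi (x, 0) + c0 \<le> phi (x, T1)"
begin

lemma x1: "a < x1 - r0" "x1 + r0 < b"
 using x1_r1 r1 by auto

definition "gap q = phi q - phi (fst q, 0)"

text \<open>A column may dip below the ground curve or overshoot the strip; such points are cut out
  so that \<open>Z\<close> maps \<open>R\<close> onto \<open>E\<close>, by the intermediate value
  theorem on each column.\<close>

definition "R = ({x1 - r0..x1 + r0} \<times> {0..T1}) \<inter> gap -` {0..c0}"

definition "E = {\<zeta>. \<bar>Re \<zeta> - x1\<bar> \<le> r0 \<and> phi (Re \<zeta>, 0) \<le> Im \<zeta> \<and> Im \<zeta> \<le> phi (Re \<zeta>, 0) + c0}"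

definition "D = {\<zeta>. \<bar>Re \<zeta> - x1\<bar> < r0 \<and> phi (Re \<zeta>, 0) < Im \<zeta> \<and> Im \<zeta> < phi (Re \<zeta>, 0) + c0}"

lemma D_subset_E: "D \<subseteq> E" by (auto simp: D_def E_def)

lemma x_in: "\<bar>x - x1\<bar> \<le> r0 ==> x \<in> {a<..<b}"
 using x1 r0 by auto

lemma box_subset: "{x1 - r0..x1 + r0} \<times> {0..T1} \<subseteq> box0"
 "{x1 - r0..x1 + r0} \<times> {0..T1} \<subseteq> {a<..<b} \<times> {0..<delta}"
 using x1 r0 T1 delta by auto

lemma continuous_on_ground: "continuous_on {a<..<b} (\<lambda>x. phi (x, 0))"
 by (rule continuous_on_compose2[OF continuous_on_phi]) (use delta in \<open>auto intro!: continuous_intros\<close>)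

lemma continuous_on_gap: "continuous_on box0 gap"
 unfolding gap_def
 by (intro continuous_intros continuous_on_phi continuous_on_compose2[OF continuous_on_ground]) auto

lemma compact_R: "compact R"
proof -
 have c: "compact ({x1 - r0..x1 + r0} \<times> {0..T1})" by (intro compact_Times) auto
 have "closed R" unfolding R_def
  by (rule continuous_closed_preimage[OF continuous_on_subset[OF continuous_on_gap box_subset(1)] compact_imp_closed[OF c]]) auto
 then have "compact (({x1 - r0..x1 + r0} \<times> {0..T1}) \<inter> R)" using c by (rule compact_Int_closed[rotated])
 moreover have "({x1 - r0..x1 + r0} \<times> {0..T1}) \<inter> R = R" by (auto simp: R_def)
 ultimately show ?thesis by simp
qed

lemma R_subset: "R \<subseteq> box0" "R \<subseteq> {a<..<b} \<times> {0..<delta}"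
 using box_subset by (auto simp: R_def)

lemma mem_R: "(x, t) \<in> R \<longleftrightarrow> \<bar>x - x1\<bar> \<le> r0 \<and> 0 \<le> t \<and> t \<le> T1 \<and> zmap phi (x, t) \<in> E"
 by (auto simp: R_def E_def gap_def zmap_def)

lemma column_continuous:
 assumes "\<bar>x - x1\<bar> \<le> r0" shows "continuous_on {0..T1} (\<lambda>t. phi (x, t))"
 by (rule continuous_on_compose2[OF continuous_on_phi])
  (use x_in[OF assms] T1 delta in \<open>auto intro!: continuous_intros\<close>)

lemma zmap_onto:
 assumes "\<zeta> \<in> E" obtains t where "0 \<le> t" "t \<le> T1" "zmap phi (Re \<zeta>, t) = \<zeta>"
proof -
 have x: "\<bar>Re \<zeta> - x1\<bar> \<le> r0" using assms by (simp add: E_def)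
 have "\<exists>t\<ge>0. t \<le> T1 \<and> phi (Re \<zeta>, t) = Im \<zeta>"
  by (rule IVT'[of "\<lambda>t. phi (Re \<zeta>, t)"]) (use assms top[OF x] T1 column_continuous[OF x] in \<open>auto simp: E_def\<close>)
 then show thesis using that by (auto simp: zmap_def complex_eq_iff)
qed

lemma zmap_image_R: "zmap phi ` R = E"
proof
 show "zmap phi ` R \<subseteq> E"
 proof
  fix \<zeta> assume "\<zeta> \<in> zmap phi ` R"
  then obtain x t where "(x, t) \<in> R" "\<zeta> = zmap phi (x, t)" by auto
  then show "\<zeta> \<in> E" using mem_R by blast
 qed
 show "E \<subseteq> zmap phi ` R"
 proof
  fix \<zeta> assume z: "\<zeta> \<in> E"
  then obtain t where t: "0 \<le> t" "t \<le> T1" "zmap phi (Re \<zeta>, t) = \<zeta>" by (rule zmap_onto)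
  then have "(Re \<zeta>, t) \<in> R" using z by (simp add: mem_R) (simp add: E_def)
  then show "\<zeta> \<in> zmap phi ` R" using t(3) by (metis imageI)
 qed
qed

lemma fibre_R:
 assumes x: "\<bar>x - x1\<bar> \<le> r0" and s: "0 \<le> s" "s \<le> T1" and t: "0 \<le> t" "t \<le> T1"
  and j: "(0 < s \<and> 0 < t) \<or> K \<le> j" and eq: "phi (x, s) = phi (x, t)"
 shows "H j (x, s) = H j (x, t)"
proof -
 have *: "H j (x, s) = H j (x, t)" if "s \<le> t" "0 \<le> s" "t \<le> T1" "phi (x, s) = phi (x, t)" "0 < s \<or> K \<le> j" for s t
 proof (rule fibre[where r = r1])
  have "C * t \<le> C * T1" using that C by simp
  then show "C * t \<le> r1 / 16" using T1 by simp
 qed (use that x x1_r1 r1 T1 in auto)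
 show ?thesis
 proof (cases "s \<le> t")
  case True
  show ?thesis by (rule *[OF True s(1) t(2) eq]) (use j in blast)
 next
  case False
  then have "t \<le> s" by simp
  show ?thesis by (rule *[OF \<open>t \<le> s\<close> t(1) s(2) eq[symmetric], symmetric]) (use j in blast)
 qed
qed

lemma quotient_exists:
 assumes "K \<le> j"
 shows "\<exists>G. continuous_on E G \<and> (\<forall>q\<in>R. G (zmap phi q) = H j q)"
proof -
 have "\<exists>G. continuous_on (zmap phi ` R) G \<and> (\<forall>q\<in>R. G (zmap phi q) = H j q)"
 proof (rule compact_quotient[OF compact_R continuous_on_subset[OF continuous_on_zmap R_subset(1)] continuous_on_subset[OF cH[OF assms] R_subset(2)]])
  fix q q' assume q: "q \<in> R" "q' \<in> R" "zmap phi q = zmap phi q'"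
  obtain x s x' t where eq: "q = (x, s)" "q' = (x', t)" by (cases q, cases q')
  have xx: "x' = x" "phi (x, s) = phi (x, t)" using q(3) unfolding eq by (auto simp: zmap_def)
  show "H j q = H j q'" unfolding eq xx
   by (rule fibre_R) (use q(1,2) assms xx in \<open>auto simp: eq mem_R\<close>)
 qed
 then show ?thesis by (simp only: zmap_image_R)
qed

definition G :: "nat => complex => complex" where
 "G j = (SOME G. continuous_on E G \<and> (\<forall>q\<in>R. G (zmap phi q) = H j q))"

lemma G: "K \<le> j ==> continuous_on E (G j)" "K \<le> j ==> q \<in> R ==> G j (zmap phi q) = H j q"
 using someI_ex[OF quotient_exists[of j]] unfolding G_def by auto

lemma open_D: "open D"
proof -
 define Q :: "complex set" where "Q = {\<zeta>. Re \<zeta> \<in> {x1 - r0<..<x1 + r0}}"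
 have "open Q" unfolding Q_def using open_vimage[OF _ continuous_on_Re[OF continuous_on_id], of "{x1 - r0<..<x1 + r0}"]
  by (simp add: vimage_def)
 have "continuous_on Q (\<lambda>\<zeta>. Im \<zeta> - phi (Re \<zeta>, 0))"
  by (intro continuous_intros continuous_on_compose2[OF continuous_on_ground]) (use x1 r0 in \<open>auto simp: Q_def\<close>)
 from continuous_open_preimage[OF this \<open>open Q\<close>, of "{0<..<c0}"]
 have "open (Q \<inter> (\<lambda>\<zeta>. Im \<zeta> - phi (Re \<zeta>, 0)) -` {0<..<c0})" by simp
 moreover have "Q \<inter> (\<lambda>\<zeta>. Im \<zeta> - phi (Re \<zeta>, 0)) -` {0<..<c0} = D" by (auto simp: Q_def D_def)
 ultimately show ?thesis by simp
qed

text \<open>\<open>phi(x, \<cdot>)\<close> need not be invertible along a column. Instead an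
  antiderivative \<open>A\<close> of \<open>G j\<close> on the vertical segment is composed with it:
  \<open>H (Suc j) - \<i> A(phi)\<close> has vanishing \<open>t\<close>-derivative while the column
  stays in the strip, and \<open>monotone_crossing\<close> provides such a stretch between any two
  levels.\<close>

lemma vertical_derivative:
 assumes j: "K \<le> j" and \<zeta>: "Complex x y \<in> D"
 shows "((\<lambda>y. G (Suc j) (Complex x y)) has_vector_derivative \<i> * G j (Complex x y)) (at y)"
proof -
 define g where "g = phi (x, 0)"
 have x: "\<bar>x - x1\<bar> < r0" "g < y" "y < g + c0" using \<zeta> by (auto simp: D_def g_def)
 have inE: "Complex x u \<in> E" if "g \<le> u" "u \<le> g + c0" for u using that x by (auto simp: E_def g_def)
 have "\<exists>A. \<forall>u::real. ereal g < u --> u < ereal (g + c0) --> (A has_vector_derivative G j (Complex x u)) (at u)"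
 proof (rule einterval_antiderivative)
  fix u :: real assume "ereal g < u" "u < ereal (g + c0)"
  moreover have "continuous_on {g<..<g + c0} (\<lambda>u. G j (Complex x u))"
   by (rule continuous_on_compose2[OF G(1)[OF j]]) (use inE in \<open>auto intro!: continuous_intros\<close>)
  ultimately show "isCont (\<lambda>u. G j (Complex x u)) u" by (simp add: continuous_on_eq_continuous_at)
 qed (use c0 in auto)
 then obtain A where A: "\<And>u. g < u ==> u < g + c0 ==> (A has_vector_derivative G j (Complex x u)) (at u)" by auto
 have inc: "G (Suc j) (Complex x v) - G (Suc j) (Complex x u) = \<i> * (A v - A u)" if uv: "g < u" "u < v" "v < g + c0" for u v
 proof -
  have x': "\<bar>x - x1\<bar> \<le> r0" using x by simp
  obtain s t where st: "0 \<le> s" "s < t" "t \<le> T1" "phi (x, s) = u" "phi (x, t) = v"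
   and btw: "\<And>w. w \<in> {s..t} ==> u \<le> phi (x, w) \<and> phi (x, w) \<le> v"
   by (rule monotone_crossing[OF column_continuous[OF x'], of u v]) (use uv T1 top[OF x'] in \<open>auto simp: g_def\<close>)
  \<comment> \<open>The stretch starts above the ground value, hence at a positive height, where
    \<open>dH\<close> is available.\<close>
  have "s \<noteq> 0" using st uv by (auto simp: g_def)
  have "(\<lambda>w. H (Suc j) (x, w) - \<i> * A (phi (x, w))) t = (\<lambda>w. H (Suc j) (x, w) - \<i> * A (phi (x, w))) s"
  proof (rule has_derivative_zero_unique[where s = "{s..t}"])
   fix w assume w: "w \<in> {s..t}"
   have wD: "(x, w) \<in> box1" using w st \<open>s \<noteq> 0\<close> T1 x_in[OF x'] by auto
   have wR: "(x, w) \<in> R" using btw[OF w] w st uv x' by (auto simp: mem_R zmap_def intro!: inE)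
   have dA: "((\<lambda>w. A (phi (x, w))) has_vector_derivative phit (x, w) *\<^sub>R G j (zmap phi (x, w))) (at w)"
   proof -
    have "((\<lambda>w. phi (x, w)) has_vector_derivative phit (x, w)) (at w)"
     using phi_deriv_t[of x w] wD by (simp add: has_real_derivative_iff_has_vector_derivative)
    moreover have "(A has_vector_derivative G j (Complex x (phi (x, w)))) (at (phi (x, w)))"
     using btw[OF w] uv by (intro A) auto
    ultimately show ?thesis
     using vector_diff_chain_at[of "\<lambda>w. phi (x, w)" "phit (x, w)" w A] by (simp add: o_def zmap_def)
   qed
   have "((\<lambda>w. H (Suc j) (x, w) - \<i> * A (phi (x, w))) has_vector_derivative
     H j (x, w) * zdt phit (x, w) - \<i> * (phit (x, w) *\<^sub>R G j (zmap phi (x, w)))) (at w)"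
    by (intro has_vector_derivative_diff has_derivative_dform_snd[OF dH[OF wD]] has_vector_derivative_mult_right dA)
   moreover have "H j (x, w) * zdt phit (x, w) - \<i> * (phit (x, w) *\<^sub>R G j (zmap phi (x, w))) = 0"
    using G(2)[OF j wR] by (simp add: zdt_def complex_eq_iff)
   ultimately have "((\<lambda>w. H (Suc j) (x, w) - \<i> * A (phi (x, w))) has_derivative (\<lambda>h. 0)) (at w)"
    by (simp add: has_vector_derivative_def)
   then show "((\<lambda>w. H (Suc j) (x, w) - \<i> * A (phi (x, w))) has_derivative (\<lambda>h. 0)) (at w within {s..t})"
    by (rule has_derivative_at_withinI)
  qed (use st in auto)
  moreover have "G (Suc j) (Complex x u) = H (Suc j) (x, s)" "G (Suc j) (Complex x v) = H (Suc j) (x, t)"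
  proof -
   have "(x, s) \<in> R" "(x, t) \<in> R" using st uv x' by (auto simp: mem_R zmap_def intro!: inE)
   then show "G (Suc j) (Complex x u) = H (Suc j) (x, s)" "G (Suc j) (Complex x v) = H (Suc j) (x, t)"
    using G(2)[of "Suc j"] j st by (auto simp: zmap_def)
  qed
  ultimately show ?thesis using st by (simp add: algebra_simps)
 qed
 have eq: "G (Suc j) (Complex x y) + \<i> * (A v - A y) = G (Suc j) (Complex x v)" if "g < v" "v < g + c0" for v
 proof -
  consider "v = y" | "y < v" | "v < y" by linarith
  then show ?thesis
   using inc[of y v] inc[of v y] x that by cases (auto simp: algebra_simps)
 qed
 have "((\<lambda>v. G (Suc j) (Complex x y) + \<i> * (A v - A y)) has_vector_derivative 0 + \<i> * (G j (Complex x y) - 0)) (at y)"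
  by (intro has_vector_derivative_add has_vector_derivative_const has_vector_derivative_mult_right has_vector_derivative_diff A x)
 then have "((\<lambda>v. G (Suc j) (Complex x y) + \<i> * (A v - A y)) has_vector_derivative \<i> * G j (Complex x y)) (at y)"
  by simp
 then show ?thesis
  by (rule has_vector_derivative_transform_within_open[where S = "{g<..<g + c0}"]) (use x eq in auto)
qed

text \<open>In the sheared coordinates \<open>m\<close> one axis follows the image of the horizontal
  line at height \<open>t\<close>, where the derivative comes from \<open>H\<close>; the other is
  vertical and covered by \<open>vertical_derivative\<close>. Both partial derivatives are
  \<open>G j \<zeta>\<close> times those of \<open>m\<close>, which is the Cauchy-Riemann
  condition.\<close>

lemma G_has_derivative:
 assumes j: "K \<le> j" and \<zeta>: "\<zeta> \<in> D"
 shows "(G (Suc j) has_field_derivative G j \<zeta>) (at \<zeta>)"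
proof -
 define x y where "x = Re \<zeta>" and "y = Im \<zeta>"
 have xy: "Complex x y = \<zeta>" by (simp add: x_def y_def)
 have x: "\<bar>x - x1\<bar> < r0" "phi (x, 0) < y" "y < phi (x, 0) + c0" using \<zeta> by (auto simp: D_def x_def y_def)
 then have x': "\<bar>x - x1\<bar> \<le> r0" by simp
 obtain t where t: "0 \<le> t" "t \<le> T1" "zmap phi (x, t) = \<zeta>"
  using zmap_onto[of \<zeta>] \<zeta> D_subset_E by (auto simp: x_def)
 then have pt: "phi (x, t) = y" by (auto simp: zmap_def y_def complex_eq_iff)
 have tn: "t \<noteq> 0" using x pt by auto
 have tD: "(x, t) \<in> box1" "t \<in> {-delta<..<delta}" using t tn T1 delta x_in[OF x'] by auto
 define Q where "Q = {q :: plane. fst q \<in> {x1 - r0<..<x1 + r0}}"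
 define m where "m q = Complex (fst q) (snd q + phi (fst q, t))" for q :: plane
 have "open Q" unfolding Q_def using open_vimage[OF _ continuous_on_fst[OF continuous_on_id], of "{x1 - r0<..<x1 + r0}"]
  by (simp add: vimage_def)
 have cm: "continuous_on Q m" unfolding m_def
  by (intro continuous_intros continuous_on_compose2[OF continuous_on_phi]) (use x1 r0 tD in \<open>auto simp: Q_def\<close>)
 define N where "N = Q \<inter> m -` D"
 have "open N" unfolding N_def by (rule continuous_open_preimage[OF cm \<open>open Q\<close> open_D])
 have xN: "(x, 0) \<in> N" using x \<zeta> xy pt by (auto simp: N_def Q_def m_def)
 define \<Psi> where "\<Psi> q = G (Suc j) (m q)" for q
 have "(\<Psi> has_derivative dform (H j (x, t) * zdx phix (x, t)) (\<i> * G j (m (x, 0)))) (at (x, 0))"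
 proof (rule has_derivative_partials[OF \<open>open N\<close> xN, where p = "\<lambda>_. H j (x, t) * zdx phix (x, t)" and q = "\<lambda>q. \<i> * G j (m q)"])
  show "((\<lambda>x. \<Psi> (x, 0)) has_vector_derivative H j (x, t) * zdx phix (x, t)) (at x)"
  proof (rule has_vector_derivative_transform_within_open[OF has_derivative_dform_fst[OF dH[OF tD(1)]]])
   have c: "continuous_on {x1 - r0<..<x1 + r0} (\<lambda>u. m (u, 0))"
    by (rule continuous_on_compose2[OF cm]) (auto simp: Q_def intro!: continuous_intros)
   show "open ({x1 - r0<..<x1 + r0} \<inter> (\<lambda>u. m (u, 0)) -` D)"
    by (rule continuous_open_preimage[OF c _ open_D]) simp
   show "x \<in> {x1 - r0<..<x1 + r0} \<inter> (\<lambda>u. m (u, 0)) -` D" using xN x by (auto simp: N_def)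
   fix u assume "u \<in> {x1 - r0<..<x1 + r0} \<inter> (\<lambda>u. m (u, 0)) -` D"
   then have "m (u, 0) \<in> E" "\<bar>u - x1\<bar> \<le> r0" using D_subset_E by auto
   moreover have "m (u, 0) = zmap phi (u, t)" by (simp add: m_def zmap_def)
   ultimately have "(u, t) \<in> R" "m (u, 0) = zmap phi (u, t)" using t by (auto simp: mem_R)
   then show "H (Suc j) (u, t) = \<Psi> (u, 0)" using G(2)[of "Suc j" "(u, t)"] j by (simp add: \<Psi>_def)
  qed
  fix u v assume "(u, v) \<in> N"
  then have "Complex u (v + phi (u, t)) \<in> D" by (auto simp: N_def m_def)
  from vertical_derivative[OF j this]
  have "((\<lambda>y. G (Suc j) (Complex u y)) \<circ> (\<lambda>v. v + phi (u, t)) has_vector_derivative 1 *\<^sub>R (\<i> * G j (Complex u (v + phi (u, t))))) (at v)"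
   by (intro vector_diff_chain_at) (auto intro!: derivative_eq_intros)
  then show "((\<lambda>v. \<Psi> (u, v)) has_vector_derivative \<i> * G j (m (u, v))) (at v)"
   by (simp add: \<Psi>_def m_def o_def)
 next
  show "continuous_on N (\<lambda>q. \<i> * G j (m q))"
   by (intro continuous_intros continuous_on_compose2[OF G(1)[OF j] continuous_on_subset[OF cm]])
    (use D_subset_E in \<open>auto simp: N_def\<close>)
 qed
 moreover have "m (x, 0) = \<zeta>" using xy pt by (simp add: m_def)
 moreover have "H j (x, t) = G j \<zeta>"
  using G(2)[OF j, of "(x, t)"] t \<zeta> D_subset_E x' by (auto simp: mem_R)
 ultimately have d\<Psi>: "(\<Psi> has_derivative dform (G j \<zeta> * zdx phix (x, t)) (\<i> * G j \<zeta>)) (at (x, 0))" by simp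
 have dphix: "((\<lambda>w. phi (Re w, t)) has_derivative (\<lambda>v. Re v * phix (x, t))) (at \<zeta>)"
 proof -
  have "((\<lambda>w. Re w) has_derivative Re) (at \<zeta>)" by (rule bounded_linear.has_derivative[OF bounded_linear_Re has_derivative_ident])
  moreover have "((\<lambda>x. phi (x, t)) has_derivative (*) (phix (x, t))) (at (Re \<zeta>))"
   using phi_deriv_x[of x t] tD by (simp add: has_field_derivative_def x_def)
  ultimately have "((\<lambda>w. phi (Re w, t)) has_derivative (\<lambda>v. phix (x, t) * Re v)) (at \<zeta>)"
   by (rule has_derivative_compose)
  moreover have "(\<lambda>v. phix (x, t) * Re v) = (\<lambda>v. Re v * phix (x, t))" by (simp only: mult.commute)
  ultimately show ?thesis by (simp only:)
 qed
 have "((\<lambda>w. (Re w, Im w - phi (Re w, t))) has_derivative (\<lambda>v. (Re v, Im v - Re v * phix (x, t)))) (at \<zeta>)"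
  by (intro has_derivative_Pair has_derivative_diff dphix bounded_linear.has_derivative[OF bounded_linear_Re has_derivative_ident]
    bounded_linear.has_derivative[OF bounded_linear_Im has_derivative_ident])
 moreover have "(Re \<zeta>, Im \<zeta> - phi (Re \<zeta>, t)) = (x, 0)" using pt by (simp add: x_def y_def)
 ultimately have "((\<lambda>w. \<Psi> (Re w, Im w - phi (Re w, t))) has_derivative
   (\<lambda>v. dform (G j \<zeta> * zdx phix (x, t)) (\<i> * G j \<zeta>) (Re v, Im v - Re v * phix (x, t)))) (at \<zeta>)"
  using has_derivative_compose[of "\<lambda>w. (Re w, Im w - phi (Re w, t))" _ \<zeta> UNIV \<Psi>] d\<Psi> by simp
 moreover have "(\<lambda>w. \<Psi> (Re w, Im w - phi (Re w, t))) = G (Suc j)"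
  by (auto simp: \<Psi>_def m_def)
 moreover have "(\<lambda>v. dform (G j \<zeta> * zdx phix (x, t)) (\<i> * G j \<zeta>) (Re v, Im v - Re v * phix (x, t))) = (*) (G j \<zeta>)"
  by (auto simp: dform_def zdx_def fun_eq_iff complex_eq_iff algebra_simps)
 ultimately show ?thesis by (simp add: has_field_derivative_def)
qed

text \<open>\<open>G j\<close> is the complex derivative of the holomorphic function
  \<open>G (Suc j)\<close>. This includes the lowest level \<open>j = K\<close>, about whose
  differentiability \<open>G_has_derivative\<close> says nothing directly.\<close>

lemma holomorphic_G: "K \<le> j ==> G j holomorphic_on D"
proof -
 assume j: "K \<le> j"
 have "G (Suc j) holomorphic_on D"
  using G_has_derivative[OF j] open_D by (auto simp: holomorphic_on_open)
 then have "deriv (G (Suc j)) holomorphic_on D" using open_D by (rule holomorphic_deriv)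
 moreover have "deriv (G (Suc j)) \<zeta> = G j \<zeta>" if "\<zeta> \<in> D" for \<zeta>
  using G_has_derivative[OF j that] by (rule DERIV_imp_deriv)
 ultimately show ?thesis using holomorphic_cong by metis
qed

text \<open>Below level \<open>K\<close> the functions \<open>H j\<close> need not extend
  continuously to the boundary, but inside they are recovered by differentiating along
  \<open>x\<close> at fixed \<open>t\<close>, where \<open>Z\<close> has nonzero derivative.\<close>

lemma H_eq_higher_deriv:
 assumes "i \<le> K"
 shows "[|\<bar>x - x1\<bar> < r0; 0 < t; t \<le> T1; zmap phi (x, t) \<in> D|] ==> H (K - i) (x, t) = (deriv ^^ i) (G K) (zmap phi (x, t))"
 using assms
proof (induction i arbitrary: x t)
 case 0
 then have "(x, t) \<in> R" using D_subset_E by (auto simp: mem_R)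
 then show ?case using G(2)[of K] by simp
next
 case (Suc i)
 then obtain j where j: "K - i = Suc j" "K - Suc i = j" by (metis Suc_diff_Suc Suc_le_lessD)
 have xt: "(x, t) \<in> box1" "(x, t) \<in> box0" using Suc.prems x_in[of x] T1 delta by auto
 define F where "F = (deriv ^^ i) (G K)"
 have F: "F holomorphic_on D" unfolding F_def by (rule holomorphic_higher_deriv[OF holomorphic_G[OF order_refl] open_D])
 define N where "N = {x1 - r0<..<x1 + r0} \<inter> (\<lambda>u. zmap phi (u, t)) -` D"
 have c: "continuous_on {x1 - r0<..<x1 + r0} (\<lambda>u. zmap phi (u, t))"
  by (rule continuous_on_compose2[OF continuous_on_zmap]) (use xt x1 r0 in \<open>auto intro!: continuous_intros\<close>)
 have oN: "open N" unfolding N_def by (rule continuous_open_preimage[OF c _ open_D]) simp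
 have xN: "x \<in> N" using Suc.prems by (auto simp: N_def)
 have "((\<lambda>u. H (Suc j) (u, t)) has_vector_derivative H j (x, t) * zdx phix (x, t)) (at x)"
  by (rule has_derivative_dform_fst[OF dH[OF xt(1)]])
 then have 1: "((\<lambda>u. F (zmap phi (u, t))) has_vector_derivative H j (x, t) * zdx phix (x, t)) (at x)"
 proof (rule has_vector_derivative_transform_within_open[OF _ oN xN])
  fix u assume "u \<in> N"
  then show "H (Suc j) (u, t) = F (zmap phi (u, t))"
   using Suc.IH[of u t] Suc.prems j by (auto simp: N_def F_def)
 qed
 have "((\<lambda>u. zmap phi (u, t)) has_vector_derivative zdx phix (x, t)) (at x)"
  by (rule has_derivative_dform_fst[OF zmap_has_derivative[OF xt(2)]])
 moreover have "(F has_field_derivative deriv F (zmap phi (x, t))) (at (zmap phi (x, t)))"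
  using holomorphic_derivI[OF F open_D] Suc.prems by blast
 ultimately have 2: "((\<lambda>u. F (zmap phi (u, t))) has_vector_derivative zdx phix (x, t) * deriv F (zmap phi (x, t))) (at x)"
  using field_vector_diff_chain_at[of "\<lambda>u. zmap phi (u, t)" "zdx phix (x, t)" x F] by (simp add: o_def)
 have "zdx phix (x, t) \<noteq> 0" by (simp add: zdx_def complex_eq_iff)
 then have "H j (x, t) = deriv F (zmap phi (x, t))"
  using vector_derivative_unique_at[OF 1 2] by simp
 then show ?case using j by (simp add: F_def)
qed

end

section \<open>A Phragmen-Lindelof argument at a boundary point\<close>

lemma power_times_exp_tendsto_0:
 assumes "e > 0"
 shows "((\<lambda>y::real. y ^ n * exp (- (e * y))) \<longlongrightarrow> 0) at_top"
proof -
 have "filterlim (\<lambda>y. e * y) at_top at_top"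
  using filterlim_tendsto_pos_mult_at_top[OF tendsto_const assms filterlim_ident] .
 from filterlim_compose[OF tendsto_power_div_exp_0[of n] this]
 have "((\<lambda>y. inverse (e ^ n) * ((e * y) ^ n / exp (e * y))) \<longlongrightarrow> inverse (e ^ n) * 0) at_top"
  by (intro tendsto_mult tendsto_const)
 moreover have "inverse (e ^ n) * ((e * y) ^ n / exp (e * y)) = y ^ n * exp (- (e * y))" for y
  using assms by (simp add: power_mult_distrib exp_minus field_simps)
 ultimately show ?thesis by simp
qed

text \<open>With \<open>y = 1 / sqrt s\<close> the claim is that
  \<open>y ^ (2 * k) * exp (- (e * y))\<close> tends to zero.\<close>

lemma singular_decay:
 assumes "e > 0" "eta > 0"
 obtains s0 where "s0 > 0" "\<And>s. 0 < s ==> s \<le> s0 ==> B / s ^ k * exp (- (e / sqrt s)) \<le> eta"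
proof -
 have "((\<lambda>y. B * (y ^ (2 * k) * exp (- (e * y)))) \<longlongrightarrow> B * 0) at_top"
  by (intro tendsto_mult tendsto_const power_times_exp_tendsto_0 assms)
 then have "\<forall>\<^sub>F y in at_top. B * (y ^ (2 * k) * exp (- (e * y))) < eta"
  using assms(2) by (intro order_tendstoD(2)[where a = eta]) auto
 then obtain Y where Y: "\<And>y. y \<ge> Y ==> B * (y ^ (2 * k) * exp (- (e * y))) < eta"
  unfolding eventually_at_top_linorder by blast
 define Y' where "Y' = max Y 1"
 show thesis
 proof (rule that[of "1 / Y'\<^sup>2"])
  show "1 / Y'\<^sup>2 > 0" by (simp add: Y'_def)
  fix s :: real assume s: "0 < s" "s \<le> 1 / Y'\<^sup>2"
  have "sqrt s \<le> sqrt (1 / Y'\<^sup>2)" using s by simp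
  also have "\<dots> = 1 / Y'" by (simp add: real_sqrt_divide Y'_def)
  finally have "sqrt s \<le> 1 / Y'" .
  moreover have "Y' > 0" by (simp add: Y'_def)
  ultimately have "Y' \<le> 1 / sqrt s" using s by (simp add: pos_le_divide_eq mult.commute)
  then have "B * ((1 / sqrt s) ^ (2 * k) * exp (- (e * (1 / sqrt s)))) < eta"
   by (intro Y) (simp add: Y'_def)
  moreover have "(1 / sqrt s) ^ (2 * k) = 1 / s ^ k" using s by (simp add: power_divide power_mult)
  ultimately show "B / s ^ k * exp (- (e / sqrt s)) \<le> eta" by simp
 qed
qed

lemma Re_inverse_norm: "Re (inverse w) = Re w / (norm w)\<^sup>2"
 by (simp add: cmod_power2)

text \<open>The factor \<open>exp (- \<epsilon> / csqrt z)\<close> absorbs the polynomial singularity at \<open>0\<close>, the factor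
 \<open>exp (- A csqrt z)\<close> makes the bound on the outer part of the boundary as small as the one near \<open>0\<close>.\<close>

lemma phragmen_lindelof_point:
 fixes v :: "complex => complex"
 assumes D: "open D" and hol: "v holomorphic_on D" and cont: "continuous_on (closure D - {0}) v"
  and c: "c > 0" "\<And>z. z \<in> closure D ==> c * sqrt (norm z) \<le> Re (csqrt z)"
  and B: "B > 0" "\<And>z. z \<in> closure D ==> z \<noteq> 0 ==> norm (v z) \<le> B / norm z ^ k"
  and r: "r > 0" and eta: "eta > 0"
  and small: "\<And>z. z \<in> frontier D ==> z \<noteq> 0 ==> norm z \<le> r ==> norm (v z) \<le> eta"
 shows "\<exists>d>0. \<forall>z\<in>D. z \<noteq> 0 --> norm z < d --> norm (v z) \<le> 2 * eta"
proof -
 define B' where "B' = B / r ^ k"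
 have B': "B' > 0" using B r by (simp add: B'_def)
 \<comment> \<open>With this value \<open>A * (c * sqrt r) = B' / eta\<close>, and
   \<open>x \<le> exp x\<close> bounds \<open>B' * exp (- (A * (c * sqrt r)))\<close> by
   \<open>eta\<close> on the outer circle.\<close>
 define A where "A = B' / eta / (c * sqrt r)"
 have A: "A > 0" using B' eta c r by (simp add: A_def)
 have outer: "B' * exp (- (A * (c * sqrt r))) \<le> eta"
 proof -
  have "B' / eta \<le> exp (B' / eta)" using exp_ge_add_one_self[of "B' / eta"] by linarith
  then have "B' * exp (- (B' / eta)) \<le> eta" using eta by (simp add: exp_minus field_simps)
  moreover have "A * (c * sqrt r) = B' / eta" using c r by (simp add: A_def)
  ultimately show ?thesis by (simp only:)
 qed
 have slit: "z \<notin> \<real>\<^sub>\<le>\<^sub>0" "Re (csqrt z) > 0" if "z \<in> closure D" "z \<noteq> 0" for z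
 proof -
  have "0 < c * sqrt (norm z)" using c that by simp
  then show pos: "Re (csqrt z) > 0" using c(2)[OF that(1)] by linarith
  show "z \<notin> \<real>\<^sub>\<le>\<^sub>0"
  proof
   assume "z \<in> \<real>\<^sub>\<le>\<^sub>0"
   then have "csqrt z = \<i> * sqrt (- Re z)"
    using csqrt_of_real_nonpos[of z] by (auto simp: complex_nonpos_Reals_iff)
   then show False using pos by simp
  qed
 qed
 have Re_inv: "c / sqrt (norm z) \<le> Re (inverse (csqrt z))" "Re (inverse (csqrt z)) \<le> 1 / sqrt (norm z)"
  if "z \<in> closure D" "z \<noteq> 0" for z
 proof -
  have "norm (csqrt z) = sqrt (norm z)" by (simp add: norm_csqrt)
  have "Re (inverse (csqrt z)) = Re (csqrt z) / (norm (csqrt z))\<^sup>2"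
   by (rule Re_inverse_norm)
  also have "\<dots> = Re (csqrt z) / norm z" using that by (simp add: \<open>norm (csqrt z) = sqrt (norm z)\<close>)
  finally have eq: "Re (inverse (csqrt z)) = Re (csqrt z) / norm z" .
  have "c / sqrt (norm z) = c * sqrt (norm z) / norm z"
   using that by (simp add: real_div_sqrt field_simps)
  also have "\<dots> \<le> Re (csqrt z) / norm z" using c(2)[OF that(1)] by (intro divide_right_mono) auto
  finally show "c / sqrt (norm z) \<le> Re (inverse (csqrt z))" unfolding eq .
  have "Re (inverse (csqrt z)) \<le> norm (inverse (csqrt z))" by (rule complex_Re_le_cmod)
  also have "\<dots> = 1 / sqrt (norm z)" using \<open>norm (csqrt z) = sqrt (norm z)\<close> by (simp only: norm_divide inverse_eq_divide norm_one)
  finally show "Re (inverse (csqrt z)) \<le> 1 / sqrt (norm z)" .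
 qed
 have main: "norm (v z) \<le> eta * exp (\<epsilon> / sqrt (norm z)) * exp (A * sqrt (norm z))"
  if z: "z \<in> D" "z \<noteq> 0" "norm z < r" and \<epsilon>: "\<epsilon> > 0" for z \<epsilon>
 proof -
  obtain s0 where s0: "s0 > 0" "\<And>s. 0 < s ==> s \<le> s0 ==> B / s ^ k * exp (- (\<epsilon> * c / sqrt s)) \<le> eta"
   using singular_decay[of "\<epsilon> * c" eta B k] \<epsilon> c eta by auto
  define s where "s = min s0 (norm z / 2)"
  have s: "0 < s" "s \<le> s0" "s < norm z" using s0 z by (auto simp: s_def min_def)
  \<comment> \<open>A disc of radius \<open>s\<close> around the singular point is removed;
    \<open>s\<close> depends on \<open>\<epsilon>\<close> and is so small that the exponential beats
    the power on the inner circle.\<close>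
  define W where "W = D \<inter> ball 0 r - cball 0 s"
  have oW: "open W" unfolding W_def using D by (intro open_Diff open_Int) auto
  have clW: "closure W \<subseteq> closure D \<inter> cball 0 r - ball 0 s"
  proof (rule closure_minimal)
   show "W \<subseteq> closure D \<inter> cball 0 r - ball 0 s" using closure_subset[of D] by (auto simp: W_def)
   show "closed (closure D \<inter> cball 0 r - ball 0 s)" by (intro closed_Diff closed_Int) auto
  qed
  then have clW': "w \<in> closure D \<and> w \<noteq> 0 \<and> s \<le> norm w \<and> norm w \<le> r" if "w \<in> closure W" for w
   using that s by auto
  define F where "F w = v w * exp (- (of_real \<epsilon> * inverse (csqrt w))) * exp (- (of_real A * csqrt w))" for w
  have nF: "norm (F w) = norm (v w) * exp (- (\<epsilon> * Re (inverse (csqrt w)))) * exp (- (A * Re (csqrt w)))" for w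
   by (simp add: F_def norm_mult del: inverse_complex.sel)
  have bW: "norm (F w) \<le> norm (v w) * exp (- (\<epsilon> * c / sqrt (norm w))) * exp (- (A * (c * sqrt (norm w))))"
   if "w \<in> closure W" for w
  proof -
   note w = clW'[OF that]
   have "\<epsilon> * (c / sqrt (norm w)) \<le> \<epsilon> * Re (inverse (csqrt w))" "A * (c * sqrt (norm w)) \<le> A * Re (csqrt w)"
    using Re_inv(1)[of w] c(2)[of w] w \<epsilon> A by (intro mult_left_mono; blast intro: less_imp_le)+
   then have "exp (- (\<epsilon> * Re (inverse (csqrt w)))) \<le> exp (- (\<epsilon> * c / sqrt (norm w)))"
     "exp (- (A * Re (csqrt w))) \<le> exp (- (A * (c * sqrt (norm w))))"
    by (simp_all only: exp_le_cancel_iff neg_le_iff_le times_divide_eq_right)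
   then show ?thesis unfolding nF by (intro mult_mono mult_nonneg_nonneg norm_ge_zero exp_ge_zero order_refl)
  qed
  have sW: "w \<notin> \<real>\<^sub>\<le>\<^sub>0" "csqrt w \<noteq> 0" if "w \<in> closure W" for w
   using slit[of w] clW'[OF that] by auto
  have WD: "W \<subseteq> D" by (auto simp: W_def)
  have cs: "continuous_on (closure W) csqrt"
   by (rule continuous_on_subset[OF holomorphic_on_imp_continuous_on[OF holomorphic_on_csqrt]]) (use sW in auto)
  have "norm (F z) \<le> eta"
  proof (rule maximum_modulus_frontier[of F W])
   have "F holomorphic_on W" unfolding F_def
    by (intro holomorphic_intros holomorphic_on_subset[OF hol]) (use sW closure_subset[of W] WD in auto)
   then show "F holomorphic_on interior W" using oW by (simp add: interior_open)
   show "continuous_on (closure W) F" unfolding F_def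
    by (intro continuous_on_mult continuous_on_exp continuous_on_minus continuous_on_const continuous_on_inverse
      cs continuous_on_subset[OF cont]) (use sW clW' in auto)
   show "bounded W" unfolding W_def by (rule bounded_subset[of "ball 0 r"]) auto
   show "z \<in> W" using z s by (simp add: W_def)
   fix w assume w: "w \<in> frontier W"
   then have wc: "w \<in> closure W" and wn: "w \<notin> W" using oW by (auto simp: frontier_def interior_open)
   note w' = clW'[OF wc]
   have nn: "0 \<le> \<epsilon> * c / sqrt (norm w)" "0 \<le> A * (c * sqrt (norm w))" using \<epsilon> A c by auto
   consider "norm w = s" | "norm w = r" | "s < norm w" "norm w < r" using w' by linarith
   then show "norm (F w) \<le> eta"
   proof cases
    case 1
    have "norm (F w) \<le> norm (v w) * exp (- (\<epsilon> * c / sqrt (norm w))) * exp (- (A * (c * sqrt (norm w))))" by (rule bW[OF wc])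
    also have "\<dots> \<le> (B / norm w ^ k) * exp (- (\<epsilon> * c / sqrt (norm w))) * 1"
     using B(2)[of w] w' nn B(1) by (intro mult_mono) auto
    also have "\<dots> \<le> eta" using s0(2)[of s] s 1 by simp
    finally show ?thesis .
   next
    case 2
    have "norm (F w) \<le> norm (v w) * exp (- (\<epsilon> * c / sqrt (norm w))) * exp (- (A * (c * sqrt (norm w))))" by (rule bW[OF wc])
    also have "\<dots> \<le> (B / norm w ^ k) * 1 * exp (- (A * (c * sqrt (norm w))))"
     using B(2)[of w] w' nn B(1) by (intro mult_mono) auto
    also have "\<dots> = B' * exp (- (A * (c * sqrt r)))" using 2 by (simp add: B'_def)
    finally show ?thesis using outer by simp
   next
    case 3
    then have "w \<notin> D" using wn by (auto simp: W_def)
    then have "w \<in> frontier D" using w' D by (simp add: frontier_def interior_open)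
    then have "norm (v w) \<le> eta" using small[of w] w' by simp
    have "norm (F w) \<le> norm (v w) * exp (- (\<epsilon> * c / sqrt (norm w))) * exp (- (A * (c * sqrt (norm w))))" by (rule bW[OF wc])
    also have "\<dots> \<le> eta * 1 * 1"
     using \<open>norm (v w) \<le> eta\<close> nn eta by (intro mult_mono) auto
    finally show ?thesis by simp
   qed
  qed
  moreover have zc: "z \<in> closure D" using z closure_subset by blast
  ultimately have "norm (v z) * exp (- (\<epsilon> * Re (inverse (csqrt z)))) * exp (- (A * Re (csqrt z))) \<le> eta"
   by (simp only: nF)
  then have "norm (v z) \<le> eta * exp (\<epsilon> * Re (inverse (csqrt z))) * exp (A * Re (csqrt z))"
   by (simp add: exp_minus field_simps del: inverse_complex.sel)
  also have "\<dots> \<le> eta * exp (\<epsilon> / sqrt (norm z)) * exp (A * sqrt (norm z))"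
  proof -
   have "\<epsilon> * Re (inverse (csqrt z)) \<le> \<epsilon> * (1 / sqrt (norm z))"
    using Re_inv(2)[OF zc z(2)] \<epsilon> by (intro mult_left_mono) auto
   moreover have "Re (csqrt z) \<le> sqrt (norm z)"
    using complex_Re_le_cmod[of "csqrt z"] by (simp add: norm_csqrt)
   ultimately show ?thesis using eta A by (intro mult_mono) auto
  qed
  finally show ?thesis .
 qed
 have main2: "norm (v z) \<le> eta * exp (A * sqrt (norm z))" if z: "z \<in> D" "z \<noteq> 0" "norm z < r" for z
 proof -
  \<comment> \<open>The bound holds for every positive \<open>\<epsilon>\<close>, with
    \<open>A\<close> independent of it, so the absorbing factor disappears in the limit.\<close>
  have "((\<lambda>\<epsilon>. eta * exp (\<epsilon> / sqrt (norm z)) * exp (A * sqrt (norm z))) \<longlongrightarrow> eta * exp (0 / sqrt (norm z)) * exp (A * sqrt (norm z))) (at_right 0)"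
   using z by (intro tendsto_intros) auto
  moreover have "\<forall>\<^sub>F \<epsilon> in at_right 0. norm (v z) \<le> eta * exp (\<epsilon> / sqrt (norm z)) * exp (A * sqrt (norm z))"
   using main[OF z] by (auto simp: eventually_at_right_field intro!: exI[of _ 1])
  ultimately have "norm (v z) \<le> eta * exp (0 / sqrt (norm z)) * exp (A * sqrt (norm z))"
   by (rule tendsto_lowerbound) simp
  then show ?thesis by simp
 qed
 \<comment> \<open>Chosen so that \<open>exp (A * sqrt (norm z))\<close> is at most
   \<open>2\<close>.\<close>
 define d where "d = min r ((ln 2 / A)\<^sup>2)"
 have "norm (v z) \<le> 2 * eta" if "z \<in> D" "z \<noteq> 0" "norm z < d" for z
 proof -
  have "norm z < (ln 2 / A)\<^sup>2" "norm z < r" using that by (auto simp: d_def)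
  then have "sqrt (norm z) \<le> sqrt ((ln 2 / A)\<^sup>2)" by (intro real_sqrt_le_mono less_imp_le)
  then have "sqrt (norm z) \<le> ln 2 / A" using A by simp
  then have "A * sqrt (norm z) \<le> ln 2" using A by (simp add: field_simps)
  then have "exp (A * sqrt (norm z)) \<le> 2" by (metis exp_le_cancel_iff exp_ln zero_less_numeral)
  then have "eta * exp (A * sqrt (norm z)) \<le> eta * 2" using eta by (intro mult_left_mono) auto
  then show ?thesis using main2[OF that(1,2)] \<open>norm z < r\<close> by simp
 qed
 moreover have "d > 0" using r A by (simp add: d_def)
 ultimately show ?thesis by blast
qed

text \<open>The square of \<open>Re (csqrt z)\<close> is \<open>(norm z + Re z) / 2\<close>. Outside
  a sector around the negative axis \<open>- Re z \<le> q * norm z\<close>, where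
  \<open>q < 1\<close> is the cosine of the half-opening of the sector.\<close>

lemma Re_csqrt_wedge:
 assumes "L > 0" obtains c where "c > 0" "\<And>z. - (L * \<bar>Im z\<bar>) \<le> Re z ==> c * sqrt (norm z) \<le> Re (csqrt z)"
proof -
 define s where "s = sqrt (1 + 1 / L\<^sup>2)"
 have s: "1 < s" using assms by (simp add: s_def)
 define q where "q = 1 / s"
 have q: "0 < q" "q < 1" using s by (auto simp: q_def)
 define c where "c = sqrt ((1 - q) / 2)"
 show thesis
 proof (rule that[of c])
  show "c > 0" using q by (simp add: c_def)
  fix z assume z: "- (L * \<bar>Im z\<bar>) \<le> Re z"
  have "- Re z \<le> q * norm z"
  proof (cases "Re z \<ge> 0")
   case True
   then show ?thesis using q by (meson less_imp_le mult_nonneg_nonneg neg_le_0_iff_le norm_ge_zero order_trans)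
  next
   case False
   have "(Re z)\<^sup>2 \<le> (L * \<bar>Im z\<bar>)\<^sup>2"
    using z False by (metis abs_le_square_iff abs_minus_cancel abs_of_neg abs_of_nonneg assms less_imp_le linorder_not_le minus_le_iff mult_nonneg_nonneg abs_ge_zero)
   then have "(Re z)\<^sup>2 / L\<^sup>2 \<le> (Im z)\<^sup>2" using assms by (simp add: power_mult_distrib divide_le_eq mult.commute)
   then have "(Re z)\<^sup>2 * (1 + 1 / L\<^sup>2) \<le> (norm z)\<^sup>2" by (simp add: cmod_power2 algebra_simps)
   then have "sqrt ((Re z)\<^sup>2 * (1 + 1 / L\<^sup>2)) \<le> norm z" by (metis norm_ge_zero real_sqrt_abs abs_of_nonneg real_sqrt_le_iff)
   then have "- Re z * s \<le> norm z" using False by (simp add: real_sqrt_mult s_def)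
   then show ?thesis using s by (simp add: q_def pos_le_divide_eq)
  qed
  then have "(1 - q) / 2 * norm z \<le> (norm z + Re z) / 2" by (simp add: field_simps)
  then have "sqrt ((1 - q) / 2 * norm z) \<le> sqrt ((norm z + Re z) / 2)" by (rule real_sqrt_le_mono)
  then show "c * sqrt (norm z) \<le> Re (csqrt z)" unfolding c_def real_sqrt_mult csqrt.sel(1) .
 qed
qed

text \<open>Powers of the increment of \<open>Z\<close> instead of that of \<open>x\<close>: the
  same polynomial makes sense in the plane of \<open>Z\<close> and can be subtracted there from the
  holomorphic function \<open>G K\<close>.\<close>

definition taylor_at :: "(real => complex) => (real => complex) => nat => (nat => complex) => real => bool" where
 "taylor_at f Z k c x1 \<longleftrightarrow> (\<forall>eta>0. \<exists>r>0. \<forall>x. \<bar>x - x1\<bar> < r -->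
   norm (f x - (\<Sum>i\<le>k. c i * (Z x - Z x1) ^ i)) \<le> eta * \<bar>x - x1\<bar> ^ k)"

lemma top_deriv_polynomial:
 fixes c :: "nat => complex"
 shows "(deriv ^^ k) (\<lambda>w. \<Sum>i\<le>k. c i * (w - a) ^ i) z = fact k * c k"
proof -
 have "(deriv ^^ k) (\<lambda>w. \<Sum>i\<le>n. c i * (w - a) ^ i) z = (\<Sum>i\<le>n. c i * (pochhammer (of_nat (Suc i - k)) k * (z - a) ^ (i - k)))" for n
 proof (induction n)
  case 0
  show ?case using higher_deriv_cmult'[of "\<lambda>w. (w - a) ^ 0" z k "c 0"] higher_deriv_power[of k a 0 z] by (simp add: analytic_intros)
 next
  case (Suc n)
  have "(deriv ^^ k) (\<lambda>w. (\<Sum>i\<le>n. c i * (w - a) ^ i) + c (Suc n) * (w - a) ^ Suc n) z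
    = (deriv ^^ k) (\<lambda>w. \<Sum>i\<le>n. c i * (w - a) ^ i) z + (deriv ^^ k) (\<lambda>w. c (Suc n) * (w - a) ^ Suc n) z"
   by (rule higher_deriv_add[of _ UNIV]) (auto intro!: holomorphic_intros)
  also have "(deriv ^^ k) (\<lambda>w. c (Suc n) * (w - a) ^ Suc n) z = c (Suc n) * (deriv ^^ k) (\<lambda>w. (w - a) ^ Suc n) z"
   by (rule higher_deriv_cmult[of _ UNIV]) (auto intro!: holomorphic_intros)
  finally show ?case using Suc higher_deriv_power[of k a "Suc n" z] by simp
 qed
 also have "(\<Sum>i\<le>k. c i * (pochhammer (of_nat (Suc i - k)) k * (z - a) ^ (i - k))) = (\<Sum>i\<le>k. if i = k then fact k * c k else 0)"
 proof (rule sum.cong[OF refl])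
  fix i assume "i \<in> {..k}"
  show "c i * (pochhammer (of_nat (Suc i - k)) k * (z - a) ^ (i - k)) = (if i = k then fact k * c k else 0)"
  proof (cases "i = k")
   case False
   then have "Suc i - k = 0" "k > 0" using \<open>i \<in> {..k}\<close> by auto
   then show ?thesis using False by (simp add: pochhammer_0_left)
  qed (simp add: pochhammer_fact[symmetric])
 qed
 finally show ?thesis by simp
qed

section \<open>The limit from the side where the gap is positive\<close>

context strip_plus
begin

lemma nontangential_limit:
 assumes tay: "taylor_at (\<lambda>x. H K (x, 0)) (\<lambda>x. zmap phi (x, 0)) K c x1" and L: "L \<ge> 0" and eta: "eta > 0"
 shows "\<exists>d>0. \<forall>x t. 0 < t --> t \<le> T1 --> 0 < gap (x, t) --> gap (x, t) < d --> \<bar>x - x1\<bar> \<le> L * gap (x, t) -->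
  norm (H 0 (x, t) - fact K * c K) < eta"
proof -
 define w0 where "w0 = zmap phi (x1, 0)"
 have w0: "Re w0 = x1" "Im w0 = phi (x1, 0)" by (auto simp: w0_def zmap_def)
 define p where "p w = (\<Sum>i\<le>K. c i * (w - w0) ^ i)" for w
 define u where "u w = G K w - p w" for w
 have pd: "p holomorphic_on UNIV" unfolding p_def by (intro holomorphic_intros)
 have E: "compact E" using compact_continuous_image[OF continuous_on_subset[OF continuous_on_zmap R_subset(1)] compact_R] by (simp add: zmap_image_R)
 have cu: "continuous_on E u" unfolding u_def
  using G(1)[of K] holomorphic_on_imp_continuous_on[OF pd] continuous_on_subset by (intro continuous_intros) blast+
 obtain B where B: "B > 0" "\<And>w. w \<in> E ==> norm (u w) \<le> B" using compact_norm_bound[OF E cu] by blast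
 have hu: "u holomorphic_on D" unfolding u_def
  using holomorphic_G[of K] holomorphic_on_subset[OF pd, of D] by (intro holomorphic_intros) auto
 \<comment> \<open>Around a point at height \<open>e\<close> above the ground curve, which has slope
   at most \<open>C\<close>, a disc of radius \<open>\<theta> * e\<close> stays at least
   \<open>e / 2\<close> above the curve.\<close>
 define \<theta> where "\<theta> = 1 / (2 * (1 + C))"
 have \<theta>: "0 < \<theta>" "\<theta> * (1 + C) = 1 / 2" "\<theta> \<le> 1" using C by (auto simp: \<theta>_def field_simps)
 \<comment> \<open>\<open>M * e\<close> bounds the distance from \<open>w0\<close> to the points of
   that disc: \<open>L\<close> and \<open>C * L\<close> account for the displacement along the
   boundary, one unit for the gap and one for the radius.\<close>
 define M where "M = L + C * L + 2"
 have M: "M \<ge> 2" using L C by (simp add: M_def)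
 define eta1 where "eta1 = eta / (4 * fact K * (M / \<theta>) ^ K)"
 have eta1: "eta1 > 0" using eta M \<theta> by (simp add: eta1_def)
 have lipg: "\<bar>phi (x, 0) - phi (y, 0)\<bar> \<le> C * \<bar>x - y\<bar>" if "\<bar>x - x1\<bar> \<le> r0" "\<bar>y - x1\<bar> \<le> r0" for x y
  using phi_lipschitz_x[OF x_in[OF that(2)] x_in[OF that(1)], of 0] delta by simp
 \<comment> \<open>Rotated so that the strip opens in the direction of the positive real axis; by
   the Lipschitz bound on the ground curve it then avoids a sector around the negative axis, and
   \<open>csqrt\<close> can be used.\<close>
 define D' where "D' = {z. w0 + \<i> * z \<in> D}"
 have "isCont (\<lambda>z. w0 + \<i> * z) z" for z by (intro continuous_intros)
 then have openD': "open D'" unfolding D'_def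
  using open_vimage[OF open_D, of "\<lambda>z. w0 + \<i> * z"] by (simp add: vimage_def continuous_at_imp_continuous_on)
 have clD': "w0 + \<i> * z \<in> E" if "z \<in> closure D'" for z
 proof -
  have "closure D' \<subseteq> (\<lambda>z. w0 + \<i> * z) -` E"
  proof (rule closure_minimal)
   show "D' \<subseteq> (\<lambda>z. w0 + \<i> * z) -` E" using D_subset_E by (auto simp: D'_def)
   show "closed ((\<lambda>z. w0 + \<i> * z) -` E)"
    by (intro closed_vimage compact_imp_closed[OF E] continuous_intros)
  qed
  then show ?thesis using that by auto
 qed
 have "\<exists>d>0. \<forall>z\<in>D'. z \<noteq> 0 --> norm z < d --> norm (u (w0 + \<i> * z) / (\<i> * z) ^ K) \<le> 2 * eta1"
 proof -
  obtain cc where cc: "cc > 0" "\<And>z. - (C * \<bar>Im z\<bar>) \<le> Re z ==> cc * sqrt (norm z) \<le> Re (csqrt z)"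
   using Re_csqrt_wedge[of C] C by auto
  obtain r1 where r1: "r1 > 0" "\<And>x. \<bar>x - x1\<bar> < r1 ==>
    norm (H K (x, 0) - (\<Sum>i\<le>K. c i * (zmap phi (x, 0) - zmap phi (x1, 0)) ^ i)) \<le> eta1 * \<bar>x - x1\<bar> ^ K"
   using tay eta1 unfolding taylor_at_def by blast
  \<comment> \<open>Frontier points of norm at most \<open>r\<close> lie on the ground curve:
    \<open>r < r0\<close> excludes the lateral sides and \<open>r * (1 + C) < c0\<close> the upper
    edge. On the ground curve the Taylor expansion is the required smallness.\<close>
  define r where "r = min (r1 / 2) (min (r0 / 2) (c0 / (2 * (1 + C))))"
  have r: "r > 0" "r < r1" "r < r0" "r * (1 + C) < c0"
  proof -
   have "c0 / (2 * (1 + C)) > 0" using c0 C by simp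
   then show "r > 0" using r1 r0 by (simp add: r_def)
   have "r \<le> r1 / 2" "r \<le> r0 / 2" "r \<le> c0 / (2 * (1 + C))" unfolding r_def by linarith+
   then show "r < r1" "r < r0" using r1 r0 by linarith+
   have "r * (1 + C) \<le> c0 / (2 * (1 + C)) * (1 + C)"
    using \<open>r \<le> c0 / (2 * (1 + C))\<close> C by (intro mult_right_mono) auto
   also have "\<dots> = c0 / 2" using C by (simp add: field_simps)
   finally show "r * (1 + C) < c0" using c0 by simp
  qed
  show ?thesis
  proof (rule phragmen_lindelof_point[OF openD' _ _ cc(1) _ B(1) _ r(1) eta1, where k = K])
   show "(\<lambda>z. u (w0 + \<i> * z) / (\<i> * z) ^ K) holomorphic_on D'"
   proof (intro holomorphic_intros)
    show "(\<lambda>z. u (w0 + \<i> * z)) holomorphic_on D'"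
    proof -
     have "(\<lambda>z. w0 + \<i> * z) holomorphic_on D'" by (intro holomorphic_intros)
     from holomorphic_on_compose_gen[OF this hu] show ?thesis by (auto simp: D'_def o_def)
    qed
    fix z assume "z \<in> D'"
    then have "z \<noteq> 0" by (auto simp: D'_def D_def w0)
    then show "(\<i> * z) ^ K \<noteq> 0" by simp
   qed
   show "continuous_on (closure D' - {0}) (\<lambda>z. u (w0 + \<i> * z) / (\<i> * z) ^ K)"
    by (intro continuous_intros continuous_on_compose2[OF cu]) (use clD' in auto)
   fix z assume z: "z \<in> closure D'"
   note zE = clD'[OF z]
   have Re: "Re (w0 + \<i> * z) = x1 - Im z" "Im (w0 + \<i> * z) = phi (x1, 0) + Re z" by (auto simp: w0)
   have x: "\<bar>(x1 - Im z) - x1\<bar> \<le> r0" and g: "phi (x1 - Im z, 0) \<le> phi (x1, 0) + Re z" "phi (x1, 0) + Re z \<le> phi (x1 - Im z, 0) + c0"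
    using zE unfolding E_def mem_Collect_eq Re by auto
   have lg: "\<bar>phi (x1 - Im z, 0) - phi (x1, 0)\<bar> \<le> C * \<bar>Im z\<bar>" using lipg[OF x, of x1] r0 by simp
   show "cc * sqrt (norm z) \<le> Re (csqrt z)" by (rule cc(2)) (use lg g in linarith)
   show "norm (u (w0 + \<i> * z) / (\<i> * z) ^ K) \<le> B / norm z ^ K"
    using B(2)[OF zE] by (simp add: norm_divide norm_power norm_mult divide_right_mono)
  next
   fix z assume z: "z \<in> frontier D'" "z \<noteq> 0" "norm z \<le> r"
   then have zc: "z \<in> closure D'" and zn: "w0 + \<i> * z \<notin> D" using openD' by (auto simp: frontier_def interior_open D'_def)
   note zE = clD'[OF zc]
   have Re: "Re (w0 + \<i> * z) = x1 - Im z" "Im (w0 + \<i> * z) = phi (x1, 0) + Re z" by (auto simp: w0)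
   have nz: "\<bar>Im z\<bar> \<le> r" "\<bar>Re z\<bar> \<le> r" using z abs_Im_le_cmod[of z] abs_Re_le_cmod[of z] by linarith+
   have lg: "\<bar>phi (x1 - Im z, 0) - phi (x1, 0)\<bar> \<le> C * \<bar>Im z\<bar>" using lipg[of "x1 - Im z" x1] r0 nz r by simp
   have "C * \<bar>Im z\<bar> \<le> C * r" using C nz by (intro mult_left_mono) auto
   then have upper: "phi (x1, 0) + Re z < phi (x1 - Im z, 0) + c0" using lg nz r by (simp add: algebra_simps)
   have "phi (x1, 0) + Re z \<le> phi (x1 - Im z, 0)"
    using zn upper nz r unfolding D_def mem_Collect_eq Re by (auto simp: not_less)
   moreover have "phi (x1 - Im z, 0) \<le> phi (x1, 0) + Re z" using zE unfolding E_def mem_Collect_eq Re by auto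
   ultimately have ground: "w0 + \<i> * z = zmap phi (x1 - Im z, 0)" by (simp add: zmap_def complex_eq_iff w0)
   have "(x1 - Im z, 0) \<in> R" using zE ground nz r T1 by (auto simp: mem_R)
   then have "G K (w0 + \<i> * z) = H K (x1 - Im z, 0)" using G(2)[of K] ground by simp
   then have "norm (u (w0 + \<i> * z)) \<le> eta1 * \<bar>Im z\<bar> ^ K"
    using r1(2)[of "x1 - Im z"] nz r unfolding u_def p_def ground by (simp add: w0_def)
   also have "\<dots> \<le> eta1 * norm z ^ K" using eta1 abs_Im_le_cmod[of z] by (intro mult_left_mono power_mono) auto
   finally show "norm (u (w0 + \<i> * z) / (\<i> * z) ^ K) \<le> eta1"
    using z by (simp add: norm_divide norm_power norm_mult divide_le_eq)
  qed
 qed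
 then obtain d0 where d0: "d0 > 0" "\<And>z. z \<in> D' ==> z \<noteq> 0 ==> norm z < d0 ==> norm (u (w0 + \<i> * z) / (\<i> * z) ^ K) \<le> 2 * eta1"
  by blast
 have ub: "norm (u w) \<le> 2 * eta1 * norm (w - w0) ^ K" if w: "w \<in> D" "norm (w - w0) < d0" for w
 proof -
  have "w \<noteq> w0" using w by (auto simp: D_def w0)
  define z where "z = - \<i> * (w - w0)"
  have z: "w0 + \<i> * z = w" by (simp add: z_def algebra_simps)
  have "norm z = norm (w - w0)" by (simp add: z_def norm_mult)
  then have "norm (u w / (w - w0) ^ K) \<le> 2 * eta1"
   using d0(2)[of z] w \<open>w \<noteq> w0\<close> z by (auto simp: D'_def z_def)
  then show ?thesis using \<open>w \<noteq> w0\<close> by (simp add: norm_divide norm_power divide_le_eq)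
 qed
 define d where "d = min (d0 / M) (min (r0 / (L + 1)) (c0 / 2)) / 2"
 have d: "d > 0" using d0 M r0 L c0 by (auto simp: d_def)
 have "norm (H 0 (x, t) - fact K * c K) < eta"
  if t: "0 < t" "t \<le> T1" and gp: "0 < gap (x, t)" "gap (x, t) < d" and xx: "\<bar>x - x1\<bar> \<le> L * gap (x, t)" for x t
 proof -
  define e where "e = gap (x, t)"
  have e: "0 < e" "M * e < d0" "(L + 1) * e < r0" "2 * e < c0"
  proof -
   show "0 < e" using gp by (simp add: e_def)
   have "2 * e < d0 / M" "2 * e < r0 / (L + 1)" "2 * e < c0 / 2" using gp by (auto simp: e_def d_def)
   then have "M * (2 * e) < d0" "(L + 1) * (2 * e) < r0" "4 * e < c0"
    using M L by (auto simp: field_simps)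
   moreover have "M * e < M * (2 * e)" "(L + 1) * e < (L + 1) * (2 * e)" using \<open>0 < e\<close> M L by auto
   ultimately show "M * e < d0" "(L + 1) * e < r0" "2 * e < c0" using \<open>0 < e\<close> by linarith+
  qed
  have xr: "\<bar>x - x1\<bar> < r0" using xx e by (simp add: e_def algebra_simps)
  define \<zeta> where "\<zeta> = zmap phi (x, t)"
  have \<zeta>: "Re \<zeta> = x" "Im \<zeta> = phi (x, 0) + e" by (auto simp: \<zeta>_def zmap_def e_def gap_def)
  have ball: "w \<in> D \<and> norm (w - w0) \<le> M * e" if w: "norm (w - \<zeta>) \<le> \<theta> * e" for w
  proof -
   have d1: "\<bar>Re w - x\<bar> \<le> \<theta> * e" "\<bar>Im w - (phi (x, 0) + e)\<bar> \<le> \<theta> * e"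
    using w abs_Re_le_cmod[of "w - \<zeta>"] abs_Im_le_cmod[of "w - \<zeta>"] \<zeta> by auto
   have te: "\<theta> * e \<le> e" using \<theta> e by (simp add: mult_left_le_one_le)
   have xe: "\<bar>x - x1\<bar> \<le> L * e" using xx by (simp add: e_def)
   have rw: "\<bar>Re w - x1\<bar> < r0" using d1(1) te xe e(3) by (simp add: algebra_simps)
   have "\<bar>phi (Re w, 0) - phi (x, 0)\<bar> \<le> C * \<bar>Re w - x\<bar>" using lipg[of "Re w" x] rw xr by simp
   also have "\<dots> \<le> C * (\<theta> * e)" using C d1 by (intro mult_left_mono) auto
   finally have gg: "\<bar>phi (Re w, 0) - phi (x, 0)\<bar> \<le> C * (\<theta> * e)" .
   have half: "\<theta> * e + C * (\<theta> * e) = e / 2"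
   proof -
    have "\<theta> * e + C * (\<theta> * e) = \<theta> * (1 + C) * e" by (simp add: algebra_simps)
    then show ?thesis using \<theta>(2) by simp
   qed
   have "w \<in> D" unfolding D_def using rw d1(2) gg half e by auto
   moreover have "norm (w - w0) \<le> M * e"
   proof -
    have "norm (\<zeta> - w0) \<le> \<bar>Re (\<zeta> - w0)\<bar> + \<bar>Im (\<zeta> - w0)\<bar>" by (rule cmod_le)
    also have "\<dots> \<le> L * e + (C * (L * e) + e)"
    proof -
     have "\<bar>phi (x, 0) - phi (x1, 0)\<bar> \<le> C * \<bar>x - x1\<bar>" using lipg[of x x1] xr r0 by simp
     also have "\<dots> \<le> C * (L * e)" using C xe by (intro mult_left_mono) auto
     finally show ?thesis using xe e \<zeta> w0 by simp
    qed
    finally have "norm (\<zeta> - w0) \<le> L * e + (C * (L * e) + e)" .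
    moreover have "norm (w - w0) \<le> norm (w - \<zeta>) + norm (\<zeta> - w0)"
     using norm_triangle_ineq[of "w - \<zeta>" "\<zeta> - w0"] by simp
    ultimately show ?thesis using w te by (simp add: M_def algebra_simps)
   qed
   ultimately show ?thesis by simp
  qed
  have \<zeta>D: "\<zeta> \<in> D" using ball[of \<zeta>] \<theta> e by simp
  have "cmod ((deriv ^^ K) u \<zeta>) \<le> fact K * (2 * eta1 * (M * e) ^ K) / (\<theta> * e) ^ K"
  proof (rule Cauchy_inequality)
   show "u holomorphic_on ball \<zeta> (\<theta> * e)"
    by (rule holomorphic_on_subset[OF hu]) (use ball in \<open>auto simp: dist_norm norm_minus_commute\<close>)
   show "continuous_on (cball \<zeta> (\<theta> * e)) u"
    by (rule continuous_on_subset[OF holomorphic_on_imp_continuous_on[OF hu]]) (use ball in \<open>auto simp: dist_norm norm_minus_commute\<close>)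
   show "0 < \<theta> * e" using \<theta> e by simp
   fix w assume "norm (\<zeta> - w) = \<theta> * e"
   then have w: "w \<in> D" "norm (w - w0) \<le> M * e" using ball[of w] by (auto simp: norm_minus_commute)
   have "norm (u w) \<le> 2 * eta1 * norm (w - w0) ^ K" using ub w e by auto
   also have "\<dots> \<le> 2 * eta1 * (M * e) ^ K" using w eta1 by (intro mult_left_mono power_mono) auto
   finally show "cmod (u w) \<le> 2 * eta1 * (M * e) ^ K" .
  qed
  also have "\<dots> = 2 * (fact K * eta1 * (M / \<theta>) ^ K)"
   using e by (simp add: power_mult_distrib power_divide field_simps)
  also have "fact K * eta1 * (M / \<theta>) ^ K = eta / 4"
   using M \<theta> by (simp add: eta1_def)
  finally have "cmod ((deriv ^^ K) u \<zeta>) < eta" using eta by simp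
  moreover have "(deriv ^^ K) u \<zeta> = (deriv ^^ K) (G K) \<zeta> - (deriv ^^ K) p \<zeta>"
   unfolding u_def
   by (rule higher_deriv_diff[OF holomorphic_G[OF order_refl] holomorphic_on_subset[OF pd] open_D \<zeta>D]) auto
  moreover have "(deriv ^^ K) p \<zeta> = fact K * c K" unfolding p_def by (rule top_deriv_polynomial)
  moreover have "H 0 (x, t) = (deriv ^^ K) (G K) \<zeta>"
   using H_eq_higher_deriv[OF order_refl xr t] \<zeta>D by (simp add: \<zeta>_def)
  ultimately show ?thesis by simp
 qed
 then show ?thesis using d by blast
qed

end

section \<open>Taylor expansions along curves\<close>

lemma integrate_small_o:
 fixes R :: "real => complex"
 assumes r: "r > 0" and R0: "R x1 = 0" and eta: "eta \<ge> 0"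
  and d: "\<And>x. \<bar>x - x1\<bar> < r ==> (R has_vector_derivative R' x) (at x)"
  and bd: "\<And>x. \<bar>x - x1\<bar> < r ==> norm (R' x) \<le> eta * \<bar>x - x1\<bar> ^ k"
  and x: "\<bar>x - x1\<bar> < r"
 shows "norm (R x) \<le> eta * \<bar>x - x1\<bar> ^ Suc k"
proof -
 have "norm (R x - R x1) \<le> (eta * \<bar>x - x1\<bar> ^ k) * norm (x - x1)"
 proof (rule differentiable_bound[where S = "closed_segment x1 x" and f' = "\<lambda>y h. h *\<^sub>R R' y"])
  fix y assume y: "y \<in> closed_segment x1 x"
  then have yb: "\<bar>y - x1\<bar> \<le> \<bar>x - x1\<bar>" by (auto simp: closed_segment_eq_real_ivl split: if_splits)
  then have yr: "\<bar>y - x1\<bar> < r" using x by simp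
  show "(R has_derivative (\<lambda>h. h *\<^sub>R R' y)) (at y within closed_segment x1 x)"
   using d[OF yr] has_derivative_at_withinI unfolding has_vector_derivative_def by blast
  show "onorm (\<lambda>h. h *\<^sub>R R' y) \<le> eta * \<bar>x - x1\<bar> ^ k"
  proof (rule onorm_le)
   fix h :: real
   have "norm (R' y) \<le> eta * \<bar>y - x1\<bar> ^ k" by (rule bd[OF yr])
   also have "\<dots> \<le> eta * \<bar>x - x1\<bar> ^ k" using yb eta by (intro mult_left_mono power_mono) auto
   finally show "norm (h *\<^sub>R R' y) \<le> eta * \<bar>x - x1\<bar> ^ k * norm h"
    by (simp add: mult.commute mult_left_mono)
  qed
 qed auto
 then show ?thesis using R0 by (simp add: mult_ac)
qed

text \<open>Integrating an expansion against \<open>Z'\<close> raises its order by one and shifts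
  the coefficients. The start asks for the derivative of \<open>f 1\<close> at the single point
  \<open>x1\<close>, with \<open>v\<close> in the role of the value one level below: this is what
  Lebesgue differentiation provides almost everywhere.\<close>

lemma taylor_chain:
 fixes f :: "nat => real => complex" and Z Z' :: "real => complex"
 assumes r: "r > 0" and Zd: "\<And>x. \<bar>x - x1\<bar> < r ==> (Z has_vector_derivative Z' x) (at x)"
  and Zb: "\<And>x. \<bar>x - x1\<bar> < r ==> norm (Z' x) \<le> B"
  and f1: "(f 1 has_vector_derivative v * Z' x1) (at x1)"
  and fs: "\<And>j x. 1 \<le> j ==> \<bar>x - x1\<bar> < r ==> (f (Suc j) has_vector_derivative f j x * Z' x) (at x)"
 shows "taylor_at (f (Suc k)) Z (Suc k) (\<lambda>i. (if i = Suc k then v else f (Suc k - i) x1) / fact i) x1"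
proof (induction k)
 case 0
 have B: "B \<ge> 0" using order_trans[OF norm_ge_zero Zb[of x1]] r by simp
 show ?case unfolding taylor_at_def
 proof (intro allI impI)
  fix eta :: real assume eta: "eta > 0"
  have "((\<lambda>x. f 1 x - v * Z x) has_vector_derivative v * Z' x1 - v * Z' x1) (at x1)"
   by (intro has_vector_derivative_diff f1 has_vector_derivative_mult_right Zd) (use r in auto)
  then have "((\<lambda>x. f 1 x - v * Z x) has_derivative (\<lambda>h. 0)) (at x1)"
   by (simp add: has_vector_derivative_def)
  then obtain d where d: "d > 0" "\<And>x. norm (x - x1) < d ==> norm ((f 1 x - v * Z x) - (f 1 x1 - v * Z x1) - 0) \<le> eta * norm (x - x1)"
   unfolding has_derivative_at_alt using eta by blast
  show "\<exists>r>0. \<forall>x. \<bar>x - x1\<bar> < r --> norm (f (Suc 0) x - (\<Sum>i\<le>Suc 0. (if i = Suc 0 then v else f (Suc 0 - i) x1) / fact i * (Z x - Z x1) ^ i)) \<le> eta * \<bar>x - x1\<bar> ^ Suc 0"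
   using d by (intro exI[of _ d]) (auto simp: algebra_simps)
 qed
next
 case (Suc k)
 define c where "c k i = (if i = Suc k then v else f (Suc k - i) x1) / fact i" for k i
 have B: "B \<ge> 0" using order_trans[OF norm_ge_zero Zb[of x1]] r by simp
 show ?case unfolding taylor_at_def c_def[symmetric]
 proof (intro allI impI)
  fix eta :: real assume eta: "eta > 0"
  define eta' where "eta' = eta / (B + 1)"
  have eta': "eta' > 0" "eta' * B \<le> eta" using eta B by (auto simp: eta'_def field_simps)
  obtain r1 where r1: "r1 > 0" "\<And>x. \<bar>x - x1\<bar> < r1 ==> norm (f (Suc k) x - (\<Sum>i\<le>Suc k. c k i * (Z x - Z x1) ^ i)) \<le> eta' * \<bar>x - x1\<bar> ^ Suc k"
   using Suc eta' unfolding taylor_at_def c_def[symmetric] by blast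
  define R where "R x = f (Suc (Suc k)) x - (\<Sum>i\<le>Suc (Suc k). c (Suc k) i * (Z x - Z x1) ^ i)" for x
  define R' where "R' x = (f (Suc k) x - (\<Sum>i\<le>Suc k. c k i * (Z x - Z x1) ^ i)) * Z' x" for x
  have "norm (R x) \<le> (eta' * B) * \<bar>x - x1\<bar> ^ Suc (Suc k)" if x: "\<bar>x - x1\<bar> < min r r1" for x
  proof (rule integrate_small_o[of "min r r1" R x1 _ R'])
   have "(\<Sum>i\<le>Suc (Suc k). c (Suc k) i * (Z x1 - Z x1) ^ i) = c (Suc k) 0"
    by (subst sum.atMost_Suc_shift) simp
   then show "R x1 = 0" by (simp add: R_def c_def)
   fix y assume y: "\<bar>y - x1\<bar> < min r r1"
   have dp: "((\<lambda>x. c (Suc k) i * (Z x - Z x1) ^ i) has_vector_derivative (c (Suc k) i * (of_nat i * (Z y - Z x1) ^ (i - 1))) * Z' y) (at y)" for i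
   proof -
    have "((\<lambda>w. c (Suc k) i * (w - Z x1) ^ i) has_field_derivative c (Suc k) i * (of_nat i * (Z y - Z x1) ^ (i - 1))) (at (Z y))"
     by (auto intro!: derivative_eq_intros)
    from field_vector_diff_chain_at[OF Zd[of y] this] y show ?thesis by (simp add: o_def mult_ac)
   qed
   have "(R has_vector_derivative f (Suc k) y * Z' y - (\<Sum>i\<le>Suc (Suc k). (c (Suc k) i * (of_nat i * (Z y - Z x1) ^ (i - 1))) * Z' y)) (at y)"
    unfolding R_def by (intro has_vector_derivative_diff has_vector_derivative_sum dp fs) (use y in auto)
   moreover have "(\<Sum>i\<le>Suc (Suc k). (c (Suc k) i * (of_nat i * (Z y - Z x1) ^ (i - 1))) * Z' y) = (\<Sum>i\<le>Suc k. c k i * (Z y - Z x1) ^ i) * Z' y"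
   proof -
    have "c (Suc k) (Suc i) * (of_nat (Suc i) * w) = c k i * w" for i w
     by (simp add: c_def field_simps del: of_nat_Suc)
    then show ?thesis
     by (subst sum.atMost_Suc_shift) (simp only: of_nat_0 mult_zero_left mult_zero_right add_0_left diff_Suc_1 sum_distrib_right)
   qed
   ultimately show "(R has_vector_derivative R' y) (at y)" by (simp only: R'_def left_diff_distrib)
   have "norm (R' y) \<le> (eta' * \<bar>y - x1\<bar> ^ Suc k) * B"
    unfolding R'_def norm_mult using r1(2)[of y] Zb[of y] y eta' by (intro mult_mono) auto
   then show "norm (R' y) \<le> eta' * B * \<bar>y - x1\<bar> ^ Suc k" by (simp add: mult_ac)
  qed (use r r1 x eta' B in auto)
  then have "norm (R x) \<le> eta * \<bar>x - x1\<bar> ^ Suc (Suc k)" if "\<bar>x - x1\<bar> < min r r1" for x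
   using that eta'(2) by (meson mult_right_mono order_trans zero_le_power abs_ge_zero)
  then show "\<exists>r>0. \<forall>x. \<bar>x - x1\<bar> < r --> norm (f (Suc (Suc k)) x - (\<Sum>i\<le>Suc (Suc k). c (Suc k) i * (Z x - Z x1) ^ i)) \<le> eta * \<bar>x - x1\<bar> ^ Suc (Suc k)"
   using r r1 by (intro exI[of _ "min r r1"]) (auto simp: R_def)
 qed
qed

text \<open>Along \<open>A\<close> the difference of the two polynomials in
  \<open>w x = Z x - Z x1\<close> is \<open>o(\<bar>w x\<bar> ^ k)\<close>, and \<open>w\<close>
  tends to zero without vanishing; so the coefficients cancel one after the other, starting from the
  lowest.\<close>

lemma taylor_at_unique:
 assumes A: "x1 islimpt A" and f: "taylor_at f Z k c x1" and g: "taylor_at g Y k e x1"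
  and eq: "\<And>x. x \<in> A ==> f x = g x \<and> Z x - Z x1 = Y x - Y x1 \<and> \<bar>x - x1\<bar> \<le> norm (Z x - Z x1)"
  and cont: "(Z \<longlongrightarrow> Z x1) (at x1)"
 shows "c k = e k"
proof -
 define F where "F = at x1 within A"
 have F: "F \<noteq> bot" using A by (simp add: F_def trivial_limit_within)
 define w where "w x = Z x - Z x1" for x
 have w0: "(w \<longlongrightarrow> 0) F"
  unfolding w_def F_def using tendsto_within_subset[OF cont subset_UNIV] by (simp add: LIM_zero)
 have ev: "\<forall>\<^sub>F x in F. x \<in> A \<and> x \<noteq> x1" by (simp add: F_def eventually_at_filter)
 define p where "p x = (\<Sum>i\<le>k. (c i - e i) * w x ^ i)" for x
 have small: "\<forall>\<^sub>F x in F. norm (p x) \<le> eta * norm (w x) ^ k" if eta: "eta > 0" for eta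
 proof -
  have "eta/2 > 0" using eta by simp
  obtain r1 where r1: "r1 > 0" "\<And>x. \<bar>x - x1\<bar> < r1 ==> norm (f x - (\<Sum>i\<le>k. c i * (Z x - Z x1) ^ i)) \<le> eta/2 * \<bar>x - x1\<bar> ^ k"
   using f \<open>eta/2 > 0\<close> unfolding taylor_at_def by blast
  obtain r2 where r2: "r2 > 0" "\<And>x. \<bar>x - x1\<bar> < r2 ==> norm (g x - (\<Sum>i\<le>k. e i * (Y x - Y x1) ^ i)) \<le> eta/2 * \<bar>x - x1\<bar> ^ k"
   using g \<open>eta/2 > 0\<close> unfolding taylor_at_def by blast
  note r = r1 r2
  have "\<forall>\<^sub>F x in F. x \<in> A \<and> \<bar>x - x1\<bar> < min r1 r2"
   using r by (auto simp: F_def eventually_at dist_real_def intro!: exI[of _ "min r1 r2"])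
  then show ?thesis
  proof eventually_elim
   case (elim x)
   then have e: "f x = g x" "Y x - Y x1 = w x" "\<bar>x - x1\<bar> \<le> norm (w x)" using eq[of x] by (auto simp: w_def)
   have "p x = (g x - (\<Sum>i\<le>k. e i * w x ^ i)) - (f x - (\<Sum>i\<le>k. c i * w x ^ i))"
    using e by (simp add: p_def algebra_simps sum_subtractf)
   then have "norm (p x) \<le> norm (g x - (\<Sum>i\<le>k. e i * w x ^ i)) + norm (f x - (\<Sum>i\<le>k. c i * w x ^ i))"
    by (simp add: norm_triangle_ineq4)
   also have "\<dots> \<le> eta/2 * \<bar>x - x1\<bar> ^ k + eta/2 * \<bar>x - x1\<bar> ^ k"
    using r(2)[of x] r(4)[of x] elim e unfolding w_def by (intro add_mono) auto
   also have "\<dots> = eta * \<bar>x - x1\<bar> ^ k" by simp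
   also have "\<dots> \<le> eta * norm (w x) ^ k" using e eta by (intro mult_left_mono power_mono) auto
   finally show ?case .
  qed
 qed
 have "i \<le> k --> c i = e i" for i
 proof (induction i rule: less_induct)
  case (less i)
  show ?case
  proof
   assume i: "i \<le> k"
   have pe: "p x = w x ^ i * ((c i - e i) + (\<Sum>m\<in>{Suc i..k}. (c m - e m) * w x ^ (m - i)))" for x
   proof -
    have "p x = (\<Sum>m\<in>{i..k}. (c m - e m) * w x ^ m)"
     unfolding p_def by (rule sum.mono_neutral_right) (use less i in auto)
    also have "\<dots> = (c i - e i) * w x ^ i + (\<Sum>m\<in>{Suc i..k}. (c m - e m) * w x ^ m)"
     using i by (simp add: sum.atLeast_Suc_atMost)
    also have "(\<Sum>m\<in>{Suc i..k}. (c m - e m) * w x ^ m) = w x ^ i * (\<Sum>m\<in>{Suc i..k}. (c m - e m) * w x ^ (m - i))"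
     unfolding sum_distrib_left by (rule sum.cong) (auto simp: power_add[symmetric] mult.left_commute)
    finally show ?thesis by (simp add: algebra_simps)
   qed
   have "((\<lambda>x. (c i - e i) + (\<Sum>m\<in>{Suc i..k}. (c m - e m) * w x ^ (m - i))) \<longlongrightarrow> (c i - e i) + (\<Sum>m\<in>{Suc i..k}. (c m - e m) * 0 ^ (m - i))) F"
    by (intro tendsto_intros w0)
   moreover have "(\<Sum>m\<in>{Suc i..k}. (c m - e m) * 0 ^ (m - i)) = 0" by (rule sum.neutral) auto
   ultimately have lim: "((\<lambda>x. (c i - e i) + (\<Sum>m\<in>{Suc i..k}. (c m - e m) * w x ^ (m - i))) \<longlongrightarrow> c i - e i) F" by simp
   have "norm (c i - e i) \<le> eta" if eta: "eta > 0" for eta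
   proof (rule tendsto_upperbound[OF tendsto_norm[OF lim] _ F])
    have "\<forall>\<^sub>F x in F. norm (w x) < 1"
     using tendstoD[OF w0, of 1] by simp
    then show "\<forall>\<^sub>F x in F. norm ((c i - e i) + (\<Sum>m\<in>{Suc i..k}. (c m - e m) * w x ^ (m - i))) \<le> eta"
     using small[OF eta] ev
    proof eventually_elim
     case (elim x)
     have wx: "w x \<noteq> 0" using eq[of x] elim by (auto simp: w_def)
     have "norm (w x) ^ i * norm ((c i - e i) + (\<Sum>m\<in>{Suc i..k}. (c m - e m) * w x ^ (m - i))) \<le> eta * norm (w x) ^ k"
      using elim pe[of x] by (simp add: norm_mult norm_power)
     also have "\<dots> \<le> norm (w x) ^ i * eta"
      using elim eta i by (simp add: mult.commute power_decreasing mult_left_mono)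
     finally show ?case using wx by simp
    qed
   qed
   then have "norm (c i - e i) \<le> 0" by (meson field_le_epsilon add_increasing dense_ge)
   then show "c i = e i" by simp
  qed
 qed
 then show ?thesis by blast
qed

section \<open>Limits inside the approach regions\<close>

context strip
begin

abbreviation "gapf x t \<equiv> phi (x, t) - phi (x, 0)"

lemma column_cont:
 assumes "x \<in> {a<..<b}" "S \<subseteq> {-delta<..<delta}" shows "continuous_on S (\<lambda>t. phi (x, t))"
 by (rule continuous_on_compose2[OF continuous_on_phi]) (use assms in \<open>auto intro!: continuous_intros\<close>)

lemma strip_plus_exists:
 assumes x1: "x1 \<in> {a<..<b}" and plus: "\<And>\<tau>. \<tau> > 0 ==> \<exists>t. 0 < t \<and> t < \<tau> \<and> phi (x1, t) > phi (x1, 0)"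
 shows "\<exists>r0 r1 T1 c0. strip_plus a b delta C phi phix phit H K x1 r0 r1 T1 c0"
proof -
 define r1 where "r1 = min (x1 - a) (b - x1) / 3"
 have r1: "r1 > 0" using x1 by (simp add: r1_def)
 have r13: "3 * r1 \<le> x1 - a" "3 * r1 \<le> b - x1" by (auto simp: r1_def)
 have "0 < min delta (r1 / (16 * C))" using delta r1 C by simp
 from plus[OF this] obtain T1 where T1: "0 < T1" "T1 < delta" "T1 < r1 / (16 * C)" "phi (x1, T1) > phi (x1, 0)" by auto
 \<comment> \<open>Half of the gap at \<open>x1\<close>; the other half pays for its variation over
   \<open>\<bar>x - x1\<bar> \<le> r0\<close>, which is at most
   \<open>C * T1 * r0 \<le> c0\<close>.\<close>
 define c0 where "c0 = gapf x1 T1 / 2"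
 have c0: "c0 > 0" using T1 by (simp add: c0_def)
 have CT: "C * T1 \<le> r1 / 16" using T1(3) C by (simp add: field_simps)
 define r0 where "r0 = min r1 (c0 / (C * T1))"
 have r0: "r0 > 0" "r0 \<le> r1" "C * T1 * r0 \<le> c0"
 proof -
  show "r0 > 0" "r0 \<le> r1" using r1 c0 C T1 by (auto simp: r0_def)
  have "C * T1 * r0 \<le> C * T1 * (c0 / (C * T1))" using C T1 by (intro mult_left_mono) (auto simp: r0_def)
  then show "C * T1 * r0 \<le> c0" using C T1 by simp
 qed
 have "strip_plus a b delta C phi phix phit H K x1 r0 r1 T1 c0"
 proof (unfold_locales)
  show "a < x1 - r0 - r1" "x1 + r0 + r1 < b" using r0 r1 r13 by linarith+
  fix x assume x: "\<bar>x - x1\<bar> \<le> r0"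
  have "x \<in> {a<..<b}" using x r0 r1 r13 by auto
  from phi_mixed[OF x1 this, of T1] T1
  have "\<bar>gapf x T1 - gapf x1 T1\<bar> \<le> C * T1 * \<bar>x - x1\<bar>" by simp
  also have "\<dots> \<le> C * T1 * r0" using x C T1 by (intro mult_left_mono) auto
  also have "\<dots> \<le> c0" by (rule r0(3))
  finally have "\<bar>gapf x T1 - gapf x1 T1\<bar> \<le> c0" .
  moreover have "gapf x1 T1 = 2 * c0" by (simp add: c0_def)
  ultimately show "phi (x, 0) + c0 \<le> phi (x, T1)" by linarith
 qed (use r0 r1 T1 CT c0 in auto)
 then show ?thesis by blast
qed

text \<open>The second claim concerns points of the column over \<open>x1\<close> at which the gap
  vanishes, where the first is silent. By constancy on fibres the solution has the same value there
  as at the last zero \<open>t2\<close> of the gap before \<open>T1\<close>, and \<open>t2\<close>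
  is approached from above by points of small positive gap. That works because the smallness in
  \<open>nontangential_limit\<close> is one of the gap and not of \<open>t\<close>.\<close>

lemma limit_plus:
 assumes x1: "x1 \<in> {a<..<b}" and plus: "\<And>\<tau>. \<tau> > 0 ==> \<exists>t. 0 < t \<and> t < \<tau> \<and> phi (x1, t) > phi (x1, 0)"
  and tay: "taylor_at (\<lambda>x. H K (x, 0)) (\<lambda>x. zmap phi (x, 0)) K c x1" and L: "L \<ge> 0"
 shows "\<And>eta. eta > 0 ==> \<exists>d>0. \<forall>x t. 0 < t --> t < d --> \<bar>x - x1\<bar> < d --> 0 < gapf x t --> \<bar>x - x1\<bar> \<le> L * gapf x t -->
   norm (H 0 (x, t) - fact K * c K) < eta"
  and "\<exists>\<tau>>0. \<forall>t. 0 < t --> t < \<tau> --> phi (x1, t) = phi (x1, 0) --> H 0 (x1, t) = fact K * c K"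
proof -
 obtain r0 r1 T1 c0 where "strip_plus a b delta C phi phix phit H K x1 r0 r1 T1 c0"
  using strip_plus_exists[OF x1 plus] by blast
 then interpret P: strip_plus a b delta C phi phix phit H K x1 r0 r1 T1 c0 .
 have gap_eq: "P.gap (x, t) = gapf x t" for x t by (simp add: P.gap_def)
 show lim: "\<exists>d>0. \<forall>x t. 0 < t --> t < d --> \<bar>x - x1\<bar> < d --> 0 < gapf x t --> \<bar>x - x1\<bar> \<le> L * gapf x t -->
   norm (H 0 (x, t) - fact K * c K) < eta" if eta: "eta > 0" for eta
 proof -
  obtain d where d: "d > 0" "\<And>x t. 0 < t ==> t \<le> T1 ==> 0 < gapf x t ==> gapf x t < d ==> \<bar>x - x1\<bar> \<le> L * gapf x t ==>
    norm (H 0 (x, t) - fact K * c K) < eta"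
   using P.nontangential_limit[OF tay L eta] unfolding gap_eq by blast
  define d' where "d' = min (min T1 (d / C)) r0"
  have "norm (H 0 (x, t) - fact K * c K) < eta"
   if t: "0 < t" "t < d'" "\<bar>x - x1\<bar> < d'" "0 < gapf x t" "\<bar>x - x1\<bar> \<le> L * gapf x t" for x t
  proof (rule d(2))
   have "x \<in> {a<..<b}" using P.x_in[of x] t by (simp add: d'_def)
   then have "\<bar>gapf x t\<bar> \<le> C * \<bar>t - 0\<bar>" using phi_lipschitz_t[of x t 0] t P.T1 delta by (auto simp: d'_def)
   also have "\<dots> < d" using t C by (simp add: d'_def field_simps)
   finally show "gapf x t < d" by simp
  qed (use t in \<open>auto simp: d'_def\<close>)
  moreover have "d' > 0" using P.T1 d C P.r0 by (simp add: d'_def)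
  ultimately show ?thesis by blast
 qed
 have "H 0 (x1, t) = fact K * c K" if t: "0 < t" "t < T1" "phi (x1, t) = phi (x1, 0)" for t
 proof -
  have cc: "continuous_on {t..T1} (\<lambda>s. gapf x1 s)"
   by (intro continuous_intros column_cont x1) (use t P.T1 delta in auto)
  have "closed ({t..T1} \<inter> (\<lambda>s. gapf x1 s) -` {0})"
   by (rule continuous_closed_preimage[OF cc]) auto
  then have "compact ({t..T1} \<inter> ({t..T1} \<inter> (\<lambda>s. gapf x1 s) -` {0}))" by (intro compact_Int_closed) auto
  then have "compact ({t..T1} \<inter> (\<lambda>s. gapf x1 s) -` {0})" by simp
  moreover have "t \<in> {t..T1} \<inter> (\<lambda>s. gapf x1 s) -` {0}" using t by auto
  ultimately have "\<exists>s\<in>{t..T1} \<inter> (\<lambda>s. gapf x1 s) -` {0}. \<forall>u\<in>{t..T1} \<inter> (\<lambda>s. gapf x1 s) -` {0}. u \<le> s"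
   by (intro compact_attains_sup) blast+
  then obtain t2 where t2: "t2 \<in> {t..T1}" "gapf x1 t2 = 0"
   and max: "\<And>s. s \<in> {t..T1} ==> gapf x1 s = 0 ==> s \<le> t2"
   by (auto simp: vimage_def)
  have gT: "gapf x1 T1 > 0" using P.top[of x1] P.r0 P.c0 by simp
  then have t2T: "t2 < T1" using t2 by (cases "t2 = T1") auto
  have pos: "gapf x1 s > 0" if s: "t2 < s" "s \<le> T1" for s
  proof (rule ccontr)
   assume "\<not> gapf x1 s > 0"
   moreover have "continuous_on {s..T1} (\<lambda>s. gapf x1 s)" by (rule continuous_on_subset[OF cc]) (use s t2 in auto)
   ultimately have "\<exists>u\<ge>s. u \<le> T1 \<and> gapf x1 u = 0" using gT s by (intro IVT'[of "\<lambda>s. gapf x1 s" s 0 T1]) auto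
   then obtain u where "s \<le> u" "u \<le> T1" "gapf x1 u = 0" by blast
   then show False using max[of u] s t2 by auto
  qed
  have cH0: "continuous_on {t2..T1} (\<lambda>s. H 0 (x1, s))"
   by (rule continuous_on_compose2[OF H0]) (use x1 t t2 P.T1 in \<open>auto intro!: continuous_intros\<close>)
  have hlim: "((\<lambda>s. H 0 (x1, s)) \<longlongrightarrow> H 0 (x1, t2)) (at_right t2)"
  proof -
   have "((\<lambda>s. H 0 (x1, s)) \<longlongrightarrow> H 0 (x1, t2)) (at t2 within {t2..T1})"
    using cH0 t2T by (auto simp: continuous_on_def)
   then show ?thesis using at_within_Icc_at_right[OF t2T] by simp
  qed
  have glim: "((\<lambda>s. gapf x1 s) \<longlongrightarrow> 0) (at_right t2)"
  proof -
   have "((\<lambda>s. gapf x1 s) \<longlongrightarrow> gapf x1 t2) (at t2 within {t..T1})"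
    using cc t2(1) unfolding continuous_on_def by blast
   then have "((\<lambda>s. gapf x1 s) \<longlongrightarrow> gapf x1 t2) (at t2 within {t2..T1})"
    by (rule tendsto_within_subset) (use t2 in auto)
   then show ?thesis using at_within_Icc_at_right[OF t2T] t2 by simp
  qed
  have "norm (H 0 (x1, t2) - fact K * c K) \<le> eta" if eta: "eta > 0" for eta
  proof -
   obtain d where d: "d > 0" "\<And>x t. 0 < t ==> t \<le> T1 ==> 0 < gapf x t ==> gapf x t < d ==> \<bar>x - x1\<bar> \<le> L * gapf x t ==>
     norm (H 0 (x, t) - fact K * c K) < eta"
    using P.nontangential_limit[OF tay L eta] unfolding gap_eq by blast
   have "\<forall>\<^sub>F s in at_right t2. gapf x1 s < d" using glim d(1) by (rule order_tendstoD)
   moreover have "\<forall>\<^sub>F s in at_right t2. t2 < s \<and> s \<le> T1"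
    using t2T by (auto simp: eventually_at_right_field intro!: exI[of _ T1])
   ultimately have "\<forall>\<^sub>F s in at_right t2. norm (H 0 (x1, s) - fact K * c K) \<le> eta"
   proof eventually_elim
    case (elim s)
    then show ?case using d(2)[of s x1] pos[of s] L t2 t by (auto intro!: less_imp_le)
   qed
   moreover have "((\<lambda>s. norm (H 0 (x1, s) - fact K * c K)) \<longlongrightarrow> norm (H 0 (x1, t2) - fact K * c K)) (at_right t2)"
    by (intro tendsto_intros hlim)
   ultimately show ?thesis by (intro tendsto_upperbound) auto
  qed
  then have "norm (H 0 (x1, t2) - fact K * c K) \<le> 0" by (meson dense_ge)
  moreover have "H 0 (x1, t) = H 0 (x1, t2)"
   by (rule P.fibre_R) (use P.r0 t t2 in auto)
  ultimately show ?thesis by simp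
 qed
 then show "\<exists>\<tau>>0. \<forall>t. 0 < t --> t < \<tau> --> phi (x1, t) = phi (x1, 0) --> H 0 (x1, t) = fact K * c K"
  using P.T1 by blast
qed

text \<open>If the column over \<open>x1\<close> does not rise near \<open>t = 0\<close> the
  statement is empty: by \<open>phi_mixed\<close> a positive gap over \<open>x\<close> within the
  approach region would force a positive gap over \<open>x1\<close>.\<close>

lemma limit_pos:
 assumes x1: "x1 \<in> {a<..<b}" and L: "L \<ge> 0" and eta: "eta > 0"
  and tay: "taylor_at (\<lambda>x. H K (x, 0)) (\<lambda>x. zmap phi (x, 0)) K c x1"
 shows "\<exists>d>0. \<forall>x t. 0 < t --> t < d --> \<bar>x - x1\<bar> < d --> 0 < gapf x t --> \<bar>x - x1\<bar> \<le> L * gapf x t -->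
   norm (H 0 (x, t) - fact K * c K) < eta"
proof (cases "\<forall>\<tau>>0. \<exists>t. 0 < t \<and> t < \<tau> \<and> phi (x1, t) > phi (x1, 0)")
 case True
 then show ?thesis using limit_plus(1)[OF x1 _ tay L eta] by blast
next
 case False
 then obtain \<tau> where \<tau>: "\<tau> > 0" "\<And>t. 0 < t ==> t < \<tau> ==> phi (x1, t) \<le> phi (x1, 0)" by force
 \<comment> \<open>\<open>t < 1 / (C * (L + 1))\<close> makes the change
   \<open>C * t * L * gapf x t\<close> of the gap smaller than the gap itself; \<open>L + 1\<close>
   covers the case \<open>L = 0\<close>.\<close>
 define d where "d = min (min \<tau> delta) (min (1 / (C * (L + 1))) (min (x1 - a) (b - x1)))"
 have d: "d > 0" using \<tau> delta C L x1 by (simp add: d_def)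
 have CL: "C * (L + 1) > 0" using C L by simp
 have False if t: "0 < t" "t < d" "\<bar>x - x1\<bar> < d" "0 < gapf x t" "\<bar>x - x1\<bar> \<le> L * gapf x t" for x t
 proof -
  have "t < 1 / (C * (L + 1))" using t by (simp add: d_def)
  then have tC: "t * (C * (L + 1)) < 1" unfolding pos_less_divide_eq[OF CL] .
  have "x \<in> {a<..<b}" using t by (auto simp: d_def)
  from phi_mixed[OF x1 this, of t] t
  have "\<bar>gapf x t - gapf x1 t\<bar> \<le> C * t * \<bar>x - x1\<bar>" by (simp add: d_def)
  moreover have "C * t * \<bar>x - x1\<bar> < gapf x t"
  proof (cases "x = x1")
   case True
   then show ?thesis using t by simp
  next
   case False
   have "C * t * \<bar>x - x1\<bar> \<le> C * t * (L * gapf x t)" using t C by (intro mult_left_mono) auto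
   also have "\<dots> < gapf x t"
   proof -
    have "C * t * L \<le> t * (C * (L + 1))" using t C L by (simp add: algebra_simps)
    then have "(C * t * L) * gapf x t < 1 * gapf x t" using t tC by (intro mult_strict_right_mono) auto
    then show ?thesis by (simp add: mult_ac)
   qed
   finally show ?thesis .
  qed
  ultimately have "gapf x1 t > 0" by linarith
  then show False using \<tau>(2)[of t] t by (auto simp: d_def)
 qed
 then show ?thesis using d by blast
qed

text \<open>On a flat column \<open>H K\<close> has vanishing \<open>t\<close>-derivative, so
  \<open>H K\<close> and \<open>Z\<close> take the same values at the heights \<open>0\<close> and
  \<open>t\<close>. At height \<open>t\<close> the expansion has the top coefficient
  \<open>H 0 (x1, t) / fact K\<close>; uniqueness along the flat columns accumulating at
  \<open>x1\<close> equates it with \<open>c K\<close>.\<close>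

lemma flat_limit:
 assumes x1: "x1 \<in> {a<..<b}" and \<tau>: "\<tau> < delta" and K: "K \<ge> 1"
  and tay: "taylor_at (\<lambda>x. H K (x, 0)) (\<lambda>x. zmap phi (x, 0)) K c x1"
  and flat1: "\<And>s. s \<in> {0..\<tau>} ==> phi (x1, s) = phi (x1, 0)"
  and lim: "x1 islimpt {x\<in>{a<..<b}. \<forall>s\<in>{0..\<tau>}. phi (x, s) = phi (x, 0)}"
  and t: "0 < t" "t < \<tau>"
 shows "H 0 (x1, t) = fact K * c K"
proof -
 obtain k where k: "K = Suc k" using K by (cases K) auto
 define r where "r = min (x1 - a) (b - x1)"
 have r: "r > 0" "\<And>x. \<bar>x - x1\<bar> < r ==> x \<in> {a<..<b}" using x1 by (auto simp: r_def)
 have dfx: "((\<lambda>x. H (Suc j) (x, t)) has_vector_derivative H j (x, t) * zdx phix (x, t)) (at x)" if "\<bar>x - x1\<bar> < r" for j x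
  using has_derivative_dform_fst[OF dH[of "(x, t)" j]] r(2)[OF that] t \<tau> by simp
 have "taylor_at (\<lambda>x. H (Suc k) (x, t)) (\<lambda>x. zmap phi (x, t)) (Suc k) (\<lambda>i. (if i = Suc k then H 0 (x1, t) else H (Suc k - i) (x1, t)) / fact i) x1"
 proof (rule taylor_chain[of r x1 _ "\<lambda>x. zdx phix (x, t)" "1 + C" "\<lambda>j x. H j (x, t)"])
  fix x assume x: "\<bar>x - x1\<bar> < r"
  then have q: "(x, t) \<in> box0" using r t \<tau> by auto
  show "((\<lambda>x. zmap phi (x, t)) has_vector_derivative zdx phix (x, t)) (at x)"
   using has_derivative_dform_fst[OF zmap_has_derivative[OF q]] by simp
  show "norm (zdx phix (x, t)) \<le> 1 + C"
   using cmod_le[of "zdx phix (x, t)"] bphix[OF q] by (simp add: zdx_def)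
  show "((\<lambda>x. H (Suc j) (x, t)) has_vector_derivative H j (x, t) * zdx phix (x, t)) (at x)" for j
   by (rule dfx[OF x])
 next
  show "((\<lambda>x. H 1 (x, t)) has_vector_derivative H 0 (x1, t) * zdx phix (x1, t)) (at x1)"
   using dfx[of x1 0] r by simp
 qed (use r in auto)
 note T = this[folded k]
 have "(if K = K then H 0 (x1, t) else H (K - K) (x1, t)) / fact K = c K"
 proof (rule taylor_at_unique[OF lim T tay])
  fix x assume "x \<in> {x\<in>{a<..<b}. \<forall>s\<in>{0..\<tau>}. phi (x, s) = phi (x, 0)}"
  then have x: "x \<in> {a<..<b}" and fl: "\<And>s. s \<in> {0..\<tau>} ==> phi (x, s) = phi (x, 0)" by blast+
  have z: "zmap phi (x, t) = zmap phi (x, 0)" "zmap phi (x1, t) = zmap phi (x1, 0)"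
   using fl[of t] flat1[of t] t unfolding zmap_def by simp_all
  have "\<bar>x - x1\<bar> \<le> norm (zmap phi (x, t) - zmap phi (x1, t))"
   using abs_Re_le_cmod[of "zmap phi (x, t) - zmap phi (x1, t)"] by (simp add: zmap_def)
  moreover have "H K (x, t) = H K (x, 0)"
  proof (rule has_derivative_zero_unique_strong_convex[of "{0..t}" "{0, t}" "\<lambda>s. H K (x, s)" 0])
   show "continuous_on {0..t} (\<lambda>s. H K (x, s))"
    by (rule continuous_on_compose2[OF cH]) (use x t \<tau> in \<open>auto intro!: continuous_intros\<close>)
   fix s assume s: "s \<in> {0..t} - {0, t}"
   have "((\<lambda>s. phi (x, 0)) has_field_derivative phit (x, s)) (at s)"
   proof (rule has_field_derivative_transform_within_open)
    show "((\<lambda>s. phi (x, s)) has_field_derivative phit (x, s)) (at s)"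
     by (rule phi_deriv_t) (use x s t \<tau> in auto)
    show "open {0<..<\<tau>}" "s \<in> {0<..<\<tau>}" using s t by auto
    show "phi (x, u) = phi (x, 0)" if "u \<in> {0<..<\<tau>}" for u using fl[of u] that by simp
   qed
   then have "phit (x, s) = 0" using DERIV_unique[OF _ DERIV_const] by blast
   then have "((\<lambda>s. H K (x, s)) has_vector_derivative 0) (at s)"
    using has_derivative_dform_snd[OF dH[of "(x, s)" k]] x s t \<tau> by (simp add: k zdt_def zero_complex.code[symmetric])
   then show "((\<lambda>s. H K (x, s)) has_derivative (\<lambda>h. 0)) (at s within {0..t})"
    using has_vector_derivative_at_within by (fastforce simp: has_vector_derivative_def)
  qed (use t in auto)
  ultimately show "H K (x, t) = H K (x, 0) \<and> zmap phi (x, t) - zmap phi (x1, t) = zmap phi (x, 0) - zmap phi (x1, 0) \<and>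
    \<bar>x - x1\<bar> \<le> norm (zmap phi (x, t) - zmap phi (x1, t))"
   using z by simp
 next
  have "isCont (\<lambda>x. zmap phi (x, t)) x1"
   using has_derivative_dform_fst[OF zmap_has_derivative[of "(x1, t)"]] x1 t \<tau>
   by (intro has_vector_derivative_continuous) auto
  then show "((\<lambda>x. zmap phi (x, t)) \<longlongrightarrow> zmap phi (x1, t)) (at x1)" by (simp add: isCont_def)
 qed
 then show ?thesis by (simp add: field_simps)
qed

text \<open>Conjugation replaces \<open>Z\<close> by its conjugate and the gap by its negative, and
  keeps entire weights entire; columns that descend below the ground curve are thereby reduced to
  rising ones.\<close>

lemma strip_conj: "strip a b delta C (\<lambda>q. - phi q) (\<lambda>q. - phix q) (\<lambda>q. - phit q) (\<lambda>j q. cnj (H j q)) K"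
proof (unfold_locales)
 have zc: "zmap (\<lambda>q. - phi q) q = cnj (zmap phi q)" "zdx (\<lambda>q. - phix q) q = cnj (zdx phix q)" "zdt (\<lambda>q. - phit q) q = cnj (zdt phit q)" for q
  by (auto simp: zmap_def zdx_def zdt_def complex_eq_iff)
 have df: "(\<lambda>v. cnj (dform p q v)) = dform (cnj p) (cnj q)" for p q
  by (auto simp: dform_def)
 show "((\<lambda>q. - phi q) has_derivative (\<lambda>v. fst v * - phix q + snd v * - phit q)) (at q)" if "q \<in> box0" for q
  using has_derivative_minus[OF dphi[OF that]] by simp
 show "((\<lambda>q. cnj (H (Suc j) q)) has_derivative dform (cnj (H j q) * zdx (\<lambda>q. - phix q) q) (cnj (H j q) * zdt (\<lambda>q. - phit q) q)) (at q)"
  if "q \<in> box1" for j q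
  using has_derivative_cnj[OF dH[OF that, of j]] unfolding df zc by simp
 show "\<exists>P. \<forall>q\<in>box1. (P has_derivative dform (cnj (H j q) * h (zmap (\<lambda>q. - phi q) q) * zdx (\<lambda>q. - phix q) q)
   (cnj (H j q) * h (zmap (\<lambda>q. - phi q) q) * zdt (\<lambda>q. - phit q) q)) (at q)"
  if h: "h holomorphic_on UNIV" for j h
 proof -
  have "(cnj \<circ> h \<circ> cnj) holomorphic_on UNIV"
   using holomorphic_on_compose_cnj_cnj[of h UNIV] h surjI[of cnj cnj] by simp
  from exact[OF this, of j] obtain P where P: "\<And>q. q \<in> box1 ==>
    (P has_derivative dform (H j q * (cnj \<circ> h \<circ> cnj) (zmap phi q) * zdx phix q) (H j q * (cnj \<circ> h \<circ> cnj) (zmap phi q) * zdt phit q)) (at q)" by blast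
  show ?thesis
  proof (intro exI ballI)
   fix q assume "q \<in> box1"
   from has_derivative_cnj[OF P[OF this]]
   show "((\<lambda>q. cnj (P q)) has_derivative dform (cnj (H j q) * h (zmap (\<lambda>q. - phi q) q) * zdx (\<lambda>q. - phix q) q)
     (cnj (H j q) * h (zmap (\<lambda>q. - phi q) q) * zdt (\<lambda>q. - phit q) q)) (at q)"
    unfolding df zc by simp
  qed
 qed
qed (use ab delta C cphix cphit bphix bphit lipphit osc H0 cH in \<open>auto intro!: continuous_intros simp: abs_minus_commute\<close>)

lemma taylor_at_cnj:
 assumes "taylor_at f Z k c x1"
 shows "taylor_at (\<lambda>x. cnj (f x)) (\<lambda>x. cnj (Z x)) k (\<lambda>i. cnj (c i)) x1"
proof -
 have "cnj (f x) - (\<Sum>i\<le>k. cnj (c i) * (cnj (Z x) - cnj (Z x1)) ^ i) = cnj (f x - (\<Sum>i\<le>k. c i * (Z x - Z x1) ^ i))" for x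
  by simp
 then show ?thesis using assms by (simp only: taylor_at_def complex_mod_cnj)
qed

text \<open>The sign of the gap at \<open>(x, t)\<close> decides. Positive and negative gaps are
  handled by \<open>limit_pos\<close> and its conjugate, and a zero gap forces
  \<open>x = x1\<close>. The column over \<open>x1\<close> rises or descends at points arbitrarily
  near \<open>t = 0\<close>, or else it is flat there; \<open>iso\<close> serves the flat
  case.\<close>

theorem strip_limit:
 assumes x1: "x1 \<in> {a<..<b}" and L: "L \<ge> 0" and eta: "eta > 0" and K: "K \<ge> 1"
  and tay: "taylor_at (\<lambda>x. H K (x, 0)) (\<lambda>x. zmap phi (x, 0)) K c x1"
  and iso: "\<And>n. 1 / real (Suc n) < delta ==> (\<forall>s\<in>{0..1 / real (Suc n)}. phi (x1, s) = phi (x1, 0)) ==>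
   x1 islimpt {x\<in>{a<..<b}. \<forall>s\<in>{0..1 / real (Suc n)}. phi (x, s) = phi (x, 0)}"
 shows "\<exists>d>0. \<forall>x t. 0 < t --> t < d --> \<bar>x - x1\<bar> < d --> \<bar>x - x1\<bar> \<le> L * \<bar>gapf x t\<bar> -->
   norm (H 0 (x, t) - fact K * c K) < eta"
proof -
 interpret M: strip a b delta C "\<lambda>q. - phi q" "\<lambda>q. - phix q" "\<lambda>q. - phit q" "\<lambda>j q. cnj (H j q)" K
  by (rule strip_conj)
 have tayM: "taylor_at (\<lambda>x. cnj (H K (x, 0))) (\<lambda>x. zmap (\<lambda>q. - phi q) (x, 0)) K (\<lambda>i. cnj (c i)) x1"
 proof -
  have "(\<lambda>x. zmap (\<lambda>q. - phi q) (x, 0)) = (\<lambda>x. cnj (zmap phi (x, 0)))" by (auto simp: zmap_def complex_eq_iff)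
  then show ?thesis using taylor_at_cnj[OF tay] by simp
 qed
 have nc: "norm (cnj z - fact K * cnj (c K)) = norm (z - fact K * c K)" for z
  by (metis complex_cnj_diff complex_cnj_fact complex_cnj_mult complex_mod_cnj)
 obtain d1 where d1: "d1 > 0" "\<And>x t. 0 < t ==> t < d1 ==> \<bar>x - x1\<bar> < d1 ==> 0 < gapf x t ==> \<bar>x - x1\<bar> \<le> L * gapf x t ==>
   norm (H 0 (x, t) - fact K * c K) < eta"
  using limit_pos[OF x1 L eta tay] by blast
 obtain d2 where d2: "d2 > 0" "\<And>x t. 0 < t ==> t < d2 ==> \<bar>x - x1\<bar> < d2 ==> 0 < - gapf x t ==> \<bar>x - x1\<bar> \<le> L * - gapf x t ==>
   norm (H 0 (x, t) - fact K * c K) < eta"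
  using M.limit_pos[OF x1 L eta tayM] unfolding nc by (auto simp: algebra_simps)
 have "\<exists>\<tau>>0. \<forall>t. 0 < t --> t < \<tau> --> phi (x1, t) = phi (x1, 0) --> H 0 (x1, t) = fact K * c K"
 proof (cases "\<forall>\<tau>>0. \<exists>t. 0 < t \<and> t < \<tau> \<and> phi (x1, t) > phi (x1, 0)")
  case True
  then show ?thesis by (intro limit_plus(2)[OF x1 _ tay L]) auto
 next
  case False
  then obtain \<tau>1 where \<tau>1: "\<tau>1 > 0" "\<And>t. 0 < t ==> t < \<tau>1 ==> phi (x1, t) \<le> phi (x1, 0)" by force
  show ?thesis
  proof (cases "\<forall>\<tau>>0. \<exists>t. 0 < t \<and> t < \<tau> \<and> - phi (x1, t) > - phi (x1, 0)")
   case True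
   then have "\<exists>\<tau>>0. \<forall>t. 0 < t --> t < \<tau> --> - phi (x1, t) = - phi (x1, 0) --> cnj (H 0 (x1, t)) = fact K * cnj (c K)"
    by (intro M.limit_plus(2)[OF x1 _ tayM L]) auto
   moreover have "fact K * cnj (c K) = cnj (fact K * c K)" by simp
   ultimately show ?thesis by (simp only: complex_cnj_cancel_iff neg_equal_iff_equal)
  next
   case False
   then obtain \<tau>2 where \<tau>2: "\<tau>2 > 0" "\<And>t. 0 < t ==> t < \<tau>2 ==> - phi (x1, t) \<le> - phi (x1, 0)" by force
   have "0 < min delta (min \<tau>1 \<tau>2)" using delta \<tau>1 \<tau>2 by simp
   then obtain n where n: "1 / real (Suc n) < min delta (min \<tau>1 \<tau>2)"
    using nat_approx_posE by blast
   have fl: "phi (x1, s) = phi (x1, 0)" if "s \<in> {0..1 / real (Suc n)}" for s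
   proof (cases "s = 0")
    case False
    then show ?thesis using \<tau>1(2)[of s] \<tau>2(2)[of s] n that by simp
   qed simp
   have "H 0 (x1, t) = fact K * c K" if "0 < t" "t < 1 / real (Suc n)" for t
   proof (rule flat_limit[OF x1 _ K tay fl _ that])
    show "1 / real (Suc n) < delta" using n by simp
    then show "x1 islimpt {x\<in>{a<..<b}. \<forall>s\<in>{0..1 / real (Suc n)}. phi (x, s) = phi (x, 0)}"
     using iso[of n] fl by blast
   qed
   then show ?thesis by (intro exI[of _ "1 / real (Suc n)"]) auto
  qed
 qed
 then obtain \<tau> where \<tau>: "\<tau> > 0" "\<And>t. 0 < t ==> t < \<tau> ==> phi (x1, t) = phi (x1, 0) ==> H 0 (x1, t) = fact K * c K" by blast
 have "norm (H 0 (x, t) - fact K * c K) < eta"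
  if t: "0 < t" "t < min d1 (min d2 \<tau>)" "\<bar>x - x1\<bar> < min d1 (min d2 \<tau>)" "\<bar>x - x1\<bar> \<le> L * \<bar>gapf x t\<bar>" for x t
 proof (cases "gapf x t" "0::real" rule: linorder_cases)
  case less
  then show ?thesis using d2(2)[of t x] t by simp
 next
  case equal
  then have "x = x1" using t by simp
  then show ?thesis using \<tau>(2)[of t] equal t eta by simp
 next
  case greater
  then show ?thesis using d1(2)[of t x] t by simp
 qed
 then show ?thesis using d1(1) d2(1) \<tau>(1) by (intro exI[of _ "min d1 (min d2 \<tau>)"]) auto
qed

end

section \<open>Boundary values as iterated derivatives\<close>

text \<open>Support in a fixed closed interval instead of a compact subset of an open one: all
  integrals can be taken over \<open>{a1..b1}\<close>, and boundary terms vanish since continuity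
  forces zeros at the end points.\<close>

definition test_in :: "real => real => (real => complex) => bool" where
 "test_in a1 b1 u \<longleftrightarrow> smooth_on UNIV u \<and> (\<forall>x. x \<notin> {a1..b1} --> u x = 0)"

text \<open>For \<open>z' = Z'\<close> this is the transpose, up to sign, of differentiation with respect to \<open>Z\<close>.\<close>

definition wd :: "(real => complex) => (real => complex) => real => complex" where
 "wd z' u = pd 1 (\<lambda>x. u x / z' x)"

lemma smooth_on_has_vector_derivative:
 fixes f :: "real => 'b::real_normed_vector"
 assumes "smooth_on S f" "open S" "x \<in> S"
 shows "(f has_vector_derivative pd 1 f x) (at x)"
proof -
 note D = smooth_on_has_derivative[OF assms]
 then have "frechet_derivative f (at x) h = h *\<^sub>R pd 1 f x" for h
  using linear_scale[OF has_derivative_linear[OF D], of h 1] by simp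
 then have "frechet_derivative f (at x) = (\<lambda>h. h *\<^sub>R pd 1 f x)" by (rule ext)
 then show ?thesis using D by (simp add: has_vector_derivative_def)
qed

lemma test_in_continuous: "test_in a1 b1 u ==> continuous_on S u"
 unfolding test_in_def using smooth_on_imp_continuous_on continuous_on_subset by blast

lemma test_in_eq_0:
 assumes "test_in a1 b1 u" "x \<notin> {a1<..<b1}" shows "u x = 0"
proof (cases "x \<in> {a1..b1}")
 case True
 have c: "isCont u x" using test_in_continuous[OF assms(1), of UNIV] by (simp add: continuous_on_eq_continuous_at)
 from True assms(2) consider "x = a1" | "x = b1" by fastforce
 then show ?thesis
 proof cases
  case 1
  have "(u \<longlongrightarrow> u x) (at_left x)" using c by (simp add: isCont_def filterlim_at_split)
  moreover have "\<forall>\<^sub>F y in at_left x. u y = 0"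
   unfolding eventually_at_filter using assms(1) 1 by (auto simp: test_in_def)
  ultimately show ?thesis using tendsto_unique[OF trivial_limit_at_left_real _ tendsto_eventually] by blast
 next
  case 2
  have "(u \<longlongrightarrow> u x) (at_right x)" using c by (simp add: isCont_def filterlim_at_split)
  moreover have "\<forall>\<^sub>F y in at_right x. u y = 0"
   unfolding eventually_at_filter using assms(1) 2 by (auto simp: test_in_def)
  ultimately show ?thesis using tendsto_unique[OF trivial_limit_at_right_real _ tendsto_eventually] by blast
 qed
qed (use assms in \<open>auto simp: test_in_def\<close>)

lemma test_in_product:
 assumes ab: "a < a1" "b1 < b" and z: "smooth_on {a<..<b} z'" and u: "test_in a1 b1 u"
 shows "test_in a1 b1 (\<lambda>x. u x * z' x)"
proof -
 have "smooth_on {a<..<b} u" using u smooth_on_subset[of UNIV u "{a<..<b}"] by (simp add: test_in_def)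
 then have "smooth_on {a<..<b} (\<lambda>x. u x * z' x)" by (intro smooth_on_mult z) auto
 moreover have "smooth_on (- {a1..b1}) (\<lambda>x. u x * z' x)"
  by (rule smooth_on_cong[of _ "\<lambda>_. 0"]) (use u in \<open>auto simp: test_in_def\<close>)
 ultimately have "smooth_on ({a<..<b} \<union> - {a1..b1}) (\<lambda>x. u x * z' x)" by (intro smooth_on_Un) auto
 moreover have "{a<..<b} \<union> - {a1..b1} = UNIV" using ab by auto
 ultimately show ?thesis using u by (simp add: test_in_def)
qed

lemma test_in_quotient:
 assumes "a < a1" "b1 < b" "smooth_on {a<..<b} z'" "\<And>x. x \<in> {a<..<b} ==> z' x \<noteq> 0" "test_in a1 b1 u"
 shows "test_in a1 b1 (\<lambda>x. u x / z' x)"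
 unfolding divide_inverse using assms by (intro test_in_product[OF assms(1,2)] smooth_on_inverse) auto

lemma test_in_pd: "test_in a1 b1 u ==> test_in a1 b1 (pd 1 u)"
 unfolding test_in_def
proof (intro conjI allI impI)
 assume u: "smooth_on UNIV u \<and> (\<forall>x. x \<notin> {a1..b1} --> u x = 0)"
 then show "smooth_on UNIV (pd 1 u)" by (intro smooth_on_pd) auto
 fix x assume "x \<notin> {a1..b1}"
 then have "frechet_derivative u (at x) = frechet_derivative (\<lambda>_. 0) (at x)"
  by (intro frechet_derivative_cong_open[of "- {a1..b1}"]) (use u in auto)
 then show "pd 1 u x = 0" by simp
qed

lemma test_in_has_vector_derivative: "test_in a1 b1 u ==> (u has_vector_derivative pd 1 u x) (at x)"
 unfolding test_in_def using smooth_on_has_vector_derivative by blast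

lemma test_in_wd:
 assumes "a < a1" "b1 < b" "smooth_on {a<..<b} z'" "\<And>x. x \<in> {a<..<b} ==> z' x \<noteq> 0" "test_in a1 b1 u"
 shows "test_in a1 b1 (wd z' u)" "((\<lambda>x. u x / z' x) has_vector_derivative wd z' u x) (at x)"
 unfolding wd_def using test_in_quotient[OF assms] test_in_pd test_in_has_vector_derivative by blast+

text \<open>The product rule for \<open>F\<close> times \<open>u / z'\<close>: the factor
  \<open>z'\<close> in the derivative of \<open>F\<close> cancels, and \<open>wd z' u\<close> is the
  derivative of the other factor.\<close>

lemma integral_by_parts_test:
 fixes F f z' u :: "real => complex"
 assumes ab: "a < a1" "a1 \<le> b1" "b1 < b" and z: "smooth_on {a<..<b} z'" "\<And>x. x \<in> {a<..<b} ==> z' x \<noteq> 0"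
  and u: "test_in a1 b1 u"
  and F: "\<And>x. x \<in> {a1..b1} ==> (F has_vector_derivative f x * z' x) (at x within {a1..b1})"
  and f: "continuous_on {a1..b1} f"
 shows "integral {a1..b1} (\<lambda>x. f x * u x) = - integral {a1..b1} (\<lambda>x. F x * wd z' u x)"
proof -
 have cF: "continuous_on {a1..b1} F" by (rule continuous_on_vector_derivative[OF F])
 note w = test_in_wd[OF ab(1,3) z u]
 have "((\<lambda>x. F x * wd z' u x + f x * u x) has_integral F b1 * (u b1 / z' b1) - F a1 * (u a1 / z' a1)) {a1..b1}"
 proof (rule fundamental_theorem_of_calculus[OF ab(2)])
  fix x assume x: "x \<in> {a1..b1}"
  have "((\<lambda>x. F x * (u x / z' x)) has_vector_derivative F x * wd z' u x + (f x * z' x) * (u x / z' x)) (at x within {a1..b1})"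
   by (rule has_vector_derivative_mult[OF F[OF x] has_vector_derivative_at_within[OF w(2)]])
  moreover have "(f x * z' x) * (u x / z' x) = f x * u x" using z(2)[of x] x ab by simp
  ultimately show "((\<lambda>x. F x * (u x / z' x)) has_vector_derivative F x * wd z' u x + f x * u x) (at x within {a1..b1})" by simp
 qed
 moreover have "u a1 = 0" "u b1 = 0" using test_in_eq_0[OF u] by auto
 ultimately have "integral {a1..b1} (\<lambda>x. F x * wd z' u x + f x * u x) = 0" by (simp add: integral_unique)
 moreover have "integral {a1..b1} (\<lambda>x. F x * wd z' u x + f x * u x)
   = integral {a1..b1} (\<lambda>x. F x * wd z' u x) + integral {a1..b1} (\<lambda>x. f x * u x)"
  by (intro integral_add integrable_continuous_real continuous_intros cF f test_in_continuous[OF w(1)] test_in_continuous[OF u])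
 ultimately show ?thesis by (simp add: add_eq_0_iff)
qed

text \<open>\<open>g\<close> is merely integrable, so its indefinite integral need not be
  differentiable everywhere and the product rule is not at hand. Fubini on the triangle
  \<open>s \<le> x\<close> takes its place.\<close>

lemma integral_by_parts_integrable:
 fixes g W W' :: "real => complex"
 assumes ab: "a1 \<le> b1" and g: "integrable (lebesgue_on {a1..b1}) g"
  and W: "\<And>x. x \<in> {a1..b1} ==> (W has_vector_derivative W' x) (at x within {a1..b1})" "continuous_on {a1..b1} W'" "W b1 = 0"
 shows "(LINT s|lebesgue_on {a1..b1}. g s * W s) = - integral {a1..b1} (\<lambda>x. integral {a1..x} g * W' x)"
proof -
 define M where "M = lebesgue_on {a1..b1}"
 have fin: "finite_measure M"
  unfolding M_def by (rule finite_measureI) (use ab in \<open>simp add: emeasure_restrict_space\<close>)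
 interpret M: finite_measure M by (rule fin)
 interpret P: pair_sigma_finite M M ..
 have spM: "space M = {a1..b1}" by (simp add: M_def)
 have contM: "integrable M f" if "continuous_on {a1..b1} f" for f :: "real => complex"
  unfolding M_def using that by (rule continuous_imp_integrable_real)
 have bM: "f \<in> borel_measurable M" if "f \<in> borel_measurable borel" for f :: "real => real"
  unfolding M_def using that by (intro measurable_restrict_space1 measurable_completion) simp
 define F where "F s x = indicator {s..} x *\<^sub>R (g s * W' x)" for s x :: real
 have gm: "g \<in> borel_measurable M" using g by (simp add: M_def)
 have W'm: "W' \<in> borel_measurable M" using contM[OF W(2)] by simp
 have idm: "(\<lambda>x. x) \<in> borel_measurable M" by (rule bM) simp
 have Fm: "case_prod F \<in> borel_measurable (M \<Otimes>\<^sub>M M)"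
 proof -
  have "(\<lambda>q. fst q) \<in> borel_measurable (M \<Otimes>\<^sub>M M)" "(\<lambda>q. snd q) \<in> borel_measurable (M \<Otimes>\<^sub>M M)"
   using measurable_compose[OF measurable_fst idm] measurable_compose[OF measurable_snd idm] by auto
  then have "{q \<in> space (M \<Otimes>\<^sub>M M). fst q \<le> snd q} \<in> sets (M \<Otimes>\<^sub>M M)"
   by (rule borel_measurable_le)
  then have i: "(\<lambda>q. indicator {q \<in> space (M \<Otimes>\<^sub>M M). fst q \<le> snd q} q :: real) \<in> borel_measurable (M \<Otimes>\<^sub>M M)"
   by (rule borel_measurable_indicator)
  have p: "(\<lambda>q. g (fst q) * W' (snd q)) \<in> borel_measurable (M \<Otimes>\<^sub>M M)"
   by (intro borel_measurable_times measurable_compose[OF measurable_fst gm] measurable_compose[OF measurable_snd W'm])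
  have "(\<lambda>q. indicator {q \<in> space (M \<Otimes>\<^sub>M M). fst q \<le> snd q} q *\<^sub>R (g (fst q) * W' (snd q))) \<in> borel_measurable (M \<Otimes>\<^sub>M M)"
   by (rule borel_measurable_scaleR[OF i p])
  then show ?thesis
   by (rule measurable_cong[THEN iffD1, rotated]) (auto simp: F_def indicator_def)
 qed
 obtain C where C: "\<And>x. x \<in> {a1..b1} ==> norm (W' x) \<le> C"
  using compact_norm_bound[OF _ W(2)] by auto
 have nF: "norm (F s x) \<le> norm (g s) * C" if "x \<in> {a1..b1}" for s x
  using C[OF that] order_trans[OF norm_ge_zero C[OF that]] by (auto simp: F_def indicator_def norm_mult intro!: mult_left_mono)
 have Fs: "integrable M (F s)" for s
 proof (rule M.integrable_const_bound)
  show "AE x in M. norm (F s x) \<le> norm (g s) * C" using nF by (intro AE_I2) (simp add: spM)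
  have "{s..} \<inter> space M \<in> sets M" by (auto simp: M_def sets_restrict_space)
  then have "(\<lambda>x. indicator {s..} x :: real) \<in> borel_measurable M" by (subst borel_measurable_indicator_iff)
  then show "F s \<in> borel_measurable M" unfolding F_def[abs_def]
   by (intro borel_measurable_scaleR borel_measurable_times W'm) auto
 qed
 have Fint: "integrable (M \<Otimes>\<^sub>M M) (case_prod F)"
 proof (rule P.Fubini_integrable[OF Fm])
  have m: "(\<lambda>s. LINT x|M. norm (case_prod F (s, x))) \<in> borel_measurable M"
   using Fm by (intro M.borel_measurable_lebesgue_integral) auto
  show "integrable M (\<lambda>s. LINT x|M. norm (case_prod F (s, x)))"
  proof (rule Bochner_Integration.integrable_bound[OF _ m])
   show "integrable M (\<lambda>s. measure M (space M) * C * norm (g s))"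
    using g by (auto simp: M_def intro!: integrable_mult_right)
   show "AE s in M. norm (LINT x|M. norm (case_prod F (s, x))) \<le> norm (measure M (space M) * C * norm (g s))"
   proof (rule AE_I2)
    fix s
    have "(LINT x|M. norm (F s x)) \<le> (LINT x|M. norm (g s) * C)"
     by (rule integral_mono) (use Fs[of s] nF in \<open>auto simp: spM\<close>)
    also have "\<dots> = measure M (space M) * C * norm (g s)" by simp
    finally show "norm (LINT x|M. norm (case_prod F (s, x))) \<le> norm (measure M (space M) * C * norm (g s))"
     by (simp add: integral_nonneg_AE abs_le_iff[of "LINT x|M. norm (F s x)"] del: abs_mult norm_mult)
   qed
  qed
  show "AE s in M. integrable M (\<lambda>x. case_prod F (s, x))" using Fs by simp
 qed
 have HK: "(LINT x|M. f x) = integral {a1..b1} f" if "integrable M f" for f :: "real => complex"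
  using lebesgue_integral_eq_integral[of "{a1..b1}" f] that by (simp add: M_def)
 have inner1: "(LINT x|M. F s x) = - (g s * W s)" if s: "s \<in> {a1..b1}" for s
 proof -
  have "(LINT x|M. F s x) = integral {a1..b1} (F s)" by (rule HK[OF Fs])
  also have "\<dots> = integral {a1..b1} (\<lambda>x. if x \<in> {s..b1} then g s * W' x else 0)"
   by (rule integral_cong) (auto simp: F_def indicator_def)
  also have "\<dots> = integral {s..b1} (\<lambda>x. g s * W' x)" 
   using integral_restrict_Int[of "{a1..b1}" "{s..b1}" "\<lambda>x. g s * W' x"] s by (simp add: inf.absorb2)
  also have "\<dots> = g s * integral {s..b1} W'" by simp
  also have "integral {s..b1} W' = W b1 - W s"
  proof (rule integral_unique[OF fundamental_theorem_of_calculus])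
   fix x assume "x \<in> {s..b1}"
   then show "(W has_vector_derivative W' x) (at x within {s..b1})"
    using W(1)[of x] s by (auto intro: has_vector_derivative_within_subset)
  qed (use s in auto)
  finally show ?thesis using W(3) by simp
 qed
 have inner2: "(LINT s|M. F s x) = integral {a1..x} g * W' x" if x: "x \<in> {a1..b1}" for x
 proof -
  have "(LINT s|M. F s x) = (LINT s|M. (indicator {a1..x} s *\<^sub>R g s) * W' x)"
   by (rule Bochner_Integration.integral_cong) (auto simp: F_def indicator_def spM)
  also have "\<dots> = (LINT s|M. indicator {a1..x} s *\<^sub>R g s) * W' x"
   by (rule Bochner_Integration.integral_mult_left_zero)
  also have "(LINT s|M. indicator {a1..x} s *\<^sub>R g s) = integral {a1..b1} (\<lambda>s. indicator {a1..x} s *\<^sub>R g s)"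
  proof (rule HK, rule integrable_mult_indicator)
   show "{a1..x} \<in> sets M" using x by (auto simp: M_def sets_restrict_space intro!: image_eqI[of _ _ "{a1..x}"])
  qed (use g in \<open>simp add: M_def\<close>)
  also have "\<dots> = integral {a1..b1} (\<lambda>s. if s \<in> {a1..x} then g s else 0)"
   by (rule integral_cong) (auto simp: indicator_def)
  also have "\<dots> = integral {a1..x} g"
   using integral_restrict_Int[of "{a1..b1}" "{a1..x}" g] x by (simp add: inf.absorb2)
  finally show ?thesis .
 qed
 have cB: "continuous_on {a1..b1} (\<lambda>x. integral {a1..x} g)"
  by (rule indefinite_integral_continuous_1) (use g in \<open>simp add: integrable_on_lebesgue_on\<close>)
 have "(LINT s|M. g s * W s) = (LINT s|M. - (LINT x|M. F s x))"
  by (rule Bochner_Integration.integral_cong) (auto simp: inner1 spM)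
 also have "\<dots> = - (LINT s|M. LINT x|M. F s x)" by simp
 also have "(LINT s|M. LINT x|M. F s x) = (LINT x|M. LINT s|M. F s x)"
  using P.Fubini_integral[OF Fint] by simp
 also have "\<dots> = (LINT x|M. integral {a1..x} g * W' x)"
  by (rule Bochner_Integration.integral_cong) (auto simp: inner2 spM)
 also have "\<dots> = integral {a1..b1} (\<lambda>x. integral {a1..x} g * W' x)"
  by (intro HK contM continuous_intros cB W)
 finally show ?thesis by (simp add: M_def)
qed

lemma smooth_bump: "smooth_on UNIV (bump eta n s)"
proof -
 have "smooth_on UNIV (\<lambda>u::real. scale eta n * (u - s))"
  by (intro smooth_on_mult smooth_on_diff smooth_on_const smooth_on_bounded_linear[OF bounded_linear_ident] open_UNIV)
 moreover have "smooth_on UNIV dstep" unfolding dstep_def by (intro smooth_on_pd smooth_step) simp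
 ultimately have "smooth_on UNIV (\<lambda>u. dstep (scale eta n * (u - s)))"
  using smooth_on_compose[OF open_UNIV open_UNIV subset_UNIV] by blast
 then show ?thesis by (intro smooth_on_mult) auto
qed

lemma test_in_bump:
 assumes "eta > 0" "a1 \<le> s" "s + eta \<le> b1"
 shows "test_in a1 b1 (\<lambda>u. of_real (bump eta n s u))"
 unfolding test_in_def
proof (intro conjI allI impI)
 show "smooth_on UNIV (\<lambda>u. complex_of_real (bump eta n s u))"
  by (rule smooth_on_linear_compose[OF bounded_linear_of_real open_UNIV smooth_bump])
 show "complex_of_real (bump eta n s u) = 0" if "u \<notin> {a1..b1}" for u
  using bump_eq_0[OF assms(1), of u s n] that assms by auto
qed

lemma lint_test:
 assumes f: "continuous_on {a1..b1} f" and u: "test_in a1 b1 u"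
 shows "(LINT x|lborel. f x * u x) = integral {a1..b1} (\<lambda>x. f x * u x)"
proof -
 have "continuous_on {a1..b1} (\<lambda>x. f x * u x)" by (intro continuous_intros f test_in_continuous[OF u])
 then have "set_integrable lborel {a1..b1} (\<lambda>x. f x * u x)" by (rule borel_integrable_atLeastAtMost')
 from set_borel_integral_eq_integral(2)[OF this]
 have "(LINT x|lborel. indicator {a1..b1} x *\<^sub>R (f x * u x)) = integral {a1..b1} (\<lambda>x. f x * u x)"
  by (simp add: set_lebesgue_integral_def)
 moreover have "indicator {a1..b1} x *\<^sub>R (f x * u x) = f x * u x" for x
  using u by (auto simp: test_in_def indicator_def)
 ultimately show ?thesis by simp
qed

text \<open>Bumps concentrating at \<open>x\<close> from the right, inside \<open>{x..b1}\<close>,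
  are admissible test functions and reproduce the value of the continuous function
  \<open>v\<close>.\<close>

lemma weak_zero:
 assumes v: "continuous_on {a1..b1} v" and x: "x \<in> {a1<..<b1}"
  and weak: "\<And>u. test_in a1 b1 u ==> integral {a1..b1} (\<lambda>x. v x * u x) = 0"
 shows "v x = (0::complex)"
proof -
 define eta where "eta = b1 - x"
 have eta: "eta > 0" using x by (simp add: eta_def)
 have sub: "{x..x + 1 / scale eta n} \<subseteq> {a1..b1}" for n
  using scale_inverse_le[OF eta, of n] x by (auto simp: eta_def)
 obtain B where B: "\<And>y. y \<in> {a1..b1} ==> norm (v y) \<le> B" using compact_norm_bound[OF _ v] by auto
 have "(\<lambda>n. LINT u|lborel. (scale eta n * dstep (scale eta n * (u - x))) *\<^sub>R v u) \<longlonglongrightarrow> v x"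
 proof (rule dstep_kernel_limit[OF scale_pos[OF eta]])
  show "continuous_on {x..x + 1 / scale eta n} v" for n by (rule continuous_on_subset[OF v sub])
  show "norm (v u) \<le> B" if "u \<in> {x..x + 1 / scale eta n}" for n u using B sub that by blast
  fix s :: real assume s: "s \<in> {0..1}"
  have "(\<lambda>n. s / scale eta n) \<longlonglongrightarrow> 0"
   by (rule real_tendsto_divide_at_top[OF tendsto_const filterlim_scale[OF eta]])
  then have "(\<lambda>n. x + s / scale eta n) \<longlonglongrightarrow> x" using tendsto_add[OF tendsto_const] by fastforce
  moreover have "isCont v x"
   using v x continuous_on_interior[of "{a1..b1}" v x] by simp
  ultimately show "(\<lambda>n. v (x + s / scale eta n)) \<longlonglongrightarrow> v x" by (rule isCont_tendsto_compose[rotated])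
 qed
 moreover have "(LINT u|lborel. (scale eta n * dstep (scale eta n * (u - x))) *\<^sub>R v u) = 0" for n
 proof -
  have t: "test_in a1 b1 (\<lambda>u. of_real (bump eta n x u))" by (rule test_in_bump[OF eta]) (use x in \<open>auto simp: eta_def\<close>)
  show ?thesis using lint_test[OF v t] weak[OF t] by (simp add: scaleR_conv_of_real mult_ac)
 qed
 ultimately show ?thesis by (simp add: LIMSEQ_const_iff)
qed

lemma test_in_unit:
 assumes "a1 < b1" obtains u where "test_in a1 b1 u" "integral {a1..b1} u = 1"
proof
 define c where "c = scale (b1 - a1) 0"
 have c: "c * (b1 - a1) = 1" using assms by (simp add: c_def scale_def)
 show "test_in a1 b1 (\<lambda>u. of_real (bump (b1 - a1) 0 a1 u))" by (rule test_in_bump) (use assms in auto)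
 have "((\<lambda>u. of_real (bump (b1 - a1) 0 a1 u)) has_integral complex_of_real (step (c * (b1 - a1))) - of_real (step (c * (a1 - a1)))) {a1..b1}"
 proof (rule fundamental_theorem_of_calculus)
  fix x
  have "((\<lambda>x. step (c * (x - a1))) has_field_derivative bump (b1 - a1) 0 a1 x) (at x)"
  proof -
   have "((\<lambda>x. c * (x - a1)) has_field_derivative c) (at x)" by (auto intro!: derivative_eq_intros)
   from DERIV_chain2[OF step_has_derivative this] show ?thesis by (simp add: c_def mult.commute)
  qed
  then have "((\<lambda>x. complex_of_real (step (c * (x - a1)))) has_vector_derivative of_real (bump (b1 - a1) 0 a1 x)) (at x)"
   by (intro has_vector_derivative_of_real) (simp add: has_real_derivative_iff_has_vector_derivative)
  then show "((\<lambda>x. complex_of_real (step (c * (x - a1)))) has_vector_derivative of_real (bump (b1 - a1) 0 a1 x)) (at x within {a1..b1})"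
   by (rule has_vector_derivative_at_within)
 qed (use assms in simp)
 moreover have "complex_of_real (step (c * (b1 - a1))) - of_real (step (c * (a1 - a1))) = 1"
  by (simp add: c step_ge_1 step_le_0)
 ultimately show "integral {a1..b1} (\<lambda>u. complex_of_real (bump (b1 - a1) 0 a1 u)) = 1"
  by (simp only: integral_unique)
qed

text \<open>The vanishing of the integral is what makes the indefinite integral vanish to the right
  of \<open>b1\<close>.\<close>

lemma test_in_antiderivative:
 assumes u: "test_in a1 b1 u" and ab: "a1 \<le> b1" and zero: "integral {a1..b1} u = 0"
 obtains U where "test_in a1 b1 U" "pd 1 U = u"
proof
 define U where "U x = integral {a1..x} u" for x
 have cu: "continuous_on S u" for S by (rule test_in_continuous[OF u])
 have ui: "u integrable_on {x..y}" for x y by (intro integrable_continuous_real cu)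
 have z: "integral {x..y} u = 0" if "y \<le> a1 \<or> b1 \<le> x" for x y
 proof -
  have "integral {x..y} u = integral {x..y} (\<lambda>_. 0)"
   by (rule integral_cong) (use that test_in_eq_0[OF u] in auto)
  then show ?thesis by simp
 qed
 have Uc: "U y = integral {c..y} u" if "c \<le> a1" "c \<le> y" for c y
 proof (cases "a1 \<le> y")
  case True
  then show ?thesis
   using Henstock_Kurzweil_Integration.integral_combine[of c a1 y u] that ui z[of a1 c] by (simp add: U_def)
 next
  case False
  then show ?thesis using z[of y c] by (simp add: U_def)
 qed
 have dU: "(U has_vector_derivative u x) (at x)" for x
 proof -
  define c where "c = min a1 x - 1"
  have "((\<lambda>y. integral {c..y} u) has_vector_derivative u x) (at x within {c..x + 1})"
   by (rule integral_has_vector_derivative[OF cu]) (auto simp: c_def)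
  moreover have "at x within {c..x + 1} = at x" by (rule at_within_Icc_at) (auto simp: c_def)
  ultimately have "((\<lambda>y. integral {c..y} u) has_vector_derivative u x) (at x)" by simp
  then show ?thesis
  proof (rule has_vector_derivative_transform_within_open[of _ _ _ "{c<..}"])
   show "integral {c..y} u = U y" if "y \<in> {c<..}" for y
    using Uc[of c y] that by (auto simp: c_def)
  qed (auto simp: c_def)
 qed
 show pdU: "pd 1 U = u"
  using frechet_derivative_real[OF dU] by auto
 have "U x = 0" if "x \<notin> {a1..b1}" for x
 proof (cases "x < a1")
  case False
  then have "b1 < x" using that by auto
  then show ?thesis
   using Henstock_Kurzweil_Integration.integral_combine[of a1 b1 x u] ab ui z[of x b1] zero by (simp add: U_def)
 qed (simp add: U_def)
 moreover have "smooth_on UNIV U"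
 proof -
  have "U differentiable_on UNIV"
   using dU by (auto simp: differentiable_on_def differentiable_def has_vector_derivative_def)
  then show ?thesis using u pdU by (subst smooth_on_iff_pd) (auto simp: test_in_def)
 qed
 ultimately show "test_in a1 b1 U" by (simp add: test_in_def)
qed

lemma test_in_diff_scale:
 assumes u: "test_in a1 b1 u" and v: "test_in a1 b1 v"
 shows "test_in a1 b1 (\<lambda>x. u x - d * v x)"
 using u v unfolding test_in_def
 by (auto intro!: smooth_on_diff smooth_on_mult)

section \<open>Weak polynomials in \<open>Z\<close> and du Bois-Reymond's lemma\<close>

locale weighted =
 fixes a b a1 b1 :: real and z' Z :: "real => complex"
 assumes ab: "a < a1" "a1 < b1" "b1 < b" and z: "smooth_on {a<..<b} z'" "\<And>x. x \<in> {a<..<b} ==> z' x \<noteq> 0"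
  and dZ: "\<And>x. x \<in> {a<..<b} ==> (Z has_vector_derivative z' x) (at x)"
begin

lemma wd: "test_in a1 b1 u ==> test_in a1 b1 (wd z' u)"
  "test_in a1 b1 u ==> ((\<lambda>x. u x / z' x) has_vector_derivative wd z' u x) (at x)"
 using test_in_wd[OF ab(1,3) z] by blast+

lemma wd_power: "test_in a1 b1 u ==> test_in a1 b1 ((wd z' ^^ k) u)"
 by (induction k) (auto intro: wd)

lemma wd_power_diff:
 assumes u: "test_in a1 b1 u" and v: "test_in a1 b1 v"
 shows "(wd z' ^^ k) (\<lambda>x. u x - d * v x) = (\<lambda>x. (wd z' ^^ k) u x - d * (wd z' ^^ k) v x)"
proof (induction k)
 case (Suc k)
 define p q where "p = (wd z' ^^ k) u" and "q = (wd z' ^^ k) v"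
 have pq: "test_in a1 b1 p" "test_in a1 b1 q" unfolding p_def q_def using wd_power u v by blast+
 have "wd z' (\<lambda>x. p x - d * q x) x = wd z' p x - d * wd z' q x" for x
 proof -
  have "((\<lambda>x. p x / z' x - d * (q x / z' x)) has_vector_derivative wd z' p x - d * wd z' q x) (at x)"
   by (intro has_vector_derivative_diff has_vector_derivative_mult_right wd(2) pq)
  then have "((\<lambda>x. (p x - d * q x) / z' x) has_vector_derivative wd z' p x - d * wd z' q x) (at x)"
   by (simp add: diff_divide_distrib)
  from frechet_derivative_real[OF this, of 1] show ?thesis by (simp add: wd_def)
 qed
 then show ?case using Suc by (simp add: p_def q_def)
qed simp

lemma continuous_Z: "continuous_on {a1..b1} Z" "continuous_on {a1..b1} z'"
proof -
 show "continuous_on {a1..b1} Z"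
  by (rule continuous_on_vector_derivative[of _ _ z']) (use ab in \<open>auto intro!: has_vector_derivative_at_within[OF dZ]\<close>)
 show "continuous_on {a1..b1} z'"
  by (rule continuous_on_subset[OF smooth_on_imp_continuous_on[OF z(1)]]) (use ab in auto)
qed

lemma power_derivative:
 assumes x: "x \<in> {a<..<b}"
 shows "((\<lambda>x. Z x ^ Suc k / fact (Suc k)) has_vector_derivative (Z x ^ k / fact k) * z' x) (at x)"
proof -
 have "((\<lambda>w. w ^ Suc k) has_field_derivative of_nat (Suc k) * Z x ^ k) (at (Z x))"
  using DERIV_power[OF DERIV_ident, of "Suc k" "Z x" UNIV] by (simp del: power_Suc of_nat_Suc)
 then have "((\<lambda>w. w ^ Suc k / fact (Suc k)) has_field_derivative of_nat (Suc k) * Z x ^ k / fact (Suc k)) (at (Z x))"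
  by (rule DERIV_cdivide)
 moreover have "of_nat (Suc k) * Z x ^ k / fact (Suc k) = Z x ^ k / fact k"
  using of_nat_neq_0[of k, where 'a = complex] by (simp del: of_nat_Suc)
 ultimately have "((\<lambda>w. w ^ Suc k / fact (Suc k)) has_field_derivative Z x ^ k / fact k) (at (Z x))" by simp
 from field_vector_diff_chain_at[OF dZ[OF x] this] show ?thesis by (simp add: o_def mult.commute)
qed

lemma integral_power:
 assumes u: "test_in a1 b1 u"
 shows "integral {a1..b1} (\<lambda>x. Z x ^ k / fact k * (wd z' ^^ k) u x) = (- 1) ^ k * integral {a1..b1} u"
proof (induction k)
 case (Suc k)
 have "integral {a1..b1} (\<lambda>x. Z x ^ k / fact k * (wd z' ^^ k) u x)
   = - integral {a1..b1} (\<lambda>x. Z x ^ Suc k / fact (Suc k) * wd z' ((wd z' ^^ k) u) x)"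
 proof (rule integral_by_parts_test[OF ab(1) less_imp_le[OF ab(2)] ab(3) z wd_power[OF u]])
  show "((\<lambda>x. Z x ^ Suc k / fact (Suc k)) has_vector_derivative Z x ^ k / fact k * z' x) (at x within {a1..b1})"
   if "x \<in> {a1..b1}" for x
   by (rule has_vector_derivative_at_within[OF power_derivative]) (use that ab in auto)
  show "continuous_on {a1..b1} (\<lambda>x. Z x ^ k / fact k)" by (intro continuous_intros continuous_Z) simp
 qed
 then have "integral {a1..b1} (\<lambda>x. Z x ^ Suc k / fact (Suc k) * wd z' ((wd z' ^^ k) u) x) = - ((- 1) ^ k * integral {a1..b1} u)"
  using Suc by (simp only: minus_minus)
 then show ?case by (simp only: funpow.simps o_apply power_Suc mult_minus1 mult_minus_left mult_1_left)
qed simp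

text \<open>Modulo images of \<open>wd\<close>, a test function is determined by its integral. So
  the pairing of \<open>v\<close> with \<open>(wd z' ^^ k) u\<close> depends on the integral of
  \<open>u\<close> alone, as it does for the monomial \<open>Z^k / k!\<close>, and subtracting a
  multiple of the monomial lowers the order. The resulting polynomial is delivered as a chain
  \<open>w\<close> of successive primitives, the form in which it joins the primitives of
  \<open>g\<close> in \<open>taylor_chain\<close>.\<close>

lemma weak_polynomial:
 assumes v: "continuous_on {a1..b1} v"
  and weak: "\<And>u. test_in a1 b1 u ==> integral {a1..b1} (\<lambda>x. v x * (wd z' ^^ k) u x) = 0"
 shows "\<exists>w. w 0 = (\<lambda>_. 0) \<and> (\<forall>j. \<forall>x\<in>{a1<..<b1}. (w (Suc j) has_vector_derivative w j x * z' x) (at x)) \<and>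
  (\<forall>x\<in>{a1<..<b1}. w k x = v x)"
 using v weak
proof (induction k arbitrary: v)
 case 0
 then show ?case using weak_zero[OF 0(1)] by (intro exI[of _ "\<lambda>_ _. 0"]) auto
next
 case (Suc k)
 obtain u0 where u0: "test_in a1 b1 u0" "integral {a1..b1} u0 = 1" using test_in_unit[OF ab(2)] by blast
 define A where "A = integral {a1..b1} (\<lambda>x. v x * (wd z' ^^ k) u0 x) * (-1) ^ k"
 have key: "integral {a1..b1} (\<lambda>x. v x * (wd z' ^^ k) u x) = A * (-1) ^ k * integral {a1..b1} u" if u: "test_in a1 b1 u" for u
 proof -
  define d where "d = integral {a1..b1} u"
  have t: "test_in a1 b1 (\<lambda>x. u x - d * u0 x)" by (rule test_in_diff_scale[OF u u0(1)])
  have "integral {a1..b1} (\<lambda>x. u x - d * u0 x) = integral {a1..b1} u - integral {a1..b1} (\<lambda>x. d * u0 x)"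
   by (intro Henstock_Kurzweil_Integration.integral_diff integrable_continuous_real continuous_intros
    test_in_continuous[OF u] test_in_continuous[OF u0(1)])
  then have "integral {a1..b1} (\<lambda>x. u x - d * u0 x) = 0" using u0(2) by (simp add: d_def)
  then obtain U where U: "test_in a1 b1 U" "pd 1 U = (\<lambda>x. u x - d * u0 x)"
   using test_in_antiderivative[OF t less_imp_le[OF ab(2)]] by blast
  \<comment> \<open>\<open>wd\<close> divides by \<open>z'\<close> before it differentiates, so this
    product satisfies \<open>wd z' X = (\<lambda>x. u x - d * u0 x)\<close>.\<close>
  define X where "X x = U x * z' x" for x
  have X: "test_in a1 b1 X" unfolding X_def by (rule test_in_product[OF ab(1,3) z(1) U(1)])
  have "X x / z' x = U x" for x
  proof (cases "x \<in> {a<..<b}")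
   case False
   then have "x \<notin> {a1..b1}" using ab by auto
   then show ?thesis using U(1) by (simp add: X_def test_in_def)
  qed (use z(2) in \<open>simp add: X_def\<close>)
  then have "wd z' X = (\<lambda>x. u x - d * u0 x)" using U(2) by (simp add: wd_def)
  then have "(wd z' ^^ Suc k) X = (wd z' ^^ k) (\<lambda>x. u x - d * u0 x)"
   by (simp add: funpow_Suc_right del: funpow.simps)
  then have "(wd z' ^^ Suc k) X = (\<lambda>x. (wd z' ^^ k) u x - d * (wd z' ^^ k) u0 x)"
   unfolding wd_power_diff[OF u u0(1)] .
  then have "integral {a1..b1} (\<lambda>x. v x * ((wd z' ^^ k) u x - d * (wd z' ^^ k) u0 x)) = 0"
   using Suc.prems(2)[OF X] by simp
  moreover have "integral {a1..b1} (\<lambda>x. v x * ((wd z' ^^ k) u x - d * (wd z' ^^ k) u0 x))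
    = integral {a1..b1} (\<lambda>x. v x * (wd z' ^^ k) u x) - integral {a1..b1} (\<lambda>x. d * (v x * (wd z' ^^ k) u0 x))"
   unfolding right_diff_distrib mult.left_commute[of _ d]
   by (intro Henstock_Kurzweil_Integration.integral_diff integrable_continuous_real continuous_intros Suc.prems(1)
    test_in_continuous[OF wd_power[OF u]] test_in_continuous[OF wd_power[OF u0(1)]])
  ultimately have "integral {a1..b1} (\<lambda>x. v x * (wd z' ^^ k) u x) = integral {a1..b1} (\<lambda>x. d * (v x * (wd z' ^^ k) u0 x))" by simp
  also have "\<dots> = d * integral {a1..b1} (\<lambda>x. v x * (wd z' ^^ k) u0 x)"
   by (rule Henstock_Kurzweil_Integration.integral_mult_right)
  also have "\<dots> = A * (-1) ^ k * d" by (simp add: A_def mult.assoc flip: power_mult_distrib)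
  finally show ?thesis by (simp only: d_def)
 qed
 define q where "q j x = Z x ^ j / fact j" for j x
 have cq: "continuous_on {a1..b1} (q k)" unfolding q_def by (intro continuous_intros continuous_Z) simp
 have "integral {a1..b1} (\<lambda>x. (v x - A * q k x) * (wd z' ^^ k) u x) = 0" if u: "test_in a1 b1 u" for u
 proof -
  have "integral {a1..b1} (\<lambda>x. (v x - A * q k x) * (wd z' ^^ k) u x)
    = integral {a1..b1} (\<lambda>x. v x * (wd z' ^^ k) u x) - integral {a1..b1} (\<lambda>x. A * (q k x * (wd z' ^^ k) u x))"
   unfolding left_diff_distrib mult.assoc
   by (intro Henstock_Kurzweil_Integration.integral_diff integrable_continuous_real continuous_intros Suc.prems(1) cq
    test_in_continuous[OF wd_power[OF u]])
  then show ?thesis unfolding Henstock_Kurzweil_Integration.integral_mult_right key[OF u] integral_power[OF u, folded q_def]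
   by simp
 qed
 moreover have "continuous_on {a1..b1} (\<lambda>x. v x - A * q k x)" by (intro continuous_intros Suc.prems(1) cq)
 ultimately have "\<exists>w. w 0 = (\<lambda>_. 0) \<and> (\<forall>j. \<forall>x\<in>{a1<..<b1}. (w (Suc j) has_vector_derivative w j x * z' x) (at x)) \<and>
   (\<forall>x\<in>{a1<..<b1}. w k x = v x - A * q k x)"
  by (intro Suc.IH) auto
 then obtain w where w: "w 0 = (\<lambda>_. 0)" "\<And>j x. x \<in> {a1<..<b1} ==> (w (Suc j) has_vector_derivative w j x * z' x) (at x)"
   "\<And>x. x \<in> {a1<..<b1} ==> w k x = v x - A * q k x"
  by blast
 define w' where "w' j = (case j of 0 => (\<lambda>_. 0) | Suc i => (\<lambda>x. w i x + A * q i x))" for j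
 show ?case
 proof (intro exI[of _ w'] conjI allI ballI)
  fix j x assume x: "x \<in> {a1<..<b1}"
  show "(w' (Suc j) has_vector_derivative w' j x * z' x) (at x)"
  proof (cases j)
   case 0
   have "((\<lambda>x. A) has_vector_derivative 0) (at x)" by simp
   then show ?thesis using 0 w(1) by (simp add: w'_def q_def)
  next
   case (Suc i)
   have "((\<lambda>x. w (Suc i) x + A * q (Suc i) x) has_vector_derivative w i x * z' x + A * (q i x * z' x)) (at x)"
    unfolding q_def using x ab
    by (intro has_vector_derivative_add has_vector_derivative_mult_right w power_derivative) auto
   then show ?thesis using Suc by (simp add: w'_def algebra_simps)
  qed
 qed (use w in \<open>auto simp: w'_def\<close>)
qed

end

text \<open>Convergence of the averages over \<open>{x..x + k}\<close> gives the right derivative at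
  almost every \<open>x\<close>; the left derivative is the same statement for the reflected
  function. \<open>g\<close> continues \<open>h\<close> by zero so that all these averages make
  sense.\<close>

lemma lebesgue_differentiation:
 fixes h :: "real => complex"
 assumes h: "h integrable_on {a1..b1}"
 obtains N where "negligible N" "\<And>x. x \<in> {a1<..<b1} - N ==> ((\<lambda>x. integral {a1..x} h) has_vector_derivative h x) (at x)"
proof -
 define g where "g x = (if x \<in> {a1..b1} then h x else 0)" for x
 have g: "g integrable_on {x..y}" for x y
 proof -
  have "g integrable_on UNIV" unfolding g_def using h integrable_restrict_UNIV by blast
  then show ?thesis by (rule integrable_on_subinterval) auto
 qed
 have g': "(\<lambda>x. g (- x)) integrable_on {x..y}" for x y
  using g[of "-y" "-x"] Henstock_Kurzweil_Integration.integrable_reflect_real[of g "-x" "-y"] by simp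
 obtain N1 where N1: "negligible N1" "\<And>x e. x \<notin> N1 ==> 0 < e ==>
   \<exists>d>0. \<forall>k. 0 < k \<and> k < d --> norm (integral (cbox x (x + k *\<^sub>R One)) g /\<^sub>R k ^ DIM(real) - g x) < e"
  using integrable_ccontinuous_explicit[of g] g by (metis box_real(2))
 obtain N2 where N2: "negligible N2" "\<And>x e. x \<notin> N2 ==> 0 < e ==>
   \<exists>d>0. \<forall>k. 0 < k \<and> k < d --> norm (integral (cbox x (x + k *\<^sub>R One)) (\<lambda>x. g (- x)) /\<^sub>R k ^ DIM(real) - g (- x)) < e"
  using integrable_ccontinuous_explicit[of "\<lambda>x. g (- x)"] g' by (metis box_real(2))
 define N where "N = N1 \<union> uminus ` N2"
 have "negligible N" unfolding N_def using N1(1) N2(1)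
  by (intro negligible_Un negligible_differentiable_image_negligible differentiable_on_minus differentiable_on_id[unfolded id_def]) auto
 moreover have "((\<lambda>x. integral {a1..x} h) has_vector_derivative h x) (at x)" if x: "x \<in> {a1<..<b1} - N" for x
 proof -
  have x1: "x \<notin> N1" "- x \<notin> N2" using x by (auto simp: N_def image_iff)
  have "((\<lambda>y. integral {a1..y} g) has_derivative (\<lambda>k. k *\<^sub>R g x)) (at x)"
   unfolding has_derivative_at_alt
  proof (intro conjI allI impI bounded_linear_scaleR_left)
   fix e :: real assume e: "e > 0"
   obtain d1 where d1: "d1 > 0" "\<And>k. 0 < k ==> k < d1 ==> norm (integral {x..x + k} g /\<^sub>R k - g x) < e"
    using N1(2)[OF x1(1) e] by auto
   obtain d2 where d2: "d2 > 0" "\<And>k. 0 < k ==> k < d2 ==> norm (integral {- x..- x + k} (\<lambda>x. g (- x)) /\<^sub>R k - g x) < e"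
    using N2(2)[OF x1(2) e] by auto
   have sc: "norm (I - k *\<^sub>R g x) \<le> e * k" if k: "0 < k" "norm (I /\<^sub>R k - g x) < e" for I k
   proof -
    have "I - k *\<^sub>R g x = k *\<^sub>R (I /\<^sub>R k - g x)" using k by (simp add: algebra_simps)
    then have "norm (I - k *\<^sub>R g x) = k * norm (I /\<^sub>R k - g x)" using k by simp
    then show ?thesis using k by (simp add: mult.commute)
   qed
   have "norm (integral {a1..y} g - integral {a1..x} g - (y - x) *\<^sub>R g x) \<le> e * norm (y - x)"
    if y: "norm (y - x) < min (min d1 d2) (min (x - a1) (b1 - x))" for y
   proof (cases y x rule: linorder_cases)
    case greater
    have "integral {a1..x} g + integral {x..y} g = integral {a1..y} g"
     using greater x g by (intro Henstock_Kurzweil_Integration.integral_combine) auto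
    then have "integral {a1..y} g - integral {a1..x} g = integral {x..y} g" by (simp add: algebra_simps)
    then show ?thesis using sc[OF _ d1(2)[of "y - x"]] greater y by simp
   next
    case less
    have "integral {a1..y} g + integral {y..x} g = integral {a1..x} g"
     using less y g by (intro Henstock_Kurzweil_Integration.integral_combine) auto
    then have IJ: "integral {a1..x} g - integral {a1..y} g = integral {y..x} g" by (simp add: algebra_simps)
    have "J - I - (y - x) *\<^sub>R g x = - ((I - J) - (x - y) *\<^sub>R g x)" for I J
     by (simp add: algebra_simps)
    then have "norm (integral {a1..y} g - integral {a1..x} g - (y - x) *\<^sub>R g x) = norm (integral {y..x} g - (x - y) *\<^sub>R g x)"
     by (simp only: IJ norm_minus_cancel)
    moreover have "norm (integral {y..x} g - (x - y) *\<^sub>R g x) \<le> e * (x - y)"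
     using sc[OF _ d2(2)[of "x - y"]] less y by simp
    ultimately show ?thesis using less by simp
   qed simp
   then show "\<exists>d>0. \<forall>y. norm (y - x) < d --> norm (integral {a1..y} g - integral {a1..x} g - (y - x) *\<^sub>R g x) \<le> e * norm (y - x)"
    using d1(1) d2(1) x by (intro exI[of _ "min (min d1 d2) (min (x - a1) (b1 - x))"]) auto
  qed
  then have "((\<lambda>y. integral {a1..y} g) has_vector_derivative g x) (at x)" by (simp add: has_vector_derivative_def)
  then have "((\<lambda>y. integral {a1..y} h) has_vector_derivative g x) (at x)"
  proof (rule has_vector_derivative_transform_within_open[of _ _ _ "{a1<..<b1}"])
   show "integral {a1..y} g = integral {a1..y} h" if "y \<in> {a1<..<b1}" for y
    by (rule integral_cong) (use that in \<open>auto simp: g_def\<close>)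
  qed (use x in auto)
  then show ?thesis using x by (simp add: g_def)
 qed
 ultimately show ?thesis using that by blast
qed

context weighted
begin

text \<open>Integration by parts shows that the iterated primitive \<open>Bs k\<close> satisfies the
  same weak identity as \<open>M\<close>, so the two differ by a weak polynomial. Expanding both by
  \<open>taylor_chain\<close> leaves \<open>g x1\<close> as the top coefficient wherever the
  indefinite integral of \<open>g * z'\<close> has the expected derivative.\<close>

lemma primitives_taylor_ae:
 assumes g: "integrable (lebesgue_on {a1..b1}) g" and M: "continuous_on {a1..b1} M"
  and weak: "\<And>u. test_in a1 b1 u ==>
   (LINT x|lebesgue_on {a1..b1}. g x * u x) = (- 1) ^ Suc k * integral {a1..b1} (\<lambda>x. M x * (wd z' ^^ Suc k) u x)"
 shows "\<exists>N. negligible N \<and> (\<forall>x1\<in>{a1<..<b1} - N. \<exists>c. taylor_at M Z (Suc k) c x1 \<and> fact (Suc k) * c (Suc k) = g x1)"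
proof -
 define h where "h x = g x * z' x" for x
 obtain Bz where Bz: "\<And>x. x \<in> {a1..b1} ==> norm (z' x) \<le> Bz" using compact_norm_bound[OF _ continuous_Z(2)] by auto
 have z'm: "z' \<in> borel_measurable (lebesgue_on {a1..b1})"
  using continuous_imp_integrable_real[OF continuous_Z(2)] by simp
 have hi: "integrable (lebesgue_on {a1..b1}) h"
 proof (rule Bochner_Integration.integrable_bound[where f = "\<lambda>x. Bz * norm (g x)"])
  show "integrable (lebesgue_on {a1..b1}) (\<lambda>x. Bz * norm (g x))" using g by (intro integrable_mult_right integrable_norm)
  show "h \<in> borel_measurable (lebesgue_on {a1..b1})" unfolding h_def[abs_def]
   using g z'm by (intro borel_measurable_times) auto
  show "AE x in lebesgue_on {a1..b1}. norm (h x) \<le> norm (Bz * norm (g x))"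
  proof (rule AE_I2)
   fix x assume "x \<in> space (lebesgue_on {a1..b1})"
   then have "norm (z' x) \<le> \<bar>Bz\<bar>" using Bz[of x] by simp
   then show "norm (h x) \<le> norm (Bz * norm (g x))"
    using mult_left_mono[of "norm (z' x)" "\<bar>Bz\<bar>" "norm (g x)"] by (simp add: h_def norm_mult abs_mult mult.commute)
  qed
 qed
 have hHK: "h integrable_on {a1..b1}" using hi by (simp add: integrable_on_lebesgue_on)
 obtain N where N: "negligible N"
  "\<And>x. x \<in> {a1<..<b1} - N ==> ((\<lambda>x. integral {a1..x} h) has_vector_derivative h x) (at x)"
  using lebesgue_differentiation[OF hHK] by blast
 \<comment> \<open>Numbered from the first primitive on: \<open>Bs j\<close> has been integrated
   \<open>j + 1\<close> times, so level \<open>j\<close> of the chain below uses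
   \<open>Bs (j - 1)\<close>.\<close>
 define Bs where "Bs j = rec_nat (\<lambda>x. integral {a1..x} h) (\<lambda>_ f x. integral {a1..x} (\<lambda>s. f s * z' s)) j" for j
 have Bs0: "Bs 0 = (\<lambda>x. integral {a1..x} h)" and BsS: "Bs (Suc j) = (\<lambda>x. integral {a1..x} (\<lambda>s. Bs j s * z' s))" for j
  by (simp_all add: Bs_def)
 have cB: "continuous_on {a1..b1} (Bs j)" for j
 proof (induction j)
  case 0
  show ?case unfolding Bs0 by (rule indefinite_integral_continuous_1[OF hHK])
 next
  case (Suc j)
  show ?case unfolding BsS
   by (rule indefinite_integral_continuous_1) (intro integrable_continuous_real continuous_intros Suc continuous_Z)
 qed
 have dB: "(Bs (Suc j) has_vector_derivative Bs j x * z' x) (at x within {a1..b1})" if "x \<in> {a1..b1}" for j x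
  unfolding BsS by (rule integral_has_vector_derivative[OF _ that]) (intro continuous_intros cB continuous_Z)
 have dB': "(Bs (Suc j) has_vector_derivative Bs j x * z' x) (at x)" if "x \<in> {a1<..<b1}" for j x
  using dB[of x j] that at_within_Icc_at[of a1 x b1] by simp
 have ibp: "(LINT x|lebesgue_on {a1..b1}. g x * u x) = (- 1) ^ Suc j * integral {a1..b1} (\<lambda>x. Bs j x * (wd z' ^^ Suc j) u x)"
  if u: "test_in a1 b1 u" for u j
 proof (induction j)
  case 0
  have "(LINT x|lebesgue_on {a1..b1}. g x * u x) = (LINT x|lebesgue_on {a1..b1}. h x * (u x / z' x))"
   by (rule Bochner_Integration.integral_cong) (use z(2) ab in \<open>auto simp: h_def\<close>)
  also have "\<dots> = - integral {a1..b1} (\<lambda>x. integral {a1..x} h * wd z' u x)"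
   by (rule integral_by_parts_integrable[OF less_imp_le[OF ab(2)] hi has_vector_derivative_at_within[OF wd(2)[OF u]]
     test_in_continuous[OF wd(1)[OF u]]])
    (use test_in_eq_0[OF u, of b1] in auto)
  finally show ?case by (simp add: Bs0)
 next
  case (Suc j)
  have "integral {a1..b1} (\<lambda>x. Bs j x * (wd z' ^^ Suc j) u x) = - integral {a1..b1} (\<lambda>x. Bs (Suc j) x * wd z' ((wd z' ^^ Suc j) u) x)"
   by (rule integral_by_parts_test[OF ab(1) less_imp_le[OF ab(2)] ab(3) z wd_power[OF u] dB cB])
  with Suc show ?case by simp
 qed
 have "integral {a1..b1} (\<lambda>x. (M x - Bs k x) * (wd z' ^^ Suc k) u x) = 0" if u: "test_in a1 b1 u" for u
 proof -
  have "integral {a1..b1} (\<lambda>x. (M x - Bs k x) * (wd z' ^^ Suc k) u x)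
    = integral {a1..b1} (\<lambda>x. M x * (wd z' ^^ Suc k) u x) - integral {a1..b1} (\<lambda>x. Bs k x * (wd z' ^^ Suc k) u x)"
   unfolding left_diff_distrib
   by (intro Henstock_Kurzweil_Integration.integral_diff integrable_continuous_real continuous_intros M cB
    test_in_continuous[OF wd_power[OF u]])
  moreover have "(- 1) ^ Suc k * integral {a1..b1} (\<lambda>x. M x * (wd z' ^^ Suc k) u x) = (- 1) ^ Suc k * integral {a1..b1} (\<lambda>x. Bs k x * (wd z' ^^ Suc k) u x)"
   using weak[OF u] ibp[OF u, of k] by (simp only:)
  then have "integral {a1..b1} (\<lambda>x. M x * (wd z' ^^ Suc k) u x) = integral {a1..b1} (\<lambda>x. Bs k x * (wd z' ^^ Suc k) u x)"
   by (simp only: mult_cancel_left) simp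
  ultimately show ?thesis by simp
 qed
 moreover have "continuous_on {a1..b1} (\<lambda>x. M x - Bs k x)" by (intro continuous_intros M cB)
 ultimately have "\<exists>w. w 0 = (\<lambda>_. 0) \<and> (\<forall>j. \<forall>x\<in>{a1<..<b1}. (w (Suc j) has_vector_derivative w j x * z' x) (at x)) \<and>
   (\<forall>x\<in>{a1<..<b1}. w (Suc k) x = M x - Bs k x)"
  by (intro weak_polynomial)
 then obtain w where w: "w 0 = (\<lambda>_. 0)" "\<And>j x. x \<in> {a1<..<b1} ==> (w (Suc j) has_vector_derivative w j x * z' x) (at x)"
   "\<And>x. x \<in> {a1<..<b1} ==> w (Suc k) x = M x - Bs k x"
  by blast
 define f where "f j x = Bs (j - 1) x + w j x" for j x
 have "\<exists>c. taylor_at M Z (Suc k) c x1 \<and> fact (Suc k) * c (Suc k) = g x1" if x1: "x1 \<in> {a1<..<b1} - N" for x1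
 proof -
  define r where "r = min (x1 - a1) (b1 - x1)"
  have r: "r > 0" "\<And>x. \<bar>x - x1\<bar> < r ==> x \<in> {a1<..<b1}" using x1 by (auto simp: r_def)
  define c where "c i = (if i = Suc k then g x1 else f (Suc k - i) x1) / fact i" for i
  have T: "taylor_at (f (Suc k)) Z (Suc k) c x1"
   unfolding c_def
  proof (rule taylor_chain[OF r(1), where Z' = z' and B = Bz])
   fix x assume x: "\<bar>x - x1\<bar> < r"
   note x' = r(2)[OF x]
   show "(Z has_vector_derivative z' x) (at x)" using dZ x' ab by simp
   show "norm (z' x) \<le> Bz" using Bz x' by simp
   fix j :: nat assume "1 \<le> j"
   then obtain i where i: "j = Suc i" by (cases j) auto
   have "(f (Suc j) has_vector_derivative Bs i x * z' x + w j x * z' x) (at x)"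
    unfolding f_def[abs_def] i diff_Suc_1 by (intro has_vector_derivative_add dB' w(2) x')
   then show "(f (Suc j) has_vector_derivative f j x * z' x) (at x)" by (simp add: f_def i distrib_right)
  next
   have "((\<lambda>x. Bs 0 x + w 1 x) has_vector_derivative h x1 + w 0 x1 * z' x1) (at x1)"
    unfolding Bs0 One_nat_def by (intro has_vector_derivative_add N(2) w(2)) (use x1 in auto)
   then show "(f 1 has_vector_derivative g x1 * z' x1) (at x1)" by (simp add: f_def[abs_def] w(1) h_def)
  qed
  have eq: "f (Suc k) x = M x" if "\<bar>x - x1\<bar> < r" for x using w(3)[OF r(2)[OF that]] by (simp add: f_def)
  have "taylor_at M Z (Suc k) c x1"
   unfolding taylor_at_def
  proof (intro allI impI)
   fix eta :: real assume "eta > 0"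
   then obtain d where d: "d > 0" "\<And>x. \<bar>x - x1\<bar> < d ==> norm (f (Suc k) x - (\<Sum>i\<le>Suc k. c i * (Z x - Z x1) ^ i)) \<le> eta * \<bar>x - x1\<bar> ^ Suc k"
    using T unfolding taylor_at_def by blast
   show "\<exists>d>0. \<forall>x. \<bar>x - x1\<bar> < d --> norm (M x - (\<Sum>i\<le>Suc k. c i * (Z x - Z x1) ^ i)) \<le> eta * \<bar>x - x1\<bar> ^ Suc k"
   proof (intro exI[of _ "min d r"] conjI allI impI)
    fix x assume "\<bar>x - x1\<bar> < min d r"
    then have "\<bar>x - x1\<bar> < d" "f (Suc k) x = M x" using eq[of x] by auto
    then show "norm (M x - (\<Sum>i\<le>Suc k. c i * (Z x - Z x1) ^ i)) \<le> eta * \<bar>x - x1\<bar> ^ Suc k"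
     using d(2)[of x] by (simp only:)
   qed (use d(1) r(1) in simp)
  qed
  moreover have "fact (Suc k) * c (Suc k) = g x1" by (simp add: c_def del: fact_Suc)
  ultimately show ?thesis by blast
 qed
 then show ?thesis using N(1) by blast
qed

end

text \<open>Every isolated point is the sole point of \<open>A\<close> in some interval with
  rational end points.\<close>

lemma countable_isolated_points:
 fixes A :: "real set" shows "countable {x\<in>A. \<not> x islimpt A}"
proof (rule countable_subset)
 show "{x\<in>A. \<not> x islimpt A} \<subseteq> range (\<lambda>(p, q). THE y. A \<inter> {of_rat p<..<of_rat q} = {y})"
 proof
  fix x assume "x \<in> {x\<in>A. \<not> x islimpt A}"
  then obtain e where xA: "x \<in> A" and e: "e > 0" "\<And>y. y \<in> A ==> dist y x < e ==> y = x"
   unfolding islimpt_approachable by auto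
  obtain p where p: "x - e < of_rat p" "of_rat p < x" using of_rat_dense[of "x - e" x] e by auto
  obtain q where q: "x < of_rat q" "of_rat q < x + e" using of_rat_dense[of x "x + e"] e by auto
  have "A \<inter> {of_rat p<..<of_rat q} = {x}"
   using xA p q e(2) by (auto simp: dist_real_def abs_less_iff)
  then have "x = (THE y. A \<inter> {of_rat p<..<of_rat q} = {y})" by auto
  then show "x \<in> range (\<lambda>(p, q). THE y. A \<inter> {of_rat p<..<of_rat q} = {y})"
   by (intro image_eqI[of _ _ "(p, q)"]) auto
 qed
qed auto

lemma negligible_countable_set: "countable (S :: real set) ==> negligible S"
 using countable_imp_null_set_lborel null_sets_completionI negligible_iff_null_sets by blast

section \<open>Taylor expansions at almost every boundary point\<close>

context strip
begin

lemma weighted_slice: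
 assumes sm: "smooth_on box0 (zdx phix)" and a1b1: "a < a1" "a1 < b1" "b1 < b" and t: "t \<in> {-delta<..<delta}"
 shows "weighted a b a1 b1 (\<lambda>x. zdx phix (x, t)) (\<lambda>x. zmap phi (x, t))"
proof (unfold_locales, use a1b1 in auto)
 have "smooth_on {a<..<b} (\<lambda>x. (x, t))"
  by (intro smooth_on_Pair smooth_on_const smooth_on_bounded_linear bounded_linear_ident) auto
 then show "smooth_on {a<..<b} (\<lambda>x. zdx phix (x, t))"
  by (intro smooth_on_compose[OF _ _ _ sm]) (use t in \<open>auto intro: open_Times\<close>)
next
 fix x assume x: "a < x" "x < b"
 show False if "zdx phix (x, t) = 0" using that by (simp add: zdx_def complex_eq_iff)
 show "((\<lambda>x. zmap phi (x, t)) has_vector_derivative zdx phix (x, t)) (at x)"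
  using has_derivative_dform_fst[OF zmap_has_derivative[of "(x, t)"]] x t by simp
qed

text \<open>\<open>wd\<close> depends on the height through the derivative of \<open>Z\<close>. As
  this derivative is smooth in both variables, the iterated operators on the slices come from one
  jointly smooth function, whose continuity allows the passage to \<open>t = 0\<close>.\<close>

lemma wd_power_joint:
 assumes sm: "smooth_on box0 (zdx phix)" and a1b1: "a < a1" "a1 < b1" "b1 < b"
  and u: "test_in a1 b1 u"
 shows "\<exists>U. smooth_on box0 U \<and>
  (\<forall>x\<in>{a<..<b}. \<forall>t\<in>{-delta<..<delta}. (wd (\<lambda>x. zdx phix (x, t)) ^^ j) u x = U (x, t))"
proof (induction j)
 case 0
 have o: "open box0" by (intro open_Times) auto
 have "smooth_on box0 (fst :: plane => real)"
  by (rule smooth_on_bounded_linear[OF bounded_linear_fst])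
 then have "smooth_on box0 (\<lambda>q. u (fst q))"
  using smooth_on_compose[OF o open_UNIV subset_UNIV] u unfolding test_in_def by blast
 then show ?case by (intro exI[of _ "\<lambda>q. u (fst q)"]) auto
next
 case (Suc j)
 define S where "S = box0"
 have o: "open S" unfolding S_def by (intro open_Times) auto
 obtain U where U: "smooth_on S U"
  "\<And>x t. x \<in> {a<..<b} ==> t \<in> {-delta<..<delta} ==> (wd (\<lambda>x. zdx phix (x, t)) ^^ j) u x = U (x, t)"
  using Suc unfolding S_def by blast
 define V where "V q = U q / zdx phix q" for q
 have "smooth_on S V" unfolding V_def
  by (intro smooth_on_divide o U(1) sm[folded S_def]) (simp add: zdx_def complex_eq_iff)
 then have V: "smooth_on S (pd (1, 0) V)" "\<And>q. q \<in> S ==> (V has_derivative frechet_derivative V (at q)) (at q)"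
  by (auto intro: smooth_on_pd smooth_on_has_derivative o simp: Basis_plane)
 have "(wd (\<lambda>x. zdx phix (x, t)) ^^ Suc j) u x = pd (1, 0) V (x, t)" if x: "x \<in> {a<..<b}" and t: "t \<in> {-delta<..<delta}" for x t
 proof -
  define p where "p = (wd (\<lambda>x. zdx phix (x, t)) ^^ j) u"
  have q: "(x, t) \<in> S" using x t by (simp add: S_def)
  have "((\<lambda>x. (x, t)) has_derivative (\<lambda>h. (h, 0))) (at x)" by (auto intro!: derivative_eq_intros)
  from has_derivative_compose[OF this V(2)[OF q]]
  have d: "((\<lambda>x. V (x, t)) has_derivative (\<lambda>h. frechet_derivative V (at (x, t)) (h, 0))) (at x)" .
  have "frechet_derivative (\<lambda>x. p x / zdx phix (x, t)) (at x) = frechet_derivative (\<lambda>x. V (x, t)) (at x)"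
   by (rule frechet_derivative_cong_open[of "{a<..<b}"]) (use x t U(2) in \<open>auto simp: V_def p_def\<close>)
  also have "\<dots> = (\<lambda>h. frechet_derivative V (at (x, t)) (h, 0))" using frechet_derivative_at[OF d] by simp
  finally show ?thesis by (simp add: wd_def p_def)
 qed
 then show ?case using V(1) unfolding S_def by blast
qed

lemma integral_wd_power:
 assumes sm: "smooth_on box0 (zdx phix)" and a1b1: "a < a1" "a1 < b1" "b1 < b"
  and u: "test_in a1 b1 u" and t: "t \<in> {0<..<delta}"
 shows "integral {a1..b1} (\<lambda>x. H 0 (x, t) * u x)
  = (- 1) ^ j * integral {a1..b1} (\<lambda>x. H j (x, t) * (wd (\<lambda>x. zdx phix (x, t)) ^^ j) u x)"
proof (induction j)
 case (Suc j)
 have t': "t \<in> {-delta<..<delta}" using t by auto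
 interpret W: weighted a b a1 b1 "\<lambda>x. zdx phix (x, t)" "\<lambda>x. zmap phi (x, t)" by (rule weighted_slice[OF sm a1b1 t'])
 have "integral {a1..b1} (\<lambda>x. H j (x, t) * (wd (\<lambda>x. zdx phix (x, t)) ^^ j) u x)
   = - integral {a1..b1} (\<lambda>x. H (Suc j) (x, t) * wd (\<lambda>x. zdx phix (x, t)) ((wd (\<lambda>x. zdx phix (x, t)) ^^ j) u) x)"
 proof (rule integral_by_parts_test[OF a1b1(1) less_imp_le[OF a1b1(2)] a1b1(3) W.z W.wd_power[OF u]])
  fix x assume x: "x \<in> {a1..b1}"
  then have "(x, t) \<in> box1" using a1b1 t by auto
  from has_derivative_dform_fst[OF dH[OF this]]
  show "((\<lambda>x. H (Suc j) (x, t)) has_vector_derivative H j (x, t) * zdx phix (x, t)) (at x within {a1..b1})"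
   by (rule has_vector_derivative_at_within)
 next
  show "continuous_on {a1..b1} (\<lambda>x. H j (x, t))"
   by (rule continuous_on_compose2[OF continuous_on_H]) (use a1b1 t in \<open>auto intro!: continuous_intros\<close>)
 qed
 with Suc show ?case by simp
qed simp

text \<open>For \<open>t > 0\<close> all \<open>K\<close> derivatives are moved to the test
  function. One side then converges to the pairing with \<open>g\<close> by \<open>lim\<close>, the
  other by continuity of \<open>H K\<close> up to \<open>t = 0\<close>, and the comparison is the
  weak identity asked for by \<open>primitives_taylor_ae\<close>.\<close>

lemma taylor_ae:
 assumes sm: "smooth_on box0 (zdx phix)" and a1b1: "a < a1" "a1 < b1" "b1 < b"
  and g: "integrable (lebesgue_on {a1..b1}) g" and K: "K \<ge> 1"
  and lim: "\<And>u. test_in a1 b1 u ==> ((\<lambda>t. integral {a1..b1} (\<lambda>x. H 0 (x, t) * u x)) \<longlongrightarrow>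
    (LINT x|lebesgue_on {a1..b1}. g x * u x)) (at_right 0)"
 shows "\<exists>N. negligible N \<and> (\<forall>x1\<in>{a1<..<b1} - N. \<exists>c. taylor_at (\<lambda>x. H K (x, 0)) (\<lambda>x. zmap phi (x, 0)) K c x1 \<and> fact K * c K = g x1)"
proof -
 obtain k where k: "K = Suc k" using K by (cases K) auto
 interpret W: weighted a b a1 b1 "\<lambda>x. zdx phix (x, 0)" "\<lambda>x. zmap phi (x, 0)"
  by (rule weighted_slice[OF sm a1b1]) (use delta in auto)
 show ?thesis unfolding k
 proof (rule W.primitives_taylor_ae[OF g])
  show "continuous_on {a1..b1} (\<lambda>x. H (Suc k) (x, 0))"
   by (rule continuous_on_compose2[OF cH]) (use a1b1 delta k in \<open>auto intro!: continuous_intros\<close>)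
  fix u assume u: "test_in a1 b1 u"
  obtain U where U: "smooth_on box0 U"
   "\<And>x t. x \<in> {a<..<b} ==> t \<in> {-delta<..<delta} ==> (wd (\<lambda>x. zdx phix (x, t)) ^^ Suc k) u x = U (x, t)"
   using wd_power_joint[OF sm a1b1 u, of "Suc k"] by blast
  define F where "F t = integral {a1..b1} (\<lambda>x. H (Suc k) (x, t) * U (x, t))" for t
  have "continuous_on {0..delta/2} (\<lambda>t. integral (cbox a1 b1) (\<lambda>x. H (Suc k) (x, t) * U (x, t)))"
  proof (rule integral_continuous_on_param)
   have "continuous_on ({0..delta/2} \<times> {a1..b1}) (\<lambda>z. H (Suc k) (snd z, fst z) * U (snd z, fst z))"
    by (intro continuous_on_mult continuous_on_compose2[OF cH] continuous_on_compose2[OF smooth_on_imp_continuous_on[OF U(1)]])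
     (use a1b1 delta k in \<open>auto intro!: continuous_intros\<close>)
   then show "continuous_on ({0..delta/2} \<times> cbox a1 b1) (\<lambda>(t, x). H (Suc k) (x, t) * U (x, t))" by (simp add: split_def)
  qed
  then have "continuous_on {0..delta/2} F" by (simp add: F_def[abs_def])
  then have "(F \<longlongrightarrow> F 0) (at 0 within {0..delta/2})" using delta by (simp add: continuous_on_def)
  moreover have "at 0 within {0..delta/2} = at_right 0" by (rule at_within_Icc_at_right) (use delta in simp)
  ultimately have F: "(F \<longlongrightarrow> F 0) (at_right 0)" by simp
  have eq: "integral {a1..b1} (\<lambda>x. H (Suc k) (x, t) * (wd (\<lambda>x. zdx phix (x, t)) ^^ Suc k) u x) = F t" if "t \<in> {-delta<..<delta}" for t
   unfolding F_def by (rule integral_cong) (use U(2) that a1b1 in auto)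
  have "\<forall>\<^sub>F t in at_right 0. (- 1) ^ Suc k * F t = integral {a1..b1} (\<lambda>x. H 0 (x, t) * u x)"
   unfolding eventually_at_right_field
   using integral_wd_power[OF sm a1b1 u, of _ "Suc k"] eq delta by (intro exI[of _ delta]) auto
  moreover have "((\<lambda>t. (- 1) ^ Suc k * F t) \<longlongrightarrow> (- 1) ^ Suc k * F 0) (at_right 0)" by (intro tendsto_intros F)
  ultimately have "((\<lambda>t. integral {a1..b1} (\<lambda>x. H 0 (x, t) * u x)) \<longlongrightarrow> (- 1) ^ Suc k * F 0) (at_right 0)"
   by (rule Lim_transform_eventually[rotated])
  from tendsto_unique[OF _ lim[OF u] this] eq[of 0] delta
  show "(LINT x|lebesgue_on {a1..b1}. g x * u x)
    = (- 1) ^ Suc k * integral {a1..b1} (\<lambda>x. H (Suc k) (x, 0) * (wd (\<lambda>x. zdx phix (x, 0)) ^^ Suc k) u x)"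
   by simp
 qed
qed

theorem strip_limit_ae:
 assumes sm: "smooth_on box0 (zdx phix)" and a1b1: "a < a1" "a1 < b1" "b1 < b"
  and g: "integrable (lebesgue_on {a1..b1}) g" and K: "K \<ge> 1"
  and lim: "\<And>u. test_in a1 b1 u ==> ((\<lambda>t. integral {a1..b1} (\<lambda>x. H 0 (x, t) * u x)) \<longlongrightarrow>
    (LINT x|lebesgue_on {a1..b1}. g x * u x)) (at_right 0)"
 shows "\<exists>N. negligible N \<and> (\<forall>x1\<in>{a1<..<b1} - N. nt_limit (H 0) (g x1) x1)"
proof -
 obtain N where N: "negligible N" "\<And>x1. x1 \<in> {a1<..<b1} - N ==>
   \<exists>c. taylor_at (\<lambda>x. H K (x, 0)) (\<lambda>x. zmap phi (x, 0)) K c x1 \<and> fact K * c K = g x1"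
  using taylor_ae[OF sm a1b1 g K lim] by blast
 \<comment> \<open>\<open>A n\<close> collects the columns flat up to height
   \<open>1 / (n + 1)\<close>. Its isolated points are countable, and every other point of it
   satisfies the hypothesis of \<open>strip_limit\<close> on flat columns.\<close>
 define A where "A n = {x\<in>{a<..<b}. \<forall>s\<in>{0..1 / real (Suc n)}. phi (x, s) = phi (x, 0)}" for n
 define N' where "N' = N \<union> (\<Union>n. {x\<in>A n. \<not> x islimpt A n})"
 have "countable (\<Union>n. {x\<in>A n. \<not> x islimpt A n})" using countable_isolated_points by blast
 then have "negligible N'" unfolding N'_def using N(1) negligible_countable_set by (intro negligible_Un)
 moreover have "nt_limit (H 0) (g x1) x1" if x1: "x1 \<in> {a1<..<b1} - N'" for x1
  unfolding nt_limit_def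
 proof (intro allI impI)
  fix L eta :: real assume L: "L \<ge> 0" and eta: "eta > 0"
  obtain c where c: "taylor_at (\<lambda>x. H K (x, 0)) (\<lambda>x. zmap phi (x, 0)) K c x1" "fact K * c K = g x1"
   using N(2)[of x1] x1 by (auto simp: N'_def)
  have "x1 \<in> {a<..<b}" using x1 a1b1 by auto
  then show "\<exists>d>0. \<forall>x t. 0 < t --> t < d --> \<bar>x - x1\<bar> < d -->
    \<bar>x - x1\<bar> \<le> L * \<bar>phi (x, t) - phi (x, 0)\<bar> --> norm (H 0 (x, t) - g x1) < eta"
  proof (rule strip_limit[OF _ L eta K c(1), unfolded c(2)])
   fix n assume "\<forall>s\<in>{0..1 / real (Suc n)}. phi (x1, s) = phi (x1, 0)"
   then have "x1 \<in> A n" using \<open>x1 \<in> {a<..<b}\<close> unfolding A_def by blast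
   then show "x1 islimpt {x\<in>{a<..<b}. \<forall>s\<in>{0..1 / real (Suc n)}. phi (x, s) = phi (x, 0)}"
    using x1 unfolding N'_def A_def[symmetric] by blast
  qed
 qed
 ultimately show ?thesis by blast
qed

end

section \<open>Iterated primitives and the growth condition\<close>

lemma onorm_scaleR_left_le: "norm w \<le> D ==> onorm (\<lambda>h. h *\<^sub>R w) \<le> D"
 by (rule onorm_le) (simp add: mult.commute[of D] mult_left_mono)

locale chain =
 fixes a b delta M :: real and zx zt :: "plane => complex" and H :: "nat => plane => complex"
 assumes ab: "a < b" and delta: "0 < delta" "delta \<le> 1" and M: "M \<ge> 0"
  and zt: "continuous_on ({a<..<b} \<times> {0<..<delta}) zt"
  and zx_bound: "\<And>x t. x \<in> {a<..<b} ==> t \<in> {0<..<delta} ==> norm (zx (x, t)) \<le> M"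
  and zt_bound: "\<And>x t. x \<in> {a<..<b} ==> t \<in> {0<..<delta} ==> norm (zt (x, t)) \<le> M"
  and zx: "continuous_on ({a<..<b} \<times> {0<..<delta}) zx"
  and H0: "continuous_on ({a<..<b} \<times> {0<..<delta}) (H 0)"
  and dH: "\<And>j x t. x \<in> {a<..<b} ==> t \<in> {0<..<delta} ==>
   (H (Suc j) has_derivative dform (H j (x, t) * zx (x, t)) (H j (x, t) * zt (x, t))) (at (x, t))"
begin

definition dominated :: "real => nat => bool" where
 "dominated r j \<longleftrightarrow> (\<exists>B\<ge>0. \<forall>x\<in>{a<..<b}. \<forall>t\<in>{0<..<delta}. norm (H j (x, t)) \<le> B * t powr - r)"

lemma dH_x: "x \<in> {a<..<b} ==> t \<in> {0<..<delta} ==> ((\<lambda>x. H (Suc j) (x, t)) has_vector_derivative H j (x, t) * zx (x, t)) (at x)"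
 using has_derivative_dform_fst[OF dH] by blast

lemma dH_t: "x \<in> {a<..<b} ==> t \<in> {0<..<delta} ==> ((\<lambda>t. H (Suc j) (x, t)) has_vector_derivative H j (x, t) * zt (x, t)) (at t)"
 using has_derivative_dform_snd[OF dH] by blast

lemma one_le_powr: "t \<in> {0<..<delta} ==> r \<ge> 0 ==> 1 \<le> t powr - r"
 using powr_le1[of r t] delta by (simp add: powr_minus one_le_inverse)

text \<open>Integration of \<open>u powr - r\<close> along a column. At \<open>r = 1\<close> a
  logarithm would appear; this value is avoided later by starting from a half-integral
  exponent.\<close>

lemma vertical_variation:
 assumes x: "x \<in> {a<..<b}" and st: "0 < s" "s < t" "t < delta" and r: "r \<noteq> 1"
  and B: "\<And>u. u \<in> {0<..<delta} ==> norm (H j (x, u)) \<le> B * u powr - r"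
 shows "norm (H (Suc j) (x, t) - H (Suc j) (x, s)) \<le> M * B / (1 - r) * t powr (1 - r) - M * B / (1 - r) * s powr (1 - r)"
proof (rule differentiable_bound_general[OF st(2)])
 have d: "((\<lambda>u. M * B / (1 - r) * u powr (1 - r)) has_real_derivative M * B * u powr - r) (at u)" if "u > 0" for u
 proof -
  have "((\<lambda>u. u powr (1 - r)) has_real_derivative (1 - r) * u powr (1 - r - 1)) (at u)"
   by (rule has_real_derivative_powr[OF that])
  from DERIV_cmult[OF this, of "M * B / (1 - r)"] r show ?thesis by (simp add: mult.assoc)
 qed
 show "continuous_on {s..t} (\<lambda>u. M * B / (1 - r) * u powr (1 - r))"
  by (rule DERIV_continuous_on[OF has_field_derivative_at_within[OF d]]) (use st in auto)
 show "continuous_on {s..t} (\<lambda>u. H (Suc j) (x, u))"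
  by (rule continuous_on_vector_derivative[OF has_vector_derivative_at_within[OF dH_t[OF x]]]) (use st in auto)
 fix u assume u: "s < u" "u < t"
 show "((\<lambda>u. H (Suc j) (x, u)) has_vector_derivative H j (x, u) * zt (x, u)) (at u)"
  by (rule dH_t[OF x]) (use u st in auto)
 show "((\<lambda>u. M * B / (1 - r) * u powr (1 - r)) has_vector_derivative M * B * u powr - r) (at u)"
  using d[of u] u st by (simp add: has_real_derivative_iff_has_vector_derivative)
 have "norm (H j (x, u) * zt (x, u)) \<le> (B * u powr - r) * M"
  unfolding norm_mult
  by (intro mult_mono zt_bound[OF x] B order_trans[OF norm_ge_zero B]) (use u st in auto)
 then show "norm (H j (x, u) * zt (x, u)) \<le> M * B * u powr - r" by (simp add: mult_ac)
qed

lemma horizontal_bound: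
 assumes "dominated r j" obtains E where "E \<ge> 0" "\<And>x. x \<in> {a<..<b} ==> norm (H (Suc j) (x, delta/2)) \<le> E"
proof -
 obtain B where B: "B \<ge> 0" "\<And>x t. x \<in> {a<..<b} ==> t \<in> {0<..<delta} ==> norm (H j (x, t)) \<le> B * t powr - r"
  using assms unfolding dominated_def by blast
 define x0 T D where "x0 = (a + b) / 2" and "T = delta / 2" and "D = B * T powr - r * M"
 have x0: "x0 \<in> {a<..<b}" and T: "T \<in> {0<..<delta}" using ab delta by (auto simp: x0_def T_def)
 have D: "D \<ge> 0" using B M by (simp add: D_def)
 have "norm (H (Suc j) (x, T)) \<le> norm (H (Suc j) (x0, T)) + D * (b - a)" if x: "x \<in> {a<..<b}" for x
 proof -
  have "norm (H (Suc j) (x, T) - H (Suc j) (x0, T)) \<le> D * norm (x - x0)"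
  proof (rule differentiable_bound[of "{a<..<b}" _ "\<lambda>y h. h *\<^sub>R (H j (y, T) * zx (y, T))"])
   fix y assume y: "y \<in> {a<..<b}"
   show "((\<lambda>y. H (Suc j) (y, T)) has_derivative (\<lambda>h. h *\<^sub>R (H j (y, T) * zx (y, T)))) (at y within {a<..<b})"
    using has_vector_derivative_at_within[OF dH_x[OF y T]] by (simp add: has_vector_derivative_def)
   have "norm (H j (y, T) * zx (y, T)) \<le> D"
    unfolding norm_mult D_def using B(2)[OF y T] zx_bound[OF y T] B(1) by (intro mult_mono) auto
   then show "onorm (\<lambda>h. h *\<^sub>R (H j (y, T) * zx (y, T))) \<le> D"
    by (rule onorm_scaleR_left_le)
  qed (use x x0 in auto)
  also have "\<dots> \<le> D * (b - a)" using D x x0 by (intro mult_left_mono) auto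
  finally show ?thesis using norm_triangle_sub[of "H (Suc j) (x, T)" "H (Suc j) (x0, T)"] by linarith
 qed
 moreover have "norm (H (Suc j) (x0, T)) + D * (b - a) \<ge> 0" using D ab by simp
 ultimately show ?thesis using that unfolding T_def by blast
qed

text \<open>Integration from the fixed height \<open>delta / 2\<close> gains one power of
  \<open>t\<close>. Once the exponent would become negative only boundedness is kept, because of the
  contribution of the starting height.\<close>

lemma dominated_step:
 assumes dom: "dominated r j" and r: "r \<noteq> 1" shows "dominated (max (r - 1) 0) (Suc j)"
proof -
 obtain B where B: "B \<ge> 0" "\<And>x t. x \<in> {a<..<b} ==> t \<in> {0<..<delta} ==> norm (H j (x, t)) \<le> B * t powr - r"
  using dom unfolding dominated_def by blast
 obtain E where E: "E \<ge> 0" "\<And>x. x \<in> {a<..<b} ==> norm (H (Suc j) (x, delta/2)) \<le> E"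
  using horizontal_bound[OF dom] by blast
 define c T r' where "c = M * B / (1 - r)" and "T = delta / 2" and "r' = max (r - 1) 0"
 have "norm (H (Suc j) (x, t)) \<le> (E + \<bar>c\<bar> * T powr (1 - r) + \<bar>c\<bar>) * t powr - r'"
  if x: "x \<in> {a<..<b}" and t: "t \<in> {0<..<delta}" for x t
 proof -
  have v: "norm (H (Suc j) (x, t) - H (Suc j) (x, s)) \<le> \<bar>c\<bar> * t powr (1 - r) + \<bar>c\<bar> * s powr (1 - r)"
   if "0 < s" "s < t" "t < delta" for s t
  proof -
   have "norm (H (Suc j) (x, t) - H (Suc j) (x, s)) \<le> c * t powr (1 - r) - c * s powr (1 - r)"
    unfolding c_def by (rule vertical_variation[OF x that r B(2)[OF x]])
   moreover have "c * y \<le> \<bar>c\<bar> * y" "- (c * y) \<le> \<bar>c\<bar> * y" if "y \<ge> 0" for y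
    using mult_right_mono[OF abs_ge_self that] mult_right_mono[OF abs_ge_minus_self that] by simp_all
   ultimately show ?thesis by (smt (verit) powr_ge_zero)
  qed
  have "norm (H (Suc j) (x, t) - H (Suc j) (x, T)) \<le> \<bar>c\<bar> * t powr (1 - r) + \<bar>c\<bar> * T powr (1 - r)"
   using v[of t T] v[of T t] t delta by (cases t T rule: linorder_cases) (auto simp: T_def norm_minus_commute)
  then have "norm (H (Suc j) (x, t)) \<le> (E + \<bar>c\<bar> * T powr (1 - r)) * 1 + \<bar>c\<bar> * t powr (1 - r)"
   using E(2)[OF x] norm_triangle_sub[of "H (Suc j) (x, t)" "H (Suc j) (x, T)"] unfolding T_def[symmetric] by simp
  also have "\<dots> \<le> (E + \<bar>c\<bar> * T powr (1 - r)) * t powr - r' + \<bar>c\<bar> * t powr - r'"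
   using E(1) t delta by (intro add_mono mult_left_mono one_le_powr powr_mono') (auto simp: r'_def)
  finally show ?thesis by (simp add: distrib_right)
 qed
 moreover have "E + \<bar>c\<bar> * T powr (1 - r) + \<bar>c\<bar> \<ge> 0" using E by simp
 ultimately show ?thesis unfolding dominated_def r'_def by blast
qed

text \<open>The growth condition bounds \<open>H 0\<close> only in the mean over \<open>x\<close>.
  The mean controls the oscillation of \<open>H 1\<close> in \<open>x\<close> at each height and, by
  differentiation under the integral sign, the average \<open>A t\<close> of \<open>H 1\<close> over
  a fixed interval; together these give a pointwise bound without loss in the exponent.\<close>

lemma dominated_start:
 assumes B: "B \<ge> 0" and r: "r \<ge> 0"
  and gr: "\<And>a1 b1 t. a < a1 ==> a1 < b1 ==> b1 < b ==> t \<in> {0<..<delta} ==> integral {a1..b1} (\<lambda>x. norm (H 0 (x, t))) \<le> B * t powr - r"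
 shows "dominated r 1"
proof -
 define a1 b1 T where "a1 = a + (b - a) / 3" and "b1 = b - (b - a) / 3" and "T = delta / 2"
 have a1b1: "a < a1" "a1 < b1" "b1 < b" and T: "T \<in> {0<..<delta}" using ab delta by (auto simp: a1_def b1_def T_def field_simps)
 have cont: "continuous_on S (\<lambda>x. H 0 (x, t))" "continuous_on S (\<lambda>x. zx (x, t))" "continuous_on S (\<lambda>x. zt (x, t))"
  if "S \<subseteq> {a<..<b}" "t \<in> {0<..<delta}" for S t
  by (rule continuous_on_compose2[OF H0] continuous_on_compose2[OF zx] continuous_on_compose2[OF zt];
   use that in \<open>auto intro!: continuous_intros\<close>)+
 have int: "norm (integral {u..v} (\<lambda>x. H 0 (x, t) * w (x, t))) \<le> M * B * t powr - r"
  if uv: "a < u" "u < v" "v < b" and t: "t \<in> {0<..<delta}" and w: "w = zx \<or> w = zt" for u v t w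
 proof -
  have uvs: "{u..v} \<subseteq> {a<..<b}" using uv by auto
  have "norm (integral {u..v} (\<lambda>x. H 0 (x, t) * w (x, t))) \<le> integral {u..v} (\<lambda>x. M * norm (H 0 (x, t)))"
  proof (rule integral_norm_bound_integral)
   show "(\<lambda>x. H 0 (x, t) * w (x, t)) integrable_on {u..v}" "(\<lambda>x. M * norm (H 0 (x, t))) integrable_on {u..v}"
    using w by (auto intro!: integrable_continuous_real continuous_intros cont[OF uvs t])
   fix x assume "x \<in> {u..v}"
   then have "norm (w (x, t)) \<le> M" using w zx_bound[of x t] zt_bound[of x t] uv t by auto
   then show "norm (H 0 (x, t) * w (x, t)) \<le> M * norm (H 0 (x, t))"
    unfolding norm_mult mult.commute[of M] by (rule mult_left_mono) simp
  qed
  also have "\<dots> = M * integral {u..v} (\<lambda>x. norm (H 0 (x, t)))" by simp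
  also have "\<dots> \<le> M * (B * t powr - r)" using gr[OF uv t] M by (rule mult_left_mono)
  finally show ?thesis by (simp add: mult_ac)
 qed
 define m where "m t = M * B * t powr - r" for t
 have m: "m t \<ge> 0" for t using M B by (simp add: m_def)
 have osc': "norm (H 1 (v, t) - H 1 (u, t)) \<le> m t" if "a < u" "u < v" "v < b" "t \<in> {0<..<delta}" for u v t
 proof -
  have "((\<lambda>x. H 0 (x, t) * zx (x, t)) has_integral H 1 (v, t) - H 1 (u, t)) {u..v}"
   unfolding One_nat_def
   by (rule fundamental_theorem_of_calculus) (use that in \<open>auto intro!: has_vector_derivative_at_within[OF dH_x]\<close>)
  then show ?thesis using int[of u v t zx] that by (simp add: integral_unique m_def)
 qed
 have osc: "norm (H 1 (v, t) - H 1 (u, t)) \<le> m t" if "u \<in> {a<..<b}" "v \<in> {a<..<b}" "t \<in> {0<..<delta}" for u v t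
  using osc'[of u v t] osc'[of v u t] that m[of t] by (cases u v rule: linorder_cases) (auto simp: norm_minus_commute)
 define A where "A t = integral {a1..b1} (\<lambda>x. H 1 (x, t))" for t
 have dA: "(A has_vector_derivative integral {a1..b1} (\<lambda>x. H 0 (x, t) * zt (x, t))) (at t)" if t: "t \<in> {0<..<delta}" for t
 proof -
  have "((\<lambda>t. integral (cbox a1 b1) (\<lambda>x. H 1 (x, t))) has_vector_derivative integral (cbox a1 b1) (\<lambda>x. H 0 (x, t) * zt (x, t))) (at t within {0<..<delta})"
  proof (rule leibniz_rule_vector_derivative)
   fix s x assume "s \<in> {0<..<delta}" "x \<in> cbox a1 b1"
   then show "((\<lambda>s. H 1 (x, s)) has_vector_derivative H 0 (x, s) * zt (x, s)) (at s within {0<..<delta})"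
    unfolding One_nat_def using a1b1 by (intro has_vector_derivative_at_within[OF dH_t]) auto
  next
   fix s assume s: "s \<in> {0<..<delta}"
   have "continuous_on {a1..b1} (\<lambda>x. H 1 (x, s))"
    unfolding One_nat_def
    by (rule continuous_on_vector_derivative[OF has_vector_derivative_at_within[OF dH_x]]) (use a1b1 s in auto)
   then show "(\<lambda>x. H 1 (x, s)) integrable_on cbox a1 b1" using integrable_continuous_real by simp
  next
   have "continuous_on ({0<..<delta} \<times> {a1..b1}) (\<lambda>z. H 0 (snd z, fst z) * zt (snd z, fst z))"
    by (intro continuous_on_mult continuous_on_compose2[OF H0] continuous_on_compose2[OF zt])
     (use a1b1 in \<open>auto intro!: continuous_intros\<close>)
   then show "continuous_on ({0<..<delta} \<times> cbox a1 b1) (\<lambda>(s, x). H 0 (x, s) * zt (x, s))" by (simp add: split_def)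
  qed (use t in auto)
  then show ?thesis using t unfolding A_def[abs_def] by (simp add: at_within_open[OF t open_greaterThanLessThan])
 qed
 have A: "norm (A t - A T) \<le> m t + m T" if t: "t \<in> {0<..<delta}" for t
 proof -
  have "norm (A t - A T) \<le> (m t + m T) * norm (t - T)"
  proof (rule differentiable_bound[of "closed_segment t T" _ "\<lambda>s h. h *\<^sub>R integral {a1..b1} (\<lambda>x. H 0 (x, s) * zt (x, s))"])
   fix s assume s: "s \<in> closed_segment t T"
   then have s': "s \<in> {0<..<delta}" "t \<le> s \<or> T \<le> s" using t T by (auto simp: closed_segment_eq_real_ivl split: if_splits)
   show "(A has_derivative (\<lambda>h. h *\<^sub>R integral {a1..b1} (\<lambda>x. H 0 (x, s) * zt (x, s)))) (at s within closed_segment t T)"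
    using has_vector_derivative_at_within[OF dA[OF s'(1)]] by (simp add: has_vector_derivative_def)
   have "s powr - r \<le> t powr - r \<or> s powr - r \<le> T powr - r"
    using s'(2) powr_mono2'[of "- r" t s] powr_mono2'[of "- r" T s] t T r by auto
   then have "s powr - r \<le> t powr - r + T powr - r"
    using powr_ge_zero[of t "- r"] powr_ge_zero[of T "- r"] by linarith
   then have "M * B * s powr - r \<le> M * B * (t powr - r + T powr - r)" using M B by (intro mult_left_mono) auto
   then have "norm (integral {a1..b1} (\<lambda>x. H 0 (x, s) * zt (x, s))) \<le> m t + m T"
    using int[OF a1b1 s'(1), of zt] by (simp add: m_def distrib_left)
   then show "onorm (\<lambda>h. h *\<^sub>R integral {a1..b1} (\<lambda>x. H 0 (x, s) * zt (x, s))) \<le> m t + m T"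
    by (rule onorm_scaleR_left_le)
  qed auto
  also have "\<dots> \<le> (m t + m T) * 1" using t T delta m by (intro mult_left_mono) (auto simp: add_nonneg_nonneg)
  finally show ?thesis by simp
 qed
 define l where "l = b1 - a1"
 have l: "l > 0" using a1b1 by (simp add: l_def)
 have "norm (H 1 (x, t)) \<le> ((norm (A T) + m T) / l + M * B / l + M * B) * t powr - r"
  if x: "x \<in> {a<..<b}" and t: "t \<in> {0<..<delta}" for x t
 proof -
  have c1: "continuous_on {a1..b1} (\<lambda>x. H 1 (x, t))"
   unfolding One_nat_def
   by (rule continuous_on_vector_derivative[OF has_vector_derivative_at_within[OF dH_x]]) (use a1b1 t in auto)
  have "norm (integral {a1..b1} (\<lambda>y. H 1 (x, t) - H 1 (y, t))) \<le> integral {a1..b1} (\<lambda>y. m t)"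
   by (rule integral_norm_bound_integral)
    (use c1 osc[of _ x t] x t a1b1 in \<open>auto intro!: integrable_continuous_real continuous_intros\<close>)
  moreover have "integral {a1..b1} (\<lambda>y. H 1 (x, t) - H 1 (y, t)) = integral {a1..b1} (\<lambda>y. H 1 (x, t)) - A t"
   unfolding A_def by (intro Henstock_Kurzweil_Integration.integral_diff integrable_continuous_real c1 continuous_intros)
  ultimately have "norm (l *\<^sub>R H 1 (x, t) - A t) \<le> l * m t"
   using a1b1 by (simp add: l_def scaleR_conv_of_real)
  then have "norm (l *\<^sub>R H 1 (x, t)) \<le> norm (A t) + l * m t"
   using norm_triangle_sub[of "l *\<^sub>R H 1 (x, t)" "A t"] by linarith
  also have "norm (A t) \<le> norm (A T) + m T + m t"
   using A[OF t] norm_triangle_sub[of "A t" "A T"] by linarith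
  finally have "l * norm (H 1 (x, t)) \<le> norm (A T) + m T + m t + l * m t" using l by simp
  then have "norm (H 1 (x, t)) \<le> (norm (A T) + m T) / l + m t / l + m t"
   using l by (simp add: field_simps)
  moreover have "(norm (A T) + m T) / l * 1 \<le> (norm (A T) + m T) / l * t powr - r"
   using l m[of T] by (intro mult_left_mono one_le_powr t r) auto
  ultimately show ?thesis by (simp add: m_def distrib_right)
 qed
 moreover have "(norm (A T) + m T) / l + M * B / l + M * B \<ge> 0" using l m[of T] M B by simp
 ultimately show ?thesis unfolding dominated_def by blast
qed

text \<open>A bounded \<open>H j\<close> makes \<open>H (Suc j)\<close> Lipschitz on a convex set,
  hence uniformly continuous, so that it extends to the closure.\<close>

lemma dominated_extension:
 assumes dom: "dominated 0 j"
 shows "\<exists>g. continuous_on ({a<..<b} \<times> {0..<delta}) g \<and> (\<forall>q\<in>{a<..<b} \<times> {0<..<delta}. g q = H (Suc j) q)"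
proof -
 define R where "R = {a<..<b} \<times> {0<..<delta}"
 obtain B where B: "B \<ge> 0" "\<And>x t. x \<in> {a<..<b} ==> t \<in> {0<..<delta} ==> norm (H j (x, t)) \<le> B * t powr - 0"
  using dom unfolding dominated_def by blast
 have Bb: "norm (H j (x, t)) \<le> B" if "x \<in> {a<..<b}" "t \<in> {0<..<delta}" for x t using B(2)[OF that] that by simp
 have "norm (H (Suc j) p - H (Suc j) q) \<le> (2 * B * M) * norm (p - q)" if pq: "p \<in> R" "q \<in> R" for p q
 proof (rule differentiable_bound[OF _ _ _ pq])
  show "convex R" unfolding R_def by (intro convex_Times) auto
  fix w assume w: "w \<in> R"
  obtain x t where xt: "w = (x, t)" "x \<in> {a<..<b}" "t \<in> {0<..<delta}" using w by (auto simp: R_def)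
  show "(H (Suc j) has_derivative dform (H j w * zx w) (H j w * zt w)) (at w within R)"
   unfolding xt by (rule has_derivative_at_withinI[OF dH[OF xt(2,3)]])
  have n: "norm (H j w * zx w) \<le> B * M" "norm (H j w * zt w) \<le> B * M"
   unfolding xt norm_mult using Bb[OF xt(2,3)] zx_bound[OF xt(2,3)] zt_bound[OF xt(2,3)] B(1) by (auto intro!: mult_mono)
  show "onorm (dform (H j w * zx w) (H j w * zt w)) \<le> 2 * B * M"
  proof (rule onorm_le)
   fix v :: plane
   have "norm (dform (H j w * zx w) (H j w * zt w) v) \<le> \<bar>fst v\<bar> * norm (H j w * zx w) + \<bar>snd v\<bar> * norm (H j w * zt w)"
    unfolding dform_def using norm_triangle_ineq[of "fst v *\<^sub>R (H j w * zx w)" "snd v *\<^sub>R (H j w * zt w)"] by simp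
   also have "\<dots> \<le> norm v * (B * M) + norm v * (B * M)"
    using n norm_fst_le[of "fst v" "snd v"] norm_snd_le[of "snd v" "fst v"] by (intro add_mono mult_mono) auto
   finally show "norm (dform (H j w * zx w) (H j w * zt w) v) \<le> 2 * B * M * norm v" by (simp add: mult_ac)
  qed
 qed
 then have "(2 * B * M)-lipschitz_on R (H (Suc j))"
  using B M by (intro lipschitz_onI) (auto simp: dist_norm)
 then have "uniformly_continuous_on R (H (Suc j))" by (rule lipschitz_on_uniformly_continuous)
 then obtain g where g: "uniformly_continuous_on (closure R) g" "\<And>q. q \<in> R ==> H (Suc j) q = g q"
  using uniformly_continuous_on_extension_on_closure by metis
 have "{a<..<b} \<times> {0..<delta} \<subseteq> closure R"
  unfolding R_def closure_Times using ab delta by (auto simp: closure_greaterThanLessThan)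
 then have "continuous_on ({a<..<b} \<times> {0..<delta}) g"
  using uniformly_continuous_imp_continuous[OF g(1)] continuous_on_subset by blast
 then show ?thesis using g(2) unfolding R_def by (intro exI[of _ g]) auto
qed

text \<open>The exponent \<open>n + 1/2\<close> never meets the logarithmic value \<open>1\<close>
  when it is lowered by integers. After \<open>H 1\<close> it takes \<open>n + 1\<close> further
  primitives to reach exponent \<open>0\<close> and one more to be continuous up to the boundary,
  whence the count \<open>n + 3\<close>.\<close>

lemma growth_extension:
 assumes B: "B \<ge> 0"
  and gr: "\<And>a1 b1 t. a < a1 ==> a1 < b1 ==> b1 < b ==> t \<in> {0<..<delta} ==>
   integral {a1..b1} (\<lambda>x. norm (H 0 (x, t))) \<le> B * t powr - (real n + 1/2)"
  and j: "j \<ge> n + 3"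
 shows "\<exists>g. continuous_on ({a<..<b} \<times> {0..<delta}) g \<and> (\<forall>q\<in>{a<..<b} \<times> {0<..<delta}. g q = H j q)"
proof -
 have d: "dominated (max (real n + 1/2 - real i) 0) (Suc i)" for i
 proof (induction i)
  case 0
  show ?case using dominated_start[OF B _ gr] by simp
 next
  case (Suc i)
  have "real n + 1/2 - real i \<noteq> 1"
  proof
   assume "real n + 1/2 - real i = 1"
   then have "real (2 * n + 1) = real (2 * i + 2)" by simp
   then show False unfolding of_nat_eq_iff by presburger
  qed
  then have "max (real n + 1/2 - real i) 0 \<noteq> 1" by (simp add: max_def)
  from dominated_step[OF Suc this] show ?case by (simp add: max_def algebra_simps split: if_splits)
 qed
 obtain i where i: "j = Suc (Suc i)" "i \<ge> n + 1" using j by (intro that[of "j - 2"]) auto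
 then show ?thesis using d[of i] dominated_extension[of "Suc i"] by (simp add: max_def split: if_splits)
qed

end

section \<open>Exactness against entire weights passes to primitives\<close>

context coords
begin

definition exact_for :: "(plane => complex) => bool" where
 "exact_for g \<longleftrightarrow> (\<forall>h. h holomorphic_on UNIV --> (\<exists>P. \<forall>q\<in>box1.
   (P has_derivative dform (g q * h (zmap phi q) * zdx phix q) (g q * h (zmap phi q) * zdt phit q)) (at q)))"

lemma dform_mult: "c * dform p q v = dform (c * p) (c * q) v"
 by (simp add: dform_def algebra_simps)

text \<open>Partial integration: with \<open>h1' = h\<close> one has
  \<open>G h(Z) dZ = d(G h1(Z)) - g h1(Z) dZ\<close>, and the last form is exact because
  \<open>h1\<close> is again entire.\<close>

lemma exact_for_primitive:
 assumes g: "exact_for g"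
  and G: "\<And>q. q \<in> box1 ==> (G has_derivative dform (g q * zdx phix q) (g q * zdt phit q)) (at q)"
 shows "exact_for G"
 unfolding exact_for_def
proof (intro allI impI)
 fix h :: "complex => complex" assume h: "h holomorphic_on UNIV"
 obtain h1 where h1: "\<And>z. (h1 has_field_derivative h z) (at z)"
  using holomorphic_convex_primitive'[OF convex_UNIV open_UNIV h] by auto
 have "h1 holomorphic_on UNIV" using h1 by (auto simp: holomorphic_on_def field_differentiable_def)
 then obtain P where P: "\<And>q. q \<in> box1 ==>
   (P has_derivative dform (g q * h1 (zmap phi q) * zdx phix q) (g q * h1 (zmap phi q) * zdt phit q)) (at q)"
  using g unfolding exact_for_def by blast
 show "\<exists>P. \<forall>q\<in>box1. (P has_derivative dform (G q * h (zmap phi q) * zdx phix q) (G q * h (zmap phi q) * zdt phit q)) (at q)"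
 proof (intro exI ballI)
  fix q assume q: "q \<in> box1"
  then have "q \<in> box0" using delta by auto
  from has_derivative_compose[OF zmap_has_derivative[OF this] h1[unfolded has_field_derivative_def]]
  have "((\<lambda>q. h1 (zmap phi q)) has_derivative (\<lambda>v. h (zmap phi q) * dform (zdx phix q) (zdt phit q) v)) (at q)" .
  from has_derivative_diff[OF has_derivative_mult[OF G[OF q] this] P[OF q]]
  have "((\<lambda>q. G q * h1 (zmap phi q) - P q) has_derivative (\<lambda>v. G q * (h (zmap phi q) * dform (zdx phix q) (zdt phit q) v)
    + dform (g q * zdx phix q) (g q * zdt phit q) v * h1 (zmap phi q)
    - dform (g q * h1 (zmap phi q) * zdx phix q) (g q * h1 (zmap phi q) * zdt phit q) v)) (at q)" .
  moreover have "(\<lambda>v. G q * (h (zmap phi q) * dform (zdx phix q) (zdt phit q) v)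
    + dform (g q * zdx phix q) (g q * zdt phit q) v * h1 (zmap phi q)
    - dform (g q * h1 (zmap phi q) * zdx phix q) (g q * h1 (zmap phi q) * zdt phit q) v)
   = dform (G q * h (zmap phi q) * zdx phix q) (G q * h (zmap phi q) * zdt phit q)"
   by (auto simp: dform_def algebra_simps)
  ultimately show "((\<lambda>q. G q * h1 (zmap phi q) - P q) has_derivative dform (G q * h (zmap phi q) * zdx phix q) (G q * h (zmap phi q) * zdt phit q)) (at q)"
   by simp
 qed
qed

theorem strip_exists:
 assumes F: "continuous_on box1 F" "exact_for F" and delta1: "delta \<le> 1" and B: "B \<ge> 0"
  and gr: "\<And>a1 b1 t. a < a1 ==> a1 < b1 ==> b1 < b ==> t \<in> {0<..<delta} ==>
   integral {a1..b1} (\<lambda>x. norm (F (x, t))) \<le> B * t powr - (real n + 1/2)"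
 shows "\<exists>H K. K \<ge> 1 \<and> strip a b delta C phi phix phit H K \<and> (\<forall>q\<in>box1. H 0 q = F q)"
proof -
 define R where "R = box1"
 have oR: "open R" unfolding R_def by (intro open_Times) auto
 have "\<exists>G. \<forall>j. (exact_for (G j) \<and> (j = 0 --> G j = F)) \<and> (\<forall>q\<in>R. (G (Suc j) has_derivative dform (G j q * zdx phix q) (G j q * zdt phit q)) (at q))"
 proof (rule dependent_nat_choice)
  show "\<exists>g. exact_for g \<and> (0 = (0::nat) --> g = F)" using F(2) by blast
  fix g and j :: nat assume g: "exact_for g \<and> (j = 0 --> g = F)"
  then obtain P where P: "\<And>q. q \<in> R ==> (P has_derivative dform (g q * 1 * zdx phix q) (g q * 1 * zdt phit q)) (at q)"
   unfolding exact_for_def R_def using holomorphic_on_const[of 1 UNIV] by metis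
  then have "exact_for P" using g exact_for_primitive[of g P] unfolding R_def by simp
  then show "\<exists>y. (exact_for y \<and> (Suc j = 0 --> y = F)) \<and> (\<forall>q\<in>R. (y has_derivative dform (g q * zdx phix q) (g q * zdt phit q)) (at q))"
   using P by (intro exI[of _ P]) auto
 qed
 then obtain G where G: "\<And>j. exact_for (G j)" "G 0 = F"
   "\<And>j q. q \<in> R ==> (G (Suc j) has_derivative dform (G j q * zdx phix q) (G j q * zdt phit q)) (at q)"
  by blast
 have sub: "R \<subseteq> box0" using delta by (auto simp: R_def)
 have bz: "norm (zdx phix q) \<le> 1 + C" "norm (zdt phit q) \<le> 1 + C" if "q \<in> R" for q
 proof -
  have q: "q \<in> box0" using sub that by blast
  show "norm (zdx phix q) \<le> 1 + C" "norm (zdt phit q) \<le> 1 + C"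
   using cmod_le[of "zdx phix q"] cmod_le[of "zdt phit q"] bphix[OF q] bphit[OF q] by (auto simp: zdx_def zdt_def)
 qed
 interpret G: chain a b delta "1 + C" "zdx phix" "zdt phit" G
 proof (unfold_locales)
  show "continuous_on box1 (zdx phix)" "continuous_on box1 (zdt phit)"
   using continuous_on_subset[OF continuous_on_zdx] continuous_on_subset[OF continuous_on_zdt] sub unfolding R_def by blast+
  fix x t j assume "x \<in> {a<..<b}" "t \<in> {0<..<delta}"
  then have q: "(x, t) \<in> R" by (simp add: R_def)
  show "norm (zdx phix (x, t)) \<le> 1 + C" "norm (zdt phit (x, t)) \<le> 1 + C" using bz[OF q] by auto
  show "(G (Suc j) has_derivative dform (G j (x, t) * zdx phix (x, t)) (G j (x, t) * zdt phit (x, t))) (at (x, t))"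
   by (rule G(3)[OF q])
 qed (use ab delta delta1 C F G(2) in auto)
 have "\<forall>j. \<exists>g. j \<ge> n + 3 --> continuous_on ({a<..<b} \<times> {0..<delta}) g \<and> (\<forall>q\<in>R. g q = G j q)"
  using G.growth_extension[OF B, unfolded G(2), OF gr] unfolding R_def by blast
 then obtain E where E: "\<And>j. j \<ge> n + 3 ==> continuous_on ({a<..<b} \<times> {0..<delta}) (E j)" "\<And>j q. j \<ge> n + 3 ==> q \<in> R ==> E j q = G j q"
  by metis
 \<comment> \<open>The primitives are altered only at \<open>t \<le> 0\<close>, outside the open
   rectangle, to take there the values of their continuous extensions \<open>E j\<close>.\<close>
 define H where "H j q = (if j \<ge> n + 3 \<and> snd q \<le> 0 then E j q else G j q)" for j q
 have HG: "H j q = G j q" if "q \<in> R" for j q using that by (auto simp: H_def R_def)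
 have "strip a b delta C phi phix phit H (n + 3)"
 proof (unfold_locales, fold R_def)
  show "continuous_on R (H 0)" using F(1) HG G(2) by (subst continuous_on_cong[OF refl HG]) (auto simp: R_def)
  fix j q assume q: "q \<in> R"
  have "(H (Suc j) has_derivative dform (G j q * zdx phix q) (G j q * zdt phit q)) (at q)"
   by (rule has_derivative_transform_within_open[OF G(3)[OF q] oR q]) (simp add: HG)
  then show "(H (Suc j) has_derivative dform (H j q * zdx phix q) (H j q * zdt phit q)) (at q)" by (simp add: HG[OF q])
 next
  fix j and h :: "complex => complex" assume "h holomorphic_on UNIV"
  then have "\<exists>P. \<forall>q\<in>R. (P has_derivative dform (G j q * h (zmap phi q) * zdx phix q) (G j q * h (zmap phi q) * zdt phit q)) (at q)"
   using G(1)[of j] unfolding exact_for_def R_def by blast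
  then show "\<exists>P. \<forall>q\<in>R. (P has_derivative dform (H j q * h (zmap phi q) * zdx phix q) (H j q * h (zmap phi q) * zdt phit q)) (at q)"
   by (simp add: HG)
 next
  fix j assume j: "n + 3 \<le> j"
  have "H j q = E j q" if "q \<in> {a<..<b} \<times> {0..<delta}" for q
  proof (cases "snd q \<le> 0")
   case False
   then have "q \<in> R" using that by (auto simp: R_def)
   then show ?thesis using HG E(2)[OF j] by simp
  qed (simp add: H_def j)
  then show "continuous_on ({a<..<b} \<times> {0..<delta}) (H j)"
   using E(1)[OF j] by (subst continuous_on_cong[OF refl]) auto
 qed
 then show ?thesis using HG G(2) by (intro exI[of _ H] exI[of _ "n + 3"]) (auto simp: R_def)
qed

end

section \<open>Adapted coordinates near a boundary point\<close>

lemma linear_plane: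
 fixes D :: "plane => 'b::real_normed_vector"
 assumes "linear D" shows "D v = fst v *\<^sub>R D (1, 0) + snd v *\<^sub>R D (0, 1)"
proof -
 have "D (fst v *\<^sub>R (1, 0) + snd v *\<^sub>R (0, 1)) = fst v *\<^sub>R D (1, 0) + snd v *\<^sub>R D (0, 1)"
  using assms by (simp only: linear_add linear_scale)
 then show ?thesis by simp
qed

lemma linear_frechet: "f differentiable (at z) ==> linear (frechet_derivative f (at z))"
 using frechet_derivative_worksI has_derivative_linear by blast

text \<open>The inverse function theorem gives one derivative of the inverse. Its partial
  derivatives are rational expressions in the first derivatives of \<open>u\<close> and
  \<open>\<rho>\<close>, composed with the inverse itself, so its regularity rises by one order at a
  time.\<close>

lemma plane_inverse:
 fixes u \<rho> :: "plane => real"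
 assumes A: "open A" "z0 \<in> A" and u: "smooth_on A u" and \<rho>: "smooth_on A \<rho>"
  and J: "\<And>v. frechet_derivative u (at z0) v = 0 ==> frechet_derivative \<rho> (at z0) v = 0 ==> v = 0"
 obtains Q V kappa where "open Q" "z0 \<in> Q" "Q \<subseteq> A" "open V"
  "\<And>q. q \<in> V ==> kappa q \<in> Q \<and> u (kappa q) = fst q \<and> \<rho> (kappa q) = snd q"
  "\<And>w. w \<in> Q ==> (u w, \<rho> w) \<in> V \<and> kappa (u w, \<rho> w) = w"
  "smooth_on V kappa" "\<And>q. q \<in> V ==> inj (frechet_derivative kappa (at q))"
proof -
 define f where "f w = (u w, \<rho> w)" for w
 define f' where "f' w = Blinfun (\<lambda>v. (frechet_derivative u (at w) v, frechet_derivative \<rho> (at w) v))" for w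
 have du: "(u has_derivative frechet_derivative u (at w)) (at w)" and d\<rho>: "(\<rho> has_derivative frechet_derivative \<rho> (at w)) (at w)"
  if "w \<in> A" for w using smooth_on_has_derivative[OF u A(1) that] smooth_on_has_derivative[OF \<rho> A(1) that] by auto
 have df: "(f has_derivative (\<lambda>v. (frechet_derivative u (at w) v, frechet_derivative \<rho> (at w) v))) (at w)" if "w \<in> A" for w
  unfolding f_def[abs_def] by (rule has_derivative_Pair[OF du[OF that] d\<rho>[OF that]])
 have f'a: "blinfun_apply (f' w) = (\<lambda>v. (frechet_derivative u (at w) v, frechet_derivative \<rho> (at w) v))" if "w \<in> A" for w
  unfolding f'_def by (rule bounded_linear_Blinfun_apply[OF has_derivative_bounded_linear[OF df[OF that]]])
 have cf': "continuous_on A f'"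
 proof (rule continuous_on_blinfun_componentwise)
  fix i :: plane assume i: "i \<in> Basis"
  have "continuous_on A (\<lambda>w. (pd i u w, pd i \<rho> w))"
   by (intro continuous_on_Pair smooth_on_imp_continuous_on smooth_on_pd u \<rho> i)
  then show "continuous_on A (\<lambda>w. blinfun_apply (f' w) i)"
   by (subst continuous_on_cong[OF refl]) (auto simp: f'a)
 qed
 define u1 u2 r1 r2 where "u1 = pd (1, 0) u" and "u2 = pd (0, 1) u" and "r1 = pd (1, 0) \<rho>" and "r2 = pd (0, 1) \<rho>"
 have lu: "frechet_derivative u (at w) v = fst v * u1 w + snd v * u2 w"
  and l\<rho>: "frechet_derivative \<rho> (at w) v = fst v * r1 w + snd v * r2 w" if "w \<in> A" for w v
  using linear_plane[OF has_derivative_linear[OF du[OF that]], of v] linear_plane[OF has_derivative_linear[OF d\<rho>[OF that]], of v]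
  by (auto simp: u1_def u2_def r1_def r2_def)
 have "\<exists>g. linear g \<and> g \<circ> blinfun_apply (f' z0) = id"
 proof (rule linear_injective_left_inverse)
  show lin: "linear (blinfun_apply (f' z0))" by (rule bounded_linear.linear[OF blinfun.bounded_linear_right])
  show "inj (blinfun_apply (f' z0))"
   unfolding linear_injective_0[OF lin] using J by (simp add: f'a[OF A(2)] zero_prod_def)
 qed
 then obtain g0 where g0: "bounded_linear g0" "\<And>v. g0 (blinfun_apply (f' z0) v) = v"
  using linear_conv_bounded_linear by (metis comp_apply id_apply)
 have inv: "Blinfun g0 o\<^sub>L f' z0 = id_blinfun"
  by (rule blinfun_eqI) (simp add: bounded_linear_Blinfun_apply[OF g0(1)] g0(2))
 have f'd: "(f has_derivative blinfun_apply (f' w)) (at w)" if "w \<in> A" for w using df[OF that] f'a[OF that] by simp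
 obtain Q V kappa g' where Q: "open Q" "Q \<subseteq> A" "z0 \<in> Q" and V: "open V" "f z0 \<in> V" and hom: "homeomorphism Q V f kappa"
  and g': "\<And>y. y \<in> V ==> (kappa has_derivative (g' y)) (at y)"
  using inverse_function_theorem[OF A(1) f'd cf' A(2) inv] by metis
 have kappa: "kappa q \<in> Q \<and> u (kappa q) = fst q \<and> \<rho> (kappa q) = snd q" if "q \<in> V" for q
 proof -
  have "f (kappa q) = q" "kappa q \<in> Q" using hom that by (auto simp: homeomorphism_def)
  then show ?thesis by (cases q) (auto simp: f_def)
 qed
 have kappa': "(u w, \<rho> w) \<in> V \<and> kappa (u w, \<rho> w) = w" if "w \<in> Q" for w
  using hom that by (auto simp: homeomorphism_def f_def)
 have chain: "fst (g' q v) * u1 (kappa q) + snd (g' q v) * u2 (kappa q) = fst v" "fst (g' q v) * r1 (kappa q) + snd (g' q v) * r2 (kappa q) = snd v"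
  if q: "q \<in> V" for q v
 proof -
  have a: "kappa q \<in> A" using kappa[OF q] Q by auto
  have e1: "(fst has_derivative (\<lambda>v. frechet_derivative u (at (kappa q)) (g' q v))) (at q)"
   by (rule has_derivative_transform_within_open[OF has_derivative_compose[OF g'[OF q] du[OF a]] V(1) q]) (use kappa in auto)
  have e2: "(snd has_derivative (\<lambda>v. frechet_derivative \<rho> (at (kappa q)) (g' q v))) (at q)"
   by (rule has_derivative_transform_within_open[OF has_derivative_compose[OF g'[OF q] d\<rho>[OF a]] V(1) q]) (use kappa in auto)
  have "(\<lambda>v. frechet_derivative u (at (kappa q)) (g' q v)) = fst"
   by (rule has_derivative_unique[OF e1 has_derivative_fst[OF has_derivative_ident]])
  then show "fst (g' q v) * u1 (kappa q) + snd (g' q v) * u2 (kappa q) = fst v" using lu[OF a] by (metis (no_types))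
  have "(\<lambda>v. frechet_derivative \<rho> (at (kappa q)) (g' q v)) = snd"
   by (rule has_derivative_unique[OF e2 has_derivative_snd[OF has_derivative_ident]])
  then show "fst (g' q v) * r1 (kappa q) + snd (g' q v) * r2 (kappa q) = snd v" using l\<rho>[OF a] by (metis (no_types))
 qed
 define jj where "jj w = u1 w * r2 w - u2 w * r1 w" for w
 have jj: "jj (kappa q) \<noteq> 0" if q: "q \<in> V" for q
 proof
  assume z: "jj (kappa q) = 0"
  note c = chain[OF q, of "(1, 0)"] chain[OF q, of "(0, 1)"]
  define p s p' s' where "p = fst (g' q (1, 0))" and "s = snd (g' q (1, 0))" and "p' = fst (g' q (0, 1))" and "s' = snd (g' q (0, 1))"
  have "(p * s' - s * p') * jj (kappa q) = (p * u1 (kappa q) + s * u2 (kappa q)) * (p' * r1 (kappa q) + s' * r2 (kappa q))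
    - (p * r1 (kappa q) + s * r2 (kappa q)) * (p' * u1 (kappa q) + s' * u2 (kappa q))"
   by (simp add: jj_def algebra_simps)
  also have "\<dots> = 1" using c by (simp add: p_def s_def p'_def s'_def)
  finally show False using z by simp
 qed
 \<comment> \<open>The columns of the inverse Jacobian matrix by Cramer's rule.\<close>
 define K1 K2 where "K1 w = (r2 w / jj w, - r1 w / jj w)" and "K2 w = (- u2 w / jj w, u1 w / jj w)" for w
 have sol: "g' q v = fst v *\<^sub>R K1 (kappa q) + snd v *\<^sub>R K2 (kappa q)" if q: "q \<in> V" for q v
 proof -
  note c = chain[OF q, of v]
  have "fst (g' q v) * jj (kappa q) = fst v * r2 (kappa q) - snd v * u2 (kappa q)" "snd (g' q v) * jj (kappa q) = snd v * u1 (kappa q) - fst v * r1 (kappa q)"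
   unfolding c[symmetric] jj_def by (auto simp: algebra_simps)
  then show ?thesis using jj[OF q] by (auto simp: prod_eq_iff K1_def K2_def field_simps)
 qed
 define A' where "A' = A \<inter> jj -` (- {0})"
 have sm: "smooth_on A u1" "smooth_on A u2" "smooth_on A r1" "smooth_on A r2"
  unfolding u1_def u2_def r1_def r2_def by (intro smooth_on_pd u \<rho>; simp add: Basis_plane)+
 have smj: "smooth_on A jj" unfolding jj_def[abs_def] by (intro smooth_on_diff smooth_on_mult sm A)
 have oA': "open A'" unfolding A'_def
  by (rule continuous_open_preimage[OF smooth_on_imp_continuous_on[OF smj] A(1)]) auto
 have smA': "smooth_on A' h" if "smooth_on A h" for h :: "plane => real" using that smooth_on_subset A'_def by blast
 have smK: "smooth_on A' K1" "smooth_on A' K2"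
  unfolding K1_def[abs_def] K2_def[abs_def]
  by (intro smooth_on_Pair smooth_on_divide smooth_on_minus smA' sm smj oA'; simp add: A'_def)+
 have VA': "kappa ` V \<subseteq> A'" using kappa Q jj by (auto simp: A'_def)
 have pdkappa: "pd (1, 0) kappa q = K1 (kappa q)" "pd (0, 1) kappa q = K2 (kappa q)" if q: "q \<in> V" for q
  using frechet_derivative_at[OF g'[OF q], symmetric] sol[OF q] by auto
 have "ndiff n V kappa" for n
 proof (induction n)
  case 0
  show ?case using g' by (auto simp: differentiable_on_def differentiable_def intro: has_derivative_at_withinI)
 next
  case (Suc n)
  have "ndiff n V (pd (1, 0) kappa)"
   by (rule ndiff_cong[OF V(1) _ ndiff_compose[OF V(1) oA' VA' smooth_on_imp_ndiff[OF smK(1)] Suc]]) (simp add: pdkappa)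
  moreover have "ndiff n V (pd (0, 1) kappa)"
   by (rule ndiff_cong[OF V(1) _ ndiff_compose[OF V(1) oA' VA' smooth_on_imp_ndiff[OF smK(2)] Suc]]) (simp add: pdkappa)
  ultimately show ?case using ndiff_differentiable[OF Suc] by (auto simp: Basis_plane)
 qed
 then have smkappa: "smooth_on V kappa" by (simp add: smooth_on_iff_ndiff)
 have inj: "inj (frechet_derivative kappa (at q))" if q: "q \<in> V" for q
 proof (rule injI)
  fix v v' assume "frechet_derivative kappa (at q) v = frechet_derivative kappa (at q) v'"
  then have "g' q v = g' q v'" using frechet_derivative_at[OF g'[OF q], symmetric] by simp
  then show "v = v'" using chain[OF q, of v] chain[OF q, of v'] by (auto simp: prod_eq_iff)
 qed
 show ?thesis by (rule that[OF Q(1,3,2) V(1) kappa kappa' smkappa inj])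
qed

text \<open>\<open>kappa\<close> is the local inverse of the map
  \<open>w \<mapsto> (Re (Z w), \<rho> w)\<close>. By \<open>lip_inv\<close> the coordinate
  \<open>x\<close> is a Lipschitz function on level curves of \<open>\<rho>\<close>, which allows
  bounds by arc length; \<open>lip\<close> carries null sets of the line to null sets of the
  boundary.\<close>

locale adapted = coords +
 fixes \<Omega> :: "plane set" and \<rho> :: "plane => real" and X Y :: "plane => plane" and W :: "plane set"
  and Z :: "plane => complex" and kappa :: "plane => plane" and M :: real
 assumes smkappa: "smooth_on box0 kappa"
  and inj_dkappa: "\<And>q. q \<in> box0 ==> inj (frechet_derivative kappa (at q))"
  and kappaW: "\<And>q. q \<in> box0 ==> kappa q \<in> W"
  and Zkappa: "\<And>q. q \<in> box0 ==> Z (kappa q) = zmap phi q"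
  and \<rho>kappa: "\<And>q. q \<in> box0 ==> \<rho> (kappa q) = snd q"
  and kappa\<Omega>: "\<And>q. q \<in> box0 ==> kappa q \<in> \<Omega> \<longleftrightarrow> snd q > 0"
  and kappa\<Sigma>: "\<And>q. q \<in> box0 ==> kappa q \<in> frontier \<Omega> \<longleftrightarrow> snd q = 0"
  and transv: "\<And>q. q \<in> box0 ==> vf_apply X Y (\<lambda>w. of_real (\<rho> w)) (kappa q) \<noteq> 0"
  and nonzero: "\<And>q. q \<in> box0 ==> X (kappa q) \<noteq> 0 \<or> Y (kappa q) \<noteq> 0"
  and open_image: "\<And>B. open B ==> B \<subseteq> box0 ==> open (kappa ` B)"
  and M: "M > 0"
  and lip_inv: "\<And>p q. p \<in> box0 ==> q \<in> box0 ==> \<bar>fst p - fst q\<bar> \<le> M * dist (kappa p) (kappa q)"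
  and lip: "\<And>p q. p \<in> box0 ==> q \<in> box0 ==> dist (kappa p) (kappa q) \<le> M * dist p q"
  and smphix: "smooth_on box0 (zdx phix)"
  and delta1: "delta \<le> 1"

lemma smooth_lipschitz:
 fixes f :: "'a::euclidean_space => 'b::real_normed_vector"
 assumes f: "smooth_on V f" "open V" and K: "compact K" "convex K" "K \<subseteq> V"
 obtains L where "L > 0" "\<And>x y. x \<in> K ==> y \<in> K ==> norm (f x - f y) \<le> L * norm (x - y)"
proof -
 have "\<exists>B>0. \<forall>x\<in>K. norm (pd e f x) \<le> B" if "e \<in> Basis" for e
  using compact_norm_bound[OF K(1) continuous_on_subset[OF smooth_on_imp_continuous_on[OF smooth_on_pd[OF f(1) that]] K(3)]] by metis
 then obtain B where B: "\<And>e. e \<in> Basis ==> B e > 0" "\<And>e x. e \<in> Basis ==> x \<in> K ==> norm (pd e f x) \<le> B e" by metis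
 define L where "L = (\<Sum>e\<in>(Basis :: 'a set). B e)"
 have "norm (f x - f y) \<le> L * norm (x - y)" if xy: "x \<in> K" "y \<in> K" for x y
 proof (rule differentiable_bound[OF K(2) _ _ xy])
  fix x assume x: "x \<in> K"
  have D: "(f has_derivative frechet_derivative f (at x)) (at x)" by (rule smooth_on_has_derivative[OF f]) (use x K in auto)
  then show "(f has_derivative frechet_derivative f (at x)) (at x within K)" by (rule has_derivative_at_withinI)
  show "onorm (frechet_derivative f (at x)) \<le> L"
  proof (rule onorm_le)
   fix v :: 'a
   have lin: "linear (frechet_derivative f (at x))" using D has_derivative_linear by blast
   have "frechet_derivative f (at x) (\<Sum>e\<in>Basis. (v \<bullet> e) *\<^sub>R e) = (\<Sum>e\<in>Basis. (v \<bullet> e) *\<^sub>R pd e f x)"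
    using lin by (simp add: linear_sum linear_scale)
   also have "norm \<dots> \<le> (\<Sum>e\<in>(Basis :: 'a set). B e * norm v)"
   proof (rule sum_norm_le)
    fix e :: 'a assume e: "e \<in> Basis"
    show "norm ((v \<bullet> e) *\<^sub>R pd e f x) \<le> B e * norm v"
     using B(2)[OF e x] B(1)[OF e] Basis_le_norm[OF e, of v] by (simp add: mult.commute[of "B e"] mult_mono)
   qed
   finally show "norm (frechet_derivative f (at x) v) \<le> L * norm v"
    by (simp add: euclidean_representation L_def sum_distrib_right)
  qed
 qed
 moreover have "L > 0" unfolding L_def using B(1) by (intro sum_pos) auto
 ultimately show ?thesis using that by blast
qed

text \<open>\<open>Re Z\<close> and \<open>\<rho>\<close> are local coordinates because
  \<open>d(Re Z)\<close> does not vanish on the kernel of \<open>d\<rho>\<close>. The bounds of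
  \<open>coords\<close> come from compactness of a small square; which part of the square belongs to
  \<open>\<Omega>\<close> is read off from \<open>\<rho>\<close> by connectedness.\<close>

lemma adapted_exists:
 assumes \<Omega>: "open \<Omega>" "defining_function \<Omega> \<rho>" and S: "z0 \<in> S" "S \<subseteq> frontier \<Omega>"
  and W: "open W" "z0 \<in> W" and XY: "smooth_on W X" "smooth_on W Y" and Z: "first_integral \<rho> S X Y W Z"
  and transv: "vf_apply X Y (\<lambda>w. of_real (\<rho> w)) z0 \<noteq> 0"
 obtains a b delta C phi phix phit kappa M where "adapted a b delta C phi phix phit \<Omega> \<rho> X Y W Z kappa M"
  "Re (Z z0) \<in> {a<..<b}" "kappa (Re (Z z0), 0) = z0"
proof -
 obtain W\<rho> where W\<rho>: "open W\<rho>" "closure \<Omega> \<subseteq> W\<rho>" "smooth_on W\<rho> \<rho>" using \<Omega>(2) unfolding defining_function_def by blast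
 have \<rho>pos: "\<rho> w > 0" if "w \<in> \<Omega>" for w using \<Omega>(2) that unfolding defining_function_def by blast
 have \<rho>0: "\<rho> w = 0" "frechet_derivative \<rho> (at w) \<noteq> (\<lambda>v. 0)" if "w \<in> frontier \<Omega>" for w
  using \<Omega>(2) that unfolding defining_function_def by blast+
 have z0: "z0 \<in> frontier \<Omega>" using S by auto
 have z0\<rho>: "z0 \<in> W\<rho>" using z0 W\<rho>(2) by (auto simp: frontier_def)
 define A where "A = W \<inter> W\<rho>"
 have A: "open A" "z0 \<in> A" using W W\<rho> z0\<rho> by (auto simp: A_def)
 have smZ: "smooth_on A Z" using Z smooth_on_subset[of W Z A] by (auto simp: first_integral_def A_def)
 have sm\<rho>: "smooth_on A \<rho>" using W\<rho>(3) smooth_on_subset[of W\<rho> \<rho> A] by (auto simp: A_def)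
 have smX: "smooth_on A X" "smooth_on A Y" using XY smooth_on_subset[of W _ A] by (auto simp: A_def)
 define u where "u w = Re (Z w)" for w
 have smu: "smooth_on A u" unfolding u_def by (rule smooth_on_linear_compose[OF bounded_linear_Re A(1) smZ])
 define \<rho>c where "\<rho>c w = complex_of_real (\<rho> w)" for w
 have sm\<rho>c: "smooth_on A \<rho>c" unfolding \<rho>c_def by (rule smooth_on_linear_compose[OF bounded_linear_of_real A(1) sm\<rho>])
 define m where "m w = vf_comp X Y (1, 0) w * pd (1, 0) \<rho>c w + vf_comp X Y (0, 1) w * pd (0, 1) \<rho>c w" for w
 have m: "vf_apply X Y \<rho>c w = m w" if "w \<in> A" for w
  unfolding m_def by (rule vf_apply_eq[OF smooth_on_has_derivative[OF sm\<rho>c A(1) that]])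
 have cm: "continuous_on A m"
  unfolding m_def[abs_def]
  by (intro continuous_intros smooth_on_imp_continuous_on smooth_on_vf_comp smooth_on_pd smX A sm\<rho>c; simp add: Basis_plane)
 \<comment> \<open>Transversality is an open condition, and where \<open>L\<rho>\<close> is nonzero
   \<open>L\<close> itself is nonzero.\<close>
 define A1 where "A1 = A \<inter> m -` (- {0})"
 have A1: "open A1" "z0 \<in> A1" "A1 \<subseteq> A"
  unfolding A1_def using continuous_open_preimage[OF cm A(1), of "- {0}"] A(2) transv m[OF A(2)] by (auto simp: \<rho>c_def[abs_def])
 have mnz: "X w \<noteq> 0 \<or> Y w \<noteq> 0" if "w \<in> A1" for w
  using that by (auto simp: A1_def m_def vf_comp_def)
 have l\<rho>: "linear (frechet_derivative \<rho> (at z0))" using smooth_on_differentiable[OF sm\<rho> A] linear_frechet by blast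
 have J: "v = 0" if "frechet_derivative u (at z0) v = 0" "frechet_derivative \<rho> (at z0) v = 0" for v
  using Z S(1) W(2) that unfolding first_integral_def u_def by blast
 obtain Q V kappa where Q: "open Q" "z0 \<in> Q" "Q \<subseteq> A1" and V: "open V"
  and kappa: "\<And>q. q \<in> V ==> kappa q \<in> Q \<and> u (kappa q) = fst q \<and> \<rho> (kappa q) = snd q"
  and kappa': "\<And>w. w \<in> Q ==> (u w, \<rho> w) \<in> V \<and> kappa (u w, \<rho> w) = w"
  and smkappa: "smooth_on V kappa" and inj: "\<And>q. q \<in> V ==> inj (frechet_derivative kappa (at q))"
  by (rule plane_inverse[OF A1(1,2) smooth_on_subset[OF smu A1(3)] smooth_on_subset[OF sm\<rho> A1(3)]]) (erule (1) J, rule that)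
 have QA: "Q \<subseteq> A" "Q \<subseteq> W" using Q(3) A1(3) A_def by auto
 define x0 where "x0 = u z0"
 have q0: "(x0, 0) \<in> V" "kappa (x0, 0) = z0" using kappa'[OF Q(2)] \<rho>0(1)[OF z0] by (auto simp: x0_def)
 define phi where "phi q = Im (Z (kappa q))" for q
 have "smooth_on V (\<lambda>q. Z (kappa q))" by (rule smooth_on_compose[OF V A(1) _ smZ smkappa]) (use kappa QA in auto)
 then have smphi: "smooth_on V phi" unfolding phi_def by (rule smooth_on_linear_compose[OF bounded_linear_Im V])
 define phix phit where "phix = pd (1, 0) phi" and "phit = pd (0, 1) phi"
 have sm': "smooth_on V phix" "smooth_on V phit"
  unfolding phix_def phit_def by (intro smooth_on_pd smphi; simp add: Basis_plane)+
 obtain s where s: "s > 0" "cball z0 s \<subseteq> Q" using Q(1,2) open_contains_cball by blast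
 have Vs: "open (V \<inter> kappa -` ball z0 s)"
  by (rule continuous_open_preimage[OF smooth_on_imp_continuous_on[OF smkappa] V open_ball])
 \<comment> \<open>\<open>1/32\<close> around the central slope yields the oscillation
   \<open>1/16\<close> between two points. The preimage of \<open>ball z0 s\<close> keeps the image
   inside a convex set on which \<open>u\<close> is Lipschitz.\<close>
 have "open ((V \<inter> kappa -` ball z0 s) \<inter> phix -` ball (phix (x0, 0)) (1/32))"
  by (rule continuous_open_preimage[OF continuous_on_subset[OF smooth_on_imp_continuous_on[OF sm'(1)]] Vs open_ball]) auto
 moreover have "(x0, 0) \<in> (V \<inter> kappa -` ball z0 s) \<inter> phix -` ball (phix (x0, 0)) (1/32)" using q0 s by simp
 ultimately obtain e where e: "e > 0" "ball (x0, 0) e \<subseteq> (V \<inter> kappa -` ball z0 s) \<inter> phix -` ball (phix (x0, 0)) (1/32)"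
  using open_contains_ball by blast
 define r where "r = min (e / 4) 1"
 have r: "r > 0" "r \<le> 1" "r \<le> e / 4" using e(1) by (auto simp: r_def)
 define K where "K = {x0 - r..x0 + r} \<times> {-r..r}"
 have Kball: "K \<subseteq> ball (x0, 0) e"
 proof
  fix q assume "q \<in> K"
  then have "\<bar>fst q - x0\<bar> \<le> r" "\<bar>snd q\<bar> \<le> r" by (auto simp: K_def)
  moreover have "dist (x0, 0) q \<le> \<bar>fst q - x0\<bar> + \<bar>snd q\<bar>"
   using sqrt_sum_squares_le_sum_abs[of "x0 - fst q" "snd q"] by (simp add: dist_prod_def dist_real_def abs_minus_commute split: prod.split)
  ultimately show "q \<in> ball (x0, 0) e" using r e(1) by simp
 qed
 have K: "compact K" "convex K" unfolding K_def by (intro compact_Times convex_Times; simp)+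
 have KV: "K \<subseteq> V" using Kball e(2) by blast
 have bd: "\<exists>B. \<forall>q\<in>K. norm (h q) \<le> B" if "continuous_on V h" for h :: "plane => 'b::real_normed_vector"
  using compact_norm_bound[OF K(1) continuous_on_subset[OF that KV]] by metis
 note cs = smooth_on_imp_continuous_on
 obtain B1 B2 where B: "\<And>q. q \<in> K ==> norm (phix q) \<le> B1" "\<And>q. q \<in> K ==> norm (phit q) \<le> B2"
  using bd[OF cs[OF sm'(1)]] bd[OF cs[OF sm'(2)]] by blast
 obtain L1 where L1: "\<And>p q. p \<in> K ==> q \<in> K ==> norm (phit p - phit q) \<le> L1 * norm (p - q)"
  using smooth_lipschitz[OF sm'(2) V K KV] by metis
 obtain L2 where L2: "L2 > 0" "\<And>p q. p \<in> K ==> q \<in> K ==> norm (kappa p - kappa q) \<le> L2 * norm (p - q)"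
  using smooth_lipschitz[OF smkappa V K KV] by metis
 have cball: "cball z0 s \<subseteq> A" using s QA by auto
 obtain L3 where L3: "\<And>w w'. w \<in> cball z0 s ==> w' \<in> cball z0 s ==> norm (u w - u w') \<le> L3 * norm (w - w')"
  using smooth_lipschitz[OF smu A(1) compact_cball convex_cball cball] by metis
 define C where "C = Max {1, B1, B2, L1}"
 have C: "C \<ge> 1" "B1 \<le> C" "B2 \<le> C" "L1 \<le> C" by (auto simp: C_def)
 define M where "M = max L2 L3"
 have M: "M > 0" "L2 \<le> M" "L3 \<le> M" using L2(1) by (auto simp: M_def)
 define a b where "a = x0 - r" and "b = x0 + r"
 define Bx where "Bx = {a<..<b} \<times> {-r<..<r}"
 have BxK: "Bx \<subseteq> K" by (auto simp: Bx_def K_def a_def b_def)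
 then have BxV: "Bx \<subseteq> V" using KV by blast
 have oBx: "open Bx" unfolding Bx_def by (intro open_Times) auto
 have kappab: "kappa q \<in> ball z0 s" "norm (phix q - phix (x0, 0)) < 1/32" if "q \<in> Bx" for q
 proof -
  have "q \<in> ball (x0, 0) e" using that BxK Kball by blast
  then have "q \<in> (V \<inter> kappa -` ball z0 s) \<inter> phix -` ball (phix (x0, 0)) (1/32)" using e(2) by blast
  then show "kappa q \<in> ball z0 s" "norm (phix q - phix (x0, 0)) < 1/32" by (auto simp: dist_norm abs_minus_commute)
 qed
 have notfr: "kappa q \<notin> frontier \<Omega>" if "q \<in> Bx" "snd q \<noteq> 0" for q
  using \<rho>0(1)[of "kappa q"] kappa[of q] that BxV by auto
 have neg: "kappa q \<notin> \<Omega>" if "q \<in> Bx" "snd q \<le> 0" for q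
  using \<rho>pos[of "kappa q"] kappa[of q] that BxV by auto
 have imopen: "open (kappa ` B)" if "open B" "B \<subseteq> Bx" for B
 proof -
  have "kappa ` B = Q \<inter> (\<lambda>w. (u w, \<rho> w)) -` B"
  proof (intro equalityI subsetI)
   fix w assume "w \<in> kappa ` B"
   then obtain q where q: "q \<in> B" "w = kappa q" by blast
   then have "q \<in> V" using that(2) BxV by blast
   then show "w \<in> Q \<inter> (\<lambda>w. (u w, \<rho> w)) -` B" using kappa[of q] q by auto
  next
   fix w assume w: "w \<in> Q \<inter> (\<lambda>w. (u w, \<rho> w)) -` B"
   then have "kappa (u w, \<rho> w) = w" using kappa'[of w] by blast
   then show "w \<in> kappa ` B" using w by (metis IntD2 imageI vimageD)
  qed
  moreover have "continuous_on Q (\<lambda>w. (u w, \<rho> w))"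
   by (intro continuous_on_Pair continuous_on_subset[OF cs[OF smu] QA(1)] continuous_on_subset[OF cs[OF sm\<rho>] QA(1)])
  ultimately show ?thesis using continuous_open_preimage[OF _ Q(1) that(1)] by metis
 qed
 \<comment> \<open>The upper half of the box has a connected image without frontier points, since
   \<open>\<rho>\<close> vanishes on the frontier; it meets \<open>\<Omega>\<close> because
   \<open>z0\<close> is in the closure of \<open>\<Omega>\<close> while the lower half stays
   outside.\<close>
 have pos: "kappa q \<in> \<Omega>" if q: "q \<in> Bx" "snd q > 0" for q
 proof -
  define P where "P = {a<..<b} \<times> {0<..<r}"
  have PB: "P \<subseteq> Bx" by (auto simp: P_def Bx_def)
  have "connected (kappa ` P)"
  proof (rule connected_continuous_image)
   show "continuous_on P kappa" using continuous_on_subset[OF cs[OF smkappa]] PB BxV by blast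
   show "connected P" unfolding P_def by (intro convex_connected convex_Times) auto
  qed
  moreover have "kappa ` P \<inter> frontier \<Omega> = {}" using notfr PB by (fastforce simp: P_def)
  moreover have "kappa ` P \<inter> \<Omega> \<noteq> {}"
  proof -
   have "(x0, 0) \<in> Bx" using r by (simp add: Bx_def a_def b_def)
   then have "z0 \<in> kappa ` Bx" using q0 by force
   moreover have "z0 \<in> closure \<Omega>" using z0 by (simp add: frontier_def)
   ultimately obtain w where w: "w \<in> \<Omega>" "w \<in> kappa ` Bx"
    using imopen[OF oBx order_refl] by (metis IntE all_not_in_conv open_Int_closure_eq_empty disjoint_iff)
   then obtain p where p: "p \<in> Bx" "w = kappa p" by blast
   then have "snd p > 0" using neg[of p] w by (cases "snd p > 0") auto
   then have "p \<in> P" using p by (auto simp: P_def Bx_def)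
   then show ?thesis using p w by blast
  qed
  ultimately have "kappa ` P \<subseteq> \<Omega>" using connected_Int_frontier[of "kappa ` P" \<Omega>] by blast
  moreover have "q \<in> P" using q by (auto simp: P_def Bx_def)
  ultimately show ?thesis by blast
 qed
 \<comment> \<open>A point at height zero is a limit of points of positive height, which lie in
   \<open>\<Omega>\<close>, and is itself outside \<open>\<Omega>\<close>.\<close>
 have zero: "kappa q \<in> frontier \<Omega>" if q: "q \<in> Bx" "snd q = 0" for q
 proof -
  have "kappa q \<in> closure \<Omega>"
  proof (rule ccontr)
   assume n: "kappa q \<notin> closure \<Omega>"
   have "open (Bx \<inter> kappa -` (- closure \<Omega>))"
    by (rule continuous_open_preimage[OF continuous_on_subset[OF cs[OF smkappa] BxV] oBx]) auto
   then obtain d where d: "d > 0" "ball q d \<subseteq> Bx \<inter> kappa -` (- closure \<Omega>)" using q n open_contains_ball by blast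
   define p where "p = (fst q, d / 2)"
   have "p \<in> ball q d" using d(1) q(2) by (cases q) (simp add: p_def dist_Pair_Pair)
   then have "p \<in> Bx" "kappa p \<notin> closure \<Omega>" using d(2) by auto
   moreover have "kappa p \<in> \<Omega>" using pos[OF \<open>p \<in> Bx\<close>] d(1) by (simp add: p_def)
   ultimately show False using closure_subset by blast
  qed
  moreover have "kappa q \<notin> \<Omega>" using neg q by auto
  ultimately show ?thesis using \<Omega>(1) by (simp add: frontier_def interior_open)
 qed
 have "adapted a b r C phi phix phit \<Omega> \<rho> X Y W Z kappa M"
 proof (unfold_locales, fold Bx_def)
  show "a < b" "0 < r" "1 \<le> C" "0 < M" "r \<le> 1" using r C M by (auto simp: a_def b_def)
  show "continuous_on Bx phix" "continuous_on Bx phit" using continuous_on_subset[OF cs[OF sm'(1)] BxV] continuous_on_subset[OF cs[OF sm'(2)] BxV] by auto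
  show "smooth_on Bx kappa" using smooth_on_subset[OF smkappa BxV] .
  have "smooth_on Bx (\<lambda>q. 1 + \<i> * complex_of_real (phix q))"
   by (intro smooth_on_add smooth_on_mult smooth_on_const oBx smooth_on_linear_compose[OF bounded_linear_of_real] smooth_on_subset[OF sm'(1) BxV])
  moreover have "(\<lambda>q. 1 + \<i> * complex_of_real (phix q)) = zdx phix" by (auto simp: zdx_def complex_eq_iff)
  ultimately show "smooth_on Bx (zdx phix)" by simp
  show "\<bar>phix q - phix q'\<bar> \<le> 1/16" if "q \<in> Bx" "q' \<in> Bx" for q q'
   using kappab(2)[OF that(1)] kappab(2)[OF that(2)] by (simp add: abs_if split: if_splits)
  show "\<bar>phit (x, t) - phit (y, t)\<bar> \<le> C * \<bar>x - y\<bar>" if "x \<in> {a<..<b}" "y \<in> {a<..<b}" "t \<in> {-r<..<r}" for x y t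
  proof -
   have "(x, t) \<in> K" "(y, t) \<in> K" using that BxK by (auto simp: Bx_def)
   from L1[OF this] show ?thesis using mult_right_mono[OF C(4), of "\<bar>x - y\<bar>"] by (simp add: norm_Pair)
  qed
  fix q assume q: "q \<in> Bx"
  then have qK: "q \<in> K" and qV: "q \<in> V" using BxK BxV by auto
  show "(phi has_derivative (\<lambda>v. fst v * phix q + snd v * phit q)) (at q)"
  proof -
   have D: "(phi has_derivative frechet_derivative phi (at q)) (at q)" by (rule smooth_on_has_derivative[OF smphi V qV])
   have "frechet_derivative phi (at q) = (\<lambda>v. fst v * phix q + snd v * phit q)"
   proof (rule ext)
    fix v
    show "frechet_derivative phi (at q) v = fst v * phix q + snd v * phit q"
     using linear_plane[OF has_derivative_linear[OF D], of v] by (simp only: phix_def phit_def real_scaleR_def)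
   qed
   with D show ?thesis by simp
  qed
  show "\<bar>phix q\<bar> \<le> C" "\<bar>phit q\<bar> \<le> C" using B(1,2)[OF qK] C by auto
  show "inj (frechet_derivative kappa (at q))" by (rule inj[OF qV])
  show "kappa q \<in> W" using kappa[OF qV] QA by auto
  show "Z (kappa q) = zmap phi q" using kappa[OF qV] by (simp add: zmap_def phi_def u_def complex_eq_iff)
  show "\<rho> (kappa q) = snd q" using kappa[OF qV] by simp
  show "kappa q \<in> \<Omega> \<longleftrightarrow> snd q > 0" using pos[OF q] neg[OF q] by (meson not_le)
  show "kappa q \<in> frontier \<Omega> \<longleftrightarrow> snd q = 0" using zero[OF q] notfr[OF q] by auto
  have w: "kappa q \<in> A1" "kappa q \<in> A" using kappa[OF qV] Q(3) QA by auto
  show "vf_apply X Y (\<lambda>w. of_real (\<rho> w)) (kappa q) \<noteq> 0" using m[OF w(2)] w(1) by (simp add: \<rho>c_def[abs_def] A1_def)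
  show "X (kappa q) \<noteq> 0 \<or> Y (kappa q) \<noteq> 0" by (rule mnz[OF w(1)])
 next
  show "open (kappa ` B)" if "open B" "B \<subseteq> Bx" for B by (rule imopen[OF that])
  fix p q assume pq: "p \<in> Bx" "q \<in> Bx"
  have "norm (u (kappa p) - u (kappa q)) \<le> L3 * norm (kappa p - kappa q)" using kappab(1) pq by (intro L3) (auto simp: less_imp_le)
  also have "\<dots> \<le> M * norm (kappa p - kappa q)" using M by (intro mult_right_mono) auto
  finally show "\<bar>fst p - fst q\<bar> \<le> M * dist (kappa p) (kappa q)"
   using kappa[OF subsetD[OF BxV pq(1)]] kappa[OF subsetD[OF BxV pq(2)]] by (simp add: dist_norm)
  have "norm (kappa p - kappa q) \<le> L2 * norm (p - q)" using pq BxK by (intro L2) auto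
  also have "\<dots> \<le> M * norm (p - q)" using M by (intro mult_right_mono) auto
  finally show "dist (kappa p) (kappa q) \<le> M * dist p q" by (simp add: dist_norm)
 qed
 moreover have "Re (Z z0) \<in> {a<..<b}" using r by (simp add: a_def b_def x0_def u_def)
 moreover have "kappa (Re (Z z0), 0) = z0" using q0 by (simp add: x0_def u_def)
 ultimately show ?thesis by (rule that)
qed

context adapted
begin

lemma kappa_continuous: "continuous_on box0 kappa"
 by (rule smooth_on_imp_continuous_on[OF smkappa])

lemma open_box: "open box0" "open box1"
 by (intro open_Times open_greaterThanLessThan)+

lemma upper_box: "box1 \<subseteq> box0"
 using delta by auto

lemma solution_continuous:
 assumes "continuous_on \<Omega> f" shows "continuous_on box1 (\<lambda>q. f (kappa q))"
proof (rule continuous_on_compose2[OF assms continuous_on_subset[OF kappa_continuous upper_box]])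
 show "kappa ` box1 \<subseteq> \<Omega>"
 proof (rule image_subsetI)
  fix q assume q: "q \<in> box1"
  then have "snd q > 0" by auto
  then show "kappa q \<in> \<Omega>" using kappa\<Omega>[OF subsetD[OF upper_box q]] by simp
 qed
qed

text \<open>Local primitives of \<open>f h(Z) dZ\<close> are pulled back by \<open>kappa\<close>,
  under which \<open>Z\<close> becomes \<open>zmap phi\<close>, and are glued over the rectangle by
  \<open>locally_exact_imp_exact\<close>.\<close>

lemma exact_for_solution:
 assumes XY: "smooth_on W X" "smooth_on W Y" and Z: "smooth_on W Z" and LZ: "\<And>w. w \<in> W ==> vf_apply X Y Z w = 0"
  and V: "\<Omega> \<inter> W \<subseteq> V" and f: "continuous_on \<Omega> f" and sol: "vf_solves V X Y (regular_distribution f) (\<lambda>_. 0)"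
 shows "exact_for (\<lambda>q. f (kappa q))"
 unfolding exact_for_def
proof (intro allI impI)
 fix h :: "complex => complex" assume h: "h holomorphic_on UNIV"
 define R where "R = box1"
 define G where "G = kappa ` R"
 have sub: "R \<subseteq> box0" unfolding R_def by (rule upper_box)
 have oR: "open R" unfolding R_def by (rule open_box)
 have oG: "open G" unfolding G_def by (rule open_image[OF oR sub])
 have GW: "G \<subseteq> W" unfolding G_def using kappaW sub by blast
 have G\<Omega>: "G \<subseteq> \<Omega>"
 proof
  fix w assume "w \<in> G"
  then obtain q where q: "q \<in> R" "w = kappa q" unfolding G_def by blast
  then have "snd q > 0" by (auto simp: R_def)
  then show "w \<in> \<Omega>" using kappa\<Omega>[OF subsetD[OF sub q(1)]] q(2) by simp
 qed
 have nz: "X w \<noteq> 0 \<or> Y w \<noteq> 0" if "w \<in> G" for w using that nonzero sub unfolding G_def by blast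
 define p where "p q = f (kappa q) * h (zmap phi q) * zdx phix q" for q
 define r where "r q = f (kappa q) * h (zmap phi q) * zdt phit q" for q
 have hc: "continuous_on UNIV h" using h by (rule holomorphic_on_imp_continuous_on)
 have fc: "continuous_on R (\<lambda>q. f (kappa q))" unfolding R_def by (rule solution_continuous[OF f])
 have cont: "continuous_on R p" "continuous_on R r" unfolding p_def r_def
  by (intro continuous_intros fc continuous_on_subset[OF continuous_on_zdx sub]
    continuous_on_subset[OF continuous_on_zdt sub] continuous_on_compose2[OF hc continuous_on_subset[OF continuous_on_zmap sub]]; simp)+
 have loc: "\<exists>N P. open N \<and> q \<in> N \<and> (\<forall>w\<in>N. (P has_derivative dform (p w) (r w)) (at w))" if q: "q \<in> R" for q
 proof -
  have w0: "kappa q \<in> G" using q by (simp add: G_def)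
  obtain N P where N: "open N" "kappa q \<in> N" "N \<subseteq> G"
   and P: "\<And>w. w \<in> N ==> (P has_derivative (\<lambda>v. f w * h (Z w) * frechet_derivative Z (at w) v)) (at w)"
   using weak_solution_locally_exact[OF oG order_trans[OF _ V] smooth_on_subset[OF XY(1) GW] smooth_on_subset[OF XY(2) GW]
    smooth_on_subset[OF Z GW] LZ nz sol continuous_on_subset[OF f G\<Omega>] h w0] G\<Omega> GW by blast
  define N' where "N' = R \<inter> kappa -` N"
  have "open N'" unfolding N'_def by (rule continuous_open_preimage[OF continuous_on_subset[OF kappa_continuous sub] oR N(1)])
  moreover have "q \<in> N'" using q N(2) by (simp add: N'_def)
  moreover have "((\<lambda>q. P (kappa q)) has_derivative dform (p w) (r w)) (at w)" if w: "w \<in> N'" for w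
  proof -
   have wR: "w \<in> R" "kappa w \<in> N" using w by (auto simp: N'_def)
   have wb: "w \<in> box0" using wR sub by blast
   have dkappa: "(kappa has_derivative frechet_derivative kappa (at w)) (at w)" by (rule smooth_on_has_derivative[OF smkappa open_box(1) wb])
   have "kappa w \<in> G" using wR by (simp add: G_def)
   then have dZ: "(Z has_derivative frechet_derivative Z (at (kappa w))) (at (kappa w))"
    by (rule smooth_on_has_derivative[OF smooth_on_subset[OF Z GW] oG])
   have "(zmap phi has_derivative (\<lambda>v. frechet_derivative Z (at (kappa w)) (frechet_derivative kappa (at w) v))) (at w)"
    by (rule has_derivative_transform_within_open[OF has_derivative_compose[OF dkappa dZ] open_box(1) wb]) (rule Zkappa)
   from has_derivative_unique[OF this zmap_has_derivative[OF wb]]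
   have e: "frechet_derivative Z (at (kappa w)) (frechet_derivative kappa (at w) v) = dform (zdx phix w) (zdt phit w) v" for v
    by (rule fun_cong)
   have "((\<lambda>q. P (kappa q)) has_derivative (\<lambda>v. f (kappa w) * h (Z (kappa w)) * frechet_derivative Z (at (kappa w)) (frechet_derivative kappa (at w) v))) (at w)"
    by (rule has_derivative_compose[OF dkappa P[OF wR(2)]])
   then show ?thesis unfolding e Zkappa[OF wb] dform_mult p_def r_def by (simp add: mult_ac)
  qed
  ultimately show ?thesis by blast
 qed
 have "\<exists>P. \<forall>q\<in>box1. (P has_derivative dform (p q) (r q)) (at q)"
  by (rule locally_exact_imp_exact[OF ab delta cont[unfolded R_def] loc[unfolded R_def]])
 then show "\<exists>P. \<forall>q\<in>box1. (P has_derivative dform (f (kappa q) * h (zmap phi q) * zdx phix q) (f (kappa q) * h (zmap phi q) * zdt phit q)) (at q)"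
  by (simp only: p_def r_def)
qed

end

section \<open>Almost everywhere convergence\<close>

context adapted
begin

lemma slice_continuous:
 assumes "A \<subseteq> {a<..<b}" "t \<in> {-delta<..<delta}" shows "continuous_on A (\<lambda>x. kappa (x, t))"
 by (rule continuous_on_compose2[OF kappa_continuous]) (use assms in \<open>auto intro!: continuous_intros\<close>)

lemma slice_lip_inv:
 assumes "x \<in> {a<..<b}" "y \<in> {a<..<b}" "t \<in> {-delta<..<delta}"
 shows "\<bar>x - y\<bar> \<le> M * dist (kappa (x, t)) (kappa (y, t))"
 using lip_inv[of "(x, t)" "(y, t)"] assms by simp

lemma Re_Z_slice: "x \<in> {a<..<b} ==> t \<in> {-delta<..<delta} ==> Re (Z (kappa (x, t))) = x"
 using Zkappa[of "(x, t)"] by (simp add: zmap_def)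

text \<open>The level sets of \<open>\<rho>\<close> in \<open>\<Omega>\<close> contain the images of
  the horizontal segments, on which Lebesgue measure is at most \<open>M\<close> times arc length.
  The summand \<open>1/2\<close> puts the exponent at a half-integer, which only weakens the bound
  as \<open>t \<le> 1\<close>; \<open>nat N\<close> takes care of negative \<open>N\<close>.\<close>

lemma growth_rect:
 assumes ms: "measure_space UNIV (sets borel) hausdorff1_outer"
  and \<Omega>: "open \<Omega>" and \<rho>: "continuous_on \<Omega> \<rho>" and f: "continuous_on \<Omega> f" and gr: "growth_bound \<Omega> \<rho> N f"
 obtains delta' B n where "0 < delta'" "delta' \<le> delta" "B \<ge> 0"
  "\<And>a1 b1 t. a < a1 ==> a1 < b1 ==> b1 < b ==> t \<in> {0<..<delta'} ==>
   integral {a1..b1} (\<lambda>x. norm (f (kappa (x, t)))) \<le> B * t powr - (real n + 1/2)"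
proof -
 obtain C0 where C0: "\<forall>\<^sub>F t in at_right 0.
   (\<integral>\<^sup>+z. ennreal (norm (f z)) \<partial>arc_length {w\<in>\<Omega>. \<rho> w = t}) \<le> ennreal (C0 * t powi (- N))"
  using gr unfolding growth_bound_def by blast
 obtain \<tau> where \<tau>: "\<tau> > 0" "\<And>t. 0 < t ==> t < \<tau> ==>
   (\<integral>\<^sup>+z. ennreal (norm (f z)) \<partial>arc_length {w\<in>\<Omega>. \<rho> w = t}) \<le> ennreal (C0 * t powi (- N))"
  using C0 unfolding eventually_at_right_field by auto
 define n where "n = nat N"
 define C1 where "C1 = max C0 0"
 have C1: "C1 \<ge> 0" "C0 \<le> C1" by (auto simp: C1_def)
 have "integral {a1..b1} (\<lambda>x. norm (f (kappa (x, t)))) \<le> (M * C1) * t powr - (real n + 1/2)"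
  if ab': "a < a1" "a1 < b1" "b1 < b" and t: "t \<in> {0<..<min \<tau> delta}" for a1 b1 t
 proof -
  have tb: "t \<in> {-delta<..<delta}" "0 < t" "t \<le> 1" using t delta1 by auto
  define A where "A = {w\<in>\<Omega>. \<rho> w = t}"
  have "closedin (top_of_set \<Omega>) (\<Omega> \<inter> \<rho> -` {t})" by (rule continuous_closedin_preimage[OF \<rho>]) simp
  then obtain T where "closed T" "\<Omega> \<inter> \<rho> -` {t} = \<Omega> \<inter> T" unfolding closedin_closed by blast
  moreover have "A = \<Omega> \<inter> \<rho> -` {t}" by (auto simp: A_def)
  ultimately have A: "A \<in> sets borel" using \<Omega> by auto
  have sub: "{a1..b1} \<subseteq> {a<..<b}" using ab' by auto
  have im: "kappa (x, t) \<in> A" if "x \<in> {a1..b1}" for x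
   using kappa\<Omega>[of "(x, t)"] \<rho>kappa[of "(x, t)"] that sub tb by (auto simp: A_def)
  have fm: "(\<lambda>z. ennreal (norm (f z))) \<in> borel_measurable (arc_length A)"
  proof -
   have "f \<in> borel_measurable (restrict_space borel A)"
    by (rule borel_measurable_continuous_on_restrict[OF continuous_on_subset[OF f]]) (auto simp: A_def)
   moreover have "sets (restrict_space borel A) = sets (restrict_space hausdorff1 A)"
    by (rule sets_restrict_space_cong) (simp add: sets_hausdorff1)
   ultimately have "f \<in> borel_measurable (restrict_space hausdorff1 A)"
    using measurable_cong_sets[of "restrict_space borel A" "restrict_space hausdorff1 A" borel borel] by simp
   then have "f \<in> borel_measurable (arc_length A)" unfolding arc_length_def by (rule measurable_completion)
   then show ?thesis by measurable
  qed
  have "(\<integral>\<^sup>+x. ennreal (norm (f (kappa (x, t)))) \<partial>lebesgue_on {a1..b1}) \<le> ennreal M * (\<integral>\<^sup>+z. ennreal (norm (f z)) \<partial>arc_length A)"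
  proof (rule parametrised_arc_length(2)[OF ms A _ slice_continuous[OF sub tb(1)] _ _ M _ fm, where g = "\<lambda>w. Re (Z w)"])
   show "(\<lambda>x. kappa (x, t)) ` {a1..b1} \<subseteq> A" using im by blast
   show "Re (Z (kappa (x, t))) = x" if "x \<in> {a1..b1}" for x using Re_Z_slice sub tb that by auto
   show "\<bar>x - y\<bar> \<le> M * dist (kappa (x, t)) (kappa (y, t))" if "x \<in> {a1..b1}" "y \<in> {a1..b1}" for x y
    using slice_lip_inv[OF subsetD[OF sub that(1)] subsetD[OF sub that(2)] tb(1)] .
  qed simp
  also have "\<dots> \<le> ennreal M * ennreal (C0 * t powi (- N))"
   unfolding A_def using t by (intro mult_left_mono \<tau>(2)) auto
  also have "\<dots> \<le> ennreal M * ennreal (C1 * t powr - (real n + 1/2))"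
  proof (intro mult_left_mono ennreal_leI)
   have "t powi (- N) = t powr (- real_of_int N)"
    using powr_real_of_int'[of t "- N"] tb by simp
   also have "\<dots> \<le> t powr - (real n + 1/2)" using tb by (intro powr_mono') (auto simp: n_def)
   finally have "C1 * t powi (- N) \<le> C1 * t powr - (real n + 1/2)" using C1 by (intro mult_left_mono)
   moreover have "C0 * t powi (- N) \<le> C1 * t powi (- N)" using C1 tb by (intro mult_right_mono) auto
   ultimately show "C0 * t powi (- N) \<le> C1 * t powr - (real n + 1/2)" by linarith
  qed simp
  also have "\<dots> = ennreal (M * C1 * t powr - (real n + 1/2))"
   using M C1 by (simp add: ennreal_mult[symmetric] mult.assoc)
  finally have le: "(\<integral>\<^sup>+x. ennreal (norm (f (kappa (x, t)))) \<partial>lebesgue_on {a1..b1}) \<le> ennreal (M * C1 * t powr - (real n + 1/2))" .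
  have c: "continuous_on {a1..b1} (\<lambda>x. norm (f (kappa (x, t))))"
   by (intro continuous_on_norm continuous_on_compose2[OF f slice_continuous[OF sub tb(1)]]) (use im in \<open>auto simp: A_def\<close>)
  then have i: "integrable (lebesgue_on {a1..b1}) (\<lambda>x. norm (f (kappa (x, t))))" by (rule continuous_imp_integrable_real)
  have "(\<integral>\<^sup>+x. ennreal (norm (f (kappa (x, t)))) \<partial>lebesgue_on {a1..b1}) = ennreal (LINT x|lebesgue_on {a1..b1}. norm (f (kappa (x, t))))"
   by (rule nn_integral_eq_integral[OF i]) simp
  also have "(LINT x|lebesgue_on {a1..b1}. norm (f (kappa (x, t)))) = integral {a1..b1} (\<lambda>x. norm (f (kappa (x, t))))"
   by (rule lebesgue_integral_eq_integral[OF i]) simp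
  finally have "ennreal (integral {a1..b1} (\<lambda>x. norm (f (kappa (x, t))))) \<le> ennreal (M * C1 * t powr - (real n + 1/2))" using le by simp
  then show ?thesis using M C1 by (subst (asm) ennreal_le_iff) auto
 qed
 then show ?thesis using that[of "min \<tau> delta" "M * C1" n] \<tau>(1) delta M C1 by auto
qed

text \<open>The growth bound holds for small \<open>t\<close> only, so the rectangle is lowered
  after the coordinates have been fixed.\<close>

lemma coords_restrict:
 assumes "0 < delta'" "delta' \<le> delta" shows "coords a b delta' C phi phix phit"
proof -
 have sub: "{a<..<b} \<times> {-delta'<..<delta'} \<subseteq> box0" using assms by auto
 show ?thesis
 proof (unfold_locales)
  show "continuous_on ({a<..<b} \<times> {-delta'<..<delta'}) phix" "continuous_on ({a<..<b} \<times> {-delta'<..<delta'}) phit"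
   using continuous_on_subset[OF cphix sub] continuous_on_subset[OF cphit sub] by auto
  show "\<bar>phit (x, t) - phit (y, t)\<bar> \<le> C * \<bar>x - y\<bar>" if "x \<in> {a<..<b}" "y \<in> {a<..<b}" "t \<in> {-delta'<..<delta'}" for x y t
   using lipphit[of x y t] that assms by auto
  show "\<bar>phix q - phix q'\<bar> \<le> 1/16" if "q \<in> {a<..<b} \<times> {-delta'<..<delta'}" "q' \<in> {a<..<b} \<times> {-delta'<..<delta'}" for q q'
   using osc that sub by blast
  fix q assume "q \<in> {a<..<b} \<times> {-delta'<..<delta'}"
  then have q: "q \<in> box0" using sub by blast
  show "(phi has_derivative (\<lambda>v. fst v * phix q + snd v * phit q)) (at q)" by (rule dphi[OF q])
  show "\<bar>phix q\<bar> \<le> C" "\<bar>phit q\<bar> \<le> C" using bphix[OF q] bphit[OF q] .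
 qed (use ab C assms in auto)
qed

lemma boundary_chart_slice:
 assumes "open I" "is_interval I" "I \<subseteq> {a<..<b}" "W \<subseteq> U"
 shows "boundary_chart \<Omega> \<rho> U X Y I delta kappa"
proof -
 have sub: "I \<times> {-delta<..<delta} \<subseteq> box0" using assms by auto
 have inj: "inj_on kappa (I \<times> {-delta<..<delta})"
 proof (rule inj_onI)
  fix p q assume pq: "p \<in> I \<times> {-delta<..<delta}" "q \<in> I \<times> {-delta<..<delta}" "kappa p = kappa q"
  then have b: "p \<in> box0" "q \<in> box0" using sub by blast+
  have "snd p = snd q" using \<rho>kappa[OF b(1)] \<rho>kappa[OF b(2)] pq(3) by simp
  moreover have "fst p = fst q" using Zkappa[OF b(1)] Zkappa[OF b(2)] pq(3) by (simp add: zmap_def)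
  ultimately show "p = q" by (simp add: prod_eq_iff)
 qed
 have pt: "inj (frechet_derivative kappa (at (x, t))) \<and> kappa (x, t) \<in> U \<and> \<rho> (kappa (x, t)) = t \<and> (kappa (x, t) \<in> \<Omega> \<longleftrightarrow> t > 0) \<and>
   (kappa (x, t) \<in> frontier \<Omega> \<longleftrightarrow> t = 0) \<and> vf_apply X Y (\<lambda>w. of_real (\<rho> w)) (kappa (x, t)) \<noteq> 0"
  if "x \<in> I" "t \<in> {-delta<..<delta}" for x t
 proof -
  have q: "(x, t) \<in> box0" using that assms by auto
  show ?thesis using inj_dkappa[OF q] kappaW[OF q] \<rho>kappa[OF q] kappa\<Omega>[OF q] kappa\<Sigma>[OF q] transv[OF q] assms(4) by auto
 qed
 show ?thesis unfolding boundary_chart_def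
  using assms(1,2) delta smooth_on_subset[OF smkappa sub] inj pt by blast
qed

text \<open>Charts have open parameter intervals inside \<open>S\<close>, while test functions are
  supported in closed ones; hence two nested intervals. The strip itself lives over all of
  \<open>{a<..<b}\<close>, and just the comparison with the boundary value is confined to the part
  of the boundary in \<open>S\<close>.\<close>

lemma slice_limit_ae:
 assumes ms: "measure_space UNIV (sets borel) hausdorff1_outer"
  and \<Omega>: "open \<Omega>" and \<rho>: "continuous_on \<Omega> \<rho>" and f: "continuous_on \<Omega> f" and gr: "growth_bound \<Omega> \<rho> N f"
  and U: "W \<subseteq> U" and XY: "smooth_on W X" "smooth_on W Y" and Z: "smooth_on W Z" and LZ: "\<And>w. w \<in> W ==> vf_apply X Y Z w = 0"
  and sol: "vf_solves (\<Omega> \<inter> U) X Y (regular_distribution f) (\<lambda>_. 0)"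
  and S: "S \<in> sets borel" and bv: "has_boundary_value \<Omega> \<rho> U X Y S f bf" and p: "1 \<le> p" "mem_Lp p (arc_length S) bf"
  and I: "a1' < a1" "a1 < b1" "b1 < b1'" "{a1'<..<b1'} \<subseteq> {a<..<b}" "\<And>x. x \<in> {a1'<..<b1'} ==> kappa (x, 0) \<in> S"
 shows "\<exists>E. negligible E \<and> (\<forall>x1\<in>{a1<..<b1} - E. nt_limit (\<lambda>q. f (kappa q)) (bf (kappa (x1, 0))) x1)"
proof -
 obtain delta' B n where delta': "0 < delta'" "delta' \<le> delta" and B: "B \<ge> 0"
  and grow: "\<And>a1 b1 t. a < a1 ==> a1 < b1 ==> b1 < b ==> t \<in> {0<..<delta'} ==>
   integral {a1..b1} (\<lambda>x. norm (f (kappa (x, t)))) \<le> B * t powr - (real n + 1/2)"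
  by (rule growth_rect[OF ms \<Omega> \<rho> f gr]) (rule that)
 define R where "R = {a<..<b} \<times> {0<..<delta'}"
 have RR: "R \<subseteq> box1" using delta' by (auto simp: R_def)
 interpret c: coords a b delta' C phi phix phit by (rule coords_restrict[OF delta'])
 have "exact_for (\<lambda>q. f (kappa q))"
  by (rule exact_for_solution[OF XY Z LZ _ f sol]) (use U in auto)
 then have ex: "c.exact_for (\<lambda>q. f (kappa q))"
  unfolding exact_for_def c.exact_for_def R_def[symmetric] using RR by (meson subsetD)
 have fc: "continuous_on ({a<..<b} \<times> {0<..<delta'}) (\<lambda>q. f (kappa q))"
  using continuous_on_subset[OF solution_continuous[OF f] RR] by (simp add: R_def)
 have delta'1: "delta' \<le> 1" using delta' delta1 by simp
 obtain H K where K: "K \<ge> 1" and strip: "strip a b delta' C phi phix phit H K"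
  and HF: "\<And>q. q \<in> {a<..<b} \<times> {0<..<delta'} ==> H 0 q = f (kappa q)"
  using c.strip_exists[OF fc ex delta'1 B grow] by blast
 interpret s: strip a b delta' C phi phix phit H K by (rule strip)
 have sub: "{a1..b1} \<subseteq> {a1'<..<b1'}" "{a1..b1} \<subseteq> {a<..<b}" using I by auto
 have a1b1: "a < a1" "b1 < b" using subsetD[OF sub(2), of a1] subsetD[OF sub(2), of b1] I(2) by auto
 have t0: "(0::real) \<in> {-delta<..<delta}" using delta by simp
 have int: "integrable (lebesgue_on {a1..b1}) (\<lambda>x. bf (kappa (x, 0)))"
 proof (rule mem_Lp_imp_integrable[OF ms S _ _ slice_continuous[OF sub(2) t0] _ _ M _ p, where g = "\<lambda>w. Re (Z w)"])
  show "(\<lambda>x. kappa (x, 0)) ` {a1..b1} \<subseteq> S" using I(5) sub by auto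
  show "Re (Z (kappa (x, 0))) = x" if "x \<in> {a1..b1}" for x using Re_Z_slice sub t0 that by auto
  show "\<bar>x - y\<bar> \<le> M * dist (kappa (x, 0)) (kappa (y, 0))" if "x \<in> {a1..b1}" "y \<in> {a1..b1}" for x y
   using slice_lip_inv[OF subsetD[OF sub(2) that(1)] subsetD[OF sub(2) that(2)] t0] .
 qed auto
 have lim: "((\<lambda>t. integral {a1..b1} (\<lambda>x. H 0 (x, t) * u x)) \<longlongrightarrow> (LINT x|lebesgue_on {a1..b1}. bf (kappa (x, 0)) * u x)) (at_right 0)"
  if u: "test_in a1 b1 u" for u
 proof -
  have chart: "boundary_chart \<Omega> \<rho> U X Y {a1'<..<b1'} delta kappa"
   by (rule boundary_chart_slice[OF _ _ I(4) U]) (auto simp: is_interval_convex_1)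
  have tf: "test_fun {a1'<..<b1'} u"
  proof -
   have "closure {x. u x \<noteq> 0} \<subseteq> {a1..b1}"
    by (rule closure_minimal) (use u in \<open>auto simp: test_in_def\<close>)
   then show ?thesis using u sub(1) unfolding test_fun_def test_in_def
    by (metis (no_types, lifting) bounded_closed_interval bounded_subset closed_closure compact_eq_bounded_closed order_trans)
  qed
  have "((\<lambda>t. LINT x|lborel. f (kappa (x, t)) * u x) \<longlongrightarrow> (LINT x|lebesgue. bf (kappa (x, 0)) * u x)) (at_right 0)"
   using bv chart tf I(5) unfolding has_boundary_value_def by blast
  moreover have "(LINT x|lebesgue. bf (kappa (x, 0)) * u x) = (LINT x|lebesgue_on {a1..b1}. bf (kappa (x, 0)) * u x)"
  proof (subst integral_restrict_space)
   show "(LINT x|lebesgue. bf (kappa (x, 0)) * u x) = (LINT x|lebesgue. indicator {a1..b1} x *\<^sub>R (bf (kappa (x, 0)) * u x))"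
    by (rule Bochner_Integration.integral_cong) (use u in \<open>auto simp: test_in_def indicator_def\<close>)
  qed simp
  moreover have "\<forall>\<^sub>F t in at_right 0. (LINT x|lborel. f (kappa (x, t)) * u x) = integral {a1..b1} (\<lambda>x. H 0 (x, t) * u x)"
  proof -
   have "(LINT x|lborel. f (kappa (x, t)) * u x) = integral {a1..b1} (\<lambda>x. H 0 (x, t) * u x)" if t: "0 < t" "t < delta'" for t
   proof -
    have "continuous_on {a1..b1} (\<lambda>x. f (kappa (x, t)))"
     by (rule continuous_on_compose2[OF fc]) (use sub t in \<open>auto intro!: continuous_intros\<close>)
    then have "(LINT x|lborel. f (kappa (x, t)) * u x) = integral {a1..b1} (\<lambda>x. f (kappa (x, t)) * u x)" by (rule lint_test[OF _ u])
    also have "\<dots> = integral {a1..b1} (\<lambda>x. H 0 (x, t) * u x)"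
     by (rule integral_cong) (use sub t HF in auto)
    finally show ?thesis .
   qed
   then show ?thesis unfolding eventually_at_right_field using delta' by blast
  qed
  ultimately show ?thesis using Lim_transform_eventually by fastforce
 qed
 have sm: "smooth_on ({a<..<b} \<times> {-delta'<..<delta'}) (zdx phix)"
  by (rule smooth_on_subset[OF smphix]) (use delta' in auto)
 obtain E where E: "negligible E" "\<And>x1. x1 \<in> {a1<..<b1} - E ==> nt_limit (H 0) (bf (kappa (x1, 0))) x1"
  using s.strip_limit_ae[OF sm a1b1(1) I(2) a1b1(2) int K lim] by blast
 have "nt_limit (\<lambda>q. f (kappa q)) (bf (kappa (x1, 0))) x1" if x1: "x1 \<in> {a1<..<b1} - E" for x1
  unfolding nt_limit_def
 proof (intro allI impI)
  fix L eta :: real assume L: "L \<ge> 0" and eta: "eta > 0"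
  then obtain d where d: "d > 0" "\<And>x t. 0 < t ==> t < d ==> \<bar>x - x1\<bar> < d ==>
   \<bar>x - x1\<bar> \<le> L * \<bar>phi (x, t) - phi (x, 0)\<bar> ==> norm (H 0 (x, t) - bf (kappa (x1, 0))) < eta"
   using E(2)[OF x1] unfolding nt_limit_def by meson
  define d' where "d' = min (min d delta') (min (x1 - a) (b - x1))"
  have "d' > 0" using d(1) delta' x1 a1b1 by (auto simp: d'_def)
  moreover have "norm (f (kappa (x, t)) - bf (kappa (x1, 0))) < eta"
   if "0 < t" "t < d'" "\<bar>x - x1\<bar> < d'" "\<bar>x - x1\<bar> \<le> L * \<bar>phi (x, t) - phi (x, 0)\<bar>" for x t
  proof -
   have "a < x" "x < b" using that(3) by (auto simp: d'_def abs_less_iff)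
   then show ?thesis using d(2)[of t x] HF[of "(x, t)"] that by (auto simp: d'_def)
  qed
  ultimately show "\<exists>d>0. \<forall>x t. 0 < t --> t < d --> \<bar>x - x1\<bar> < d -->
   \<bar>x - x1\<bar> \<le> L * \<bar>phi (x, t) - phi (x, 0)\<bar> --> norm (f (kappa (x, t)) - bf (kappa (x1, 0))) < eta"
   by blast
 qed
 then show ?thesis using E(1) by blast
qed

text \<open>On a level curve \<open>A * (x - x1) = B * (phi (x, t) - phi (x1, 0))\<close> with
  \<open>\<bar>A\<bar> \<ge> 3/4\<close> and \<open>\<bar>B\<bar> < \<epsilon>\<close>. The part of
  the right side due to the boundary curve, at most
  \<open>\<epsilon> * C * \<bar>x - x1\<bar>\<close>, is absorbed since
  \<open>\<epsilon> * C \<le> 1/4\<close>. What remains is \<open>\<bar>x - x1\<bar> \<le> 4 *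
  \<epsilon> * \<bar>phi (x, t) - phi (x, 0)\<bar>\<close>, the aperture for which
  \<open>nt_limit\<close> is invoked.\<close>

lemma approach_region_limit:
 assumes x1: "x1 \<in> {a<..<b}" and \<epsilon>: "0 < \<epsilon>" "\<epsilon> \<le> 1 / (4 * C)"
  and lim: "nt_limit (\<lambda>q. f (kappa q)) l x1"
 shows "(f \<longlongrightarrow> l) (at (kappa (x1, 0)) within approach_region \<Omega> W Z \<epsilon> (kappa (x1, 0)))"
proof (rule tendstoI)
 fix eta :: real assume "eta > 0"
 then obtain d where d: "d > 0" "\<And>x t. 0 < t ==> t < d ==> \<bar>x - x1\<bar> < d ==>
   \<bar>x - x1\<bar> \<le> 4 * \<epsilon> * \<bar>phi (x, t) - phi (x, 0)\<bar> ==> norm (f (kappa (x, t)) - l) < eta"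
  using lim[unfolded nt_limit_def, rule_format, of "4 * \<epsilon>" eta] \<epsilon>(1) by auto
 define D where "D = ({x1 - d<..<x1 + d} \<inter> {a<..<b}) \<times> ({-d<..<d} \<inter> {-delta<..<delta})"
 have sub: "D \<subseteq> box0" by (auto simp: D_def)
 have "open D" unfolding D_def by (intro open_Times open_Int open_greaterThanLessThan)
 from open_image[OF this sub] have o: "open (kappa ` D)" .
 have "(x1, 0) \<in> D" using x1 d(1) delta by (simp add: D_def)
 then have "\<forall>\<^sub>F w in at (kappa (x1, 0)) within approach_region \<Omega> W Z \<epsilon> (kappa (x1, 0)). w \<in> kappa ` D"
  using o by (intro eventually_at_in_open'[THEN filter_leD[OF at_le[OF subset_UNIV]]]) auto
 moreover have "\<forall>\<^sub>F w in at (kappa (x1, 0)) within approach_region \<Omega> W Z \<epsilon> (kappa (x1, 0)). w \<in> approach_region \<Omega> W Z \<epsilon> (kappa (x1, 0))"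
  by (simp add: eventually_at_filter)
 ultimately show "\<forall>\<^sub>F w in at (kappa (x1, 0)) within approach_region \<Omega> W Z \<epsilon> (kappa (x1, 0)). dist (f w) l < eta"
 proof eventually_elim
  case (elim w)
  then obtain x t where w: "w = kappa (x, t)" and xt: "(x, t) \<in> D" by auto
  have xb: "(x, t) \<in> box0" using xt sub by blast
  have x1b: "(x1, 0) \<in> box0" using x1 delta by simp
  obtain A B where AB: "(A, B) \<in> ball (1, 0) \<epsilon>" and lev: "Re (Complex A B * Z w) = Re (Complex A B * Z (kappa (x1, 0)))" and w\<Omega>: "w \<in> \<Omega>"
   using elim(2) unfolding approach_region_def level_curve_def by auto
  have t: "t > 0" using kappa\<Omega>[OF xb] w\<Omega> w by simp
  have "\<bar>A - 1\<bar> \<le> dist (1, 0) (A, B)" "\<bar>B\<bar> \<le> dist (1, 0) (A, B)"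
   using dist_fst_le[of "(1, 0)" "(A, B)"] dist_snd_le[of "(1, 0)" "(A, B)"] by (auto simp: dist_real_def abs_minus_commute)
  then have AB': "\<bar>A - 1\<bar> < \<epsilon>" "\<bar>B\<bar> < \<epsilon>" using AB by auto
  have "\<epsilon> * (4 * C) \<le> 1" using \<epsilon>(2) C by (simp add: field_simps)
  moreover have "\<epsilon> * 4 \<le> \<epsilon> * (4 * C)" using \<epsilon>(1) C by simp
  ultimately have \<epsilon>4: "\<epsilon> \<le> 1/4" and \<epsilon>C: "\<epsilon> * C \<le> 1/4" by linarith+
  define g where "g = phi (x, t) - phi (x, 0)"
  have eq: "A * (x - x1) = B * (phi (x, t) - phi (x1, 0))"
   using lev unfolding w Zkappa[OF xb] Zkappa[OF x1b] zmap_def by (simp add: algebra_simps)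
  have "\<bar>phi (x, t) - phi (x1, 0)\<bar> \<le> \<bar>g\<bar> + C * \<bar>x - x1\<bar>"
   using phi_lipschitz_x[OF x1, of x 0] xb delta by (auto simp: g_def)
  then have "\<bar>B\<bar> * \<bar>phi (x, t) - phi (x1, 0)\<bar> \<le> \<epsilon> * (\<bar>g\<bar> + C * \<bar>x - x1\<bar>)"
   using AB' \<epsilon>(1) by (intro mult_mono) auto
  moreover have "\<bar>A\<bar> * \<bar>x - x1\<bar> = \<bar>B\<bar> * \<bar>phi (x, t) - phi (x1, 0)\<bar>"
   using eq by (simp add: abs_mult[symmetric])
  moreover have "3/4 * \<bar>x - x1\<bar> \<le> \<bar>A\<bar> * \<bar>x - x1\<bar>" using AB' \<epsilon>4 by (intro mult_right_mono) auto
  moreover have "\<epsilon> * (\<bar>g\<bar> + C * \<bar>x - x1\<bar>) = \<epsilon> * \<bar>g\<bar> + (\<epsilon> * C) * \<bar>x - x1\<bar>" by (simp add: algebra_simps)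
  moreover have "(\<epsilon> * C) * \<bar>x - x1\<bar> \<le> 1/4 * \<bar>x - x1\<bar>" using \<epsilon>C by (intro mult_right_mono) auto
  moreover have "0 \<le> \<epsilon> * \<bar>g\<bar>" using \<epsilon>(1) by simp
  ultimately have "\<bar>x - x1\<bar> \<le> 4 * (\<epsilon> * \<bar>g\<bar>)" by linarith
  then have "norm (f (kappa (x, t)) - l) < eta"
   using xt t unfolding g_def by (intro d(2)) (auto simp: D_def abs_less_iff)
  then show ?case by (simp add: w dist_norm)
 qed
qed

text \<open>An arc of the chart whose end points are not in the connected set \<open>S\<close> meets \<open>S\<close> in a
 relatively clopen subset, hence contains \<open>S\<close> or is disjoint from it. So the part of the chart in
 \<open>S\<close>, or its complement, is an interval.\<close>

lemma negligible_end_points: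
 assumes S: "compact S" "connected S" "S \<subseteq> frontier \<Omega>" and Z: "continuous_on W Z"
  and J: "J = {x\<in>{a<..<b}. kappa (x, 0) \<in> S}"
 shows "negligible (J - interior J)"
proof -
 have clopen: "J \<inter> {p<..<q} = {} \<or> S \<subseteq> (\<lambda>x. kappa (x, 0)) ` {p<..<q}"
  if pq: "p \<in> {a<..<b} - J" "q \<in> {a<..<b} - J" for p q
 proof -
  have b: "{p..q} \<subseteq> {a<..<b}" using pq by auto
  define D where "D = {p<..<q} \<times> {-delta<..<delta}"
  have D: "D \<subseteq> box0" using pq by (auto simp: D_def)
  have oD: "open (kappa ` D)" by (rule open_image[OF _ D]) (auto simp: D_def intro: open_Times)
  define T where "T = (\<lambda>x. kappa (x, 0)) ` {p..q}"
  have "closed T" unfolding T_def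
   by (intro compact_imp_closed compact_continuous_image slice_continuous[OF b]) (use delta in auto)
  have e1: "S \<inter> kappa ` D \<subseteq> (\<lambda>x. kappa (x, 0)) ` {p<..<q}"
  proof
   fix w assume w: "w \<in> S \<inter> kappa ` D"
   then obtain x t where xt: "w = kappa (x, t)" "(x, t) \<in> D" by auto
   have "w \<in> frontier \<Omega>" using w S(3) by blast
   then have "t = 0" using kappa\<Sigma>[OF subsetD[OF D xt(2)]] xt(1) by simp
   then show "w \<in> (\<lambda>x. kappa (x, 0)) ` {p<..<q}" using xt by (auto simp: D_def)
  qed
  have e2: "S \<inter> T \<subseteq> kappa ` D"
  proof
   fix w assume w: "w \<in> S \<inter> T"
   then obtain x where x: "x \<in> {p..q}" "w = kappa (x, 0)" by (auto simp: T_def)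
   then have "x \<in> J" using w b J by auto
   then have "x \<noteq> p" "x \<noteq> q" using pq by auto
   then have "(x, 0) \<in> D" using x delta by (auto simp: D_def)
   then show "w \<in> kappa ` D" using x by blast
  qed
  have e3: "(\<lambda>x. kappa (x, 0)) ` {p<..<q} \<subseteq> T" by (auto simp: T_def)
  have "S \<inter> kappa ` D = {} \<or> S \<inter> - T = {}"
   using connectedD[OF S(2) oD open_Compl[OF \<open>closed T\<close>]] e1 e2 e3 by blast
  then show ?thesis
  proof
   assume "S \<inter> kappa ` D = {}"
   then have "x \<notin> J" if "x \<in> {p<..<q}" for x
    using that delta by (auto simp: J D_def image_iff) (metis delta greaterThanLessThan_iff mem_Sigma_iff neg_less_0_iff_less disjoint_iff imageI)
   then show ?thesis by blast
  next
   assume "S \<inter> - T = {}"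
   then have "S \<subseteq> S \<inter> T" by blast
   then have "S \<subseteq> (\<lambda>x. kappa (x, 0)) ` {p<..<q}" using e1 e2 by blast
   then show ?thesis by blast
  qed
 qed
 show ?thesis
 proof (cases "\<exists>p q. p \<in> {a<..<b} - J \<and> q \<in> {a<..<b} - J \<and> S \<subseteq> (\<lambda>x. kappa (x, 0)) ` {p<..<q}")
  case True
  then obtain p q where pq: "p \<in> {a<..<b} - J" "q \<in> {a<..<b} - J" "S \<subseteq> (\<lambda>x. kappa (x, 0)) ` {p<..<q}" by blast
  have sub: "{p<..<q} \<subseteq> {a<..<b}" using pq by auto
  have t0: "(0::real) \<in> {-delta<..<delta}" using delta by simp
  have "S \<subseteq> W"
  proof
   fix w assume "w \<in> S"
   then obtain x where "x \<in> {p<..<q}" "w = kappa (x, 0)" using pq(3) by blast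
   then show "w \<in> W" using kappaW[of "(x, 0)"] sub t0 by auto
  qed
  then have "connected ((\<lambda>w. Re (Z w)) ` S)"
   by (intro connected_continuous_image continuous_intros continuous_on_subset[OF Z] S(2))
  moreover have "(\<lambda>w. Re (Z w)) ` S = J"
  proof (intro equalityI subsetI)
   fix x assume "x \<in> (\<lambda>w. Re (Z w)) ` S"
   then obtain w where w: "w \<in> S" "x = Re (Z w)" by blast
   then obtain y where y: "y \<in> {p<..<q}" "w = kappa (y, 0)" using pq(3) by blast
   then have "y \<in> {a<..<b}" using sub by blast
   then show "x \<in> J" using Re_Z_slice[OF _ t0, of y] w y by (simp add: J)
  next
   fix x assume "x \<in> J"
   then show "x \<in> (\<lambda>w. Re (Z w)) ` S"
    using Re_Z_slice[OF _ t0, of x] unfolding J by (intro image_eqI[of _ _ "kappa (x, 0)"]) auto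
  qed
  ultimately have "convex J" by (simp add: is_interval_connected_1 flip: is_interval_convex_1)
  then have "negligible (frontier J)" by (rule negligible_convex_frontier)
  then show ?thesis by (rule negligible_subset) (auto simp: frontier_def intro: closure_subset[THEN subsetD])
 next
  case False
  then have e: "J \<inter> {p<..<q} = {}" if "p \<in> {a<..<b} - J" "q \<in> {a<..<b} - J" for p q using clopen that by blast
  define C' where "C' = {a<..<b} - J"
  have "is_interval C'" unfolding is_interval_1
  proof (intro ballI allI impI)
   fix p q x assume pq: "p \<in> C'" "q \<in> C'" "p \<le> x \<and> x \<le> q"
   then have "x \<in> {a<..<b}" by (auto simp: C'_def)
   moreover have "x \<notin> J" using e[of p q] pq by (cases "x = p \<or> x = q") (auto simp: C'_def)
   ultimately show "x \<in> C'" by (simp add: C'_def)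
  qed
  then have "negligible (frontier C')" by (intro negligible_convex_frontier) (simp add: is_interval_convex_1)
  moreover have "J - interior J \<subseteq> frontier C'"
  proof
   fix x assume x: "x \<in> J - interior J"
   then have xab: "x \<in> {a<..<b}" by (simp add: J)
   have "x \<in> closure C'"
   proof (rule ccontr)
    assume "x \<notin> closure C'"
    then have "x \<in> {a<..<b} \<inter> - closure C'" using xab by simp
    moreover have "open ({a<..<b} \<inter> - closure C')" by (intro open_Int open_Compl) auto
    moreover have "{a<..<b} \<inter> - closure C' \<subseteq> J" using closure_subset[of C'] by (auto simp: C'_def)
    ultimately have "x \<in> interior J" by (meson interiorI)
    then show False using x by simp
   qed
   moreover have "x \<notin> interior C'" using x interior_subset[of C'] by (auto simp: C'_def)
   ultimately show "x \<in> frontier C'" by (simp add: frontier_def)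
  qed
  ultimately show ?thesis by (rule negligible_subset)
 qed
qed

end

theorem theorem5p1:
  fixes \<Omega> S U W :: "plane set" and \<rho> :: "plane \<Rightarrow> real" and X Y :: "plane \<Rightarrow> plane"
    and Z :: "plane \<Rightarrow> complex" and z0 :: plane
  assumes "open \<Omega>" and "connected \<Omega>" and "defining_function \<Omega> \<rho>"
    and "compact S" and "connected S" and "S \<subseteq> frontier \<Omega>"
    and "open U" and "S \<subseteq> U" and "smooth_on U X" and "smooth_on U Y"
    and "locally_solvable_on U X Y"
    and transversal: "\<And>z. z \<in> S \<Longrightarrow> vf_apply X Y (\<lambda>w. of_real (\<rho> w)) z \<noteq> 0"
    and "z0 \<in> S" and "open W" and "z0 \<in> W" and "W \<subseteq> U" and "first_integral \<rho> S X Y W Z"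
  shows "\<exists>\<epsilon>\<^sub>0>0. \<exists>W0. open W0 \<and> z0 \<in> W0 \<and> W0 \<subseteq> W \<and>
    (\<forall>\<epsilon>. 0 < \<epsilon> \<and> \<epsilon> \<le> \<epsilon>\<^sub>0 \<longrightarrow>
      (\<forall>(f :: plane \<Rightarrow> complex) (N :: int) (p :: ennreal) (bf :: plane \<Rightarrow> complex).
        continuous_on \<Omega> f \<and>
        vf_solves (\<Omega> \<inter> U) X Y (regular_distribution f) (\<lambda>_. 0) \<and>
        growth_bound \<Omega> \<rho> N f \<and>
        1 \<le> p \<and> has_boundary_value \<Omega> \<rho> U X Y S f bf \<and> mem_Lp p (arc_length S) bf \<longrightarrow>
        (AE z in arc_length S. z \<in> W0 \<longrightarrow>
           (f \<longlongrightarrow> bf z) (at z within approach_region \<Omega> W Z \<epsilon> z))))"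
proof -
 obtain W\<rho> where W\<rho>: "closure \<Omega> \<subseteq> W\<rho>" "smooth_on W\<rho> \<rho>"
  using assms(3) unfolding defining_function_def by blast
 have \<rho>c: "continuous_on \<Omega> \<rho>"
  using continuous_on_subset[OF smooth_on_imp_continuous_on[OF W\<rho>(2)]] W\<rho>(1) closure_subset by blast
 have XY: "smooth_on W X" "smooth_on W Y"
  using smooth_on_subset[OF assms(9) \<open>W \<subseteq> U\<close>] smooth_on_subset[OF assms(10) \<open>W \<subseteq> U\<close>] by auto
 have Z: "smooth_on W Z" "\<And>w. w \<in> W ==> vf_apply X Y Z w = 0"
  using \<open>first_integral \<rho> S X Y W Z\<close> unfolding first_integral_def by auto
 obtain a b delta C phi phix phit kappa M where ad: "adapted a b delta C phi phix phit \<Omega> \<rho> X Y W Z kappa M"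
  and x0: "Re (Z z0) \<in> {a<..<b}" "kappa (Re (Z z0), 0) = z0"
  by (rule adapted_exists[OF assms(1,3) \<open>z0 \<in> S\<close> assms(6) \<open>open W\<close> \<open>z0 \<in> W\<close> XY \<open>first_integral \<rho> S X Y W Z\<close>
   transversal[OF \<open>z0 \<in> S\<close>]]) (rule that)
 interpret adapted a b delta C phi phix phit \<Omega> \<rho> X Y W Z kappa M by (rule ad)
 \<comment> \<open>\<open>W0\<close> and the bound \<open>1 / (4 * C)\<close> depend on the chart
   alone; the solution, its boundary value and the exponents enter afterwards, through the null
   set.\<close>
 define W0 where "W0 = kappa ` ({a<..<b} \<times> {-delta<..<delta})"
 have W0: "open W0" "W0 \<subseteq> W" unfolding W0_def using open_image[OF open_box(1) order_refl] kappaW by auto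
 have "(Re (Z z0), 0) \<in> {a<..<b} \<times> {-delta<..<delta}" using x0(1) delta by simp
 then have z0W0: "z0 \<in> W0" unfolding W0_def using x0(2) by (metis imageI)
 have Sb: "S \<in> sets borel" using compact_imp_closed[OF assms(4)] by auto
 define J where "J = {x\<in>{a<..<b}. kappa (x, 0) \<in> S}"
 have Jn: "negligible (J - interior J)"
  by (rule negligible_end_points[OF assms(4,5,6) smooth_on_imp_continuous_on[OF Z(1)] J_def])
 have "AE z in arc_length S. z \<in> W0 --> (f \<longlongrightarrow> bf z) (at z within approach_region \<Omega> W Z \<epsilon> z)"
  if \<epsilon>: "0 < \<epsilon>" "\<epsilon> \<le> 1 / (4 * C)" and f: "continuous_on \<Omega> f"
   and sol: "vf_solves (\<Omega> \<inter> U) X Y (regular_distribution f) (\<lambda>_. 0)" and gr: "growth_bound \<Omega> \<rho> N f"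
   and p: "1 \<le> p" and bv: "has_boundary_value \<Omega> \<rho> U X Y S f bf" and Lp: "mem_Lp p (arc_length S) bf" for \<epsilon> f N p bf
 proof (rule AE_arc_length_measure_space[OF Sb])
  assume ms: "measure_space UNIV (sets borel) hausdorff1_outer"
  define good where "good x1 \<longleftrightarrow> nt_limit (\<lambda>q. f (kappa q)) (bf (kappa (x1, 0))) x1" for x1
  \<comment> \<open>Rational end points make the exceptional sets countable in number; the set for
    \<open>r\<close> and \<open>s\<close> does not depend on the margin \<open>e\<close> by which
    the interval stays inside \<open>J\<close>.\<close>
  have "\<exists>E. negligible E \<and> (\<forall>e>0. of_rat r < (of_rat s :: real) \<and> {of_rat r - e<..<of_rat s + e} \<subseteq> J -->
    (\<forall>x1\<in>{of_rat r<..<of_rat s} - E. good x1))" for r s :: rat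
  proof (cases "\<exists>e>0. of_rat r < (of_rat s :: real) \<and> {of_rat r - e<..<of_rat s + e} \<subseteq> J")
   case True
   then obtain e where e: "e > 0" "of_rat r < (of_rat s :: real)" "{of_rat r - e<..<of_rat s + e} \<subseteq> J" by blast
   have "\<exists>E. negligible E \<and> (\<forall>x1\<in>{of_rat r<..<of_rat s} - E. good x1)"
    unfolding good_def
    by (rule slice_limit_ae[OF ms assms(1) \<rho>c f gr \<open>W \<subseteq> U\<close> XY Z sol Sb bv p Lp, where a1' = "of_rat r - e" and b1' = "of_rat s + e"])
     (use e in \<open>auto simp: J_def\<close>)
   then show ?thesis by blast
  next
   case False
   then show ?thesis by (intro exI[of _ "{}"]) auto
  qed
  then obtain E where E: "\<And>r s. negligible (E r s)"
   "\<And>r s e x1. e > 0 ==> of_rat r < (of_rat s :: real) ==> {of_rat r - e<..<of_rat s + e} \<subseteq> J ==> x1 \<in> {of_rat r<..<of_rat s} - E r s ==> good x1"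
   by metis
  \<comment> \<open>The end points of the part of the chart in \<open>S\<close> are discarded too,
    since no chart with boundary part in \<open>S\<close> surrounds them.\<close>
  define Q where "Q = ((\<Union>q\<in>UNIV. E (fst q) (snd q)) \<union> (J - interior J)) \<inter> {a<..<b}"
  have "negligible (\<Union>q\<in>UNIV. E (fst q) (snd q))"
   by (rule negligible_countable_Union) (auto simp: E(1))
  then have "negligible Q" unfolding Q_def using Jn by (intro negligible_Int negligible_Un) auto
  then have null: "hausdorff1_outer ((\<lambda>x. kappa (x, 0)) ` Q) = 0"
  proof (rule hausdorff1_outer_lipschitz_null[OF _ M])
   show "dist (kappa (x, 0)) (kappa (y, 0)) \<le> M * \<bar>x - y\<bar>" if "x \<in> Q" "y \<in> Q" for x y
    using lip[of "(x, 0)" "(y, 0)"] that delta by (simp add: Q_def dist_Pair_Pair dist_real_def)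
  qed
  show ?thesis
  proof (rule AE_arc_lengthI[OF Sb null], rule impI)
   fix z assume z: "z \<in> S" "z \<notin> (\<lambda>x. kappa (x, 0)) ` Q" "z \<in> W0"
   obtain x1 t where xt: "z = kappa (x1, t)" "(x1, t) \<in> {a<..<b} \<times> {-delta<..<delta}" using z(3) by (auto simp: W0_def)
   have "z \<in> frontier \<Omega>" using z(1) assms(6) by blast
   then have "t = 0" using kappa\<Sigma>[OF xt(2)] xt(1) by simp
   then have z_eq: "z = kappa (x1, 0)" and x1: "x1 \<in> {a<..<b}" using xt by auto
   then have x1J: "x1 \<in> J" and x1Q: "x1 \<notin> Q" using z by (auto simp: J_def)
   then have "x1 \<in> interior J" using x1 by (auto simp: Q_def)
   then obtain e where e: "e > 0" "ball x1 e \<subseteq> J" using mem_interior by blast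
   obtain r where r: "x1 - e/2 < of_rat r" "of_rat r < x1" using of_rat_dense[of "x1 - e/2" x1] e by auto
   obtain s where s: "x1 < of_rat s" "of_rat s < x1 + e/2" using of_rat_dense[of x1 "x1 + e/2"] e by auto
   have "{of_rat r - e/2<..<of_rat s + e/2} \<subseteq> ball x1 e" using r s by (auto simp: dist_real_def abs_less_iff)
   moreover have "x1 \<notin> E r s" using x1Q x1 unfolding Q_def by (metis (mono_tags, lifting) IntI UN_I UNIV_I UnI1 fst_conv snd_conv)
   ultimately have "good x1" using E(2)[of "e/2" r s x1] e r s by auto
   then show "(f \<longlongrightarrow> bf z) (at z within approach_region \<Omega> W Z \<epsilon> z)"
    unfolding z_eq using \<epsilon> by (intro approach_region_limit[OF x1]) (auto simp: good_def)
  qed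
 qed
 then have "\<forall>\<epsilon>. 0 < \<epsilon> \<and> \<epsilon> \<le> 1 / (4 * C) -->
   (\<forall>(f :: plane => complex) (N :: int) (p :: ennreal) (bf :: plane => complex).
    continuous_on \<Omega> f \<and>
    vf_solves (\<Omega> \<inter> U) X Y (regular_distribution f) (\<lambda>_. 0) \<and>
    growth_bound \<Omega> \<rho> N f \<and>
    1 \<le> p \<and> has_boundary_value \<Omega> \<rho> U X Y S f bf \<and> mem_Lp p (arc_length S) bf -->
    (AE z in arc_length S. z \<in> W0 --> (f \<longlongrightarrow> bf z) (at z within approach_region \<Omega> W Z \<epsilon> z)))"
  by blast
 moreover have "1 / (4 * C) > 0" using C by simp
 ultimately show ?thesis using W0 z0W0 by blast
qed

end
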